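(* Let $L(s)=\sum_I b_I I^{-s}$ be a Dirichlet series in the motivic class $\mathfrak M$. Then $L(s)$ analytically continues (from its half-plane of absolute convergence) to an essentially algebraic entire function on $S_\infty$. Moreover, for every prime $v$ of $A$ and every $k$-embedding $\sigma\colon\mathbb V\to\bar k_v$, the $v$-adic interpolation $L(s_\sigma)=\sum_{I\in\mathcal I(v)} b_I I^{-s_\sigma}$ analytically continues to an essentially algebraic entire function on $\mathbb C_v^\ast\times S_\sigma$.
   Context: Setting: $C$ smooth projective geometrically connected curve over $\mathbb F_r$ ($r$ a power of $p$), $\infty$ a closed point of degree $d_\infty$, $A$ the functions regular off $\infty$, $k=\mathrm{Frac}(A)$, $K=k_\infty$ with fixed uniformizer $\pi$, residue field $\mathbb F_\infty$, $\mathbb C_\infty$ the completion of an algebraic closure of $K$ with absolute value $|\cdot|_\infty$. Each $\alpha\in K^\ast$ is uniquely $\zeta_\alpha\pi^{n_\alpha}\langle\alpha\rangle$ ($\zeta_\alpha\in\mathbb F_\infty^\ast$, $\langle\alpha\rangle$ a $1$-unit); $\alpha$ is positive if $\zeta_\alpha=1$. $\mathcal I$ = nonzero fractional ideals of $A$; $\langle\cdot\rangle\colon\mathcal I\to U_1(\mathbb C_\infty)$ is the unique homomorphism with $\langle\lambda A\rangle=\langle\lambda\rangle$ for positive $\lambda$. $\deg_k I$ = degree over $\mathbb F_r$ of the divisor of $I$ on $C\setminus\{\infty\}$. $S_\infty=\mathbb C_\infty^\ast\times\mathbb Z_p$; for $s=(x,y)$, $I^s=x^{\deg_k I}\langle I\rangle^y$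 ($u^y=\sum_j\binom yj(u-1)^j$). Fix $\pi_\ast^{d_\infty}=\pi$; $I^{s_1}:=\pi_\ast^{-\deg_kI}\langle I\rangle$; $\mathbb V=k(\{I^{s_1}\})$ (finite over $k$), $\mathcal O_{\mathbb V}$ the integral closure of $A$ in $\mathbb V$. For an integer $j$ write $-j$ for $y=-j\in\mathbb Z_p$. Motivic class $\mathfrak M$: Dirichlet series $L(s)=\sum_I b_I I^{-s}$ ($I$ over nonzero ideals of $A$, $s\in S_\infty$) such that (1) all $b_I\in A$; (2) there is a real $t>0$ such that for all $(x,y)$ with $|x|_\infty\ge t$, $b_II^{-s}\to0$ as $\deg_kI\to\infty$ (absolute convergence on this half-plane); (3) for each integer $j\ge0$ the formal power series $L(\pi_\ast^jx,-j)=\sum_I b_I (I^{s_1})^j x^{-\deg_k I}$ in $x^{-1}$ is a polynomial in $x^{-1}$ with coefficients in $\mathcal O_{\mathbb V}$ whose degree is $O(\log j)$ as $j\to\infty$. Entire function on $S_\infty$: a family $\{g_y\}_{y\in\mathbb Z_p}$ of power series $g_y(u)\in\mathbb C_\infty[[u]]$ each converging for all $u\in\mathbb C_\infty$, such that for every bounded $B\subset\mathbb C_\infty$ and $\epsilon>0$ there is $\delta>0$ with $|g_{y_0}(u)-g_{y_1}(u)|_\infty<\epsilon$ for all $u\in B$ whenever $|y_0-y_1|_p<\delta$; it is viewed as the function $(x,y)\mapsto g_y(1/x)$. Such a function attached to a Dirichlet series with coefficients in a finite extension $H$ of $k$ is essentially algebraic if for every integer $j\ge0$, $z_L(x,-j):=L(\pi_\ast^jx,-j)$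 lies in $(H\mathbb V)[x^{-1}]$. $v$-adic setting: $v$ a prime of $A$ of degree $d_v$ over $\mathbb F_r$, $k_v$ the completion, $\mathbb C_v$ the completion of an algebraic closure $\bar k_v$, $\sigma\colon\mathbb V\to\bar k_v$ a $k$-embedding, $k_\sigma=k_v(\sigma(\mathbb V))$ with integer ring $A_\sigma$ and residue degree $f_\sigma$ over that of $k_v$. Each $\beta\in A_\sigma^\ast$ is uniquely $\omega(\beta)\langle\beta\rangle_\sigma$ with $\omega(\beta)$ a $(r^{d_vf_\sigma}-1)$-th root of unity and $\langle\beta\rangle_\sigma$ a $1$-unit. $S_\sigma=\varprojlim_j\mathbb Z/(p^j(r^{d_vf_\sigma}-1))\cong\mathbb Z_p\times\mathbb Z/(r^{d_vf_\sigma}-1)$, and for $y_\sigma=(y_0,y_1)$, $\beta^{y_\sigma}=\omega(\beta)^{y_1}\langle\beta\rangle_\sigma^{y_0}$. $\mathcal I(v)$ is the group of fractional ideals prime to $v$; for $I\in\mathcal I(v)$ (so $\sigma(I^{s_1})\in A_\sigma^\ast$) and $s_\sigma=(x_v,y_\sigma)\in\mathbb C_v^\ast\times S_\sigma$, $I^{s_\sigma}=x_v^{\deg_kI}\sigma(I^{s_1})^{y_\sigma}$. Entire and essentially algebraic functions on $\mathbb C_v^\ast\times S_\sigma$ are defined analogously (continuous families over $S_\sigma$ of entire power series in $x_v^{-1}$; essentially algebraic meaning that for each integer $j\ge0$ the value at $(x_v,-j)$, namely $\sum_{I\in\mathcal I(v)}b_I\sigma(I^{s_1})^jx_v^{-\deg_kI}$,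 is a polynomial in $x_v^{-1}$). *)

theory Defs
  imports
    "HOL-Analysis.Analysis"
    "HOL-Library.Landau_Symbols"
    "HOL-Computational_Algebra.Computational_Algebra"
begin

section \<open>Subrings and field extensions inside a field\<close>

definition is_subring :: "'a::field set \<Rightarrow> bool" where
  "is_subring S \<longleftrightarrow> 1 \<in> S \<and> (\<forall>x\<in>S. \<forall>y\<in>S. x - y \<in> S \<and> x * y \<in> S)"

definition is_subfield :: "'a::field set \<Rightarrow> bool" where
  "is_subfield S \<longleftrightarrow> is_subring S \<and> (\<forall>x\<in>S. inverse x \<in> S)"

definition algebraic_over :: "'a::field set \<Rightarrow> 'a \<Rightarrow> bool" where
  "algebraic_over L x \<longleftrightarrow> (\<exists>P. P \<noteq> 0 \<and> set (coeffs P) \<subseteq> L \<and> poly P x = 0)"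

definition integral_over :: "'a::field set \<Rightarrow> 'a \<Rightarrow> bool" where
  "integral_over R x \<longleftrightarrow> (\<exists>P. lead_coeff P = 1 \<and> set (coeffs P) \<subseteq> R \<and> poly P x = 0)"

definition alg_closed_set :: "'a::field set \<Rightarrow> bool" where
  "alg_closed_set L \<longleftrightarrow>
     (\<forall>P. set (coeffs P) \<subseteq> L \<and> degree P > 0 \<longrightarrow> (\<exists>x\<in>L. poly P x = 0))"

definition field_embedding_on :: "'a::field set \<Rightarrow> ('a \<Rightarrow> 'b::field) \<Rightarrow> bool" where
  "field_embedding_on S f \<longleftrightarrow> f 1 = 1 \<and>
     (\<forall>x\<in>S. \<forall>y\<in>S. f (x + y) = f x + f y \<and> f (x * y) = f x * f y)"

text \<open>For a ring \<open>S\<close> with maximal ideal \<open>m\<close> and a subring \<open>R\<close> of \<open>S\<close> such that \<open>m \<inter> R\<close> is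
  maximal in \<open>R\<close>: the dimension of \<open>S / m\<close> over \<open>R / (m \<inter> R)\<close>.  The set \<open>B\<close> is a system of
  representatives of a basis.\<close>

definition residue_degree :: "'a::field set \<Rightarrow> 'a set \<Rightarrow> 'a set \<Rightarrow> nat" where
  "residue_degree R S m = (THE n. \<exists>B. finite B \<and> B \<subseteq> S \<and> card B = n \<and>
     (\<forall>x\<in>S. \<exists>c. c ` B \<subseteq> R \<and> x - (\<Sum>e\<in>B. c e * e) \<in> m) \<and>
     (\<forall>c. c ` B \<subseteq> R \<and> (\<Sum>e\<in>B. c e * e) \<in> m \<longrightarrow> c ` B \<subseteq> m))"


section \<open>Function fields, places and ideals\<close>

text \<open>A smooth projective geometrically connected curve over the finite field \<open>Fr\<close> is given by its
  function field \<open>'k\<close>: finitely generated of transcendence degree one, with \<open>Fr\<close> algebraically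
  closed in it.  Its closed points are represented by their local rings, which are exactly the
  proper valuation rings of \<open>'k\<close> containing \<open>Fr\<close>.\<close>

definition is_function_field :: "'k::field set \<Rightarrow> bool" where
  "is_function_field Fr \<longleftrightarrow> is_subfield Fr \<and> finite Fr \<and>
     (\<forall>x. algebraic_over Fr x \<longrightarrow> x \<in> Fr) \<and>
     (\<exists>T. \<not> algebraic_over Fr T \<and>
       (\<exists>B. finite B \<and> (\<forall>x. \<exists>c. c ` B \<subseteq> is_subfield hull (insert T Fr) \<and> x = (\<Sum>e\<in>B. c e * e))))"

definition places :: "'k::field set \<Rightarrow> 'k set set" where
  "places Fr = {R. is_subring R \<and> Fr \<subseteq> R \<and> R \<noteq> UNIV \<and> (\<forall>x. x \<in> R \<or> inverse x \<in> R)}"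

definition max_ideal :: "'k::field set \<Rightarrow> 'k set" where
  "max_ideal R = {x \<in> R. x = 0 \<or> inverse x \<notin> R}"

definition place_degree :: "'k::field set \<Rightarrow> 'k set \<Rightarrow> nat" where
  "place_degree Fr R = residue_degree Fr R (max_ideal R)"

definition ord_elem :: "'k::field set \<Rightarrow> 'k \<Rightarrow> int" where
  "ord_elem R x = (THE n. \<exists>t u. max_ideal R = (\<lambda>z. t * z) ` R \<and>
     u \<in> R \<and> u \<notin> max_ideal R \<and> x = u * t powi n)"

definition ord_ideal :: "'k::field set \<Rightarrow> 'k set \<Rightarrow> int" where
  "ord_ideal R I = (INF x\<in>I - {0}. ord_elem R x)"

definition regular_off :: "'k::field set \<Rightarrow> 'k set \<Rightarrow> 'k set" where
  "regular_off Fr Oi = \<Inter> (places Fr - {Oi})"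

definition fractional_ideals :: "'k::field set \<Rightarrow> 'k set set" where
  "fractional_ideals A = {I. 0 \<in> I \<and> I \<noteq> {0} \<and> (\<forall>x\<in>I. \<forall>y\<in>I. x + y \<in> I) \<and>
     (\<forall>a\<in>A. \<forall>x\<in>I. a * x \<in> I) \<and> (\<exists>d\<in>A - {0}. \<forall>x\<in>I. d * x \<in> A)}"

definition nonzero_ideals :: "'k::field set \<Rightarrow> 'k set set" where
  "nonzero_ideals A = {I \<in> fractional_ideals A. I \<subseteq> A}"

definition ideal_mult :: "'k::field set \<Rightarrow> 'k set \<Rightarrow> 'k set" where
  "ideal_mult I J = {(\<Sum>i<n. f i * g i) | f g (n::nat). (\<forall>i<n. f i \<in> I \<and> g i \<in> J)}"

definition primes_of :: "'k::field set \<Rightarrow> 'k set set" where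
  "primes_of A = {v \<in> nonzero_ideals A. v \<noteq> A \<and>
     (\<forall>x\<in>A. \<forall>y\<in>A. x * y \<in> v \<longrightarrow> x \<in> v \<or> y \<in> v)}"

definition localization :: "'k::field set \<Rightarrow> 'k set \<Rightarrow> 'k set" where
  "localization A v = {a / s | a s. a \<in> A \<and> s \<in> A - v}"

definition ideals_prime_to :: "'k::field set \<Rightarrow> 'k set \<Rightarrow> 'k set set" where
  "ideals_prime_to A v = {I \<in> fractional_ideals A. ord_ideal (localization A v) I = 0}"

definition ideal_degree :: "'k::field set \<Rightarrow> 'k set \<Rightarrow> 'k set \<Rightarrow> int" where
  "ideal_degree Fr Oi I =
     (\<Sum>P | P \<in> places Fr - {Oi} \<and> ord_ideal P I \<noteq> 0. ord_ideal P I * int (place_degree Fr P))"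


section \<open>Non-archimedean absolute values\<close>

definition nonarch_abs :: "('a::field \<Rightarrow> real) \<Rightarrow> bool" where
  "nonarch_abs nrm \<longleftrightarrow> (\<forall>x. 0 \<le> nrm x) \<and> (\<forall>x. nrm x = 0 \<longleftrightarrow> x = 0) \<and>
     (\<forall>x y. nrm (x * y) = nrm x * nrm y) \<and> (\<forall>x y. nrm (x + y) \<le> max (nrm x) (nrm y))"

abbreviation abs_topology :: "('a::field \<Rightarrow> real) \<Rightarrow> 'a topology" where
  "abs_topology nrm \<equiv> Metric_space.mtopology UNIV (\<lambda>x y. nrm (x - y))"

definition completion_in :: "('k::field \<Rightarrow> 'c::field) \<Rightarrow> ('c \<Rightarrow> real) \<Rightarrow> 'c set" where
  "completion_in emb nrm = abs_topology nrm closure_of (range emb)"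

definition alg_closure_in :: "('k::field \<Rightarrow> 'c::field) \<Rightarrow> ('c \<Rightarrow> real) \<Rightarrow> 'c set" where
  "alg_closure_in emb nrm = {x. algebraic_over (completion_in emb nrm) x}"

text \<open>\<open>('c, nrm)\<close> is the completion of an algebraic closure of the completion of \<open>'k\<close> at the
  place with valuation ring \<open>R\<close>.  Only the equivalence class of the absolute value on \<open>'k\<close> is
  prescribed, by its valuation ring; no normalization is needed.\<close>

definition completed_alg_closure ::
    "'k::field set \<Rightarrow> ('k \<Rightarrow> 'c::field) \<Rightarrow> ('c \<Rightarrow> real) \<Rightarrow> bool" where
  "completed_alg_closure R emb nrm \<longleftrightarrow>
     field_embedding_on UNIV emb \<and> nonarch_abs nrm \<and>
     (\<forall>a. nrm (emb a) \<le> 1 \<longleftrightarrow> a \<in> R) \<and>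
     alg_closed_set (alg_closure_in emb nrm) \<and>
     abs_topology nrm closure_of (alg_closure_in emb nrm) = UNIV \<and>
     Metric_space.mcomplete UNIV (\<lambda>x y. nrm (x - y))"

definition one_units :: "('a::field \<Rightarrow> real) \<Rightarrow> 'a set" where
  "one_units nrm = {u. nrm (u - 1) < 1}"

text \<open>\<open>\<alpha> = \<zeta> \<pi>\<^sup>n u\<close> with \<open>u\<close> a 1-unit of the completion \<open>K\<close> and \<open>\<zeta>\<close> a nonzero element of its
  residue field, which is embedded in \<open>K\<close> as the field of elements algebraic over \<open>Fr\<close>.\<close>

definition sign_decomposition ::
    "'k::field set \<Rightarrow> ('k \<Rightarrow> 'c::field) \<Rightarrow> ('c \<Rightarrow> real) \<Rightarrow> 'c \<Rightarrow> 'c \<Rightarrow> 'c \<Rightarrow> int \<Rightarrow> 'c \<Rightarrow> bool" where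
  "sign_decomposition Fr emb nrm \<pi> \<alpha> \<zeta> n u \<longleftrightarrow>
     \<zeta> \<in> completion_in emb nrm \<and> algebraic_over (emb ` Fr) \<zeta> \<and> \<zeta> \<noteq> 0 \<and>
     u \<in> completion_in emb nrm \<and> u \<in> one_units nrm \<and> \<alpha> = \<zeta> * \<pi> powi n * u"


section \<open>Exponents\<close>

text \<open>The inverse limit of the rings \<open>\<int> / p^n N\<close>, an element being the sequence of its
  least nonnegative residues.  For \<open>N = 1\<close> this is \<open>\<int>\<^sub>p\<close>, and \<open>exponent_dist p\<close> is then
  the \<open>p\<close>-adic distance: if \<open>n\<close> is least with \<open>y n \<noteq> z n\<close>, then \<open>y - z\<close> has valuation
  \<open>n - 1\<close>.  In general it is a metric defining the inverse limit topology.\<close>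

definition exponents :: "nat \<Rightarrow> nat \<Rightarrow> (nat \<Rightarrow> int) set" where
  "exponents p N = {y. \<forall>n. 0 \<le> y n \<and> y n < int (p ^ n * N) \<and> y (Suc n) mod int (p ^ n * N) = y n}"

definition exponent_of_int :: "nat \<Rightarrow> nat \<Rightarrow> int \<Rightarrow> nat \<Rightarrow> int" where
  "exponent_of_int p N a = (\<lambda>n. a mod int (p ^ n * N))"

definition exponent_dist :: "nat \<Rightarrow> (nat \<Rightarrow> int) \<Rightarrow> (nat \<Rightarrow> int) \<Rightarrow> real" where
  "exponent_dist p y z = (if y = z then 0 else real p powr (1 - real (LEAST n. y n \<noteq> z n)))"

text \<open>\<open>u\<^sup>y = (\<Sum>j. (y choose j) (u - 1)\<^sup>j)\<close> for \<open>y \<in> \<int>\<^sub>p\<close>, in characteristic \<open>p\<close>.  There only the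
  class of \<open>y choose j\<close> modulo \<open>p\<close> matters, and it depends only on \<open>y\<close> modulo \<open>p\<^sup>j\<close>,
  since \<open>j < p\<^sup>j\<close>.\<close>

definition one_unit_power :: "('a::field \<Rightarrow> real) \<Rightarrow> 'a \<Rightarrow> (nat \<Rightarrow> int) \<Rightarrow> 'a" where
  "one_unit_power nrm u y = (THE w. limitin (abs_topology nrm)
     (\<lambda>n. \<Sum>j<n. of_nat (nat (y j) choose j) * (u - 1) ^ j) w sequentially)"


section \<open>Entire functions and continuation\<close>

abbreviation fps_converges_to :: "('a::field \<Rightarrow> real) \<Rightarrow> 'a fps \<Rightarrow> 'a \<Rightarrow> 'a \<Rightarrow> bool" where
  "fps_converges_to nrm f u w \<equiv>
     limitin (abs_topology nrm) (\<lambda>n. \<Sum>i<n. fps_nth f i * u ^ i) w sequentially"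

definition fps_at :: "('a::field \<Rightarrow> real) \<Rightarrow> 'a fps \<Rightarrow> 'a \<Rightarrow> 'a" where
  "fps_at nrm f u = (THE w. fps_converges_to nrm f u w)"

definition entire_family ::
    "('a::field \<Rightarrow> real) \<Rightarrow> nat \<Rightarrow> nat \<Rightarrow> ((nat \<Rightarrow> int) \<Rightarrow> 'a fps) \<Rightarrow> bool" where
  "entire_family nrm p N g \<longleftrightarrow>
     (\<forall>y\<in>exponents p N. \<forall>u. \<exists>w. fps_converges_to nrm (g y) u w) \<and>
     (\<forall>B \<epsilon>. (\<exists>R. \<forall>u\<in>B. nrm u \<le> R) \<and> 0 < \<epsilon> \<longrightarrow>
       (\<exists>\<delta>>0. \<forall>y\<in>exponents p N. \<forall>z\<in>exponents p N. exponent_dist p y z < \<delta> \<longrightarrow>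
         (\<forall>u\<in>B. nrm (fps_at nrm (g y) u - fps_at nrm (g z) u) < \<epsilon>)))"

text \<open>Half-planes of absolute convergence of a series \<open>\<Sum>I\<in>X. T I x y\<close> with degree function
  \<open>dg\<close> on \<open>X\<close>, and continuation of its sum to the function \<open>(x, y) \<mapsto> g y (1 / x)\<close>.\<close>

definition abs_convergent_from ::
    "('a::field \<Rightarrow> real) \<Rightarrow> (nat \<Rightarrow> int) set \<Rightarrow> 'i set \<Rightarrow> ('i \<Rightarrow> int) \<Rightarrow>
     ('i \<Rightarrow> 'a \<Rightarrow> (nat \<Rightarrow> int) \<Rightarrow> 'a) \<Rightarrow> real \<Rightarrow> bool" where
  "abs_convergent_from nrm S X dg T t \<longleftrightarrow> 0 < t \<and>
     (\<forall>x. \<forall>y\<in>S. t \<le> nrm x \<longrightarrow>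
       (\<forall>\<epsilon>>0. \<exists>D. \<forall>I\<in>X. D \<le> dg I \<longrightarrow> nrm (T I x y) < \<epsilon>))"

definition continues_to ::
    "('a::field \<Rightarrow> real) \<Rightarrow> (nat \<Rightarrow> int) set \<Rightarrow> 'i set \<Rightarrow> ('i \<Rightarrow> int) \<Rightarrow>
     ('i \<Rightarrow> 'a \<Rightarrow> (nat \<Rightarrow> int) \<Rightarrow> 'a) \<Rightarrow> ((nat \<Rightarrow> int) \<Rightarrow> 'a fps) \<Rightarrow> bool" where
  "continues_to nrm S X dg T g \<longleftrightarrow>
     (\<exists>t. abs_convergent_from nrm S X dg T t) \<and>
     (\<forall>t. abs_convergent_from nrm S X dg T t \<longrightarrow>
       (\<forall>x. \<forall>y\<in>S. t \<le> nrm x \<longrightarrow>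
         limitin (abs_topology nrm) (\<lambda>F. \<Sum>I\<in>F. T I x y) (fps_at nrm (g y) (1 / x))
           (finite_subsets_at_top X)))"


section \<open>The setting at infinity\<close>

locale infinity_setting =
  fixes Fr :: "'k::field set"
    and Oi :: "'k set"
    and emb :: "'k \<Rightarrow> 'c::field"
    and nrm :: "'c \<Rightarrow> real"
    and \<pi> :: 'c
    and \<pi>s :: 'c
    and br :: "'k set \<Rightarrow> 'c"
  assumes function_field: "is_function_field Fr"
    and place_infinity: "Oi \<in> places Fr"
    and C_infinity: "completed_alg_closure Oi emb nrm"
    and uniformizer: "\<pi> \<in> completion_in emb nrm" "\<pi> \<noteq> 0" "nrm \<pi> < 1"
      "\<And>x. x \<in> completion_in emb nrm \<Longrightarrow> nrm x < 1 \<Longrightarrow> nrm x \<le> nrm \<pi>"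
    and pi_star: "\<pi>s ^ place_degree Fr Oi = \<pi>"
    and br_one_unit: "\<And>I. I \<in> fractional_ideals (regular_off Fr Oi) \<Longrightarrow> br I \<in> one_units nrm"
    and br_mult: "\<And>I J. I \<in> fractional_ideals (regular_off Fr Oi) \<Longrightarrow>
      J \<in> fractional_ideals (regular_off Fr Oi) \<Longrightarrow> br (ideal_mult I J) = br I * br J"
    \<comment> \<open>\<open>l\<close> is positive when its sign \<open>\<zeta>\<close> is 1; then \<open>u\<close> is its 1-unit part.\<close>
    and br_principal: "\<And>l n u. sign_decomposition Fr emb nrm \<pi> (emb l) 1 n u \<Longrightarrow>
      br ((\<lambda>a. l * a) ` regular_off Fr Oi) = u"
begin

definition "A = regular_off Fr Oi"

definition "deg I = ideal_degree Fr Oi I"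

definition power_at :: "'k set \<Rightarrow> 'c \<Rightarrow> (nat \<Rightarrow> int) \<Rightarrow> 'c" where
  "power_at I x y = x powi deg I * one_unit_power nrm (br I) y"

definition power_s1 :: "'k set \<Rightarrow> 'c" where
  "power_s1 I = \<pi>s powi (- deg I) * br I"

definition V :: "'c set" where
  "V = is_subfield hull (range emb \<union> power_s1 ` fractional_ideals A)"

definition OV :: "'c set" where
  "OV = {x \<in> V. integral_over (emb ` A) x}"

text \<open>The terms of \<open>L(s) = \<Sum>I. b\<^sub>I I\<^bsup>-s\<^esup>\<close> and the formal series \<open>L(\<pi>\<^sub>*\<^sup>j x, -j)\<close> in \<open>x\<^bsup>-1\<^esup>\<close>.\<close>

definition L_term :: "('k set \<Rightarrow> 'k) \<Rightarrow> 'k set \<Rightarrow> 'c \<Rightarrow> (nat \<Rightarrow> int) \<Rightarrow> 'c" where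
  "L_term b I x y = emb (b I) / power_at I x y"

definition special_series :: "('k set \<Rightarrow> 'k) \<Rightarrow> nat \<Rightarrow> 'c fps" where
  "special_series b j = Abs_fps (\<lambda>d.
     \<Sum>I | I \<in> nonzero_ideals A \<and> deg I = int d. emb (b I) * power_s1 I ^ j)"

definition motivic_class :: "('k set \<Rightarrow> 'k) \<Rightarrow> bool" where
  "motivic_class b \<longleftrightarrow>
     (\<forall>I\<in>nonzero_ideals A. b I \<in> A) \<and>
     (\<exists>t. abs_convergent_from nrm (exponents CHAR('k) 1) (nonzero_ideals A) deg (L_term b) t) \<and>
     (\<exists>P. (\<forall>j. special_series b j = fps_of_poly (P j) \<and> set (coeffs (P j)) \<subseteq> OV) \<and>
       (\<lambda>j. real (degree (P j))) \<in> O(\<lambda>j. ln (real j)))"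

text \<open>Essentially algebraic, for coefficients in \<open>H = k\<close>, so that \<open>H\<V> = \<V>\<close>.\<close>

definition essentially_algebraic :: "((nat \<Rightarrow> int) \<Rightarrow> 'c fps) \<Rightarrow> bool" where
  "essentially_algebraic g \<longleftrightarrow>
     (\<forall>j::nat. \<exists>P. set (coeffs P) \<subseteq> V \<and>
       (\<forall>x. x \<noteq> 0 \<longrightarrow>
         fps_at nrm (g (exponent_of_int CHAR('k) 1 (- int j))) (1 / (\<pi>s ^ j * x)) = poly P (1 / x)))"

definition continues_essentially_algebraic :: "('k set \<Rightarrow> 'k) \<Rightarrow> bool" where
  "continues_essentially_algebraic b \<longleftrightarrow>
     (\<exists>g. entire_family nrm CHAR('k) 1 g \<and>
       continues_to nrm (exponents CHAR('k) 1) (nonzero_ideals A) deg (L_term b) g \<and>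
       essentially_algebraic g)"

end


section \<open>The setting at a prime of \<open>A\<close>\<close>

locale v_adic_setting = infinity_setting Fr Oi emb nrm \<pi> \<pi>s br
  for Fr :: "'k::field set" and Oi and emb :: "'k \<Rightarrow> 'c::field" and nrm \<pi> \<pi>s br +
  fixes v :: "'k set"
    and embv :: "'k \<Rightarrow> 'd::field"
    and nrmv :: "'d \<Rightarrow> real"
    and \<sigma> :: "'c \<Rightarrow> 'd"
  assumes prime_v: "v \<in> primes_of A"
    and C_v: "completed_alg_closure (localization A v) embv nrmv"
    and sigma_embedding: "field_embedding_on V \<sigma>"
    and sigma_over_k: "\<And>a. \<sigma> (emb a) = embv a"
    and sigma_algebraic: "\<sigma> ` V \<subseteq> alg_closure_in embv nrmv"
begin

definition kv :: "'d set" where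
  "kv = completion_in embv nrmv"

definition k\<sigma> :: "'d set" where
  "k\<sigma> = is_subfield hull (kv \<union> \<sigma> ` V)"

definition f\<sigma> :: nat where
  "f\<sigma> = residue_degree {x \<in> kv. nrmv x \<le> 1} {x \<in> k\<sigma>. nrmv x \<le> 1} {x \<in> k\<sigma>. nrmv x < 1}"

definition Q :: nat where
  "Q = card Fr ^ (residue_degree Fr A v * f\<sigma>)"

definition \<omega> :: "'d \<Rightarrow> 'd" where
  "\<omega> \<beta> = (THE z. z \<in> k\<sigma> \<and> z ^ (Q - 1) = 1 \<and> \<beta> / z \<in> one_units nrmv)"

text \<open>With \<open>p = CHAR('k)\<close>, \<open>S\<^sub>\<sigma>\<close> is \<open>exponents p (Q - 1)\<close>.  The components of \<open>y\<close>
  in \<open>\<int> / (Q - 1)\<close> and in \<open>\<int>\<^sub>p\<close> are \<open>y 0\<close> and the sequence of the \<open>y n mod p\<^sup>n\<close>.\<close>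

definition unit_power :: "'d \<Rightarrow> (nat \<Rightarrow> int) \<Rightarrow> 'd" where
  "unit_power \<beta> y =
     \<omega> \<beta> ^ nat (y 0) * one_unit_power nrmv (\<beta> / \<omega> \<beta>) (\<lambda>n. y n mod int (CHAR('k) ^ n))"

definition v_power_at :: "'k set \<Rightarrow> 'd \<Rightarrow> (nat \<Rightarrow> int) \<Rightarrow> 'd" where
  "v_power_at I x y = x powi deg I * unit_power (\<sigma> (power_s1 I)) y"

definition v_term :: "('k set \<Rightarrow> 'k) \<Rightarrow> 'k set \<Rightarrow> 'd \<Rightarrow> (nat \<Rightarrow> int) \<Rightarrow> 'd" where
  "v_term b I x y = embv (b I) / v_power_at I x y"

text \<open>The coefficients \<open>b\<^sub>I\<close> are supported on the integral ideals.\<close>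

definition v_ideals :: "'k set set" where
  "v_ideals = nonzero_ideals A \<inter> ideals_prime_to A v"

definition v_special_series :: "('k set \<Rightarrow> 'k) \<Rightarrow> nat \<Rightarrow> 'd fps" where
  "v_special_series b j = Abs_fps (\<lambda>d.
     \<Sum>I | I \<in> v_ideals \<and> deg I = int d. embv (b I) * \<sigma> (power_s1 I) ^ j)"

definition v_essentially_algebraic ::
    "('k set \<Rightarrow> 'k) \<Rightarrow> ((nat \<Rightarrow> int) \<Rightarrow> 'd fps) \<Rightarrow> bool" where
  "v_essentially_algebraic b g \<longleftrightarrow>
     (\<forall>j::nat. \<exists>P. set (coeffs P) \<subseteq> \<sigma> ` V \<and> v_special_series b j = fps_of_poly P \<and>
       (\<forall>x. x \<noteq> 0 \<longrightarrow>
         fps_at nrmv (g (exponent_of_int CHAR('k) (Q - 1) (- int j))) (1 / x) = poly P (1 / x)))"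

definition v_continues_essentially_algebraic :: "('k set \<Rightarrow> 'k) \<Rightarrow> bool" where
  "v_continues_essentially_algebraic b \<longleftrightarrow>
     (\<exists>g. entire_family nrmv CHAR('k) (Q - 1) g \<and>
       continues_to nrmv (exponents CHAR('k) (Q - 1)) v_ideals deg (v_term b) g \<and>
       v_essentially_algebraic b g)"

end

end

theory Submission
  imports Defs
begin

text \<open>Every \<open>y\<close> is congruent to some \<open>-j\<close> with \<open>j < p\<^sup>n\<close> modulo \<open>p\<^sup>n\<close>, and then the coefficients of \<open>x\<^bsup>-d\<^esup>\<close> at \<open>y\<close>
  and at \<open>-j\<close> differ by at most \<open>C t\<^sup>d \<rho>\<^bsup>p^n\<^esup>\<close> with a uniform \<open>\<rho> < 1\<close>.  The coefficient at \<open>-j\<close> vanishes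
  once \<open>d\<close> exceeds a constant multiple of \<open>n + 1\<close>, because the degrees of the special polynomials grow
  logarithmically.  Hence the coefficients decay doubly exponentially in \<open>d\<close>, uniformly in \<open>y\<close>.

  At a prime \<open>v\<close> one takes \<open>j \<ge> p\<^sup>n\<close>, so that the ideals divisible by \<open>v\<close> contribute at most \<open>\<rho>\<^bsup>p^n\<^esup>\<close>
  to the vanishing coefficient.  The coefficients of the \<open>v\<close>-adic special values are elements of \<open>\<V>\<close> of
  height \<open>O(d)\<close> and of doubly exponentially small \<open>v\<close>-adic absolute value, so a Liouville inequality
  forces them to vanish for large \<open>d\<close>.

  Counting the elements of bounded pole order replaces the theorem of Riemann and Roch in proving that
  the class group, the residue fields and the extension \<open>\<V>\<close> of \<open>k\<close> are finite.\<close>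

section \<open>Subrings and indices\<close>

text \<open>The curve is known only through the valuation rings of its function field, so
  discreteness of valuations, finite residue fields and divisors all have to be produced.
  Cardinalities replace dimensions throughout: \<open>Fr\<close> is finite, so the elements of
  bounded degree form a finite set, a linear dependence is a pigeonhole collision and a dimension is
  the logarithm of an index. The constant \<open>N0\<close> takes the place of the genus.

  The uniform \<rho> exists because there are finitely many ideals up to positive principal factors,
  and the 1-unit parts of those factors lie in a discretely valued completion. Exponents j below p^n
  force degrees O(n), so degree d permits an n proportional to d; then \<rho>^(p^n) is doubly
  exponential in d and beats both the growth t^d of the coefficients and the lower bound,
  exponential in d, that a height O(d) imposes on a nonzero value.

  At v the argument gives no degree bound that is uniform in j. Continuity in y uses estimates
  alone, and polynomiality is proved for one j at a time.\<close>

definition add_subgroup :: "'a::ab_group_add set \<Rightarrow> bool" where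
  "add_subgroup S \<longleftrightarrow> 0 \<in> S \<and> (\<forall>x\<in>S. \<forall>y\<in>S. x - y \<in> S)"

lemma add_subgroup_minus: "add_subgroup S \<Longrightarrow> x \<in> S \<Longrightarrow> - x \<in> S"
  unfolding add_subgroup_def by (metis diff_0)

lemma add_subgroup_add: "add_subgroup S \<Longrightarrow> x \<in> S \<Longrightarrow> y \<in> S \<Longrightarrow> x + y \<in> S"
  using add_subgroup_minus[of S y] unfolding add_subgroup_def
  by (metis diff_minus_eq_add)

lemma add_subgroup_diff: "add_subgroup S \<Longrightarrow> x \<in> S \<Longrightarrow> y \<in> S \<Longrightarrow> x - y \<in> S"
  unfolding add_subgroup_def by blast

lemma add_subgroup_zero: "add_subgroup S \<Longrightarrow> 0 \<in> S"
  unfolding add_subgroup_def by blast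

lemma add_subgroup_sum: "add_subgroup S \<Longrightarrow> (\<And>i. i \<in> X \<Longrightarrow> f i \<in> S) \<Longrightarrow> sum f X \<in> S"
  by (induction X rule: infinite_finite_induct) (auto simp: add_subgroup_add add_subgroup_zero)

lemma add_subgroup_diff_swap: "add_subgroup S \<Longrightarrow> x - y \<in> S \<Longrightarrow> y - x \<in> S"
  using add_subgroup_minus[of S "x - y"] by simp

lemma add_subgroup_diff_trans: "add_subgroup S \<Longrightarrow> x - y \<in> S \<Longrightarrow> y - z \<in> S \<Longrightarrow> x - z \<in> S"
  using add_subgroup_add[of S "x - y" "y - z"] by simp

lemma add_subgroup_diff_iff: "add_subgroup S \<Longrightarrow> x - y \<in> S \<Longrightarrow> x \<in> S \<longleftrightarrow> y \<in> S"
  using add_subgroup_add[of S "x - y" y] add_subgroup_diff[of S x "x - y"] by auto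

lemma subring_add_subgroup: "is_subring S \<Longrightarrow> add_subgroup S"
  unfolding is_subring_def add_subgroup_def by (metis diff_self)

lemma subring_one: "is_subring S \<Longrightarrow> 1 \<in> S"
  unfolding is_subring_def by blast

lemma subring_mult: "is_subring S \<Longrightarrow> x \<in> S \<Longrightarrow> y \<in> S \<Longrightarrow> x * y \<in> S"
  unfolding is_subring_def by blast

lemma subring_power: "is_subring S \<Longrightarrow> x \<in> S \<Longrightarrow> x ^ n \<in> S"
  by (induction n) (auto simp: subring_one subring_mult)

lemma subring_prod: "is_subring S \<Longrightarrow> (\<And>i. i \<in> X \<Longrightarrow> f i \<in> S) \<Longrightarrow> prod f X \<in> S"
  by (induction X rule: infinite_finite_induct) (auto simp: subring_one subring_mult)

lemmas subring_add = add_subgroup_add[OF subring_add_subgroup]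
  and subring_diff = add_subgroup_diff[OF subring_add_subgroup]
  and subring_minus = add_subgroup_minus[OF subring_add_subgroup]
  and subring_zero = add_subgroup_zero[OF subring_add_subgroup]
  and subring_sum = add_subgroup_sum[OF subring_add_subgroup]

lemma subfield_subring: "is_subfield S \<Longrightarrow> is_subring S"
  unfolding is_subfield_def by blast

lemma subfield_inverse: "is_subfield S \<Longrightarrow> x \<in> S \<Longrightarrow> inverse x \<in> S"
  unfolding is_subfield_def by blast

lemma subfield_divide: "is_subfield S \<Longrightarrow> x \<in> S \<Longrightarrow> y \<in> S \<Longrightarrow> x / y \<in> S"
  unfolding divide_inverse by (metis subfield_inverse subfield_subring subring_mult)

lemma subfield_hull: "is_subfield (is_subfield hull X)"
  by (rule hull_in) (auto simp: is_subfield_def is_subring_def)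

lemma poly_in_subring:
  assumes "is_subring S" "\<And>i. coeff p i \<in> S" "x \<in> S"
  shows "poly p x \<in> S"
  unfolding poly_altdef using assms by (intro subring_sum subring_mult subring_power) auto

section \<open>Indices of additive subgroups, computed from systems of representatives\<close>

definition transversal :: "'a::ab_group_add set \<Rightarrow> 'a set \<Rightarrow> 'a set \<Rightarrow> bool" where
  "transversal S m R \<longleftrightarrow> R \<subseteq> S \<and> (\<forall>x\<in>S. \<exists>y\<in>R. x - y \<in> m) \<and>
     (\<forall>x\<in>R. \<forall>y\<in>R. x - y \<in> m \<longrightarrow> x = y)"

definition has_index :: "'a::ab_group_add set \<Rightarrow> 'a set \<Rightarrow> nat \<Rightarrow> bool" where
  "has_index S m n \<longleftrightarrow> (\<exists>R. transversal S m R \<and> finite R \<and> card R = n)"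

text \<open>The map \<open>f\<close> need not be additive. Compatibility with the two congruences
  makes it injective on cosets and \<open>surj\<close> makes it onto, so it carries a transversal to
  a transversal.\<close>

lemma has_index_map:
  assumes m: "add_subgroup m" and m': "add_subgroup m'"
    and into: "\<And>x. x \<in> S \<Longrightarrow> f x \<in> S'"
    and iff: "\<And>x y. x \<in> S \<Longrightarrow> y \<in> S \<Longrightarrow> f x - f y \<in> m' \<longleftrightarrow> x - y \<in> m"
    and surj: "\<And>z. z \<in> S' \<Longrightarrow> \<exists>x\<in>S. z - f x \<in> m'"
    and ind: "has_index S m n"
  shows "has_index S' m' n"
proof -
  obtain R where R: "transversal S m R" "finite R" "card R = n"
    using ind unfolding has_index_def by blast
  have inj: "inj_on f R"
  proof (rule inj_onI)
    fix x y assume xy: "x \<in> R" "y \<in> R" "f x = f y"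
    hence "x - y \<in> m" using iff[of x y] R(1) add_subgroup_zero[OF m']
      unfolding transversal_def by auto
    thus "x = y" using R(1) xy unfolding transversal_def by blast
  qed
  have "transversal S' m' (f ` R)"
    unfolding transversal_def
  proof (intro conjI ballI impI)
    show "f ` R \<subseteq> S'" using R(1) into unfolding transversal_def by blast
  next
    fix z assume "z \<in> S'"
    then obtain x where x: "x \<in> S" "z - f x \<in> m'" using surj by blast
    then obtain y where y: "y \<in> R" "x - y \<in> m" using R(1) unfolding transversal_def by blast
    have "f x - f y \<in> m'" using iff[of x y] x y R(1) unfolding transversal_def by blast
    thus "\<exists>y\<in>f ` R. z - y \<in> m'" using add_subgroup_diff_trans[OF m' x(2)] y by blast
  next
    fix u w assume uw: "u \<in> f ` R" "w \<in> f ` R" "u - w \<in> m'"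
    then obtain x y where "x \<in> R" "y \<in> R" "u = f x" "w = f y" by blast
    thus "u = w" using uw iff[of x y] R(1) unfolding transversal_def by blast
  qed
  thus ?thesis unfolding has_index_def using R card_image[OF inj] by blast
qed

text \<open>For the cases in which the index on the target side is the known one. A choice of
  preimages modulo \<open>m'\<close> is a map in the other direction to which
  \<open>has_index_map\<close> applies.\<close>

lemma has_index_map_rev:
  assumes m: "add_subgroup m" and m': "add_subgroup m'"
    and into: "\<And>x. x \<in> S \<Longrightarrow> f x \<in> S'"
    and iff: "\<And>x y. x \<in> S \<Longrightarrow> y \<in> S \<Longrightarrow> f x - f y \<in> m' \<longleftrightarrow> x - y \<in> m"
    and surj: "\<And>z. z \<in> S' \<Longrightarrow> \<exists>x\<in>S. z - f x \<in> m'"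
    and ind: "has_index S' m' n"
  shows "has_index S m n"
proof -
  obtain g where g: "\<And>z. z \<in> S' \<Longrightarrow> g z \<in> S \<and> z - f (g z) \<in> m'" using surj by metis
  show ?thesis
  proof (rule has_index_map[OF m' m _ _ _ ind])
    fix z w assume zw: "z \<in> S'" "w \<in> S'"
    have a: "z - f (g z) \<in> m'" "w - f (g w) \<in> m'" using g zw by auto
    have "g z - g w \<in> m \<longleftrightarrow> f (g z) - f (g w) \<in> m'" using iff g zw by blast
    also have "\<dots> \<longleftrightarrow> z - w \<in> m'"
      using add_subgroup_diff_trans[OF m' a(1), of "f (g w)"] add_subgroup_diff_trans[OF m' _ a(2)]
        add_subgroup_diff_trans[OF m' _ add_subgroup_diff_swap[OF m' a(2)], of z]
        add_subgroup_diff_trans[OF m' add_subgroup_diff_swap[OF m' a(1)]]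
        add_subgroup_diff_swap[OF m'] by (meson add_subgroup_diff_trans m')
    finally show "g z - g w \<in> m \<longleftrightarrow> z - w \<in> m'" .
  next
    fix x assume x: "x \<in> S"
    hence "f x - f (g (f x)) \<in> m'" using into g by blast
    hence "x - g (f x) \<in> m" using iff x g into by blast
    thus "\<exists>z\<in>S'. x - g z \<in> m" using into x by blast
  qed (use g in blast)
qed

lemma has_index_le_card:
  assumes "add_subgroup m" "transversal S m R" "finite X" "f ` S \<subseteq> X"
    and "\<And>x y. x \<in> S \<Longrightarrow> y \<in> S \<Longrightarrow> f x = f y \<Longrightarrow> x - y \<in> m"
  shows "finite R \<and> card R \<le> card X"
proof -
  have "inj_on f R" using assms(2,5) unfolding transversal_def inj_on_def by (meson subsetD)
  moreover have "f ` R \<subseteq> X" using assms(2,4) unfolding transversal_def by blast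
  ultimately show ?thesis using assms(3) by (meson card_inj_on_le inj_on_finite)
qed

lemma has_index_unique:
  assumes m: "add_subgroup m" and a: "has_index S m a" and b: "has_index S m b"
  shows "a = b"
proof -
  have le: "a \<le> b" if ab: "has_index S m a" "has_index S m b" for a b
  proof -
    obtain R where R: "transversal S m R" "finite R" "card R = a"
      using ab(1) unfolding has_index_def by blast
    obtain R' where R': "transversal S m R'" "finite R'" "card R' = b"
      using ab(2) unfolding has_index_def by blast
    obtain f where f: "\<And>x. x \<in> S \<Longrightarrow> f x \<in> R' \<and> x - f x \<in> m"
      using R'(1) unfolding transversal_def by metis
    have "f ` S \<subseteq> R'" using f by blast
    moreover have "x - y \<in> m" if "x \<in> S" "y \<in> S" "f x = f y" for x y
      using f[OF that(1)] f[OF that(2)] that(3) m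
      by (metis add_subgroup_diff_swap add_subgroup_diff_trans)
    ultimately show ?thesis using has_index_le_card[OF m R(1) R'(2), of f] R R' by blast
  qed
  show ?thesis using le[OF a b] le[OF b a] by simp
qed

lemma has_index_exists:
  assumes m: "add_subgroup m" and X: "finite X" "f ` S \<subseteq> X"
    and f: "\<And>x y. x \<in> S \<Longrightarrow> y \<in> S \<Longrightarrow> f x = f y \<Longrightarrow> x - y \<in> m"
  shows "\<exists>n. has_index S m n"
proof -
  define rep where "rep x = (SOME y. y \<in> S \<and> x - y \<in> m)" for x
  have rep: "rep x \<in> S \<and> x - rep x \<in> m" if "x \<in> S" for x
    unfolding rep_def by (rule someI[of _ x]) (use that add_subgroup_zero[OF m] in auto)
  \<comment> \<open>Congruent elements satisfy the same choice predicate, so \<open>SOME\<close>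
    picks one representative for a whole coset.\<close>
  have rep_eq: "rep x = rep y" if "x - y \<in> m" for x y
  proof -
    have "(z \<in> S \<and> x - z \<in> m) \<longleftrightarrow> (z \<in> S \<and> y - z \<in> m)" for z
      using that add_subgroup_diff_swap[OF m that] add_subgroup_diff_trans[OF m] by blast
    thus ?thesis unfolding rep_def by presburger
  qed
  have "transversal S m (rep ` S)"
    unfolding transversal_def
  proof (intro conjI ballI impI)
    show "rep ` S \<subseteq> S" using rep by blast
  next
    fix x assume "x \<in> S"
    thus "\<exists>y\<in>rep ` S. x - y \<in> m" using rep by blast
  next
    fix u w assume uw: "u \<in> rep ` S" "w \<in> rep ` S" "u - w \<in> m"
    then obtain x y where xy: "x \<in> S" "y \<in> S" "u = rep x" "w = rep y" by blast
    have "x - y \<in> m" using rep[OF xy(1)] rep[OF xy(2)] uw(3) xy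
      by (metis add_subgroup_diff_swap add_subgroup_diff_trans m)
    thus "u = w" using rep_eq xy by simp
  qed
  thus ?thesis using has_index_le_card[OF m _ X f] unfolding has_index_def by blast
qed

text \<open>Tower law: sums of a representative of S / J and a representative of J / I represent S /
  I exactly once.\<close>

lemma has_index_trans:
  assumes J: "add_subgroup J" and I: "add_subgroup I" and sub: "I \<subseteq> J" "J \<subseteq> S"
    and S: "add_subgroup S"
    and a: "has_index S J a" and b: "has_index J I b"
  shows "has_index S I (a * b)"
proof -
  obtain R where R: "transversal S J R" "finite R" "card R = a"
    using a unfolding has_index_def by blast
  obtain Q where Q: "transversal J I Q" "finite Q" "card Q = b"
    using b unfolding has_index_def by blast
  have RS: "x \<in> S" if "x \<in> R" for x using R(1) that unfolding transversal_def by blast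
  have QJ: "x \<in> J" if "x \<in> Q" for x using Q(1) that unfolding transversal_def by blast
  define f where "f = (\<lambda>(x, y). x + y :: 'a)"
  have key: "x = x' \<and> y = y'" if "x \<in> R" "x' \<in> R" "y \<in> Q" "y' \<in> Q" "(x + y) - (x' + y') \<in> I"
    for x x' y y'
  proof -
    have "x - x' = ((x + y) - (x' + y')) - (y - y')" by simp
    moreover have "\<dots> \<in> J" using that(5) sub QJ[OF that(3)] QJ[OF that(4)] J
      by (meson add_subgroup_diff subsetD)
    ultimately have "x = x'" using R(1) that unfolding transversal_def by auto
    thus ?thesis using that Q(1) unfolding transversal_def by auto
  qed
  have inj: "inj_on f (R \<times> Q)"
    unfolding f_def inj_on_def using key add_subgroup_zero[OF I] by auto
  have "transversal S I (f ` (R \<times> Q))"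
    unfolding transversal_def
  proof (intro conjI ballI impI)
    show "f ` (R \<times> Q) \<subseteq> S" 
    proof
      fix z assume "z \<in> f ` (R \<times> Q)"
      then obtain x y where "x \<in> R" "y \<in> Q" "z = x + y" unfolding f_def by auto
      thus "z \<in> S" using add_subgroup_add[OF S RS] QJ sub(2) by blast
    qed
  next
    fix x assume "x \<in> S"
    then obtain y where y: "y \<in> R" "x - y \<in> J" using R(1) unfolding transversal_def by blast
    then obtain z where z: "z \<in> Q" "x - y - z \<in> I" using Q(1) unfolding transversal_def by blast
    have "f (y, z) \<in> f ` (R \<times> Q)" "x - f (y, z) \<in> I"
      using y z unfolding f_def by (auto simp: diff_diff_eq)
    thus "\<exists>y\<in>f ` (R \<times> Q). x - y \<in> I" by blast
  next
    fix u w assume "u \<in> f ` (R \<times> Q)" "w \<in> f ` (R \<times> Q)" "u - w \<in> I"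
    thus "u = w" using key unfolding f_def by auto
  qed
  thus ?thesis unfolding has_index_def
    using card_image[OF inj] R Q by (metis card_cartesian_product finite_SigmaI finite_imageI)
qed

lemma has_index_zero: "finite S \<Longrightarrow> has_index S {0} (card S)"
  unfolding has_index_def transversal_def by (rule exI[of _ S]) auto

lemma has_index_card:
  assumes "finite S" "add_subgroup S" "add_subgroup m" "m \<subseteq> S" "has_index S m n"
  shows "card S = n * card m"
proof -
  have "has_index S {0} (n * card m)"
    by (rule has_index_trans[OF assms(3) _ _ assms(4,2,5)])
      (use assms has_index_zero[OF finite_subset[OF assms(4,1)]] in
        \<open>auto simp: add_subgroup_def\<close>)
  thus ?thesis using has_index_unique[OF _ has_index_zero[OF assms(1)]]
    by (auto simp: add_subgroup_def)
qed

text \<open>Largeness of \<open>Z\<close> is phrased as a negated conjunction so that infinite sets,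
  whose \<open>card\<close> is 0, are covered too.\<close>

lemma has_index_pigeonhole:
  assumes m: "add_subgroup m" and "has_index S m n" "Z \<subseteq> S" "\<not> (finite Z \<and> card Z \<le> n)"
  shows "\<exists>x\<in>Z. \<exists>y\<in>Z. x \<noteq> y \<and> x - y \<in> m"
proof (rule ccontr)
  assume no: "\<not> ?thesis"
  obtain R where R: "transversal S m R" "finite R" "card R = n"
    using assms(2) unfolding has_index_def by blast
  obtain f where f: "\<And>x. x \<in> S \<Longrightarrow> f x \<in> R \<and> x - f x \<in> m"
    using R(1) unfolding transversal_def by metis
  have "inj_on f Z"
    by (rule inj_onI) (metis (no_types) f no m assms(3) add_subgroup_diff_swap
        add_subgroup_diff_trans subsetD)
  moreover have "f ` Z \<subseteq> R" using f assms(3) by blast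
  ultimately show False using R assms(4) by (metis card_inj_on_le inj_on_finite)
qed

section \<open>Rings exhausted by finite sets, and counting\<close>

text \<open>Elements of \<open>S\<close> are combinations of the finite set \<open>B\<close> with
  coefficients in the fraction field of the union of the finite sets \<open>L D\<close>, where D
  measures degree. There are two instances: the function field over polynomials in a transcendental
  element, and the field \<open>V\<close> over elements of \<open>A\<close> of bounded pole
  order.\<close>

locale filtered_span =
  fixes L :: "nat \<Rightarrow> 'a::field set" and B S :: "'a set"
  assumes S: "is_subring S" and LS: "L D \<subseteq> S" and B: "finite B" "B \<subseteq> S"
    and L_one: "1 \<in> L 0" and L_finite: "finite (L D)" and L_Suc: "L D \<subseteq> L (Suc D)"
    and L_diff: "x \<in> L D \<Longrightarrow> y \<in> L D \<Longrightarrow> x - y \<in> L D"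
    and L_mult: "x \<in> L D \<Longrightarrow> y \<in> L E \<Longrightarrow> x * y \<in> L (D + E)"
    and den: "x \<in> S \<Longrightarrow> \<exists>D g p. g \<in> L D \<and> g \<noteq> 0 \<and> (\<forall>e\<in>B. p e \<in> L D) \<and> g * x = (\<Sum>e\<in>B. p e * e)"
begin

lemma L_mono: "D \<le> E \<Longrightarrow> L D \<subseteq> L E"
  by (induction E) (use L_Suc le_Suc_eq in auto)

lemma L_group: "add_subgroup (L D)"
proof -
  have "1 \<in> L D" using L_mono[of 0 D] L_one by auto
  thus ?thesis unfolding add_subgroup_def using L_diff by (metis diff_self)
qed

text \<open>A set of bounded height: D bounds the degree of the coefficients.\<close>

definition U :: "nat \<Rightarrow> 'a set" where
  "U D = {(\<Sum>e\<in>B. p e * e) | p. \<forall>e\<in>B. p e \<in> L D}"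

lemma U_group: "add_subgroup (U D)"
  unfolding add_subgroup_def
proof (intro conjI ballI)
  show "0 \<in> U D" unfolding U_def
    using add_subgroup_zero[OF L_group] by (intro CollectI exI[of _ "\<lambda>_. 0"]) auto
next
  fix x y assume "x \<in> U D" "y \<in> U D"
  then obtain p q where "\<forall>e\<in>B. p e \<in> L D" "\<forall>e\<in>B. q e \<in> L D"
    "x = (\<Sum>e\<in>B. p e * e)" "y = (\<Sum>e\<in>B. q e * e)" unfolding U_def by blast
  thus "x - y \<in> U D" unfolding U_def
    by (intro CollectI exI[of _ "\<lambda>e. p e - q e"])
      (auto simp: sum_subtractf left_diff_distrib L_diff)
qed

lemma U_mono: "D \<le> E \<Longrightarrow> U D \<subseteq> U E"
  using L_mono unfolding U_def by blast

lemma L_U_mult: "a \<in> L D \<Longrightarrow> u \<in> U E \<Longrightarrow> a * u \<in> U (D + E)"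
proof -
  assume a: "a \<in> L D" and "u \<in> U E"
  then obtain p where "\<forall>e\<in>B. p e \<in> L E" "u = (\<Sum>e\<in>B. p e * e)" unfolding U_def by blast
  thus ?thesis unfolding U_def using a
    by (intro CollectI exI[of _ "\<lambda>e. a * p e"]) (auto simp: sum_distrib_left mult.assoc L_mult)
qed

lemma U_card: "finite (U D) \<and> card (U D) \<le> card (L D) ^ card B"
proof -
  have sub: "U D \<subseteq> (\<lambda>p. \<Sum>e\<in>B. p e * e) ` (B \<rightarrow>\<^sub>E L D)"
  proof
    fix x assume "x \<in> U D"
    then obtain p where p: "\<forall>e\<in>B. p e \<in> L D" "x = (\<Sum>e\<in>B. p e * e)" unfolding U_def by blast
    have "x = (\<Sum>e\<in>B. restrict p B e * e)" unfolding p(2) by (rule sum.cong) auto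
    moreover have "restrict p B \<in> B \<rightarrow>\<^sub>E L D" using p(1) by auto
    ultimately show "x \<in> (\<lambda>p. \<Sum>e\<in>B. p e * e) ` (B \<rightarrow>\<^sub>E L D)" by (rule image_eqI)
  qed
  have fin: "finite (B \<rightarrow>\<^sub>E L D)" using B(1) L_finite by (simp add: finite_PiE)
  have "card (U D) \<le> card (B \<rightarrow>\<^sub>E L D)" using fin sub by (meson surj_card_le)
  also have "\<dots> = card (L D) ^ card B" using B(1) by (simp add: card_PiE)
  finally show ?thesis using fin sub by (meson finite_imageI finite_subset)
qed

lemma common_den:
  assumes "finite Z" "Z \<subseteq> S"
  shows "\<exists>D g. g \<in> L D \<and> g \<noteq> 0 \<and> (\<forall>z\<in>Z. g * z \<in> U D)"
  using assms
proof (induction Z rule: finite_induct)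
  case empty
  thus ?case using L_one by (intro exI[of _ 0] exI[of _ 1]) auto
next
  case (insert x Z)
  then obtain D g where g: "g \<in> L D" "g \<noteq> 0" "\<forall>z\<in>Z. g * z \<in> U D" by auto
  obtain E h p where h: "h \<in> L E" "h \<noteq> 0"
    and p: "\<forall>e\<in>B. p e \<in> L E" "h * x = (\<Sum>e\<in>B. p e * e)"
    using den[of x] insert.prems by auto
  have hx: "h * x \<in> U E" unfolding p(2) U_def using p(1) by (intro CollectI exI[of _ p]) simp
  have "g * h * z \<in> U (D + E)" if "z \<in> Z" for z
    using L_U_mult[OF h(1), of "g * z"] g(3) that by (auto simp: ac_simps)
  moreover have "g * h * x \<in> U (D + E)" using L_U_mult[OF g(1) hx] by (simp add: ac_simps)
  moreover have "g * h \<in> L (D + E)" using L_mult g h by blast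
  ultimately show ?case using g(2) h(2) by (intro exI[of _ "D + E"] exI[of _ "g * h"]) auto
qed

text \<open>Clearing at once the denominators of the finitely many products of two elements of
  \<open>B\<close> makes heights additive up to the constant \<open>H\<close>.\<close>

lemma structure_constants:
  "\<exists>H k. k \<in> L H \<and> k \<noteq> 0 \<and> (\<forall>D E. \<forall>u\<in>U D. \<forall>w\<in>U E. k * (u * w) \<in> U (D + E + H))"
proof -
  have "(\<lambda>(x, y). x * y) ` (B \<times> B) \<subseteq> S" using B(2) subring_mult[OF S] by auto
  then obtain H k where k: "k \<in> L H" "k \<noteq> 0"
    and "\<forall>z\<in>(\<lambda>(x, y). x * y) ` (B \<times> B). k * z \<in> U H"
    using common_den[of "(\<lambda>(x, y). x * y) ` (B \<times> B)"] B(1) by blast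
  hence kB: "k * (e * e') \<in> U H" if "e \<in> B" "e' \<in> B" for e e' using that by auto
  have "k * (u * w) \<in> U (D + E + H)" if uw: "u \<in> U D" "w \<in> U E" for D E u w
  proof -
    obtain p where p: "\<forall>e\<in>B. p e \<in> L D" "u = (\<Sum>e\<in>B. p e * e)" using uw unfolding U_def by blast
    obtain q where q: "\<forall>e\<in>B. q e \<in> L E" "w = (\<Sum>e\<in>B. q e * e)" using uw unfolding U_def by blast
    have "k * (u * w) = (\<Sum>e\<in>B. \<Sum>e'\<in>B. (p e * q e') * (k * (e * e')))"
      unfolding p(2) q(2) sum_product by (simp add: sum_distrib_left ac_simps)
    also have "\<dots> \<in> U (D + E + H)"
      using p(1) q(1) kB by (intro add_subgroup_sum[OF U_group] L_U_mult L_mult) auto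
    finally show ?thesis .
  qed
  thus ?thesis using k by blast
qed

text \<open>Siegel's lemma by pigeonhole: there are more coefficient vectors than possible values in
  \<open>U (R + D)\<close>, and the difference of two vectors with equal value is the
  relation.\<close>

lemma small_relation:
  assumes w: "\<And>i. i \<le> N \<Longrightarrow> w i \<in> U D" and less: "card (L (R + D)) ^ card B < card (L R) ^ (N + 1)"
  shows "\<exists>c. (\<forall>i\<le>N. c i \<in> L R) \<and> (\<exists>i\<le>N. c i \<noteq> 0) \<and> (\<Sum>i\<le>(N::nat). c i * w i) = 0"
proof -
  define f where "f c = (\<Sum>i\<le>N. c i * w i)" for c
  let ?X = "{..N} \<rightarrow>\<^sub>E L R"
  have "f ` ?X \<subseteq> U (R + D)"
    unfolding f_def using w by (auto intro!: add_subgroup_sum[OF U_group] L_U_mult)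
  hence "card (f ` ?X) \<le> card (U (R + D))" using U_card by (intro card_mono) auto
  also have "\<dots> \<le> card (L (R + D)) ^ card B" using U_card by blast
  also have "\<dots> < card ?X" using less by (simp add: card_PiE)
  finally have "\<not> inj_on f ?X" by (rule pigeonhole)
  then obtain c c' where cc: "c \<in> ?X" "c' \<in> ?X" "c \<noteq> c'" "f c = f c'" unfolding inj_on_def by blast
  have "(\<Sum>i\<le>N. (c i - c' i) * w i) = 0"
    using cc(4) unfolding f_def by (simp add: left_diff_distrib sum_subtractf)
  moreover have "\<exists>i\<le>N. c i - c' i \<noteq> 0"
    using cc by (metis PiE_ext atMost_iff right_minus_eq)
  moreover have "\<forall>i\<le>N. c i - c' i \<in> L R" using cc L_diff by (auto simp: PiE_iff)
  ultimately show ?thesis by (intro exI[of _ "\<lambda>i. c i - c' i"]) auto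
qed

text \<open>\<open>small_relation\<close> for the powers of e, whose heights grow linearly with the
  height of e. The constant \<open>K\<close> absorbs the denominators.\<close>

lemma power_relation:
  "\<exists>K. \<forall>E R e. e \<in> U E \<longrightarrow> card (L (R + K * (E + 1))) ^ card B < card (L R) ^ (card B + 1) \<longrightarrow>
     (\<exists>c. (\<forall>i\<le>card B. c i \<in> L R) \<and> (\<exists>i\<le>card B. c i \<noteq> 0) \<and> (\<Sum>i\<le>card B. c i * e ^ i) = 0)"
proof -
  obtain H k where k: "k \<in> L H" "k \<noteq> 0"
    and kU: "\<And>D E u w. u \<in> U D \<Longrightarrow> w \<in> U E \<Longrightarrow> k * (u * w) \<in> U (D + E + H)"
    using structure_constants by blast
  obtain D0 g where g: "g \<in> L D0" "g \<noteq> 0" "g * 1 \<in> U D0"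
    using common_den[of "{1}"] subring_one[OF S] by auto
  define N where "N = card B"
  define K where "K = D0 + N * (H + 1)"
  have "\<exists>c. (\<forall>i\<le>N. c i \<in> L R) \<and> (\<exists>i\<le>N. c i \<noteq> 0) \<and> (\<Sum>i\<le>N. c i * e ^ i) = 0"
    if e: "e \<in> U E" and less: "card (L (R + K * (E + 1))) ^ N < card (L R) ^ (N + 1)" for E R e
  proof -
    \<comment> \<open>Each factor e costs one factor k, and further factors k are harmless. Padding
      all powers to the same factor k^N makes a relation among the \<open>w i\<close> a relation
      among the powers of e.\<close>
    have pw: "k ^ (a + i) * e ^ i * g \<in> U (D0 + (a + i) * (E + H))" for a i
    proof (induction i)
      case 0
      show ?case
      proof (induction a)
        case 0 thus ?case using g by simp
      next
        case (Suc a)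
        have "k * (k ^ a * g) \<in> U (H + (D0 + a * (E + H)))" using L_U_mult[OF k(1)] Suc by simp
        moreover have "H + (D0 + a * (E + H)) \<le> D0 + Suc a * (E + H)" by simp
        ultimately have "k * (k ^ a * g) \<in> U (D0 + Suc a * (E + H))" using U_mono by blast
        thus ?case by (simp add: ac_simps)
      qed
    next
      case (Suc i)
      have "k * (e * (k ^ (a + i) * e ^ i * g)) \<in> U (E + (D0 + (a + i) * (E + H)) + H)"
        using kU[OF e Suc] .
      thus ?case by (simp add: ac_simps)
    qed
    define w where "w i = k ^ N * e ^ i * g" for i
    have w: "w i \<in> U (K * (E + 1))" if "i \<le> N" for i
    proof -
      have "w i \<in> U (D0 + N * (E + H))" using pw[of "N - i" i] that unfolding w_def by simp
      moreover have "D0 + N * (E + H) \<le> K * (E + 1)"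
        unfolding K_def by (simp add: algebra_simps)
      ultimately show ?thesis using U_mono by blast
    qed
    obtain c where c: "\<forall>i\<le>N. c i \<in> L R" "\<exists>i\<le>N. c i \<noteq> 0" "(\<Sum>i\<le>N. c i * w i) = 0"
      using small_relation[of N w "K * (E + 1)" R] w less unfolding N_def by blast
    have "k ^ N * g * (\<Sum>i\<le>N. c i * e ^ i) = (\<Sum>i\<le>N. c i * w i)"
      unfolding w_def sum_distrib_left by (simp add: ac_simps)
    hence "(\<Sum>i\<le>N. c i * e ^ i) = 0" using k g c(3) by simp
    thus ?thesis using c by blast
  qed
  thus ?thesis unfolding N_def by blast
qed

text \<open>The number of products \<open>x\<^sup>i y\<^sub>j\<close> with \<open>i \<le> D\<close>, \<open>j \<le> N\<close> outgrows the space in which they lie.\<close>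

lemma linear_relation:
  assumes F: "finite F" "is_subfield F" "F \<subseteq> L 0" and La: "\<And>D. card (L D) \<le> card F ^ (a * (D + 1))"
    and x: "x \<in> S" "x \<noteq> 0"
  shows "\<exists>N::nat. \<forall>y. (\<forall>j\<le>N. y j \<in> S) \<longrightarrow> (\<exists>p. (\<forall>j i. coeff (p j) i \<in> F) \<and>
           (\<exists>j\<le>N. coeff (p j) 0 \<noteq> 0) \<and> (\<Sum>j\<le>N. poly (p j) x * y j) = 0)"
proof -
  note F_ring = subfield_subring[OF F(2)]
  have "0 \<in> F" "1 \<in> F" using subring_zero[OF F_ring] subring_one[OF F_ring] by auto
  hence r: "card F \<ge> 2" using F(1) card_mono[of F "{0, 1}"] by auto
  obtain H k where k: "k \<in> L H" "k \<noteq> 0"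
    and kU: "\<And>D E u w. u \<in> U D \<Longrightarrow> w \<in> U E \<Longrightarrow> k * (u * w) \<in> U (D + E + H)"
    using structure_constants by blast
  obtain D1 g where g: "g \<in> L D1" "g \<noteq> 0" "g * x \<in> U D1"
    using common_den[of "{x}"] x by auto
  define h where "h = k * g"
  define M where "M = H + D1"
  have h0: "h \<noteq> 0" and hL: "h \<in> L M" using k g L_mult unfolding h_def M_def by auto
  \<comment> \<open>Chosen so that the exponents of \<open>card F\<close>, target against source,
    compare as D + N * D < (N + 1) * (D + 1) for the D defined below.\<close>
  define N where "N = a * card B * M"
  show ?thesis
  proof (intro exI[of _ N] allI impI)
    fix y :: "nat \<Rightarrow> 'a" assume y: "\<forall>j\<le>N. y j \<in> S"
    obtain D0 G where G: "G \<in> L D0" "G \<noteq> 0" "\<forall>z\<in>y ` {..N}. G * z \<in> U D0"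
      using common_den[of "y ` {..N}"] y by (metis atMost_iff finite_atMost finite_imageI image_subsetI)
    have pw: "h ^ b * (h * x) ^ i * u \<in> U (D0 + (b + i) * M)" if u: "u \<in> U D0" for b i u
    proof (induction b)
      case 0
      show ?case
      proof (induction i)
        case 0 thus ?case using u by simp
      next
        case (Suc i)
        have "k * ((g * x) * ((h * x) ^ i * u)) \<in> U (D1 + (D0 + i * M) + H)"
          using kU[OF g(3)] Suc by simp
        thus ?case unfolding h_def M_def by (simp add: ac_simps)
      qed
    next
      case (Suc b)
      have "h * (h ^ b * (h * x) ^ i * u) \<in> U (M + (D0 + (b + i) * M))" using L_U_mult[OF hL Suc] .
      thus ?case by (simp add: ac_simps)
    qed
    define D where "D = a * card B * (D0 + 1)"
    define w where "w = (\<lambda>(j, i). h ^ D * x ^ i * (G * y j))"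
    have w: "w (j, i) \<in> U (D0 + M * D)" if "j \<le> N" "i \<le> D" for i j
    proof -
      have eq: "h ^ D = h ^ (D - i) * h ^ i" using that by (simp add: power_add[symmetric])
      have "h ^ (D - i) * (h * x) ^ i * (G * y j) \<in> U (D0 + (D - i + i) * M)"
        using pw G(3) that by blast
      thus ?thesis unfolding w_def using that by (simp add: eq power_mult_distrib ac_simps)
    qed
    define f where "f c = (\<Sum>z\<in>{..N} \<times> {..D}. c z * w z)" for c
    let ?X = "({..N} \<times> {..D}) \<rightarrow>\<^sub>E F"
    have "f c \<in> U (D0 + M * D)" if c: "c \<in> ?X" for c
      unfolding f_def
    proof (rule add_subgroup_sum[OF U_group])
      fix z assume z: "z \<in> {..N} \<times> {..D}"
      hence "c z \<in> L 0" using c F(3) by (auto simp: PiE_iff)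
      moreover have "w z \<in> U (D0 + M * D)" using w z by auto
      ultimately show "c z * w z \<in> U (D0 + M * D)" using L_U_mult[of "c z" 0] by auto
    qed
    hence "card (f ` ?X) \<le> card (U (D0 + M * D))" using U_card by (intro card_mono) auto
    also have "\<dots> \<le> card (L (D0 + M * D)) ^ card B" using U_card by blast
    also have "\<dots> \<le> (card F ^ (a * (D0 + M * D + 1))) ^ card B"
      by (rule power_mono[OF La]) simp
    also have "\<dots> = card F ^ (a * card B * (D0 + M * D + 1))"
      unfolding power_mult[symmetric] by (rule arg_cong[of _ _ "\<lambda>n. card F ^ n"]) (simp only: ac_simps)
    also have "\<dots> < card F ^ ((N + 1) * (D + 1))"
    proof (rule power_strict_increasing)
      have "a * card B * (D0 + M * D + 1) = a * card B * (D0 + 1) + a * card B * M * D"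
        by (simp only: algebra_simps)
      also have "\<dots> = D + N * D" unfolding N_def D_def[symmetric] ..
      also have "\<dots> < (N + 1) * (D + 1)" by simp
      finally show "a * card B * (D0 + M * D + 1) < (N + 1) * (D + 1)" .
    qed (use r in simp)
    also have "\<dots> = card ?X" by (simp add: card_PiE card_cartesian_product)
    finally have "\<not> inj_on f ?X" by (rule pigeonhole)
    then obtain c c' where cc: "c \<in> ?X" "c' \<in> ?X" "c \<noteq> c'" "f c = f c'" unfolding inj_on_def by blast
    define q where "q j i = c (j, i) - c' (j, i)" for j i
    have qF: "q j i \<in> F" if "j \<le> N" "i \<le> D" for j i
      unfolding q_def using cc that subring_diff[OF F_ring] by (auto simp: PiE_iff)
    have "(\<Sum>z\<in>{..N} \<times> {..D}. (c z - c' z) * w z) = 0"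
      using cc(4) unfolding f_def by (simp add: left_diff_distrib sum_subtractf)
    hence "(\<Sum>(j, i)\<in>{..N} \<times> {..D}. q j i * (h ^ D * x ^ i * (G * y j))) = 0"
      unfolding q_def w_def by (simp add: case_prod_unfold)
    hence "h ^ D * G * (\<Sum>j\<le>N. \<Sum>i\<le>D. q j i * x ^ i * y j) = 0"
      unfolding sum.cartesian_product[symmetric] sum_distrib_left by (simp add: ac_simps)
    hence rel: "(\<Sum>j\<le>N. \<Sum>i\<le>D. q j i * x ^ i * y j) = 0" using h0 G by simp
    have "\<exists>z\<in>{..N} \<times> {..D}. c z \<noteq> c' z" using cc by (metis PiE_ext)
    hence ex: "\<exists>i. i \<le> D \<and> (\<exists>j\<le>N. q j i \<noteq> 0)" unfolding q_def by auto
    \<comment> \<open>The lowest power of x that occurs. Dividing the relation by x^i0 makes some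
      constant coefficient nonzero.\<close>
    define i0 where "i0 = (LEAST i. i \<le> D \<and> (\<exists>j\<le>N. q j i \<noteq> 0))"
    have i0: "i0 \<le> D" "\<exists>j\<le>N. q j i0 \<noteq> 0" using LeastI_ex[OF ex] unfolding i0_def by auto
    have i0_least: "q j i = 0" if "i < i0" "j \<le> N" for i j
    proof (rule ccontr)
      assume "q j i \<noteq> 0"
      hence "i0 \<le> i" unfolding i0_def using that i0(1) by (intro Least_le) auto
      thus False using that by simp
    qed
    define p where "p j = (if j \<le> N then \<Sum>i\<in>{i0..D}. monom (q j i) (i - i0) else 0)" for j
    have pF: "coeff (p j) i \<in> F" for i j
      unfolding p_def using qF \<open>0 \<in> F\<close> by (auto simp: coeff_sum intro!: subring_sum[OF F_ring])
    have p0: "coeff (p j) 0 = q j i0" if "j \<le> N" for j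
    proof -
      have "coeff (p j) 0 = (\<Sum>i\<in>{i0..D}. coeff (monom (q j i) (i - i0)) 0)"
        unfolding p_def using that by (simp add: coeff_sum)
      also have "\<dots> = (\<Sum>i\<in>{i0..D}. if i = i0 then q j i0 else 0)"
        by (rule sum.cong) auto
      finally show ?thesis using i0(1) by simp
    qed
    have px: "x ^ i0 * poly (p j) x = (\<Sum>i\<le>D. q j i * x ^ i)" if "j \<le> N" for j
    proof -
      have "x ^ i0 * poly (p j) x = (\<Sum>i\<in>{i0..D}. x ^ i0 * (q j i * x ^ (i - i0)))"
        unfolding p_def using that by (simp add: poly_sum poly_monom sum_distrib_left)
      also have "\<dots> = (\<Sum>i\<in>{i0..D}. q j i * x ^ i)"
      proof (rule sum.cong)
        fix i assume "i \<in> {i0..D}"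
        hence "x ^ i = x ^ i0 * x ^ (i - i0)" by (simp flip: power_add)
        thus "x ^ i0 * (q j i * x ^ (i - i0)) = q j i * x ^ i" by simp
      qed simp
      also have "\<dots> = (\<Sum>i\<le>D. q j i * x ^ i)"
        by (rule sum.mono_neutral_left) (use i0_least that in \<open>auto simp: not_le\<close>)
      finally show ?thesis .
    qed
    have "x ^ i0 * (\<Sum>j\<le>N. poly (p j) x * y j) = (\<Sum>j\<le>N. x ^ i0 * poly (p j) x * y j)"
      by (simp add: sum_distrib_left mult.assoc)
    also have "\<dots> = (\<Sum>j\<le>N. (\<Sum>i\<le>D. q j i * x ^ i) * y j)"
      using px by (intro sum.cong) auto
    also have "\<dots> = 0" using rel by (simp add: sum_distrib_right)
    finally have "(\<Sum>j\<le>N. poly (p j) x * y j) = 0" using x by simp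
    moreover have "\<exists>j\<le>N. coeff (p j) 0 \<noteq> 0" using p0 i0(2) by auto
    ultimately show "\<exists>p. (\<forall>j i. coeff (p j) i \<in> F) \<and> (\<exists>j\<le>N. coeff (p j) 0 \<noteq> 0) \<and>
        (\<Sum>j\<le>N. poly (p j) x * y j) = 0"
      using pF by (intro exI[of _ p]) simp
  qed
qed

end

section \<open>Residue degrees\<close>

text \<open>The two clauses in the description of \<open>residue_degree\<close>, independence and
  spanning modulo m, get separate names so that a basis can be built step by step.\<close>

definition residue_independent :: "'a::field set \<Rightarrow> 'a set \<Rightarrow> 'a set \<Rightarrow> bool" where
  "residue_independent R m B \<longleftrightarrow> (\<forall>c. c ` B \<subseteq> R \<and> (\<Sum>e\<in>B. c e * e) \<in> m \<longrightarrow> c ` B \<subseteq> m)"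

definition residue_spanning :: "'a::field set \<Rightarrow> 'a set \<Rightarrow> 'a set \<Rightarrow> 'a set \<Rightarrow> bool" where
  "residue_spanning R S m B \<longleftrightarrow> (\<forall>x\<in>S. \<exists>c. c ` B \<subseteq> R \<and> x - (\<Sum>e\<in>B. c e * e) \<in> m)"

locale residue_extension =
  fixes R S m :: "'a::field set"
  assumes R: "is_subring R" and S: "is_subring S" and RS: "R \<subseteq> S"
    and m: "add_subgroup m" and mS: "m \<subseteq> S" and ideal: "\<And>x y. x \<in> S \<Longrightarrow> y \<in> m \<Longrightarrow> x * y \<in> m"
    and one: "1 \<notin> m"
    and inv: "\<And>x. x \<in> R \<Longrightarrow> x \<notin> m \<Longrightarrow> \<exists>y\<in>R. x * y - 1 \<in> m"
begin

text \<open>Coordinates with respect to a basis, taken among representatives of R modulo m, are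
  unique, and each coordinate has q possible values.\<close>

lemma span_index:
  assumes B: "finite B" "B \<subseteq> S" "residue_independent R m B" "residue_spanning R S m B"
    and q: "has_index R (m \<inter> R) q"
  shows "has_index S m (q ^ card B)"
proof -
  obtain T where T: "transversal R (m \<inter> R) T" "finite T" "card T = q"
    using q unfolding has_index_def by blast
  have TR: "T \<subseteq> R" using T(1) unfolding transversal_def by blast
  define f where "f c = (\<Sum>e\<in>B. c e * e)" for c :: "'a \<Rightarrow> 'a"
  let ?X = "B \<rightarrow>\<^sub>E T"
  have key: "c = c'" if c: "c \<in> ?X" "c' \<in> ?X" "f c - f c' \<in> m" for c c'
  proof -
    have "(\<Sum>e\<in>B. (c e - c' e) * e) \<in> m"
      using c(3) unfolding f_def by (simp add: left_diff_distrib sum_subtractf)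
    moreover have d: "(\<lambda>e. c e - c' e) ` B \<subseteq> R"
    proof (intro image_subsetI)
      fix e assume "e \<in> B"
      hence "c e \<in> R" "c' e \<in> R" using c TR by (auto simp: PiE_iff)
      thus "c e - c' e \<in> R" by (rule subring_diff[OF R])
    qed
    ultimately have "(\<lambda>e. c e - c' e) ` B \<subseteq> m"
      using B(3) unfolding residue_independent_def by (auto dest: spec[of _ "\<lambda>e. c e - c' e"])
    hence "c e = c' e" if "e \<in> B" for e
      using that d c T(1) unfolding transversal_def by (auto simp: PiE_iff image_subset_iff)
    thus ?thesis using c by (metis PiE_ext)
  qed
  have inj: "inj_on f ?X"
    by (rule inj_onI) (use key add_subgroup_zero[OF m] in auto)
  have "transversal S m (f ` ?X)"
    unfolding transversal_def
  proof (intro conjI ballI impI)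
    show "f ` ?X \<subseteq> S"
      unfolding f_def using B(2) TR RS
      by (auto intro!: subring_sum[OF S] subring_mult[OF S] simp: PiE_iff)
  next
    fix x assume "x \<in> S"
    then obtain c where c: "c ` B \<subseteq> R" "x - (\<Sum>e\<in>B. c e * e) \<in> m"
      using B(4) unfolding residue_spanning_def by blast
    have "\<forall>e\<in>B. \<exists>t\<in>T. c e - t \<in> m" using c(1) T(1) unfolding transversal_def by blast
    then obtain d where d: "\<And>e. e \<in> B \<Longrightarrow> d e \<in> T \<and> c e - d e \<in> m" by metis
    have "f c - f (restrict d B) = (\<Sum>e\<in>B. (c e - d e) * e)"
      unfolding f_def by (simp add: left_diff_distrib sum_subtractf)
    also have "\<dots> \<in> m"
    proof (rule add_subgroup_sum[OF m])
      fix e assume e: "e \<in> B"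
      have "e * (c e - d e) \<in> m" using ideal d e B(2) by blast
      thus "(c e - d e) * e \<in> m" by (simp add: mult.commute)
    qed
    finally have "x - f (restrict d B) \<in> m"
      using add_subgroup_diff_trans[OF m] c(2) unfolding f_def by blast
    moreover have "restrict d B \<in> ?X" using d by auto
    ultimately show "\<exists>y\<in>f ` ?X. x - y \<in> m" by blast
  next
    fix u w assume "u \<in> f ` ?X" "w \<in> f ` ?X" "u - w \<in> m"
    thus "u = w" using key by auto
  qed
  moreover have "card (f ` ?X) = q ^ card B"
    using card_image[OF inj] B(1) T by (simp add: card_PiE)
  moreover have "finite (f ` ?X)" using B(1) T(2) by (simp add: finite_PiE)
  ultimately show ?thesis unfolding has_index_def by blast
qed

text \<open>An independent set of maximal size spans, as in linear algebra over the field R / (m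
  \<inter> R): otherwise a further element enters a dependence with a coefficient that is invertible
  modulo m.\<close>

lemma basis_exists:
  assumes bound: "\<And>B. finite B \<Longrightarrow> B \<subseteq> S \<Longrightarrow> residue_independent R m B \<Longrightarrow> card B \<le> K"
  shows "\<exists>B. finite B \<and> B \<subseteq> S \<and> residue_independent R m B \<and> residue_spanning R S m B"
proof -
  define Q where "Q n \<longleftrightarrow> (\<exists>B. finite B \<and> B \<subseteq> S \<and> residue_independent R m B \<and> card B = n)" for n
  have "Q 0" unfolding Q_def residue_independent_def by (rule exI[of _ "{}"]) auto
  moreover have le: "\<And>n. Q n \<Longrightarrow> n \<le> K" unfolding Q_def using bound by blast
  ultimately have Q: "Q (Greatest Q)" and max: "\<And>n. Q n \<Longrightarrow> n \<le> Greatest Q"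
    by (auto intro: GreatestI_nat Greatest_le_nat)
  obtain B where B: "finite B" "B \<subseteq> S" "residue_independent R m B" "card B = Greatest Q"
    using Q unfolding Q_def by blast
  have "\<exists>c. c ` B \<subseteq> R \<and> x - (\<Sum>e\<in>B. c e * e) \<in> m" if x: "x \<in> S" for x
  proof (cases "x \<in> B")
    case True
    have "(\<Sum>e\<in>B. (if e = x then 1 else 0) * e) = (\<Sum>e\<in>B. if e = x then x else 0)"
      by (rule sum.cong) auto
    also have "\<dots> = x" using B(1) True by simp
    finally show ?thesis
      using subring_one[OF R] subring_zero[OF R] add_subgroup_zero[OF m]
      by (intro exI[of _ "\<lambda>e. if e = x then 1 else 0"]) auto
  next
    case False
    have "\<not> residue_independent R m (insert x B)"
    proof
      assume "residue_independent R m (insert x B)"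
      hence "Q (card (insert x B))" unfolding Q_def using B x by (intro exI[of _ "insert x B"]) auto
      from max[OF this] show False using B False by simp
    qed
    then obtain c where c: "c ` insert x B \<subseteq> R" "(\<Sum>e\<in>insert x B. c e * e) \<in> m"
      and nz: "\<not> c ` insert x B \<subseteq> m"
      unfolding residue_independent_def by blast
    have sum: "c x * x + (\<Sum>e\<in>B. c e * e) \<in> m" using c(2) B(1) False by simp
    have cR: "c x \<in> R" "\<And>e. e \<in> B \<Longrightarrow> c e \<in> R" using c(1) by auto
    have "c x \<notin> m"
    proof
      assume cx: "c x \<in> m"
      hence "x * c x \<in> m" using ideal x by blast
      hence "(\<Sum>e\<in>B. c e * e) \<in> m"
        using add_subgroup_diff[OF m sum, of "x * c x"] by (simp add: mult.commute)
      hence "c ` B \<subseteq> m" using B(3) c(1) unfolding residue_independent_def by blast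
      thus False using nz cx by auto
    qed
    then obtain y where y: "y \<in> R" "c x * y - 1 \<in> m" using inv cR by blast
    have "y * (c x * x + (\<Sum>e\<in>B. c e * e)) - x * (c x * y - 1) \<in> m"
      using add_subgroup_diff[OF m] ideal sum y x RS by blast
    moreover have "y * (c x * x + (\<Sum>e\<in>B. c e * e)) - x * (c x * y - 1) = x - (\<Sum>e\<in>B. (- y * c e) * e)"
      by (simp add: algebra_simps sum_negf sum_distrib_left)
    ultimately have "x - (\<Sum>e\<in>B. (- y * c e) * e) \<in> m" by simp
    moreover have "(\<lambda>e. - y * c e) ` B \<subseteq> R"
      using cR y subring_mult[OF R] subring_minus[OF R] by auto
    ultimately show ?thesis by (intro exI[of _ "\<lambda>e. - y * c e"]) simp
  qed
  thus ?thesis using B unfolding residue_spanning_def by blast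
qed

lemma base_index:
  assumes n: "has_index S m n"
  shows "\<exists>q\<ge>2. has_index R (m \<inter> R) q"
proof -
  have mR: "add_subgroup (m \<inter> R)" using m subring_add_subgroup[OF R] unfolding add_subgroup_def by blast
  obtain T where T: "transversal S m T" "finite T" using n unfolding has_index_def by blast
  obtain f where f: "\<And>x. x \<in> S \<Longrightarrow> f x \<in> T \<and> x - f x \<in> m"
    using T(1) unfolding transversal_def by metis
  have "\<exists>q. has_index R (m \<inter> R) q"
  proof (rule has_index_exists[OF mR T(2), of f])
    show "f ` R \<subseteq> T" using f RS by blast
  next
    fix x y assume xy: "x \<in> R" "y \<in> R" "f x = f y"
    hence "x - f x \<in> m" "y - f x \<in> m" using f RS by (metis subsetD)+
    thus "x - y \<in> m \<inter> R" using xy subring_diff[OF R] add_subgroup_diff_trans[OF m]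
        add_subgroup_diff_swap[OF m] by blast
  qed
  then obtain q where q: "has_index R (m \<inter> R) q" by blast
  have "q \<ge> 2"
  proof (rule ccontr)
    assume "\<not> 2 \<le> q"
    hence "\<exists>x\<in>{0,1}. \<exists>y\<in>{0,1}. x \<noteq> y \<and> x - y \<in> m \<inter> R"
      using subring_zero[OF R] subring_one[OF R] by (intro has_index_pigeonhole[OF mR q]) auto
    thus False using one add_subgroup_minus[OF m, of "-1"] by auto
  qed
  thus ?thesis using q by blast
qed

lemma independent_bound_relation:
  assumes rel: "\<And>y. (\<And>j. j \<le> N \<Longrightarrow> y j \<in> S) \<Longrightarrow>
      \<exists>c. (\<forall>j\<le>N. c j \<in> R) \<and> (\<exists>j\<le>N. c j \<notin> m) \<and> (\<Sum>j\<le>(N::nat). c j * y j) \<in> m"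
    and B: "finite B" "B \<subseteq> S" "residue_independent R m B"
  shows "card B \<le> N"
proof (rule ccontr)
  assume "\<not> card B \<le> N"
  hence "Suc N \<le> card B" by simp
  then obtain B' where B': "B' \<subseteq> B" "card B' = Suc N" by (rule obtain_subset_with_card_n)
  have "finite B'" using B' B(1) finite_subset by blast
  then obtain y where y: "bij_betw y {..N} B'" using B' by (metis card_atMost finite_atMost finite_same_card_bij)
  have yB: "y j \<in> B'" if "j \<le> N" for j using y that by (auto simp: bij_betw_def)
  obtain c where c: "\<forall>j\<le>N. c j \<in> R" "\<exists>j\<le>N. c j \<notin> m" "(\<Sum>j\<le>N. c j * y j) \<in> m"
    using rel[of y] yB B' B(2) by blast
  define d where "d e = (if e \<in> B' then c (inv_into {..N} y e) else 0)" for e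
  have dy: "d (y j) = c j" if "j \<le> N" for j
  proof -
    have "inv_into {..N} y (y j) = j" using y that by (simp add: bij_betw_def)
    thus ?thesis unfolding d_def using yB[OF that] by simp
  qed
  have "d ` B \<subseteq> R"
  proof
    fix z assume "z \<in> d ` B"
    then obtain e where e: "e \<in> B" "z = d e" by blast
    show "z \<in> R"
    proof (cases "e \<in> B'")
      case True
      then obtain j where "j \<le> N" "e = y j" using y by (auto simp: bij_betw_def)
      thus ?thesis using dy c(1) e by simp
    qed (use e subring_zero[OF R] in \<open>simp add: d_def\<close>)
  qed
  moreover have "(\<Sum>e\<in>B. d e * e) \<in> m"
  proof -
    have "(\<Sum>e\<in>B. d e * e) = (\<Sum>e\<in>B'. d e * e)"
      by (rule sum.mono_neutral_right) (use B(1) B' in \<open>auto simp: d_def\<close>)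
    also have "\<dots> = (\<Sum>j\<le>N. d (y j) * y j)" using sum.reindex_bij_betw[OF y, of "\<lambda>e. d e * e"] by simp
    also have "\<dots> = (\<Sum>j\<le>N. c j * y j)" by (rule sum.cong) (simp_all add: dy)
    finally show ?thesis using c(3) by simp
  qed
  ultimately have dm: "d ` B \<subseteq> m" using B(3) unfolding residue_independent_def by blast
  obtain j where j: "j \<le> N" "c j \<notin> m" using c(2) by blast
  have "y j \<in> B" using yB[OF j(1)] B'(1) by blast
  hence "d (y j) \<in> m" using dm by blast
  thus False using dy[OF j(1)] j(2) by simp
qed

text \<open>Two of the n + 1 partial sums are congruent modulo m. Their difference is a relation
  with coefficients 0 and 1, and 1 is not in m.\<close>

lemma independent_bound:
  assumes B: "finite B" "B \<subseteq> S" "residue_independent R m B" and n: "has_index S m n"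
  shows "card B \<le> n"
proof (rule independent_bound_relation[OF _ B])
  fix y assume y: "\<And>j. j \<le> n \<Longrightarrow> y j \<in> S"
  define f where "f j = (\<Sum>i<j. y i)" for j
  have "\<exists>i\<in>{..n}. \<exists>j\<in>{..n}. i \<noteq> j \<and> f i - f j \<in> m"
  proof (cases "inj_on f {..n}")
    case True
    have "f ` {..n} \<subseteq> S" unfolding f_def using y by (auto intro!: subring_sum[OF S])
    hence "\<exists>x\<in>f ` {..n}. \<exists>z\<in>f ` {..n}. x \<noteq> z \<and> x - z \<in> m"
      by (intro has_index_pigeonhole[OF m n]) (auto simp: card_image[OF True])
    then obtain i j where ij: "i \<in> {..n}" "j \<in> {..n}" "f i \<noteq> f j" "f i - f j \<in> m" by (elim bexE imageE conjE) simp
    hence "i \<noteq> j" by auto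
    thus ?thesis using ij by (intro bexI[of _ i] bexI[of _ j] conjI)
  next
    case False
    then obtain i j where "i \<in> {..n}" "j \<in> {..n}" "i \<noteq> j" "f i = f j" unfolding inj_on_def by blast
    thus ?thesis using add_subgroup_zero[OF m] by (intro bexI[of _ i] bexI[of _ j]) auto
  qed
  hence "\<exists>i j. i < j \<and> j \<le> n \<and> f j - f i \<in> m"
    using add_subgroup_diff_swap[OF m] by (metis atMost_iff linorder_neqE_nat)
  then obtain i j where ij: "i < j" "j \<le> n" "f j - f i \<in> m" by blast
  define c :: "nat \<Rightarrow> 'a" where "c k = (if i \<le> k \<and> k < j then 1 else 0)" for k
  have "(\<Sum>k\<le>n. c k * y k) = (\<Sum>k\<in>{i..<j}. c k * y k)"
    by (rule sum.mono_neutral_right) (use ij in \<open>auto simp: c_def\<close>)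
  also have "\<dots> = f j - f i"
    using sum_diff_nat_ivl[of 0 i j y] ij(1) unfolding f_def c_def by (simp add: atLeast0LessThan)
  finally have "(\<Sum>k\<le>n. c k * y k) \<in> m" using ij(3) by simp
  moreover have "c k \<in> R" for k unfolding c_def using subring_zero[OF R] subring_one[OF R] by simp
  moreover have "c i \<notin> m" unfolding c_def using ij(1) one by simp
  ultimately show "\<exists>c. (\<forall>j\<le>n. c j \<in> R) \<and> (\<exists>j\<le>n. c j \<notin> m) \<and> (\<Sum>j\<le>n. c j * y j) \<in> m"
    using ij by (intro exI[of _ c] conjI exI[of _ i]) auto
qed

text \<open>By \<open>span_index\<close> a basis of size c forces n = q^c with q at least 2, so all
  bases have the same size and the definite description in \<open>residue_degree\<close> denotes
  it.\<close>

lemma residue_degree_index: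
  assumes n: "has_index S m n" and q: "has_index R (m \<inter> R) q"
  shows "n = q ^ residue_degree R S m"
proof -
  have mR: "add_subgroup (m \<inter> R)" using m subring_add_subgroup[OF R] unfolding add_subgroup_def by blast
  obtain q' where "q' \<ge> 2" "has_index R (m \<inter> R) q'" using base_index[OF n] by blast
  hence q2: "q \<ge> 2" using has_index_unique[OF mR q] by blast
  have uniq: "q ^ card B = n"
    if "finite B" "B \<subseteq> S" "residue_independent R m B" "residue_spanning R S m B" for B
    using has_index_unique[OF m span_index[OF that q] n] .
  obtain B where B: "finite B" "B \<subseteq> S" "residue_independent R m B" "residue_spanning R S m B"
    using basis_exists[of n] independent_bound[OF _ _ _ n] by blast
  have "residue_degree R S m = (THE k. \<exists>B. finite B \<and> B \<subseteq> S \<and> card B = k \<and>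
      residue_spanning R S m B \<and> residue_independent R m B)"
    unfolding residue_degree_def residue_spanning_def residue_independent_def ..
  also have "\<dots> = card B"
  proof (rule the_equality)
    show "\<exists>Ba. finite Ba \<and> Ba \<subseteq> S \<and> card Ba = card B \<and> residue_spanning R S m Ba \<and>
        residue_independent R m Ba" using B by blast
  next
    fix k assume "\<exists>B. finite B \<and> B \<subseteq> S \<and> card B = k \<and> residue_spanning R S m B \<and>
        residue_independent R m B"
    then obtain B' where "finite B'" "B' \<subseteq> S" "card B' = k" "residue_spanning R S m B'"
      "residue_independent R m B'" by blast
    hence "q ^ k = q ^ card B" using uniq B by metis
    thus "k = card B" using q2 by (metis Suc_1 Suc_le_lessD power_inject_exp)
  qed
  finally show ?thesis using uniq[OF B] by simp
qed

end

section \<open>Function fields\<close>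

definition polys_over :: "'a::field set \<Rightarrow> 'a poly set" where
  "polys_over F = {p. \<forall>i. coeff p i \<in> F}"

lemma polys_over_closed:
  assumes "is_subring F"
  shows "p \<in> polys_over F \<Longrightarrow> q \<in> polys_over F \<Longrightarrow> p - q \<in> polys_over F"
    and "p \<in> polys_over F \<Longrightarrow> q \<in> polys_over F \<Longrightarrow> p + q \<in> polys_over F"
    and "p \<in> polys_over F \<Longrightarrow> q \<in> polys_over F \<Longrightarrow> p * q \<in> polys_over F"
    and "a \<in> F \<Longrightarrow> [:a:] \<in> polys_over F" and "1 \<in> polys_over F" and "[:0, 1:] \<in> polys_over F"
proof -
  show "p \<in> polys_over F \<Longrightarrow> q \<in> polys_over F \<Longrightarrow> p * q \<in> polys_over F"
    unfolding polys_over_def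
    by (auto simp: coeff_mult intro!: subring_sum[OF assms] subring_mult[OF assms])
  have c: "a \<in> F \<Longrightarrow> [:a:] \<in> polys_over F" for a
    unfolding polys_over_def by (auto simp: coeff_pCons subring_zero[OF assms] split: nat.splits)
  show "a \<in> F \<Longrightarrow> [:a:] \<in> polys_over F" by (rule c)
  show "1 \<in> polys_over F" using c[OF subring_one[OF assms]] by (simp add: one_pCons)
  show "[:0, 1:] \<in> polys_over F"
    unfolding polys_over_def
    by (auto simp: coeff_pCons subring_zero[OF assms] subring_one[OF assms] split: nat.splits)
qed (use subring_diff[OF assms] subring_add[OF assms] in \<open>auto simp: polys_over_def\<close>)

lemma coeffs_subset_iff: "0 \<in> F \<Longrightarrow> set (coeffs p) \<subseteq> F \<longleftrightarrow> p \<in> polys_over F"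
proof -
  assume "0 \<in> F"
  hence "set (coeffs p) \<subseteq> F \<longleftrightarrow> range (coeff p) \<subseteq> F" unfolding range_coeff by simp
  thus ?thesis unfolding polys_over_def by auto
qed

lemma hull_insert_fractions:
  assumes F: "is_subfield F" and T: "\<not> algebraic_over F T"
    and x: "x \<in> is_subfield hull (insert T F)"
  obtains p q where "p \<in> polys_over F" "q \<in> polys_over F" "poly q T \<noteq> 0" "x = poly p T / poly q T"
proof -
  note F_ring = subfield_subring[OF F]
  note cl = polys_over_closed[OF F_ring]
  let ?Q = "{poly p T / poly q T | p q. p \<in> polys_over F \<and> q \<in> polys_over F \<and> poly q T \<noteq> 0}"
  have Qi: "poly p T / poly q T \<in> ?Q" if "p \<in> polys_over F" "q \<in> polys_over F" "poly q T \<noteq> 0" for p q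
    using that by blast
  have "is_subfield ?Q"
    unfolding is_subfield_def is_subring_def
  proof (intro conjI ballI)
    show "1 \<in> ?Q" using Qi[OF cl(5) cl(5)] by simp
  next
    fix x y assume "x \<in> ?Q" "y \<in> ?Q"
    then obtain p q p' q' where h: "p \<in> polys_over F" "q \<in> polys_over F" "poly q T \<noteq> 0"
      "x = poly p T / poly q T" "p' \<in> polys_over F" "q' \<in> polys_over F" "poly q' T \<noteq> 0"
      "y = poly p' T / poly q' T" by blast
    have "x - y = poly (p * q' - p' * q) T / poly (q * q') T"
      using h by (simp add: diff_frac_eq mult.commute)
    also have "\<dots> \<in> ?Q" using h cl by (intro Qi) auto
    finally show "x - y \<in> ?Q" .
    have "x * y = poly (p * p') T / poly (q * q') T" using h by simp
    also have "\<dots> \<in> ?Q" using h cl by (intro Qi) auto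
    finally show "x * y \<in> ?Q" .
  next
    fix x assume "x \<in> ?Q"
    then obtain p q where h: "p \<in> polys_over F" "q \<in> polys_over F" "poly q T \<noteq> 0"
      "x = poly p T / poly q T" by blast
    show "inverse x \<in> ?Q"
    proof (cases "poly p T = 0")
      case True
      have "poly [:0:] T / poly 1 T \<in> ?Q" by (intro Qi cl subring_zero[OF F_ring]) simp
      thus ?thesis using True h by simp
    next
      case False
      hence "poly q T / poly p T \<in> ?Q" using h by (intro Qi)
      thus ?thesis using h by simp
    qed
  qed
  moreover have "insert T F \<subseteq> ?Q"
  proof (intro insert_subsetI subsetI)
    show "T \<in> ?Q" using Qi[OF cl(6) cl(5)] by simp
    fix a assume "a \<in> F"
    thus "a \<in> ?Q" using Qi[OF cl(4) cl(5), of a] by simp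
  qed
  ultimately have "x \<in> ?Q" using x hull_minimal[of "insert T F" ?Q is_subfield] by blast
  thus ?thesis using that by blast
qed

definition bounded_polys :: "'a::field set \<Rightarrow> 'a \<Rightarrow> nat \<Rightarrow> 'a set" where
  "bounded_polys F T D = {poly p T | p. p \<in> polys_over F \<and> degree p \<le> D}"

lemma bounded_polys_card:
  assumes "finite F"
  shows "finite (bounded_polys F T D)" and "card (bounded_polys F T D) \<le> card F ^ (D + 1)"
proof -
  have sub: "bounded_polys F T D \<subseteq> (\<lambda>c. \<Sum>i\<le>D. c i * T ^ i) ` ({..D} \<rightarrow>\<^sub>E F)"
  proof
    fix x assume "x \<in> bounded_polys F T D"
    then obtain p where p: "p \<in> polys_over F" "degree p \<le> D" "x = poly p T"
      unfolding bounded_polys_def by blast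
    have "x = (\<Sum>i\<le>D. coeff p i * T ^ i)"
      unfolding p(3) poly_altdef
      by (rule sum.mono_neutral_left) (use p(2) in \<open>auto simp: coeff_eq_0\<close>)
    also have "\<dots> = (\<Sum>i\<le>D. restrict (coeff p) {..D} i * T ^ i)" by (rule sum.cong) auto
    finally have eq: "x = (\<Sum>i\<le>D. restrict (coeff p) {..D} i * T ^ i)" .
    have "restrict (coeff p) {..D} \<in> {..D} \<rightarrow>\<^sub>E F" using p(1) by (auto simp: polys_over_def)
    with eq show "x \<in> (\<lambda>c. \<Sum>i\<le>D. c i * T ^ i) ` ({..D} \<rightarrow>\<^sub>E F)" by (rule image_eqI)
  qed
  have fin: "finite ({..D} \<rightarrow>\<^sub>E F)" using assms by (simp add: finite_PiE)
  show "finite (bounded_polys F T D)" using sub fin by (meson finite_imageI finite_subset)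
  have "card (bounded_polys F T D) \<le> card ({..D} \<rightarrow>\<^sub>E F)" using sub fin by (meson surj_card_le)
  thus "card (bounded_polys F T D) \<le> card F ^ (D + 1)" by (simp add: card_PiE)
qed

lemma bounded_polys_closed:
  assumes F: "is_subring F"
  shows "x \<in> bounded_polys F T D \<Longrightarrow> y \<in> bounded_polys F T D \<Longrightarrow> x - y \<in> bounded_polys F T D"
    and "x \<in> bounded_polys F T D \<Longrightarrow> y \<in> bounded_polys F T E \<Longrightarrow> x * y \<in> bounded_polys F T (D + E)"
    and "D \<le> E \<Longrightarrow> bounded_polys F T D \<subseteq> bounded_polys F T E"
    and "F \<subseteq> bounded_polys F T 0"
proof -
  note cl = polys_over_closed[OF F]
  assume "x \<in> bounded_polys F T D"
  then obtain p where p: "p \<in> polys_over F" "degree p \<le> D" "x = poly p T"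
    unfolding bounded_polys_def by blast
  show "x - y \<in> bounded_polys F T D" if "y \<in> bounded_polys F T D"
  proof -
    obtain q where q: "q \<in> polys_over F" "degree q \<le> D" "y = poly q T"
      using \<open>y \<in> bounded_polys F T D\<close> unfolding bounded_polys_def by blast
    show ?thesis unfolding bounded_polys_def
      by (intro CollectI exI[of _ "p - q"]) (use p q cl degree_diff_le in auto)
  qed
  show "x * y \<in> bounded_polys F T (D + E)" if "y \<in> bounded_polys F T E"
  proof -
    obtain q where q: "q \<in> polys_over F" "degree q \<le> E" "y = poly q T"
      using \<open>y \<in> bounded_polys F T E\<close> unfolding bounded_polys_def by blast
    have "degree (p * q) \<le> D + E" using degree_mult_le[of p q] p q by linarith
    thus ?thesis unfolding bounded_polys_def
      by (intro CollectI exI[of _ "p * q"]) (use p q cl in auto)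
  qed
next
  show "D \<le> E \<Longrightarrow> bounded_polys F T D \<subseteq> bounded_polys F T E" unfolding bounded_polys_def by auto
  show "F \<subseteq> bounded_polys F T 0"
  proof
    fix a assume "a \<in> F"
    thus "a \<in> bounded_polys F T 0" unfolding bounded_polys_def
      using polys_over_closed(4)[OF F] by (intro CollectI exI[of _ "[:a:]"]) auto
  qed
qed

locale function_field =
  fixes Fr :: "'k::field set"
  assumes function_field: "is_function_field Fr"
begin

lemma Fr_field: "is_subfield Fr" and Fr_finite: "finite Fr"
  and Fr_closed: "algebraic_over Fr x \<Longrightarrow> x \<in> Fr"
  using function_field unfolding is_function_field_def by blast+

lemmas Fr_ring = subfield_subring[OF Fr_field]

lemma Fr_card: "card Fr \<ge> 2"
  using card_mono[OF Fr_finite, of "{0, 1}"] subring_zero[OF Fr_ring] subring_one[OF Fr_ring] by auto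

lemma transcendental_poly:
  assumes "x \<notin> Fr" "p \<in> polys_over Fr" "p \<noteq> 0"
  shows "poly p x \<noteq> 0"
  using assms Fr_closed[of x] coeffs_subset_iff[OF subring_zero[OF Fr_ring]]
  unfolding algebraic_over_def by blast

text \<open>The finitely many coefficients of an element over Fr(T) have a common denominator that
  is a polynomial in T.\<close>

lemma exists_filtered_span: "\<exists>T B. filtered_span (bounded_polys Fr T) B UNIV"
proof -
  obtain T B where T: "\<not> algebraic_over Fr T" and B: "finite B"
    and span: "\<And>x. \<exists>c. c ` B \<subseteq> is_subfield hull (insert T Fr) \<and> x = (\<Sum>e\<in>B. c e * e)"
    using function_field unfolding is_function_field_def by metis
  note cl = bounded_polys_closed[OF Fr_ring]
  have common: "\<exists>D g. g \<in> bounded_polys Fr T D \<and> g \<noteq> 0 \<and> (\<forall>e\<in>B'. g * c e \<in> bounded_polys Fr T D)"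
    if "finite B'" "c ` B' \<subseteq> is_subfield hull (insert T Fr)" for B' c
    using that
  proof (induction B' rule: finite_induct)
    case empty
    show ?case using cl(4) subring_one[OF Fr_ring] by (intro exI[of _ 0] exI[of _ 1]) auto
  next
    case (insert e B')
    then obtain D g where g: "g \<in> bounded_polys Fr T D" "g \<noteq> 0"
      "\<forall>e\<in>B'. g * c e \<in> bounded_polys Fr T D" by auto
    obtain p q where pq: "p \<in> polys_over Fr" "q \<in> polys_over Fr" "poly q T \<noteq> 0" "c e = poly p T / poly q T"
      using hull_insert_fractions[OF Fr_field T, of "c e"] insert.prems by auto
    define E where "E = max (degree p) (degree q)"
    have q: "poly q T \<in> bounded_polys Fr T E" and p: "poly p T \<in> bounded_polys Fr T E"
      unfolding bounded_polys_def E_def using pq by auto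
    have "poly q T * g * c e' \<in> bounded_polys Fr T (E + D)" if "e' \<in> B'" for e'
      using cl(2)[OF q, of "g * c e'"] g(3) that by (simp add: mult.assoc)
    moreover have "poly q T * g * c e \<in> bounded_polys Fr T (E + D)"
      using cl(2)[OF p g(1)] pq by (simp add: field_simps)
    moreover have "poly q T * g \<in> bounded_polys Fr T (E + D)" using cl(2)[OF q g(1)] .
    ultimately show ?case using pq(3) g(2) by (intro exI[of _ "E + D"] exI[of _ "poly q T * g"]) auto
  qed
  have "filtered_span (bounded_polys Fr T) B UNIV"
  proof
    fix x :: 'k
    obtain c where c: "c ` B \<subseteq> is_subfield hull (insert T Fr)" "x = (\<Sum>e\<in>B. c e * e)"
      using span by blast
    obtain D g where "g \<in> bounded_polys Fr T D" "g \<noteq> 0" "\<forall>e\<in>B. g * c e \<in> bounded_polys Fr T D"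
      using common[OF B c(1)] by blast
    thus "\<exists>D g p. g \<in> bounded_polys Fr T D \<and> g \<noteq> 0 \<and> (\<forall>e\<in>B. p e \<in> bounded_polys Fr T D) \<and>
        g * x = (\<Sum>e\<in>B. p e * e)"
      using c(2) by (intro exI[of _ D] exI[of _ g] exI[of _ "\<lambda>e. g * c e"])
        (auto simp: sum_distrib_left mult.assoc)
  next
    show "is_subring (UNIV :: 'k set)" unfolding is_subring_def by blast
    show "1 \<in> bounded_polys Fr T 0" using cl(4) subring_one[OF Fr_ring] by blast
  qed (use B cl bounded_polys_card[OF Fr_finite] in auto)
  thus ?thesis by blast
qed

text \<open>N depends on x only. A relation in which some constant coefficient is nonzero stays
  nontrivial at every place where x vanishes; discreteness of valuations, finiteness of residue
  fields and finiteness of zero sets are all read off from this.\<close>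

lemma linear_relation:
  assumes "x \<noteq> 0"
  shows "\<exists>N::nat. \<forall>y. \<exists>p. (\<forall>j. p j \<in> polys_over Fr) \<and> (\<exists>j\<le>N. coeff (p j) 0 \<noteq> 0) \<and>
           (\<Sum>j\<le>N. poly (p j) x * y j) = 0"
proof -
  obtain T B where "filtered_span (bounded_polys Fr T) B UNIV" using exists_filtered_span by blast
  then interpret filtered_span "bounded_polys Fr T" B UNIV .
  have "\<exists>N::nat. \<forall>y. (\<forall>j\<le>N. y j \<in> UNIV) \<longrightarrow> (\<exists>p. (\<forall>j i. coeff (p j) i \<in> Fr) \<and>
           (\<exists>j\<le>N. coeff (p j) 0 \<noteq> 0) \<and> (\<Sum>j\<le>N. poly (p j) x * y j) = 0)"
    by (rule linear_relation[OF Fr_finite Fr_field bounded_polys_closed(4)[OF Fr_ring], of 1])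
      (use bounded_polys_card[OF Fr_finite] assms in auto)
  thus ?thesis unfolding polys_over_def by simp
qed

end

section \<open>Places\<close>

context function_field
begin

lemma place_ring: "P \<in> places Fr \<Longrightarrow> is_subring P"
  and place_Fr: "P \<in> places Fr \<Longrightarrow> Fr \<subseteq> P"
  and place_total: "P \<in> places Fr \<Longrightarrow> x \<in> P \<or> inverse x \<in> P"
  and place_proper: "P \<in> places Fr \<Longrightarrow> P \<noteq> UNIV"
  unfolding places_def by auto

lemma max_ideal_subset: "max_ideal P \<subseteq> P"
  unfolding max_ideal_def by blast

lemma max_ideal_iff: "P \<in> places Fr \<Longrightarrow> x \<in> max_ideal P \<longleftrightarrow> x = 0 \<or> inverse x \<notin> P"
  using place_total[of P x] subring_zero[OF place_ring, of P] unfolding max_ideal_def by blast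

lemma unit_inverse: "P \<in> places Fr \<Longrightarrow> x \<notin> max_ideal P \<Longrightarrow> inverse x \<in> P"
  using max_ideal_iff by blast

lemma max_ideal_mult:
  assumes P: "P \<in> places Fr" and "x \<in> P" "y \<in> max_ideal P"
  shows "x * y \<in> max_ideal P"
proof (rule ccontr)
  assume n: "x * y \<notin> max_ideal P"
  hence "x * y \<noteq> 0" "inverse (x * y) \<in> P" using max_ideal_iff[OF P] by blast+
  hence "x * inverse (x * y) \<in> P" using subring_mult[OF place_ring[OF P] assms(2)] by blast
  moreover have "x * inverse (x * y) = inverse y" using \<open>x * y \<noteq> 0\<close> by (simp add: field_simps)
  ultimately have "inverse y \<in> P" by (simp only:)
  thus False using assms(3) max_ideal_iff[OF P, of y] \<open>x * y \<noteq> 0\<close> by auto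
qed

lemma one_notin_max_ideal: "P \<in> places Fr \<Longrightarrow> 1 \<notin> max_ideal P"
  using max_ideal_iff[of P 1] subring_one[OF place_ring, of P] by simp

lemma max_ideal_group:
  assumes P: "P \<in> places Fr"
  shows "add_subgroup (max_ideal P)"
  unfolding add_subgroup_def
proof (intro conjI ballI)
  show "0 \<in> max_ideal P" using max_ideal_iff[OF P] by blast
  have *: "x - y \<in> max_ideal P" if xy: "x \<in> max_ideal P" "y \<in> max_ideal P" "x / y \<in> P" "y \<noteq> 0" for x y
  proof -
    have "(x / y - 1) * y \<in> max_ideal P"
      using xy subring_diff[OF place_ring[OF P]] subring_one[OF place_ring[OF P]]
      by (intro max_ideal_mult[OF P]) auto
    thus ?thesis using xy by (simp add: left_diff_distrib)
  qed
  have neg: "- x \<in> max_ideal P" if "x \<in> max_ideal P" for x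
  proof -
    have "(-1) * x \<in> max_ideal P"
      using that subring_minus[OF place_ring[OF P] subring_one[OF place_ring[OF P]]]
      by (intro max_ideal_mult[OF P])
    thus ?thesis by simp
  qed
  fix x y assume xy: "x \<in> max_ideal P" "y \<in> max_ideal P"
  consider "x = 0" | "y = 0" | "x \<noteq> 0" "y \<noteq> 0" "x / y \<in> P" | "x \<noteq> 0" "y \<noteq> 0" "y / x \<in> P"
    using place_total[OF P, of "x / y"] by auto
  thus "x - y \<in> max_ideal P"
  proof cases
    case 4
    hence "- (y - x) \<in> max_ideal P" using *[of y x] xy neg by blast
    thus ?thesis by simp
  qed (use xy * neg in auto)
qed

lemma Fr_max_ideal:
  assumes "P \<in> places Fr" "a \<in> Fr" "a \<in> max_ideal P"
  shows "a = 0"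
  using assms max_ideal_iff[of P a] subfield_inverse[OF Fr_field, of a] place_Fr[of P] by blast

lemma poly_place:
  assumes P: "P \<in> places Fr" and p: "p \<in> polys_over Fr" and x: "x \<in> P"
  shows "poly p x \<in> P"
  by (rule poly_in_subring[OF place_ring[OF P] _ x])
    (use p place_Fr[OF P] in \<open>auto simp: polys_over_def\<close>)

lemma poly_residue:
  assumes P: "P \<in> places Fr" and p: "p \<in> polys_over Fr" and x: "x \<in> max_ideal P"
  shows "poly p x - coeff p 0 \<in> max_ideal P"
proof (cases p)
  case (pCons a q)
  have "q \<in> polys_over Fr" using p unfolding polys_over_def pCons by (auto dest: spec[of _ "Suc _"])
  hence "poly q x * x \<in> max_ideal P"
    using poly_place[OF P] x max_ideal_subset by (intro max_ideal_mult[OF P]) blast+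
  thus ?thesis using pCons by (simp add: mult.commute)
qed

text \<open>In a relation whose coefficients are polynomials in x, the term with the first nonzero
  constant coefficient strictly dominates: earlier terms carry a factor x, which outweighs the whole
  chain by \<open>long\<close>, and later ones are smaller by \<open>chain\<close>. So a strict
  chain of N steps cannot fit below the valuation of x.\<close>

lemma no_long_chain:
  assumes P: "P \<in> places Fr" and x: "x \<in> max_ideal P" "x \<noteq> 0"
  shows "\<exists>N::nat. \<forall>y. (\<forall>j\<le>N. y j \<noteq> 0) \<and> (\<forall>i j. i < j \<and> j \<le> N \<longrightarrow> y j / y i \<in> max_ideal P) \<longrightarrow>
           x * y 0 / y N \<notin> max_ideal P"
proof -
  note ring = place_ring[OF P] and grp = max_ideal_group[OF P] and ideal = max_ideal_mult[OF P]
  obtain N :: nat where N: "\<And>y. \<exists>p. (\<forall>j. p j \<in> polys_over Fr) \<and> (\<exists>j\<le>N. coeff (p j) 0 \<noteq> 0) \<and>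
           (\<Sum>j\<le>N. poly (p j) x * y j) = 0"
    using linear_relation[OF x(2)] by blast
  have main: False if nz: "\<And>j. j \<le> N \<Longrightarrow> y j \<noteq> 0"
    and chain: "\<And>i j. i < j \<Longrightarrow> j \<le> N \<Longrightarrow> y j / y i \<in> max_ideal P"
    and long: "x * y 0 / y N \<in> max_ideal P" for y :: "nat \<Rightarrow> 'k"
  proof -
    obtain p where p: "\<And>j. p j \<in> polys_over Fr" and ex: "\<exists>j\<le>N. coeff (p j) 0 \<noteq> 0"
      and rel: "(\<Sum>j\<le>N. poly (p j) x * y j) = 0"
      using N by blast
    define j where "j = (LEAST j. j \<le> N \<and> coeff (p j) 0 \<noteq> 0)"
    have j: "j \<le> N" "coeff (p j) 0 \<noteq> 0" using LeastI_ex[OF ex] unfolding j_def by auto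
    have j_least: "coeff (p i) 0 = 0" if "i < j" for i
      using not_less_Least[of i "\<lambda>j. j \<le> N \<and> coeff (p j) 0 \<noteq> 0"] that j(1) unfolding j_def by auto
    have down: "y i / y i' \<in> P" if "i' \<le> i" "i \<le> N" for i i'
      using chain[of i' i] that nz[of i] subring_one[OF ring] max_ideal_subset[of P]
      by (cases "i' = i") auto
    have "poly (p i) x * y i / y j \<in> max_ideal P" if i: "i \<le> N" "i \<noteq> j" for i
    proof (cases "i < j")
      case True
      obtain q where q: "p i = pCons 0 q" using j_least[OF True] by (cases "p i") auto
      have "q \<in> polys_over Fr" using p[of i] unfolding polys_over_def q by (auto dest: spec[of _ "Suc _"])
      hence "poly q x \<in> P" using poly_place[OF P] x max_ideal_subset by blast
      hence "poly q x * ((y i / y 0) * ((y N / y j) * (x * y 0 / y N))) \<in> max_ideal P"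
        using long down[of 0 i] down[of j N] j i by (intro ideal) auto
      moreover have "poly q x * ((y i / y 0) * ((y N / y j) * (x * y 0 / y N))) = poly (p i) x * y i / y j"
        using nz[of 0] nz[of N] unfolding q by simp
      ultimately show ?thesis by simp
    next
      case False
      hence "y i / y j \<in> max_ideal P" using chain i by simp
      moreover have "poly (p i) x \<in> P" using poly_place[OF P p] x max_ideal_subset by blast
      ultimately show ?thesis using ideal by fastforce
    qed
    hence "(\<Sum>i\<in>{..N} - {j}. poly (p i) x * y i / y j) \<in> max_ideal P"
      by (intro add_subgroup_sum[OF grp]) auto
    moreover have "(\<Sum>i\<in>{..N} - {j}. poly (p i) x * y i / y j) = - poly (p j) x"
    proof -
      have "0 = (\<Sum>i\<le>N. poly (p i) x * y i / y j)" using rel by (simp add: sum_divide_distrib[symmetric])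
      also have "\<dots> = poly (p j) x * y j / y j + (\<Sum>i\<in>{..N} - {j}. poly (p i) x * y i / y j)"
        using j by (subst sum.remove[of _ j]) auto
      finally show ?thesis using nz[OF j(1)] by (simp add: eq_neg_iff_add_eq_0 add.commute)
    qed
    ultimately have "poly (p j) x \<in> max_ideal P" using add_subgroup_minus[OF grp] by fastforce
    hence "coeff (p j) 0 \<in> max_ideal P"
      using add_subgroup_diff_iff[OF grp poly_residue[OF P p x(1)]] by blast
    thus False using Fr_max_ideal[OF P] p j(2) unfolding polys_over_def by blast
  qed
  show ?thesis
  proof (intro exI[of _ N] allI impI notI)
    fix y :: "nat \<Rightarrow> 'k"
    assume "(\<forall>j\<le>N. y j \<noteq> 0) \<and> (\<forall>i j. i < j \<and> j \<le> N \<longrightarrow> y j / y i \<in> max_ideal P)"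
      and "x * y 0 / y N \<in> max_ideal P"
    thus False by (intro main[of y]) auto
  qed
qed

lemma max_ideal_nonzero: "P \<in> places Fr \<Longrightarrow> \<exists>x\<in>max_ideal P. x \<noteq> 0"
  using place_proper[of P] place_total[of P] max_ideal_iff[of P]
  by (metis UNIV_eq_I inverse_inverse_eq inverse_zero subring_zero place_ring)

text \<open>If no element generates, every nonzero element of the maximal ideal is properly
  divisible by another one of the ideal. Such divisions, repeated from x on, contradict
  \<open>no_long_chain\<close>.\<close>

lemma max_ideal_principal:
  assumes P: "P \<in> places Fr"
  shows "\<exists>t. t \<noteq> 0 \<and> max_ideal P = (\<lambda>z. t * z) ` P"
proof (rule ccontr)
  assume no: "\<not> ?thesis"
  note ideal = max_ideal_mult[OF P]
  obtain x where x: "x \<in> max_ideal P" "x \<noteq> 0" using max_ideal_nonzero[OF P] by blast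
  have step: "\<exists>z. (z \<in> max_ideal P \<and> z \<noteq> 0) \<and> t / z \<in> max_ideal P"
    if t: "t \<in> max_ideal P \<and> t \<noteq> 0" for t and n :: nat
  proof -
    have "(\<lambda>z. t * z) ` P \<subseteq> max_ideal P" using ideal t by (auto simp: mult.commute)
    then obtain z where z: "z \<in> max_ideal P" "z \<notin> (\<lambda>z. t * z) ` P" using no t by blast
    have "z / t \<notin> P"
    proof
      assume "z / t \<in> P"
      hence "t * (z / t) \<in> (\<lambda>z. t * z) ` P" by blast
      thus False using z t by simp
    qed
    hence "t / z \<in> max_ideal P" "z \<noteq> 0" using max_ideal_iff[OF P, of "t / z"] subring_zero[OF place_ring[OF P]]
      by auto
    thus ?thesis using z by blast
  qed
  obtain s where s: "s 0 = x" "\<And>n::nat. s n \<in> max_ideal P \<and> s n \<noteq> 0" "\<And>n. s n / s (Suc n) \<in> max_ideal P"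
    using dependent_nat_choice[of "\<lambda>n t. (t \<in> max_ideal P \<and> t \<noteq> 0) \<and> (n = (0::nat) \<longrightarrow> t = x)"
        "\<lambda>n t z. t / z \<in> max_ideal P"] x step by auto
  have s_lt: "s i / s j \<in> max_ideal P" if "i < j" for i j
    using that
  proof (induction j)
    case (Suc j)
    show ?case
    proof (cases "i = j")
      case False
      hence "s i / s j \<in> P" using Suc max_ideal_subset by auto
      hence "(s i / s j) * (s j / s (Suc j)) \<in> max_ideal P" using s(3) by (intro ideal)
      thus ?thesis using s(2)[of j] by simp
    qed (use s in simp)
  qed simp
  obtain N :: nat where N: "\<And>y. (\<forall>j\<le>N. y j \<noteq> 0) \<and> (\<forall>i j. i < j \<and> j \<le> N \<longrightarrow> y j / y i \<in> max_ideal P) \<longrightarrow>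
           x * y 0 / y N \<notin> max_ideal P"
    using no_long_chain[OF P x] by blast
  \<comment> \<open>The chain runs backwards along s. As \<open>s 0\<close> is x, this quotient
    equals \<open>s N\<close>, which lies in the maximal ideal.\<close>
  have "x * s N / s 0 \<notin> max_ideal P"
    using N[of "\<lambda>j. s (N - j)"] s(2) s_lt by auto
  thus False using s(1,2) x by simp
qed

section \<open>Uniformizers and the order of an element\<close>

definition uniformizes :: "'k set \<Rightarrow> 'k \<Rightarrow> bool" where
  "uniformizes P t \<longleftrightarrow> t \<noteq> 0 \<and> max_ideal P = (\<lambda>z. t * z) ` P"

lemma uniformizes_iff: "uniformizes P t \<Longrightarrow> x \<in> max_ideal P \<longleftrightarrow> x / t \<in> P"
  unfolding uniformizes_def by (force simp: image_iff)

lemma exists_uniformizer: "P \<in> places Fr \<Longrightarrow> \<exists>t. uniformizes P t"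
  using max_ideal_principal unfolding uniformizes_def by blast

abbreviation place_unit :: "'k set \<Rightarrow> 'k \<Rightarrow> bool" where
  "place_unit P u \<equiv> u \<in> P \<and> u \<notin> max_ideal P"

lemma place_unit_nonzero: "P \<in> places Fr \<Longrightarrow> place_unit P u \<Longrightarrow> u \<noteq> 0"
  using max_ideal_iff by blast

lemma place_unit_inverse: "P \<in> places Fr \<Longrightarrow> place_unit P u \<Longrightarrow> place_unit P (inverse u)"
  using max_ideal_iff[of P u] max_ideal_iff[of P "inverse u"] by auto

lemma place_unit_mult: "P \<in> places Fr \<Longrightarrow> place_unit P u \<Longrightarrow> place_unit P w \<Longrightarrow> place_unit P (u * w)"
  using max_ideal_iff[of P "u * w"] max_ideal_iff[of P u] max_ideal_iff[of P w]
    subring_mult[OF place_ring, of P u w] subring_mult[OF place_ring, of P "inverse u" "inverse w"]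
  by (metis inverse_mult_distrib mult_eq_0_iff)

lemma place_unit_one: "P \<in> places Fr \<Longrightarrow> place_unit P 1"
  using subring_one[OF place_ring] one_notin_max_ideal by blast

lemma place_unit_power: "P \<in> places Fr \<Longrightarrow> place_unit P u \<Longrightarrow> place_unit P (u ^ i)"
  by (induction i) (auto simp: place_unit_mult place_unit_one)

text \<open>Applied to the powers of t, \<open>no_long_chain\<close> shows that x is not divisible
  by all of them, and the last power dividing x leaves a unit. Elements outside P are reached
  through their inverses.\<close>

lemma place_decomposition:
  assumes P: "P \<in> places Fr" and t: "uniformizes P t" and x: "x \<noteq> 0"
  shows "\<exists>n u. place_unit P u \<and> x = u * t powi n"
proof -
  have t0: "t \<noteq> 0" using t unfolding uniformizes_def by blast
  have tm: "t \<in> max_ideal P" using uniformizes_iff[OF t, of t] t0 subring_one[OF place_ring[OF P]] by simp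
  have main: "\<exists>n u. place_unit P u \<and> x = u * t powi n" if x: "x \<noteq> 0" "x \<in> P" for x
  proof (cases "x \<in> max_ideal P")
    case False
    thus ?thesis using x by (intro exI[of _ 0] exI[of _ x]) auto
  next
    case True
    obtain N :: nat where N: "\<And>y. (\<forall>j\<le>N. y j \<noteq> 0) \<and> (\<forall>i j. i < j \<and> j \<le> N \<longrightarrow> y j / y i \<in> max_ideal P) \<longrightarrow>
           x * y 0 / y N \<notin> max_ideal P"
      using no_long_chain[OF P True x(1)] by blast
    have tp: "t ^ j / t ^ i \<in> max_ideal P" if "i < j" for i j
    proof -
      have "t ^ j = t ^ i * (t ^ (j - i - 1) * t)"
      proof -
        have "j = i + ((j - i - 1) + 1)" using that by simp
        hence "t ^ j = t ^ (i + ((j - i - 1) + 1))" by simp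
        thus ?thesis unfolding power_add by simp
      qed
      hence "t ^ j / t ^ i = t ^ (j - i - 1) * t" using t0 by simp
      thus ?thesis using max_ideal_mult[OF P _ tm] subring_power[OF place_ring[OF P], of t] tm max_ideal_subset
        by auto
    qed
    have "x * t ^ 0 / t ^ N \<notin> max_ideal P" using N[of "\<lambda>j. t ^ j"] t0 tp by auto
    hence "x / t ^ Suc N \<notin> P" using uniformizes_iff[OF t, of "x / t ^ N"] by (simp add: mult.commute)
    hence ex: "\<exists>n. x / t ^ n \<notin> P" by blast
    define n where "n = (LEAST n. x / t ^ n \<notin> P)"
    have n: "x / t ^ n \<notin> P" using LeastI_ex[OF ex] unfolding n_def .
    have "n \<noteq> 0"
    proof
      assume "n = 0"
      thus False using n x by simp
    qed
    then obtain k where k: "n = Suc k" by (cases n) auto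
    have "x / t ^ k \<in> P" using not_less_Least[of k "\<lambda>n. x / t ^ n \<notin> P"] k unfolding n_def by auto
    moreover have "x / t ^ k \<notin> max_ideal P" using n uniformizes_iff[OF t, of "x / t ^ k"] k by (simp add: mult.commute)
    ultimately show ?thesis using t0 by (intro exI[of _ "int k"] exI[of _ "x / t ^ k"]) auto
  qed
  show ?thesis
  proof (cases "x \<in> P")
    case False
    hence "inverse x \<in> P" "inverse x \<noteq> 0" using place_total[OF P] x by auto
    from main[OF this(2,1)] obtain n u where u: "place_unit P u" "inverse x = u * t powi n" by blast
    have "x = inverse (u * t powi n)" by (simp add: u(2)[symmetric])
    also have "\<dots> = inverse u * t powi (- n)" by (simp add: power_int_minus)
    finally show ?thesis using place_unit_inverse[OF P u(1)] by blast
  qed (use main x in blast)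
qed

lemma uniformizer_power_in:
  assumes P: "P \<in> places Fr" and t: "uniformizes P t" and u: "place_unit P u"
  shows "u * t powi n \<in> P \<longleftrightarrow> n \<ge> 0"
proof -
  have t0: "t \<noteq> 0" using t unfolding uniformizes_def by blast
  have tm: "t \<in> max_ideal P" using uniformizes_iff[OF t, of t] t0 subring_one[OF place_ring[OF P]] by simp
  have pos: "u * t powi n \<in> P" if "n \<ge> 0" "place_unit P u" for n u
    using that tm max_ideal_subset[of P] subring_mult[OF place_ring[OF P]] subring_power[OF place_ring[OF P]]
    by (auto simp: power_int_def)
  have "u * t powi n \<notin> P" if n: "n < 0"
  proof
    assume a: "u * t powi n \<in> P"
    have "inverse u * t powi (- n - 1) \<in> P" using n place_unit_inverse[OF P u] by (intro pos) auto
    hence "(u * t powi n) * (inverse u * t powi (- n - 1)) * t \<in> max_ideal P"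
      using max_ideal_mult[OF P subring_mult[OF place_ring[OF P] a] tm] by blast
    moreover have "(u * t powi n) * (inverse u * t powi (- n - 1)) * t = (u * inverse u) * (t powi n * t powi (- n - 1) * t powi 1)"
      by (simp add: ac_simps)
    moreover have "\<dots> = 1" using place_unit_nonzero[OF P u] t0 by (simp flip: power_int_add)
    ultimately show False using one_notin_max_ideal[OF P] by simp
  qed
  thus ?thesis using pos u by force
qed

text \<open>The description in \<open>ord_elem\<close> ranges over all uniformizers, so its
  uniqueness rests on any two of them differing by a unit c.\<close>

lemma ord_elem_eqI:
  assumes P: "P \<in> places Fr" and t: "uniformizes P t" and u: "place_unit P u"
  shows "ord_elem P (u * t powi n) = n"
proof -
  have t0: "t \<noteq> 0" using t unfolding uniformizes_def by blast
  show ?thesis unfolding ord_elem_def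
  proof (rule the_equality)
    show "\<exists>s w. max_ideal P = (\<lambda>z. s * z) ` P \<and> w \<in> P \<and> w \<notin> max_ideal P \<and> u * t powi n = w * s powi n"
      using t u unfolding uniformizes_def by blast
  next
    fix n' assume "\<exists>s w. max_ideal P = (\<lambda>z. s * z) ` P \<and> w \<in> P \<and> w \<notin> max_ideal P \<and>
        u * t powi n = w * s powi n'"
    then obtain s w where s: "max_ideal P = (\<lambda>z. s * z) ` P" and w: "place_unit P w"
      and eq: "u * t powi n = w * s powi n'" by blast
    have "s \<noteq> 0" using s max_ideal_nonzero[OF P] by auto
    hence s': "uniformizes P s" using s unfolding uniformizes_def by blast
    have mem: "t \<in> max_ideal P" "s \<in> max_ideal P"
      using uniformizes_iff[OF t, of t] uniformizes_iff[OF s', of s] t0 \<open>s \<noteq> 0\<close> subring_one[OF place_ring[OF P]]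
      by auto
    define c where "c = s / t"
    have "c \<in> P" "inverse c \<in> P" using mem uniformizes_iff[OF t, of s] uniformizes_iff[OF s', of t]
      unfolding c_def by auto
    moreover have "c \<noteq> 0" unfolding c_def using t0 \<open>s \<noteq> 0\<close> by simp
    ultimately have c: "place_unit P c" "place_unit P (inverse c)"
      using max_ideal_iff[OF P, of c] place_unit_inverse[OF P] by auto
    have "place_unit P (c powi n')" using place_unit_power[OF P c(1)] place_unit_power[OF P c(2)] by (auto simp: power_int_def)
    hence uu: "place_unit P (w * c powi n' * inverse u)"
      using w place_unit_inverse[OF P u] by (intro place_unit_mult[OF P]) auto
    have "s = c * t" unfolding c_def using t0 by simp
    hence "u * t powi n = w * c powi n' * t powi n'" using eq by (simp add: power_int_mult_distrib)
    hence e: "t powi n = (w * c powi n' * inverse u) * t powi n'"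
      using place_unit_nonzero[OF P u] by (simp add: field_simps)
    have "1 * t powi (n - n') = (w * c powi n' * inverse u) * t powi 0"
      using e t0 by (simp add: power_int_diff)
    moreover have "1 * t powi (n' - n) = inverse (w * c powi n' * inverse u) * t powi 0"
    proof -
      have "1 * t powi (n' - n) = t powi n' / t powi n" using t0 by (simp add: power_int_diff)
      also have "\<dots> = inverse (w * c powi n' * inverse u) * t powi 0" unfolding e using t0 by (simp add: divide_inverse)
      finally show ?thesis .
    qed
    ultimately have "1 * t powi (n - n') \<in> P" "1 * t powi (n' - n) \<in> P"
      using uu place_unit_inverse[OF P uu] by auto
    thus "n' = n"
      using uniformizer_power_in[OF P t, of 1] subring_one[OF place_ring[OF P]] one_notin_max_ideal[OF P]
      by (metis antisym diff_ge_0_iff_ge)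
  qed
qed

lemma ord_decomposition:
  assumes P: "P \<in> places Fr" and t: "uniformizes P t" and x: "x \<noteq> 0"
  obtains u where "place_unit P u" "x = u * t powi ord_elem P x"
proof -
  obtain n u where u: "place_unit P u" "x = u * t powi n" using place_decomposition[OF assms] by blast
  hence "ord_elem P x = n" using ord_elem_eqI[OF P t] by simp
  thus ?thesis using that u by blast
qed

lemma ord_mult:
  assumes P: "P \<in> places Fr" and "x \<noteq> 0" "y \<noteq> 0"
  shows "ord_elem P (x * y) = ord_elem P x + ord_elem P y"
proof -
  obtain t where t: "uniformizes P t" using exists_uniformizer[OF P] by blast
  obtain u where u: "place_unit P u" "x = u * t powi ord_elem P x" using ord_decomposition[OF P t assms(2)] .
  obtain w where w: "place_unit P w" "y = w * t powi ord_elem P y" using ord_decomposition[OF P t assms(3)] .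
  have "t \<noteq> 0" using t unfolding uniformizes_def by blast
  hence "x * y = (u * w) * t powi (ord_elem P x + ord_elem P y)"
    by (subst u(2), subst w(2)) (simp add: power_int_add)
  thus ?thesis using ord_elem_eqI[OF P t place_unit_mult[OF P u(1) w(1)]] by simp
qed

lemma ord_one: "P \<in> places Fr \<Longrightarrow> ord_elem P 1 = 0"
  using ord_mult[of P 1 1] by simp

lemma ord_inverse: "P \<in> places Fr \<Longrightarrow> x \<noteq> 0 \<Longrightarrow> ord_elem P (inverse x) = - ord_elem P x"
  using ord_mult[of P x "inverse x"] ord_one[of P] by simp

lemma ord_divide: "P \<in> places Fr \<Longrightarrow> x \<noteq> 0 \<Longrightarrow> y \<noteq> 0 \<Longrightarrow> ord_elem P (x / y) = ord_elem P x - ord_elem P y"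
  using ord_mult[of P x "inverse y"] ord_inverse[of P y] by (simp add: divide_inverse)

lemma ord_power: "P \<in> places Fr \<Longrightarrow> x \<noteq> 0 \<Longrightarrow> ord_elem P (x ^ n) = int n * ord_elem P x"
  by (induction n) (auto simp: ord_one ord_mult algebra_simps)

lemma place_iff_ord: "P \<in> places Fr \<Longrightarrow> x \<in> P \<longleftrightarrow> x = 0 \<or> ord_elem P x \<ge> 0"
proof (cases "x = 0")
  case False
  assume P: "P \<in> places Fr"
  obtain t where t: "uniformizes P t" using exists_uniformizer[OF P] by blast
  obtain u where u: "place_unit P u" "x = u * t powi ord_elem P x" using ord_decomposition[OF P t False] .
  show ?thesis using uniformizer_power_in[OF P t u(1), of "ord_elem P x"] u(2) False by simp
qed (use subring_zero[OF place_ring] in auto)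

lemma max_ideal_iff_ord: "P \<in> places Fr \<Longrightarrow> x \<in> max_ideal P \<longleftrightarrow> x = 0 \<or> ord_elem P x \<ge> 1"
  using max_ideal_iff[of P x] place_iff_ord[of P "inverse x"] ord_inverse[of P x] by auto

lemma exists_ord:
  assumes P: "P \<in> places Fr"
  shows "\<exists>t. t \<noteq> 0 \<and> ord_elem P t = n"
proof -
  obtain t where t: "uniformizes P t" using exists_uniformizer[OF P] by blast
  hence "t \<noteq> 0" unfolding uniformizes_def by blast
  thus ?thesis using place_unit_one[OF P] ord_elem_eqI[OF P t, of 1 n] by (intro exI[of _ "t powi n"]) auto
qed

section \<open>Powers of the maximal ideal, and residue fields\<close>

definition fpower :: "'k set \<Rightarrow> int \<Rightarrow> 'k set" where
  "fpower P n = {x. x = 0 \<or> n \<le> ord_elem P x}"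

lemma fpower_0: "P \<in> places Fr \<Longrightarrow> fpower P 0 = P"
  unfolding fpower_def using place_iff_ord by auto

lemma fpower_1: "P \<in> places Fr \<Longrightarrow> fpower P 1 = max_ideal P"
  unfolding fpower_def using max_ideal_iff_ord by auto

lemma fpower_mono: "m \<le> n \<Longrightarrow> fpower P n \<subseteq> fpower P m"
  unfolding fpower_def by auto

lemma fpower_mult: "P \<in> places Fr \<Longrightarrow> x \<in> fpower P m \<Longrightarrow> y \<in> fpower P n \<Longrightarrow> x * y \<in> fpower P (m + n)"
  unfolding fpower_def using ord_mult[of P x y] by (cases "x = 0"; cases "y = 0") auto

lemma fpower_iff_place:
  assumes P: "P \<in> places Fr" and t: "t \<noteq> 0" "ord_elem P t = n"
  shows "x \<in> fpower P n \<longleftrightarrow> x / t \<in> P"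
  unfolding fpower_def using place_iff_ord[OF P] ord_divide[OF P, of x t] t by (cases "x = 0") auto

lemma fpower_group:
  assumes P: "P \<in> places Fr"
  shows "add_subgroup (fpower P n)"
proof -
  obtain t where t: "t \<noteq> 0" "ord_elem P t = n" using exists_ord[OF P] by blast
  show ?thesis unfolding add_subgroup_def Ball_def fpower_iff_place[OF P t]
    using subring_zero[OF place_ring[OF P]] subring_diff[OF place_ring[OF P]] by (simp add: diff_divide_distrib)
qed

lemma ord_add_eq:
  assumes P: "P \<in> places Fr" and x: "x \<noteq> 0" and y: "y \<in> fpower P (ord_elem P x + 1)"
  shows "x + y \<noteq> 0 \<and> ord_elem P (x + y) = ord_elem P x"
proof -
  note grp = fpower_group[OF P]
  have xx: "x \<in> fpower P (ord_elem P x)" "x \<notin> fpower P (ord_elem P x + 1)" using x unfolding fpower_def by auto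
  have "x + y \<in> fpower P (ord_elem P x)"
    using add_subgroup_add[OF grp xx(1)] y fpower_mono[of "ord_elem P x" "ord_elem P x + 1"] by auto
  moreover have n: "x + y \<notin> fpower P (ord_elem P x + 1)"
    using add_subgroup_diff[OF grp _ y, of "x + y"] xx(2) by auto
  ultimately show ?thesis unfolding fpower_def by auto
qed

lemma place_residue_extension:
  assumes P: "P \<in> places Fr"
  shows "residue_extension Fr P (max_ideal P)"
proof
  fix x assume "x \<in> Fr" "x \<notin> max_ideal P"
  moreover have "x \<noteq> 0" using \<open>x \<notin> max_ideal P\<close> max_ideal_iff[OF P] by blast
  ultimately show "\<exists>y\<in>Fr. x * y - 1 \<in> max_ideal P"
    using subfield_inverse[OF Fr_field] add_subgroup_zero[OF max_ideal_group[OF P]]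
    by (intro bexI[of _ "inverse x"]) auto
qed (use P Fr_ring place_ring place_Fr max_ideal_group max_ideal_subset max_ideal_mult
    one_notin_max_ideal in blast)+

lemma index_Fr_max_ideal: "P \<in> places Fr \<Longrightarrow> has_index Fr (max_ideal P \<inter> Fr) (card Fr)"
proof -
  assume P: "P \<in> places Fr"
  have "max_ideal P \<inter> Fr = {0}"
    using Fr_max_ideal[OF P] subring_zero[OF Fr_ring] add_subgroup_zero[OF max_ideal_group[OF P]] by blast
  thus ?thesis using has_index_zero[OF Fr_finite] by simp
qed

text \<open>At a place where x vanishes the polynomial coefficients of a relation reduce to
  constants in \<open>Fr\<close>, not all zero, so any N + 1 elements of P are dependent modulo the
  maximal ideal.\<close>

lemma residue_finite:
  assumes P: "P \<in> places Fr"
  shows "\<exists>n. has_index P (max_ideal P) n"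
proof -
  interpret residue_extension Fr P "max_ideal P" by (rule place_residue_extension[OF P])
  obtain x where x: "x \<in> max_ideal P" "x \<noteq> 0" using max_ideal_nonzero[OF P] by blast
  obtain N :: nat where N: "\<And>y. \<exists>p. (\<forall>j. p j \<in> polys_over Fr) \<and> (\<exists>j\<le>N. coeff (p j) 0 \<noteq> 0) \<and>
           (\<Sum>j\<le>N. poly (p j) x * y j) = 0"
    using linear_relation[OF x(2)] by blast
  have bound: "card B \<le> N" if "finite B" "B \<subseteq> P" "residue_independent Fr (max_ideal P) B" for B
  proof (rule independent_bound_relation[OF _ that])
    fix y assume y: "\<And>j. j \<le> N \<Longrightarrow> y j \<in> P"
    obtain p where p: "\<And>j. p j \<in> polys_over Fr" and ex: "\<exists>j\<le>N. coeff (p j) 0 \<noteq> 0"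
      and rel: "(\<Sum>j\<le>N. poly (p j) x * y j) = 0" using N by blast
    have cF: "coeff (p j) 0 \<in> Fr" for j using p unfolding polys_over_def by blast
    have "(\<Sum>j\<le>N. coeff (p j) 0 * y j) = - (\<Sum>j\<le>N. (poly (p j) x - coeff (p j) 0) * y j)"
      using rel by (simp add: left_diff_distrib sum_subtractf)
    also have "\<dots> \<in> max_ideal P"
    proof (intro add_subgroup_minus[OF m] add_subgroup_sum[OF m])
      fix j assume "j \<in> {..N}"
      hence "y j * (poly (p j) x - coeff (p j) 0) \<in> max_ideal P"
        using y by (intro ideal poly_residue[OF P p x(1)]) auto
      thus "(poly (p j) x - coeff (p j) 0) * y j \<in> max_ideal P" by (simp add: mult.commute)
    qed
    finally show "\<exists>c. (\<forall>j\<le>N. c j \<in> Fr) \<and> (\<exists>j\<le>N. c j \<notin> max_ideal P) \<and> (\<Sum>j\<le>N. c j * y j) \<in> max_ideal P"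
      using cF ex Fr_max_ideal[OF P] by (intro exI[of _ "\<lambda>j. coeff (p j) 0"]) blast
  qed
  obtain B where "finite B" "B \<subseteq> P" "residue_independent Fr (max_ideal P) B"
    "residue_spanning Fr P (max_ideal P) B" using basis_exists[of N] bound by blast
  from span_index[OF this index_Fr_max_ideal[OF P]] show ?thesis by blast
qed

lemma place_index: "P \<in> places Fr \<Longrightarrow> has_index P (max_ideal P) (card Fr ^ place_degree Fr P)"
proof -
  assume P: "P \<in> places Fr"
  interpret residue_extension Fr P "max_ideal P" by (rule place_residue_extension[OF P])
  obtain n where n: "has_index P (max_ideal P) n" using residue_finite[OF P] by blast
  show ?thesis
    using n residue_degree_index[OF n index_Fr_max_ideal[OF P]] unfolding place_degree_def by simp
qed

lemma place_degree_pos: "P \<in> places Fr \<Longrightarrow> place_degree Fr P > 0"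
proof (rule ccontr)
  assume P: "P \<in> places Fr" and "\<not> 0 < place_degree Fr P"
  hence "has_index P (max_ideal P) 1" using place_index[OF P] by simp
  hence "\<exists>x\<in>{0,1}. \<exists>y\<in>{0,1}. x \<noteq> y \<and> x - y \<in> max_ideal P"
    using subring_zero[OF place_ring[OF P]] subring_one[OF place_ring[OF P]]
    by (intro has_index_pigeonhole[OF max_ideal_group[OF P]]) auto
  thus False using one_notin_max_ideal[OF P] add_subgroup_minus[OF max_ideal_group[OF P], of "-1"] by auto
qed

text \<open>Multiplication by an element of order n + k carries the residue field onto the k-th
  graded piece.\<close>

lemma fpower_index:
  assumes P: "P \<in> places Fr"
  shows "has_index (fpower P n) (fpower P (n + int k)) ((card Fr ^ place_degree Fr P) ^ k)"
proof (induction k)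
  case 0
  have "transversal (fpower P n) (fpower P n) {0}"
    unfolding transversal_def using add_subgroup_zero[OF fpower_group[OF P]] by auto
  thus ?case unfolding has_index_def by (intro exI[of _ "{0}"]) auto
next
  case (Suc k)
  obtain t where t: "t \<noteq> 0" "ord_elem P t = n + int k" using exists_ord[OF P] by blast
  have "x * t \<in> fpower P (n + int k)" if "x \<in> P" for x using fpower_iff_place[OF P t] that t by simp
  moreover have "x * t - y * t \<in> fpower P (n + int (Suc k)) \<longleftrightarrow> x - y \<in> max_ideal P" for x y
    unfolding left_diff_distrib[symmetric] fpower_def max_ideal_iff_ord[OF P]
    using ord_mult[OF P, of "x - y" t] t by (cases "x = y") auto
  moreover have "\<exists>x\<in>P. z - x * t \<in> fpower P (n + int (Suc k))" if "z \<in> fpower P (n + int k)" for z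
    using that fpower_iff_place[OF P t, of z] t add_subgroup_zero[OF fpower_group[OF P]]
    by (intro bexI[of _ "z / t"]) auto
  ultimately have "has_index (fpower P (n + int k)) (fpower P (n + int (Suc k))) (card Fr ^ place_degree Fr P)"
    using has_index_map[OF max_ideal_group[OF P] fpower_group[OF P] _ _ _ place_index[OF P], of "\<lambda>x. x * t"]
    by blast
  from has_index_trans[OF fpower_group[OF P] fpower_group[OF P] _ _ fpower_group[OF P] Suc this]
  show ?case using fpower_mono[of "n + int k" "n + int (Suc k)"] fpower_mono[of n "n + int k"]
    by (simp add: mult.commute)
qed

end

section \<open>Approximation\<close>

context function_field
begin

text \<open>Discreteness gives rank one: if a in Q has a pole at P, every x becomes regular at P
  after division by a high power of a, and hence lies in Q.\<close>

lemma places_incomparable: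
  assumes P: "P \<in> places Fr" and Q: "Q \<in> places Fr" and sub: "P \<subseteq> Q"
  shows "P = Q"
proof (rule ccontr)
  assume "P \<noteq> Q"
  then obtain a where a: "a \<in> Q" "a \<notin> P" using sub by blast
  have a0: "a \<noteq> 0" "ord_elem P a < 0" using a place_iff_ord[OF P, of a] by auto
  have "x \<in> Q" for x
  proof (cases "x = 0")
    case False
    define n where "n = nat \<bar>ord_elem P x\<bar>"
    have "int n * ord_elem P a \<le> int n * (-1)" using a0 by (intro mult_left_mono) auto
    hence "ord_elem P (x / a ^ n) \<ge> 0"
      using a0 False by (simp add: ord_divide[OF P] ord_power[OF P] n_def)
    hence "x / a ^ n \<in> Q" using sub place_iff_ord[OF P] by blast
    hence "x / a ^ n * a ^ n \<in> Q" using a(1) subring_mult[OF place_ring[OF Q]] subring_power[OF place_ring[OF Q]] by blast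
    thus ?thesis using a0 by simp
  qed (use subring_zero[OF place_ring[OF Q]] in simp)
  thus False using place_proper[OF Q] by blast
qed

lemma separate_two:
  assumes P: "P \<in> places Fr" and Q: "Q \<in> places Fr" and ne: "P \<noteq> Q"
  shows "\<exists>y. y \<noteq> 0 \<and> ord_elem P y > 0 \<and> ord_elem Q y < 0"
proof -
  obtain a b where ab: "a \<in> P" "a \<notin> Q" "b \<in> Q" "b \<notin> P"
    using places_incomparable[OF P Q] places_incomparable[OF Q P] ne by blast
  hence "a \<noteq> 0" "b \<noteq> 0" "ord_elem P a \<ge> 0" "ord_elem Q a < 0" "ord_elem Q b \<ge> 0" "ord_elem P b < 0"
    using place_iff_ord[OF P] place_iff_ord[OF Q] by auto
  thus ?thesis by (intro exI[of _ "a / b"]) (auto simp: ord_divide[OF P] ord_divide[OF Q])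
qed

text \<open>Induction on the set of prescribed poles. The element z for \<open>Qs\<close> is
  corrected by an element y that separates P from the new place Q, according to the behaviour of z
  at Q.\<close>

lemma separate_finite:
  assumes P: "P \<in> places Fr" and Qs: "finite Qs" "Qs \<subseteq> places Fr" "P \<notin> Qs"
  shows "\<exists>z. z \<noteq> 0 \<and> ord_elem P z > 0 \<and> (\<forall>Q\<in>Qs. ord_elem Q z < 0)"
  using Qs
proof (induction Qs rule: finite_induct)
  case empty
  thus ?case using exists_ord[OF P, of 1] by fastforce
next
  case (insert Q Qs)
  then obtain z where z: "z \<noteq> 0" "ord_elem P z > 0" "\<And>Q. Q \<in> Qs \<Longrightarrow> ord_elem Q z < 0" by auto
  have Q: "Q \<in> places Fr" "P \<noteq> Q" using insert.prems by auto
  obtain y where y: "y \<noteq> 0" "ord_elem P y > 0" "ord_elem Q y < 0" using separate_two[OF P Q] by blast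
  \<comment> \<open>Large enough for the poles of z^r along \<open>Qs\<close> to dominate the orders
    of y there.\<close>
  define r where "r = nat (1 + (\<Sum>Q\<in>Qs. \<bar>ord_elem Q y\<bar>))"
  have r1: "int r \<ge> 1" unfolding r_def by (simp add: sum_nonneg)
  have r: "int r * ord_elem R z + ord_elem R y < 0" if R: "R \<in> Qs" for R
  proof -
    have "\<bar>ord_elem R y\<bar> \<le> (\<Sum>Q\<in>Qs. \<bar>ord_elem Q y\<bar>)" using R insert.hyps by (intro member_le_sum) auto
    hence "ord_elem R y < int r" unfolding r_def by linarith
    moreover have "int r * ord_elem R z \<le> int r * (-1)" using z(3)[OF R] by (intro mult_left_mono) auto
    ultimately show ?thesis by linarith
  qed
  have pr: "R \<in> places Fr" if "R \<in> Qs" for R using that insert.prems by auto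
  consider "ord_elem Q z < 0" | "ord_elem Q z = 0" | "ord_elem Q z > 0" by linarith
  thus ?case
  proof cases
    case 1
    thus ?thesis using z by (intro exI[of _ z]) auto
  next
    case 2
    have "ord_elem P (z ^ r * y) > 0" using z y r1 by (simp add: ord_mult[OF P] ord_power[OF P] add_nonneg_pos)
    moreover have "ord_elem Q (z ^ r * y) < 0" using z y 2 by (simp add: ord_mult[OF Q(1)] ord_power[OF Q(1)])
    moreover have "ord_elem R (z ^ r * y) < 0" if "R \<in> Qs" for R
      using r[OF that] z y by (simp add: ord_mult[OF pr[OF that]] ord_power[OF pr[OF that]])
    ultimately show ?thesis using z y by (intro exI[of _ "z ^ r * y"]) auto
  next
    case 3
    \<comment> \<open>Here z vanishes at Q, so multiplying by z^r could destroy the pole of y at Q.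
      The factor 1 + z^r is a unit at both P and Q and still has the poles along
      \<open>Qs\<close>.\<close>
    have one: "1 + z ^ r \<noteq> 0 \<and> ord_elem R (1 + z ^ r) = 0" if "R \<in> places Fr" "ord_elem R z > 0" for R
    proof -
      have "ord_elem R (z ^ r) \<ge> 1" using that z(1) mult_mono[of 1 "int r" 1 "ord_elem R z"] r1 by (simp add: ord_power)
      hence "z ^ r \<in> fpower R (ord_elem R 1 + 1)" using ord_one[OF that(1)] unfolding fpower_def by simp
      thus ?thesis using ord_add_eq[OF that(1), of 1 "z ^ r"] ord_one[OF that(1)] by simp
    qed
    have "ord_elem R (1 + z ^ r) = int r * ord_elem R z" if R: "R \<in> Qs" for R
    proof -
      have "int r * ord_elem R z \<le> 1 * (-1)" using z(3)[OF R] r1 mult_mono[of 1 "int r" 1 "- ord_elem R z"] by simp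
      hence "1 \<in> fpower R (ord_elem R (z ^ r) + 1)"
        using z ord_one[OF pr[OF R]] unfolding fpower_def by (simp add: ord_power[OF pr[OF R]])
      thus ?thesis using ord_add_eq[OF pr[OF R], of "z ^ r" 1] z by (simp add: ord_power[OF pr[OF R]] add.commute)
    qed
    hence "ord_elem R ((1 + z ^ r) * y) < 0" if "R \<in> Qs" for R
      using r[OF that] one[OF P z(2)] y that by (simp add: ord_mult[OF pr[OF that]])
    moreover have "ord_elem P ((1 + z ^ r) * y) > 0" using one[OF P z(2)] y by (simp add: ord_mult[OF P])
    moreover have "ord_elem Q ((1 + z ^ r) * y) < 0" using one[OF Q(1) 3] y by (simp add: ord_mult[OF Q(1)])
    ultimately show ?thesis using one[OF P z(2)] y by (intro exI[of _ "(1 + z ^ r) * y"]) auto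
  qed
qed

lemma near_one_unit:
  assumes P: "P \<in> places Fr" and u: "u - 1 \<in> fpower P n" and n: "n \<ge> 1"
  shows "place_unit P u"
proof -
  have u1: "u - 1 \<in> max_ideal P" using u fpower_mono[OF n, of P] fpower_1[OF P] by blast
  have "u \<notin> max_ideal P"
    using add_subgroup_diff_iff[OF max_ideal_group[OF P] u1] one_notin_max_ideal[OF P] by blast
  moreover have "u \<in> P"
    using u1 max_ideal_subset[of P] subring_one[OF place_ring[OF P]]
      add_subgroup_diff_iff[OF subring_add_subgroup[OF place_ring[OF P]], of u 1] by blast
  ultimately show ?thesis by blast
qed

text \<open>The function 1 / (1 + z^n) is close to 1 where z vanishes and close to 0 where z has a
  pole.\<close>

lemma approximate_one:
  assumes P: "P \<in> places Fr" and Qs: "finite Qs" "Qs \<subseteq> places Fr" "P \<notin> Qs"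
  shows "\<exists>u. u \<noteq> 0 \<and> u - 1 \<in> fpower P (int n) \<and> (\<forall>Q\<in>Qs. u \<in> fpower Q (int n))"
proof (cases "n = 0")
  case True
  have "1 \<in> fpower Q 0" if "Q \<in> places Fr" for Q unfolding fpower_def using ord_one[OF that] by simp
  thus ?thesis using True Qs add_subgroup_zero[OF fpower_group[OF P]] by (intro exI[of _ 1]) auto
next
  case False
  obtain z where z: "z \<noteq> 0" "ord_elem P z > 0" "\<forall>Q\<in>Qs. ord_elem Q z < 0" using separate_finite[OF assms] by blast
  have "ord_elem P (z ^ n) \<ge> int n" using z False mult_left_mono[of 1 "ord_elem P z" "int n"] by (simp add: ord_power[OF P])
  hence zP: "z ^ n \<in> fpower P (int n)" and "z ^ n \<in> fpower P (ord_elem P 1 + 1)"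
    using ord_one[OF P] False unfolding fpower_def by auto
  hence one: "1 + z ^ n \<noteq> 0" "ord_elem P (1 + z ^ n) = 0"
    using ord_add_eq[OF P, of 1 "z ^ n"] ord_one[OF P] by auto
  define u where "u = 1 / (1 + z ^ n)"
  have "u - 1 = z ^ n * (- 1 / (1 + z ^ n))" unfolding u_def using one by (simp add: field_simps)
  moreover have "- 1 / (1 + z ^ n) \<in> fpower P 0"
    using one ord_divide[OF P, of 1 "1 + z ^ n"] ord_one[OF P] add_subgroup_minus[OF fpower_group[OF P], of "1 / (1 + z ^ n)" 0]
    by (auto simp: fpower_def)
  ultimately have "u - 1 \<in> fpower P (int n)" using fpower_mult[OF P zP, of "- 1 / (1 + z ^ n)" 0] by simp
  moreover have "u \<in> fpower Q (int n)" if Q: "Q \<in> Qs" for Q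
  proof -
    have QP: "Q \<in> places Fr" using Q Qs by blast
    have "ord_elem Q z \<le> - 1" using z Q by force
    hence le: "ord_elem Q (z ^ n) \<le> - int n" using z(1) mult_left_mono[of "ord_elem Q z" "-1" "int n"]
      by (simp add: ord_power[OF QP])
    hence "1 \<in> fpower Q (ord_elem Q (z ^ n) + 1)" unfolding fpower_def using ord_one[OF QP] False by simp
    hence "ord_elem Q (1 + z ^ n) = ord_elem Q (z ^ n)" using ord_add_eq[OF QP, of "z ^ n" 1] z by (simp add: add.commute)
    thus ?thesis unfolding u_def fpower_def using le one ord_divide[OF QP, of 1 "1 + z ^ n"] ord_one[OF QP] by simp
  qed
  moreover have "u \<noteq> 0" unfolding u_def using one by simp
  ultimately show ?thesis by (intro exI[of _ u]) simp
qed

text \<open>N + 1 zeros would be separated by elements u_j that are 1 at the j-th zero and 0 at the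
  others. A relation among these, read at the j-th zero, says that the constant coefficient of the
  j-th polynomial is zero.\<close>

lemma finite_zeros:
  assumes x: "x \<noteq> 0"
  shows "finite {P \<in> places Fr. x \<in> max_ideal P}"
proof (rule ccontr)
  assume inf: "infinite {P \<in> places Fr. x \<in> max_ideal P}"
  obtain N :: nat where N: "\<And>y. \<exists>p. (\<forall>j. p j \<in> polys_over Fr) \<and> (\<exists>j\<le>N. coeff (p j) 0 \<noteq> 0) \<and>
           (\<Sum>j\<le>N. poly (p j) x * y j) = 0"
    using linear_relation[OF x] by blast
  obtain Z where Z: "Z \<subseteq> {P \<in> places Fr. x \<in> max_ideal P}" "finite Z" "card Z = Suc N"
    using infinite_arbitrarily_large[OF inf, of "Suc N"] by blast
  obtain f where f: "bij_betw f {..N} Z" using Z by (metis card_atMost finite_atMost finite_same_card_bij)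
  have fP: "f j \<in> places Fr" "x \<in> max_ideal (f j)" if "j \<le> N" for j
    using f Z(1) that by (auto simp: bij_betw_def)
  have "\<exists>u. u - 1 \<in> max_ideal (f j) \<and> (\<forall>i\<le>N. i \<noteq> j \<longrightarrow> u \<in> max_ideal (f i))" if j: "j \<le> N" for j
  proof -
    have a: "finite (f ` ({..N} - {j}))" "f ` ({..N} - {j}) \<subseteq> places Fr" using fP by auto
    have b: "f j \<notin> f ` ({..N} - {j})" using f j by (auto simp: bij_betw_def inj_on_def)
    obtain u where u: "u - 1 \<in> fpower (f j) (int 1)" "\<forall>Q\<in>f ` ({..N} - {j}). u \<in> fpower Q (int 1)"
      using approximate_one[OF fP(1)[OF j] a b, of 1] by blast
    have "u \<in> max_ideal (f i)" if i: "i \<le> N" "i \<noteq> j" for i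
    proof -
      have "u \<in> fpower (f i) (int 1)" using u(2) i by blast
      thus ?thesis using fpower_1[OF fP(1)[OF i(1)]] by simp
    qed
    hence "\<forall>i\<le>N. i \<noteq> j \<longrightarrow> u \<in> max_ideal (f i)" by (intro allI impI)
    moreover have "u - 1 \<in> max_ideal (f j)" using u(1) unfolding of_nat_1 fpower_1[OF fP(1)[OF j]] .
    ultimately show ?thesis by (intro exI[of _ u] conjI)
  qed
  then have "\<forall>j\<in>{..N}. \<exists>u. u - 1 \<in> max_ideal (f j) \<and> (\<forall>i\<le>N. i \<noteq> j \<longrightarrow> u \<in> max_ideal (f i))" by blast
  from bchoice[OF this] obtain u where uu: "\<forall>j\<in>{..N}. u j - 1 \<in> max_ideal (f j) \<and>
      (\<forall>i\<le>N. i \<noteq> j \<longrightarrow> u j \<in> max_ideal (f i))" ..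
  have u: "u j - 1 \<in> max_ideal (f j)" if "j \<le> N" for j using uu that by blast
  have u': "u j \<in> max_ideal (f i)" if "j \<le> N" "i \<le> N" "i \<noteq> j" for i j using uu that by blast
  obtain p where p: "\<And>j. p j \<in> polys_over Fr" and ex: "\<exists>j\<le>N. coeff (p j) 0 \<noteq> 0"
    and rel: "(\<Sum>j\<le>N. poly (p j) x * u j) = 0" using N by blast
  obtain j where j: "j \<le> N" "coeff (p j) 0 \<noteq> 0" using ex by blast
  note P = fP(1)[OF j(1)] and xm = fP(2)[OF j(1)]
  note grp = max_ideal_group[OF P]
  have pP: "poly (p i) x \<in> f j" for i using poly_place[OF P p] xm max_ideal_subset by blast
  have "(\<Sum>i\<in>{..N} - {j}. poly (p i) x * u i) \<in> max_ideal (f j)"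
    using pP u' j by (intro add_subgroup_sum[OF grp] max_ideal_mult[OF P]) auto
  moreover have "poly (p j) x * u j = - (\<Sum>i\<in>{..N} - {j}. poly (p i) x * u i)"
    using rel j unfolding eq_neg_iff_add_eq_0 by (subst (asm) sum.remove[of _ j]) auto
  ultimately have "poly (p j) x * u j \<in> max_ideal (f j)"
    using add_subgroup_minus[OF grp] by metis
  moreover have "poly (p j) x * (u j - 1) \<in> max_ideal (f j)" using pP u[OF j(1)] by (intro max_ideal_mult[OF P])
  ultimately have "poly (p j) x * u j - poly (p j) x * (u j - 1) \<in> max_ideal (f j)"
    by (rule add_subgroup_diff[OF grp])
  hence "poly (p j) x \<in> max_ideal (f j)" by (simp add: algebra_simps)
  hence "coeff (p j) 0 \<in> max_ideal (f j)"
    using add_subgroup_diff_iff[OF grp poly_residue[OF P p xm]] by blast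
  thus False using Fr_max_ideal[OF P] p j(2) unfolding polys_over_def by blast
qed

lemma finite_support:
  assumes x: "x \<noteq> 0"
  shows "finite {P \<in> places Fr. ord_elem P x \<noteq> 0}"
proof -
  have "{P \<in> places Fr. ord_elem P x \<noteq> 0} \<subseteq>
      {P \<in> places Fr. x \<in> max_ideal P} \<union> {P \<in> places Fr. inverse x \<in> max_ideal P}"
    using x by (auto simp: max_ideal_iff_ord ord_inverse)
  thus ?thesis using finite_zeros[OF x] finite_zeros[of "inverse x"] x by (simp add: finite_subset)
qed

section \<open>Existence of places\<close>

definition adjoin :: "'k set \<Rightarrow> 'k \<Rightarrow> 'k set" where
  "adjoin M z = {poly p z | p. p \<in> polys_over M}"

lemma adjoin_ring:
  assumes M: "is_subring M"
  shows "is_subring (adjoin M z)" and "M \<subseteq> adjoin M z" and "z \<in> adjoin M z"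
proof -
  note cl = polys_over_closed[OF M]
  have i: "poly p z \<in> adjoin M z" if "p \<in> polys_over M" for p using that unfolding adjoin_def by blast
  show "M \<subseteq> adjoin M z" using i[OF cl(4)] by auto
  show "z \<in> adjoin M z" using i[OF cl(6)] by simp
  show "is_subring (adjoin M z)"
    unfolding is_subring_def
  proof (intro conjI ballI)
    show "1 \<in> adjoin M z" using i[OF cl(5)] by simp
    fix x y assume "x \<in> adjoin M z" "y \<in> adjoin M z"
    then obtain p q where "p \<in> polys_over M" "q \<in> polys_over M" "x = poly p z" "y = poly q z"
      unfolding adjoin_def by blast
    thus "x - y \<in> adjoin M z" "x * y \<in> adjoin M z" using i[OF cl(1)] i[OF cl(3)] by (metis poly_diff poly_mult)+
  qed
qed

text \<open>Chevalley's argument: a ring maximal among those that avoid x, and containing 1 / x, is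
  a valuation ring.\<close>

lemma maximal_subring_is_place:
  assumes M: "is_subring M" "Fr \<subseteq> M" "inverse x \<in> M" "x \<notin> M"
    and max: "\<And>R. is_subring R \<Longrightarrow> M \<subseteq> R \<Longrightarrow> x \<notin> R \<Longrightarrow> R = M"
  shows "M \<in> places Fr"
proof -
  define y where "y = inverse x"
  have x0: "x \<noteq> 0" using M subring_zero[OF M(1)] by auto
  hence yx: "y * x = 1" "x * y = 1" unfolding y_def by auto
  have yM: "y \<in> M" using M y_def by simp
  have adj: "\<exists>p. p \<in> polys_over M \<and> poly p z = x" if "z \<notin> M" for z
  proof -
    have "x \<in> adjoin M z" using max[OF adjoin_ring(1,2)[OF M(1)], of z] adjoin_ring(3)[OF M(1), of z] that by blast
    thus ?thesis unfolding adjoin_def by blast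
  qed
  \<comment> \<open>This says that y = 1 / x lies in the Jacobson radical of M. If s = 1 - y r had
    no inverse in M, adjoining the inverse would produce x; clearing denominators puts s^n x into M,
    and since s^n is 1 modulo y, also x itself.\<close>
  have unit: "1 - y * r \<noteq> 0 \<and> inverse (1 - y * r) \<in> M" if r: "r \<in> M" for r
  proof -
    define s where "s = 1 - y * r"
    have s0: "s \<noteq> 0"
    proof
      assume "s = 0"
      hence "x * (y * r) = x" unfolding s_def by simp
      hence "r = x" using yx by (simp add: mult.assoc[symmetric])
      thus False using r M by simp
    qed
    have sM: "s \<in> M" unfolding s_def using r yM M(1) subring_diff subring_mult subring_one by metis
    have pw: "\<exists>r'\<in>M. s ^ n = 1 - y * r'" for n
    proof (induction n)
      case 0
      show ?case using subring_zero[OF M(1)] by (intro bexI[of _ 0]) auto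
    next
      case (Suc n)
      then obtain r' where r': "r' \<in> M" "s ^ n = 1 - y * r'" by blast
      have "s ^ Suc n = 1 - y * (r + s * r')" unfolding power_Suc r'(2) unfolding s_def by (simp add: algebra_simps)
      moreover have "r + s * r' \<in> M" using r r' sM subring_add[OF M(1)] subring_mult[OF M(1)] by blast
      ultimately show ?case by blast
    qed
    have "inverse s \<in> M"
    proof (rule ccontr)
      assume "inverse s \<notin> M"
      then obtain p where p: "p \<in> polys_over M" "poly p (inverse s) = x" using adj by blast
      define n where "n = degree p"
      have "s ^ n * x = (\<Sum>i\<le>n. s ^ n * (coeff p i * inverse s ^ i))"
        unfolding p(2)[symmetric] poly_altdef n_def sum_distrib_left ..
      also have "\<dots> = (\<Sum>i\<le>n. coeff p i * s ^ (n - i))"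
      proof (rule sum.cong)
        fix i assume "i \<in> {..n}"
        hence "s ^ n = s ^ (n - i) * s ^ i" by (simp flip: power_add)
        thus "s ^ n * (coeff p i * inverse s ^ i) = coeff p i * s ^ (n - i)"
          using s0 by (simp add: power_inverse field_simps)
      qed simp
      also have "\<dots> \<in> M" using p(1) sM unfolding polys_over_def
        by (intro subring_sum[OF M(1)] subring_mult[OF M(1)] subring_power[OF M(1)]) auto
      finally have 1: "s ^ n * x \<in> M" .
      obtain r' where r': "r' \<in> M" "s ^ n = 1 - y * r'" using pw by blast
      have "s ^ n * x = x - y * x * r'" unfolding r'(2) by (simp add: algebra_simps)
      hence "x = s ^ n * x + r'" using yx by simp
      hence "x \<in> M" using subring_add[OF M(1) 1 r'(1)] by simp
      thus False using M by blast
    qed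
    thus ?thesis using s0 s_def by simp
  qed
  \<comment> \<open>An expression of x by powers of 1 / w, multiplied by y and divided by the unit 1
    - y c_0, expresses 1 by powers of 1 / w without constant term. That relation eliminates the
    leading term of the expression of x by powers of w.\<close>
  have reduce: "\<exists>p'. p' \<in> polys_over M \<and> poly p' w = x \<and> degree p' < degree p"
    if w: "w \<noteq> 0" and p: "p \<in> polys_over M" "poly p w = x" and q: "q \<in> polys_over M" "poly q (inverse w) = x"
      and le: "degree q \<le> degree p" for w p q
  proof -
    define n m where "n = degree p" and "m = degree q"
    have qM: "coeff q i \<in> M" and pM: "coeff p i \<in> M" for i using p q unfolding polys_over_def by auto
    have m0: "m \<noteq> 0"
    proof
      assume "m = 0"
      hence "q = [:coeff q 0:]" unfolding m_def by (auto elim: degree_eq_zeroE)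
      hence "x = coeff q 0" using q(2) by (metis poly_const_conv)
      thus False using qM M by metis
    qed
    define c where "c i = y * coeff q i * inverse (1 - y * coeff q 0)" for i
    have cM: "c i \<in> M" for i unfolding c_def using unit[OF qM] qM yM subring_mult[OF M(1)] by blast
    have "y * x = (\<Sum>i\<le>m. y * coeff q i * inverse w ^ i)"
      unfolding q(2)[symmetric] poly_altdef m_def sum_distrib_left by (simp add: mult.assoc)
    also have "\<dots> = y * coeff q 0 + (\<Sum>i\<in>{1..m}. y * coeff q i * inverse w ^ i)"
      using sum.atLeast_Suc_atMost[of 0 m "\<lambda>i. y * coeff q i * inverse w ^ i"] by (simp add: atMost_atLeast0)
    finally have "1 - y * coeff q 0 = (\<Sum>i\<in>{1..m}. y * coeff q i * inverse w ^ i)"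
      using yx by (metis add_diff_cancel_left')
    hence "1 = inverse (1 - y * coeff q 0) * (\<Sum>i\<in>{1..m}. y * coeff q i * inverse w ^ i)"
      using unit[OF qM, of 0] by simp
    hence one: "1 = (\<Sum>i\<in>{1..m}. c i * inverse w ^ i)" unfolding c_def by (simp add: sum_distrib_left ac_simps)
    have "w ^ n = (\<Sum>i\<in>{1..m}. w ^ n * (c i * inverse w ^ i))" using one by (simp flip: sum_distrib_left)
    also have "\<dots> = (\<Sum>i\<in>{1..m}. c i * w ^ (n - i))"
    proof (rule sum.cong)
      fix i assume "i \<in> {1..m}"
      hence "w ^ n = w ^ (n - i) * w ^ i" using le unfolding n_def m_def by (simp flip: power_add)
      thus "w ^ n * (c i * inverse w ^ i) = c i * w ^ (n - i)" using w by (simp add: power_inverse field_simps)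
    qed simp
    finally have wn: "w ^ n = (\<Sum>i\<in>{1..m}. c i * w ^ (n - i))" .
    define p' where "p' = p - monom (coeff p n) n + (\<Sum>i\<in>{1..m}. monom (coeff p n * c i) (n - i))"
    have "poly p' w = x - coeff p n * w ^ n + (\<Sum>i\<in>{1..m}. coeff p n * c i * w ^ (n - i))"
      unfolding p'_def using p(2) by (simp add: poly_monom poly_sum)
    hence "poly p' w = x" using wn by (simp add: sum_distrib_left mult.assoc)
    moreover have "coeff p' i \<in> M" for i
      unfolding p'_def using pM cM subring_zero[OF M(1)]
      by (auto simp: coeff_sum intro!: subring_add[OF M(1)] subring_diff[OF M(1)] subring_sum[OF M(1)] subring_mult[OF M(1)])
    moreover have "degree p' < n"
    proof -
      have "coeff p' i = 0" if i: "i > n - 1" for i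
      proof -
        have "(\<Sum>j\<in>{1..m}. coeff (monom (coeff p n * c j) (n - j)) i) = 0"
          using i m0 le unfolding n_def m_def by (intro sum.neutral) auto
        moreover have "coeff p i - coeff (monom (coeff p n) n) i = 0" using i by (cases "i = n") (auto simp: n_def coeff_eq_0)
        ultimately show ?thesis unfolding p'_def by (simp add: coeff_sum)
      qed
      hence "degree p' \<le> n - 1" by (intro degree_le) blast
      thus ?thesis using m0 le unfolding n_def m_def by linarith
    qed
    ultimately show ?thesis unfolding polys_over_def n_def by (intro exI[of _ p']) simp
  qed
  \<comment> \<open>Reducing whichever of the two expressions has the larger degree would lower the
    total degree forever.\<close>
  have clash: False if "w \<noteq> 0" "p \<in> polys_over M" "poly p w = x" "q \<in> polys_over M" "poly q (inverse w) = x" for w p q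
    using that
  proof (induction "degree p + degree q" arbitrary: p q w rule: less_induct)
    case less
    show ?case
    proof (cases "degree q \<le> degree p")
      case True
      then obtain p' where "p' \<in> polys_over M" "poly p' w = x" "degree p' < degree p"
        using reduce[OF less.prems] by blast
      thus ?thesis using less.hyps[of p' q w] less.prems by simp
    next
      case False
      then obtain q' where "q' \<in> polys_over M" "poly q' (inverse w) = x" "degree q' < degree q"
        using reduce[of "inverse w" q p] less.prems by auto
      thus ?thesis using less.hyps[of p q' w] less.prems by simp
    qed
  qed
  have "z \<in> M \<or> inverse z \<in> M" for z
  proof (rule ccontr)
    assume n: "\<not> ?thesis"
    hence "z \<noteq> 0" using subring_zero[OF M(1)] by auto
    moreover obtain p where "p \<in> polys_over M" "poly p z = x" using adj[of z] n by blast
    moreover obtain q where "q \<in> polys_over M" "poly q (inverse z) = x" using adj[of "inverse z"] n by blast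
    ultimately show False by (rule clash)
  qed
  thus ?thesis unfolding places_def using M by blast
qed

text \<open>As y = 1 / x is transcendental, x is not a polynomial in y, and Zorn's lemma applies to
  the rings that contain \<open>Fr\<close> and y but not x.\<close>

lemma exists_pole:
  assumes x: "x \<notin> Fr"
  shows "\<exists>P\<in>places Fr. x \<notin> P"
proof -
  define y where "y = inverse x"
  have x0: "x \<noteq> 0" using x subring_zero[OF Fr_ring] by auto
  have yF: "y \<notin> Fr" using x subfield_inverse[OF Fr_field, of y] unfolding y_def by auto
  define C where "C = {R. is_subring R \<and> Fr \<subseteq> R \<and> y \<in> R \<and> x \<notin> R}"
  have "x \<notin> adjoin Fr y"
  proof
    assume "x \<in> adjoin Fr y"
    then obtain p where p: "p \<in> polys_over Fr" "x = poly p y" unfolding adjoin_def by blast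
    have "poly (1 - [:0, 1:] * p) y = 0" using p(2) x0 unfolding y_def by simp
    moreover have "1 - [:0, 1:] * p \<in> polys_over Fr"
      by (rule polys_over_closed(1)[OF Fr_ring polys_over_closed(5)[OF Fr_ring]
          polys_over_closed(3)[OF Fr_ring polys_over_closed(6)[OF Fr_ring] p(1)]])
    ultimately have "1 - [:0, 1:] * p = 0" using transcendental_poly[OF yF] by blast
    hence "coeff (1 - [:0, 1:] * p) 0 = 0" by simp
    thus False by simp
  qed
  hence "adjoin Fr y \<in> C" unfolding C_def using adjoin_ring[OF Fr_ring, of y] by blast
  hence "C \<noteq> {}" by blast
  moreover have "\<Union>K \<in> C" if K: "K \<noteq> {}" "subset.chain C K" for K
  proof -
    have KC: "R \<in> C" if "R \<in> K" for R using K(2) that unfolding subset.chain_def by blast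
    have "is_subring (\<Union>K)"
      unfolding is_subring_def
    proof (intro conjI ballI)
      show "1 \<in> \<Union>K" using K(1) KC subring_one unfolding C_def by blast
      fix a b assume "a \<in> \<Union>K" "b \<in> \<Union>K"
      then obtain R R' where R: "R \<in> K" "a \<in> R" "R' \<in> K" "b \<in> R'" by blast
      have "R \<subseteq> R' \<or> R' \<subseteq> R" using R K(2) unfolding subset.chain_def by blast
      then obtain R'' where "R'' \<in> K" "a \<in> R''" "b \<in> R''" using R by blast
      thus "a - b \<in> \<Union>K" "a * b \<in> \<Union>K"
        using KC[of R''] subring_diff[of R'' a b] subring_mult[of R'' a b] unfolding C_def by blast+
    qed
    moreover have "Fr \<subseteq> \<Union>K" "y \<in> \<Union>K" "x \<notin> \<Union>K" using K(1) KC unfolding C_def by blast+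
    ultimately show ?thesis unfolding C_def by blast
  qed
  ultimately obtain M where M: "M \<in> C" "\<forall>R\<in>C. M \<subseteq> R \<longrightarrow> R = M" using subset_Zorn_nonempty[of C] by blast
  have "M \<in> places Fr"
  proof (rule maximal_subring_is_place)
    fix R assume "is_subring R" "M \<subseteq> R" "x \<notin> R"
    thus "R = M" using M unfolding C_def by blast
  qed (use M in \<open>auto simp: C_def y_def\<close>)
  thus ?thesis using M unfolding C_def by blast
qed

end

section \<open>Integral spanning sets\<close>

lemma polys_over_minus_monom:
  assumes "is_subring F" "p \<in> polys_over F"
  shows "p - monom (lead_coeff p) (degree p) \<in> polys_over F"
  using assms subring_zero[OF assms(1)] unfolding polys_over_def by auto

lemma degree_minus_lead_monom:
  assumes "degree p > 0"
  shows "degree (p - monom (lead_coeff p) (degree p)) < degree p"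
proof -
  have "degree (p - monom (lead_coeff p) (degree p)) \<le> degree p - 1"
  proof (rule degree_le, intro allI impI)
    fix i assume "degree p - 1 < i"
    thus "coeff (p - monom (lead_coeff p) (degree p)) i = 0"
      by (cases "i = degree p") (auto simp: coeff_eq_0)
  qed
  thus ?thesis using assms by linarith
qed

lemma polys_over_division:
  assumes F: "is_subfield F" and q: "q \<in> polys_over F" "q \<noteq> 0" and p: "p \<in> polys_over F"
  shows "\<exists>c d. c \<in> polys_over F \<and> d \<in> polys_over F \<and> p = c * q + d \<and> (d = 0 \<or> degree d < degree q)"
  using p
proof (induction "degree p" arbitrary: p rule: less_induct)
  case less
  note R = subfield_subring[OF F] and cl = polys_over_closed[OF subfield_subring[OF F]]
  have zero: "0 \<in> polys_over F" using subring_zero[OF R] unfolding polys_over_def by simp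
  show ?case
  proof (cases "degree p < degree q")
    case True
    thus ?thesis using less.prems zero by (intro exI[of _ 0] exI[of _ p]) auto
  next
    case le: False
    define a where "a = lead_coeff p / lead_coeff q"
    define m where "m = monom a (degree p - degree q)"
    have aF: "a \<in> F" unfolding a_def using less.prems q subfield_divide[OF F] unfolding polys_over_def by blast
    hence m: "m \<in> polys_over F" unfolding m_def polys_over_def using subring_zero[OF R] by auto
    define p' where "p' = p - m * q"
    have p': "p' \<in> polys_over F" unfolding p'_def by (rule cl(1)[OF less.prems cl(3)[OF m q(1)]])
    show ?thesis
    proof (cases "degree p = 0")
      case True
      hence "degree q = 0" using le by simp
      then obtain b where b: "q = [:b:]" by (auto elim: degree_eq_zeroE)
      obtain a' where a': "p = [:a':]" using True by (auto elim: degree_eq_zeroE)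
      have "b \<noteq> 0" using q b by auto
      hence "p = m * q + 0" unfolding m_def a_def b a' by (simp add: monom_0)
      thus ?thesis using m zero by blast
    next
      case False
      have "degree p' \<le> degree p - 1"
      proof (rule degree_le, intro allI impI)
        fix i assume i: "degree p - 1 < i"
        show "coeff p' i = 0"
        proof (cases "i = degree p")
          case True
          have "coeff (m * q) i = a * lead_coeff q" unfolding m_def True coeff_monom_mult using le by simp
          thus ?thesis unfolding p'_def a_def using q(2) True by simp
        next
          case False
          hence "i - (degree p - degree q) > degree q" "i > degree p" using i le by auto
          thus ?thesis unfolding p'_def m_def by (simp add: coeff_monom_mult coeff_eq_0)
        qed
      qed
      hence "degree p' < degree p" using False by linarith
      then obtain c d where cd: "c \<in> polys_over F" "d \<in> polys_over F" "p' = c * q + d" "d = 0 \<or> degree d < degree q"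
        using less.hyps p' by blast
      have "p = (c + m) * q + d" using cd(3) unfolding p'_def by (simp add: algebra_simps)
      thus ?thesis using cd cl(2) m by blast
    qed
  qed
qed

context function_field
begin

text \<open>At a pole of t the leading term dominates all others.\<close>

lemma ord_poly_pole:
  assumes P: "P \<in> places Fr" and t: "t \<notin> P"
  shows "p \<in> polys_over Fr \<Longrightarrow> degree p \<le> n \<Longrightarrow> poly p t \<in> fpower P (int n * ord_elem P t)"
    and "p \<in> polys_over Fr \<Longrightarrow> p \<noteq> 0 \<Longrightarrow> poly p t \<noteq> 0 \<and> ord_elem P (poly p t) = int (degree p) * ord_elem P t"
proof -
  have t0: "t \<noteq> 0" "ord_elem P t < 0" using t place_iff_ord[OF P, of t] by auto
  have Fr0: "ord_elem P a = 0" if "a \<in> Fr" "a \<noteq> 0" for a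
  proof -
    have "ord_elem P a \<ge> 0" "ord_elem P (inverse a) \<ge> 0"
      using that subfield_inverse[OF Fr_field] place_Fr[OF P] place_iff_ord[OF P] by (metis inverse_nonzero_iff_nonzero subsetD)+
    thus ?thesis using ord_inverse[OF P that(2)] by simp
  qed
  have mono: "a * t ^ i \<in> fpower P (int n * ord_elem P t)" if "a \<in> Fr" "i \<le> n" for a i n
  proof (cases "a = 0")
    case False
    have "int n * ord_elem P t \<le> int i * ord_elem P t" using that t0 by (intro mult_right_mono_neg) auto
    thus ?thesis using Fr0[OF that(1) False] False t0 unfolding fpower_def by (simp add: ord_mult[OF P] ord_power[OF P])
  qed (simp add: fpower_def)
  have 1: "poly p t \<in> fpower P (int n * ord_elem P t)" if "p \<in> polys_over Fr" "degree p \<le> n" for p n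
    unfolding poly_altdef
    by (rule add_subgroup_sum[OF fpower_group[OF P]], rule mono) (use that in \<open>auto simp: polys_over_def\<close>)
  show "p \<in> polys_over Fr \<Longrightarrow> degree p \<le> n \<Longrightarrow> poly p t \<in> fpower P (int n * ord_elem P t)" by (rule 1)
  assume p: "p \<in> polys_over Fr" "p \<noteq> 0"
  define a n where "a = lead_coeff p" and "n = degree p"
  have a: "a \<in> Fr" "a \<noteq> 0" using p unfolding a_def polys_over_def by auto
  have at: "a * t ^ n \<noteq> 0" "ord_elem P (a * t ^ n) = int n * ord_elem P t"
    using a t0 Fr0 by (auto simp: ord_mult[OF P] ord_power[OF P])
  define q where "q = p - monom a n"
  have q: "q \<in> polys_over Fr" unfolding q_def a_def n_def by (rule polys_over_minus_monom[OF Fr_ring p(1)])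
  show "poly p t \<noteq> 0 \<and> ord_elem P (poly p t) = int (degree p) * ord_elem P t"
  proof (cases "n = 0")
    case True
    then obtain b where "p = [:b:]" unfolding n_def by (auto elim: degree_eq_zeroE)
    thus ?thesis using at True a unfolding n_def a_def by simp
  next
    case False
    hence "degree q \<le> n - 1" using degree_minus_lead_monom[of p] unfolding q_def a_def n_def by linarith
    hence "poly q t \<in> fpower P (int (n - 1) * ord_elem P t)" using 1[OF q] by blast
    moreover have "int (n - 1) * ord_elem P t \<ge> ord_elem P (a * t ^ n) + 1"
      unfolding at(2) using False t0 by (simp add: of_nat_diff left_diff_distrib)
    ultimately have "poly q t \<in> fpower P (ord_elem P (a * t ^ n) + 1)" using fpower_mono by blast
    from ord_add_eq[OF P at(1) this] at show ?thesis unfolding q_def n_def by (simp add: poly_monom)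
  qed
qed

text \<open>If c_J y had a pole, so would y, and the leading term would have strictly smaller order
  than all the other terms.\<close>

lemma leading_integral:
  assumes P: "P \<in> places Fr" and c: "\<And>i. i \<le> J \<Longrightarrow> c i \<in> P" and rel: "(\<Sum>i\<le>J. c i * y ^ i) = 0" and cJ: "c J \<noteq> 0"
  shows "c J * y \<in> P"
proof (rule ccontr)
  assume n: "c J * y \<notin> P"
  have y0: "y \<noteq> 0" using n subring_zero[OF place_ring[OF P]] by auto
  have o: "ord_elem P (c J) + ord_elem P y < 0"
    using n place_iff_ord[OF P, of "c J * y"] cJ y0 by (simp add: ord_mult[OF P])
  have "ord_elem P (c J) \<ge> 0" using c[of J] cJ place_iff_ord[OF P] by auto
  hence oy: "ord_elem P y < 0" using o by linarith
  have "J \<noteq> 0"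
  proof
    assume "J = 0"
    thus False using rel cJ by simp
  qed
  then obtain k where k: "J = Suc k" by (cases J) auto
  have "(\<Sum>i\<le>k. c i * y ^ i) \<in> fpower P (int k * ord_elem P y)"
  proof (rule add_subgroup_sum[OF fpower_group[OF P]])
    fix i assume "i \<in> {..k}"
    hence i: "i \<le> k" "c i \<in> fpower P 0" using c k fpower_0[OF P] by auto
    have "int k * ord_elem P y \<le> int i * ord_elem P y" using i oy by (intro mult_right_mono_neg) auto
    hence "y ^ i \<in> fpower P (int k * ord_elem P y)" using y0 unfolding fpower_def by (simp add: ord_power[OF P])
    thus "c i * y ^ i \<in> fpower P (int k * ord_elem P y)" using fpower_mult[OF P i(2)] by fastforce
  qed
  moreover have "c J * y ^ J = - (\<Sum>i\<le>k. c i * y ^ i)" using rel k by (simp add: eq_neg_iff_add_eq_0 add.commute)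
  ultimately have "c J * y ^ J \<in> fpower P (int k * ord_elem P y)" using add_subgroup_minus[OF fpower_group[OF P]] by metis
  hence "int k * ord_elem P y \<le> ord_elem P (c J) + int J * ord_elem P y"
    using cJ y0 unfolding fpower_def by (simp add: ord_mult[OF P] ord_power[OF P])
  thus False using o k by (simp add: algebra_simps)
qed

text \<open>The multiplier is the coefficient of the highest power that really occurs in a relation
  among the powers of y over the polynomials in t.\<close>

lemma exists_integral_multiple:
  assumes t: "t \<notin> Fr"
  shows "\<exists>h. h \<in> polys_over Fr \<and> h \<noteq> 0 \<and> (\<forall>P\<in>places Fr. t \<in> P \<longrightarrow> poly h t * y \<in> P)"
proof -
  have "t \<noteq> 0" using t subring_zero[OF Fr_ring] by auto
  from linear_relation[OF this] obtain N :: nat where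
    "\<And>y. \<exists>p. (\<forall>j. p j \<in> polys_over Fr) \<and> (\<exists>j\<le>N. coeff (p j) 0 \<noteq> 0) \<and> (\<Sum>j\<le>N. poly (p j) t * y j) = 0"
    by blast
  from this[of "\<lambda>j. y ^ j"] obtain p where p: "\<And>j. p j \<in> polys_over Fr" and ex: "\<exists>j\<le>N. coeff (p j) 0 \<noteq> 0"
    and rel: "(\<Sum>j\<le>N. poly (p j) t * y ^ j) = 0" by blast
  obtain j where j: "j \<le> N" "p j \<noteq> 0" using ex by fastforce
  define J where "J = (GREATEST j. j \<le> N \<and> p j \<noteq> 0)"
  have J: "J \<le> N \<and> p J \<noteq> 0" unfolding J_def by (rule GreatestI_nat[of _ j N]) (use j in auto)
  have above: "p i = 0" if "J < i" "i \<le> N" for i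
  proof (rule ccontr)
    assume "p i \<noteq> 0"
    hence "i \<le> J" unfolding J_def by (intro Greatest_le_nat[of _ i N]) (use that in auto)
    thus False using that by simp
  qed
  have "(\<Sum>j\<le>J. poly (p j) t * y ^ j) = (\<Sum>j\<le>N. poly (p j) t * y ^ j)"
    by (rule sum.mono_neutral_left) (use J above in auto)
  hence rel': "(\<Sum>j\<le>J. poly (p j) t * y ^ j) = 0" using rel by simp
  have nz: "poly (p J) t \<noteq> 0" using transcendental_poly[OF t p] J by blast
  have "poly (p J) t * y \<in> P" if "P \<in> places Fr" "t \<in> P" for P
    by (rule leading_integral[OF that(1) _ rel' nz]) (use poly_place[OF that(1) p that(2)] in blast)
  thus ?thesis using p J by (intro exI[of _ "p J"]) simp
qed

text \<open>Independence over the polynomials in t bounds the size of a set by N, because N + 1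
  elements always satisfy a relation; a set of maximal size spans up to denominators.\<close>

lemma exists_spanning_set:
  assumes t: "t \<notin> Fr"
  shows "\<exists>E. finite E \<and> (\<forall>z. \<exists>q p. q \<in> polys_over Fr \<and> q \<noteq> 0 \<and> (\<forall>e. p e \<in> polys_over Fr) \<and>
           poly q t * z = (\<Sum>e\<in>E. poly (p e) t * e))"
proof -
  have t0: "t \<noteq> 0" using t subring_zero[OF Fr_ring] by auto
  obtain N :: nat where N:
    "\<And>y. \<exists>p. (\<forall>j. p j \<in> polys_over Fr) \<and> (\<exists>j\<le>N. coeff (p j) 0 \<noteq> 0) \<and> (\<Sum>j\<le>N. poly (p j) t * y j) = 0"
    using linear_relation[OF t0] by blast
  define ind where "ind E \<longleftrightarrow> (\<forall>p. (\<forall>e. p e \<in> polys_over Fr) \<and> (\<Sum>e\<in>E. poly (p e) t * e) = 0 \<longrightarrow>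
      (\<forall>e\<in>E. p e = 0))" for E
  have zero: "0 \<in> polys_over Fr" using subring_zero[OF Fr_ring] unfolding polys_over_def by simp
  have bound: "card E \<le> N" if E: "finite E" "ind E" for E
  proof (rule ccontr)
    assume "\<not> card E \<le> N"
    hence "Suc N \<le> card E" by simp
    then obtain E' where E': "E' \<subseteq> E" "card E' = Suc N" by (rule obtain_subset_with_card_n)
    have fin: "finite E'" using E' E(1) finite_subset by blast
    then obtain y where y: "bij_betw y {..N} E'" using E' by (metis card_atMost finite_atMost finite_same_card_bij)
    obtain p where p: "\<And>j. p j \<in> polys_over Fr" and ex: "\<exists>j\<le>N. coeff (p j) 0 \<noteq> 0"
      and rel: "(\<Sum>j\<le>N. poly (p j) t * y j) = 0" using N by blast
    define i where "i = inv_into {..N} y"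
    define c where "c e = (if e \<in> E' then p (i e) else 0)" for e
    have iy: "i (y j) = j" if "j \<le> N" for j unfolding i_def using y that by (simp add: bij_betw_def)
    have yE: "y j \<in> E'" if "j \<le> N" for j using y that by (auto simp: bij_betw_def)
    have "(\<Sum>e\<in>E. poly (c e) t * e) = (\<Sum>e\<in>E'. poly (c e) t * e)"
      by (rule sum.mono_neutral_right) (use E(1) E' in \<open>auto simp: c_def\<close>)
    also have "\<dots> = (\<Sum>j\<le>N. poly (c (y j)) t * y j)"
      using sum.reindex_bij_betw[OF y, of "\<lambda>e. poly (c e) t * e"] by simp
    also have "\<dots> = 0" unfolding rel[symmetric] by (rule sum.cong) (use iy yE in \<open>auto simp: c_def\<close>)
    finally have "(\<Sum>e\<in>E. poly (c e) t * e) = 0" .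
    moreover have "\<forall>e. c e \<in> polys_over Fr" using p zero unfolding c_def by simp
    ultimately have "\<forall>e\<in>E. c e = 0" 
      by (intro mp[OF spec[OF E(2)[unfolded ind_def], of c]] conjI)
    hence cE: "c e = 0" if "e \<in> E" for e using that by blast
    obtain j where j: "j \<le> N" "coeff (p j) 0 \<noteq> 0" using ex by blast
    have "c (y j) = p j" unfolding c_def using iy yE j by simp
    moreover have "c (y j) = 0" by (rule cE) (use yE[OF j(1)] E' in blast)
    ultimately show False using j by simp
  qed
  define Q where "Q n \<longleftrightarrow> (\<exists>E. finite E \<and> ind E \<and> card E = n)" for n
  have "Q 0" unfolding Q_def ind_def by (rule exI[of _ "{}"]) auto
  moreover have "\<And>n. Q n \<Longrightarrow> n \<le> N" unfolding Q_def using bound by blast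
  ultimately have Q: "Q (Greatest Q)" and max: "\<And>n. Q n \<Longrightarrow> n \<le> Greatest Q"
    by (auto intro: GreatestI_nat Greatest_le_nat)
  obtain E where E: "finite E" "ind E" "card E = Greatest Q" using Q unfolding Q_def by blast
  have "\<exists>q p. q \<in> polys_over Fr \<and> q \<noteq> 0 \<and> (\<forall>e. p e \<in> polys_over Fr) \<and>
           poly q t * z = (\<Sum>e\<in>E. poly (p e) t * e)" for z
  proof (cases "z \<in> E")
    case True
    have "(\<Sum>e\<in>E. poly (if e = z then 1 else 0) t * e) = (\<Sum>e\<in>E. if e = z then z else 0)"
      by (rule sum.cong) auto
    hence "poly 1 t * z = (\<Sum>e\<in>E. poly (if e = z then 1 else 0) t * e)" using True E(1) by simp
    moreover have "1 \<in> polys_over Fr" by (rule polys_over_closed(5)[OF Fr_ring])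
    ultimately show ?thesis using zero by (intro exI[of _ 1] exI[of _ "\<lambda>e. if e = z then 1 else 0"]) auto
  next
    case False
    have "\<not> ind (insert z E)"
    proof
      assume "ind (insert z E)"
      hence "Q (card (insert z E))" unfolding Q_def using E by (intro exI[of _ "insert z E"]) auto
      from max[OF this] show False using E False by simp
    qed
    then obtain p where pp: "\<forall>e. p e \<in> polys_over Fr" and rel: "(\<Sum>e\<in>insert z E. poly (p e) t * e) = 0"
      and nz: "\<exists>e\<in>insert z E. p e \<noteq> 0" unfolding ind_def by auto
    have p: "p e \<in> polys_over Fr" for e using pp by simp
    have rel': "poly (p z) t * z + (\<Sum>e\<in>E. poly (p e) t * e) = 0" using rel E(1) False by simp
    have "p z \<noteq> 0"
    proof
      assume pz: "p z = 0"
      hence "(\<Sum>e\<in>E. poly (p e) t * e) = 0" using rel' by simp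
      with pp have "\<forall>e\<in>E. p e = 0" by (intro mp[OF spec[OF E(2)[unfolded ind_def], of p]] conjI)
      thus False using nz pz by blast
    qed
    moreover have "- p e \<in> polys_over Fr" for e
      using p[of e] subring_minus[OF Fr_ring] unfolding polys_over_def by auto
    moreover have "poly (p z) t * z = (\<Sum>e\<in>E. poly (- p e) t * e)"
      using rel' by (simp add: sum_negf eq_neg_iff_add_eq_0)
    ultimately show ?thesis using p by (intro exI[of _ "p z"] exI[of _ "\<lambda>e. - p e"]) auto
  qed
  thus ?thesis using E(1) by blast
qed

lemma split_factor_X:
  assumes "h \<in> polys_over F" "h \<noteq> 0"
  shows "\<exists>a g. h = monom 1 a * g \<and> g \<in> polys_over F \<and> coeff g 0 \<noteq> 0"
  using assms
proof (induction "degree h" arbitrary: h rule: less_induct)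
  case less
  show ?case
  proof (cases "coeff h 0 = 0")
    case False
    thus ?thesis using less.prems by (intro exI[of _ 0] exI[of _ h]) auto
  next
    case True
    then obtain g where g: "h = pCons 0 g" by (cases h) auto
    have "g \<noteq> 0" using less.prems g by auto
    moreover have "g \<in> polys_over F" using less.prems(1) unfolding polys_over_def g by (auto dest: spec[of _ "Suc _"])
    moreover have "degree g < degree h" using g \<open>g \<noteq> 0\<close> by simp
    ultimately obtain a g' where "g = monom 1 a * g'" "g' \<in> polys_over F" "coeff g' 0 \<noteq> 0" using less.hyps by blast
    thus ?thesis using g by (intro exI[of _ "Suc a"] exI[of _ g']) (auto simp: monom_Suc)
  qed
qed

text \<open>The point is that N is the same for all z; this does the work of a finite first
  cohomology group. Write z in a spanning set whose members are integral over the polynomials in t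
  and divide the coefficients with remainder: the quotients give b, and the proper fractions, which
  are regular at the poles of t, give w.\<close>

lemma decompose:
  assumes t: "t \<notin> Fr"
  shows "\<exists>N. \<forall>z. \<exists>b w. z = b + w \<and> (\<forall>P\<in>places Fr. t \<in> P \<longrightarrow> b \<in> P) \<and>
           (\<forall>P\<in>places Fr. t \<notin> P \<longrightarrow> w / t ^ N \<in> P)"
proof -
  have t0: "t \<noteq> 0" using t subring_zero[OF Fr_ring] by auto
  define s where "s = inverse t"
  have sF: "s \<notin> Fr" using t subfield_inverse[OF Fr_field, of s] unfolding s_def by auto
  obtain E where E: "finite E" and span: "\<And>z. \<exists>q p. q \<in> polys_over Fr \<and> q \<noteq> 0 \<and> (\<forall>e. p e \<in> polys_over Fr) \<and>
           poly q t * z = (\<Sum>e\<in>E. poly (p e) t * e)" using exists_spanning_set[OF t] by blast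
  have "\<forall>e. \<exists>h. h \<in> polys_over Fr \<and> h \<noteq> 0 \<and> (\<forall>P\<in>places Fr. t \<in> P \<longrightarrow> poly h t * e \<in> P)"
    using exists_integral_multiple[OF t] by blast
  from choice[OF this] obtain h where hh: "\<forall>e. h e \<in> polys_over Fr \<and> h e \<noteq> 0 \<and>
      (\<forall>P\<in>places Fr. t \<in> P \<longrightarrow> poly (h e) t * e \<in> P)" ..
  have h: "h e \<in> polys_over Fr" "h e \<noteq> 0" "P \<in> places Fr \<Longrightarrow> t \<in> P \<Longrightarrow> poly (h e) t * e \<in> P" for e P
    using hh by simp_all
  define e' where "e' e = poly (h e) t * e" for e
  \<comment> \<open>The same integrality for s = 1 / t bounds the poles of y above the poles of t: a
    nonzero polynomial in s is a power of s times a unit at every place where s vanishes.\<close>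
  have "\<exists>a. \<forall>P\<in>places Fr. t \<notin> P \<longrightarrow> s ^ a * y \<in> P" for y
  proof -
    from exists_integral_multiple[OF sF, of y] obtain g where
      g: "g \<in> polys_over Fr" "g \<noteq> 0" "\<forall>P\<in>places Fr. s \<in> P \<longrightarrow> poly g s * y \<in> P" by (elim exE conjE)
    obtain a u where u: "g = monom 1 a * u" "u \<in> polys_over Fr" "coeff u 0 \<noteq> 0" using split_factor_X[OF g(1,2)] by blast
    have "s ^ a * y \<in> P" if P: "P \<in> places Fr" "t \<notin> P" for P
    proof -
      have sm: "s \<in> max_ideal P" using P max_ideal_iff[OF P(1), of s] unfolding s_def by simp
      have "s \<in> P" using sm max_ideal_subset by blast
      hence "poly g s * y \<in> P" using g(3) P(1) by simp
      hence gy: "s ^ a * poly u s * y \<in> P" unfolding u(1) by (simp add: poly_monom)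
      have "coeff u 0 \<notin> max_ideal P" using Fr_max_ideal[OF P(1)] u unfolding polys_over_def by blast
      hence "poly u s \<notin> max_ideal P"
        using add_subgroup_diff_iff[OF max_ideal_group[OF P(1)] poly_residue[OF P(1) u(2) sm]] by blast
      hence "inverse (poly u s) \<in> P" "poly u s \<noteq> 0" using max_ideal_iff[OF P(1)] by auto
      hence "inverse (poly u s) * (s ^ a * poly u s * y) \<in> P" "poly u s \<noteq> 0"
        using gy subring_mult[OF place_ring[OF P(1)]] by blast+
      thus ?thesis by (simp add: field_simps)
    qed
    thus ?thesis by blast
  qed
  hence "\<forall>e. \<exists>a. \<forall>P\<in>places Fr. t \<notin> P \<longrightarrow> s ^ a * e' e \<in> P" by blast
  from choice[OF this] obtain a where aa: "\<forall>e. \<forall>P\<in>places Fr. t \<notin> P \<longrightarrow> s ^ a e * e' e \<in> P" ..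
  have a: "P \<in> places Fr \<Longrightarrow> t \<notin> P \<Longrightarrow> s ^ a e * e' e \<in> P" for e P using aa by simp
  define N where "N = (\<Sum>e\<in>E. a e)"
  have "\<exists>b w. z = b + w \<and> (\<forall>P\<in>places Fr. t \<in> P \<longrightarrow> b \<in> P) \<and>
           (\<forall>P\<in>places Fr. t \<notin> P \<longrightarrow> w / t ^ N \<in> P)" for z
  proof -
    from span[of z] obtain q p where q: "q \<in> polys_over Fr" "q \<noteq> 0" and pp: "\<forall>e. p e \<in> polys_over Fr"
      and z: "poly q t * z = (\<Sum>e\<in>E. poly (p e) t * e)" by (elim exE conjE)
    have p: "p e \<in> polys_over Fr" for e using pp by simp
    have qh: "q * h e \<in> polys_over Fr" "q * h e \<noteq> 0" for e
      using q h polys_over_closed(3)[OF Fr_ring] by auto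
    have "\<forall>e. \<exists>cd. fst cd \<in> polys_over Fr \<and> snd cd \<in> polys_over Fr \<and> p e = fst cd * (q * h e) + snd cd \<and>
        (snd cd = 0 \<or> degree (snd cd) < degree (q * h e))"
      using polys_over_division[OF Fr_field qh p] by (metis fst_conv snd_conv)
    from choice[OF this] obtain f where ff: "\<forall>e. fst (f e) \<in> polys_over Fr \<and> snd (f e) \<in> polys_over Fr \<and>
      p e = fst (f e) * (q * h e) + snd (f e) \<and> (snd (f e) = 0 \<or> degree (snd (f e)) < degree (q * h e))" ..
    have f: "fst (f e) \<in> polys_over Fr" "snd (f e) \<in> polys_over Fr"
      "p e = fst (f e) * (q * h e) + snd (f e)" "snd (f e) = 0 \<or> degree (snd (f e)) < degree (q * h e)" for e
      using ff by simp_all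
    define c d where "c e = fst (f e)" and "d e = snd (f e)" for e
    have nzt: "poly (q * h e) t \<noteq> 0" for e using transcendental_poly[OF t qh] .
    define b where "b = (\<Sum>e\<in>E. poly (c e) t * e' e)"
    define w where "w = (\<Sum>e\<in>E. poly (d e) t / poly (q * h e) t * e' e)"
    have "poly q t * (b + w) = (\<Sum>e\<in>E. poly (p e) t * e)"
      unfolding b_def w_def sum.distrib[symmetric] sum_distrib_left
    proof (rule sum.cong)
      fix e
      have hq: "poly q t \<noteq> 0" "poly (h e) t \<noteq> 0" using nzt[of e] by auto
      have "poly (p e) t = poly (c e) t * (poly q t * poly (h e) t) + poly (d e) t"
        using f(3)[of e] unfolding c_def d_def by (metis poly_add poly_mult)
      thus "poly q t * (poly (c e) t * e' e + poly (d e) t / poly (q * h e) t * e' e) = poly (p e) t * e"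
        unfolding e'_def using hq by (simp add: field_simps)
    qed simp
    hence "z = b + w" using z transcendental_poly[OF t q] by (metis mult_left_cancel)
    moreover have "b \<in> P" if "P \<in> places Fr" "t \<in> P" for P
      unfolding b_def e'_def c_def
    proof (rule subring_sum[OF place_ring[OF that(1)]])
      fix e
      show "poly (fst (f e)) t * (poly (h e) t * e) \<in> P"
        by (rule subring_mult[OF place_ring[OF that(1)] poly_place[OF that(1) f(1) that(2)] h(3)[OF that]])
    qed
    moreover have "w / t ^ N \<in> P" if P: "P \<in> places Fr" "t \<notin> P" for P
    proof -
      note ring = place_ring[OF P(1)]
      have ot: "ord_elem P t < 0" using P place_iff_ord[OF P(1)] by auto
      have sP: "s \<in> P" using place_total[OF P(1), of t] P(2) unfolding s_def by blast
      have "s ^ N * (poly (d e) t / poly (q * h e) t * e' e) \<in> P" if e: "e \<in> E" for e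
      proof -
        have "poly (d e) t / poly (q * h e) t \<in> P"
        proof (cases "d e = 0")
          case True
          thus ?thesis using subring_zero[OF ring] by simp
        next
          case False
          note od = ord_poly_pole(2)[OF P f(2)[of e, folded d_def] False]
          note oq = ord_poly_pole(2)[OF P qh[of e]]
          have "int (degree (q * h e)) * ord_elem P t \<le> int (degree (d e)) * ord_elem P t"
            using f(4)[of e] False ot unfolding d_def by (intro mult_right_mono_neg) auto
          thus ?thesis using od oq place_iff_ord[OF P(1)] ord_divide[OF P(1)] by auto
        qed
        moreover have "s ^ N * e' e \<in> P"
        proof -
          have "a e \<le> N" unfolding N_def using e E by (intro member_le_sum) auto
          hence "s ^ N = s ^ (N - a e) * s ^ a e" by (simp flip: power_add)
          thus ?thesis using a[OF P] subring_mult[OF ring] subring_power[OF ring sP] by (simp add: mult.assoc)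
        qed
        ultimately have "poly (d e) t / poly (q * h e) t * (s ^ N * e' e) \<in> P" by (rule subring_mult[OF ring])
        thus ?thesis by (simp add: ac_simps)
      qed
      hence "(\<Sum>e\<in>E. s ^ N * (poly (d e) t / poly (q * h e) t * e' e)) \<in> P" by (rule subring_sum[OF ring])
      moreover have "w / t ^ N = s ^ N * w" unfolding s_def by (simp add: field_simps)
      ultimately show ?thesis unfolding w_def sum_distrib_left by simp
    qed
    ultimately show ?thesis by blast
  qed
  thus ?thesis by blast
qed

end

section \<open>The affine ring\<close>

lemma has_index_finite: "has_index S {0} n \<Longrightarrow> finite S \<and> card S = n"
proof -
  assume "has_index S {0} n"
  then obtain R where R: "transversal S {0} R" "finite R" "card R = n" unfolding has_index_def by blast
  hence "R = S" unfolding transversal_def by auto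
  thus ?thesis using R by simp
qed

locale affine_curve = function_field Fr for Fr :: "'k::field set" +
  fixes Oi :: "'k set"
  assumes place_Oi: "Oi \<in> places Fr"
begin

abbreviation A :: "'k set" where "A \<equiv> regular_off Fr Oi"

abbreviation q :: nat where "q \<equiv> card Fr ^ place_degree Fr Oi"

lemma A_iff: "x \<in> A \<longleftrightarrow> (\<forall>P\<in>places Fr. P \<noteq> Oi \<longrightarrow> x \<in> P)"
  unfolding regular_off_def by auto

lemma A_place: "x \<in> A \<Longrightarrow> P \<in> places Fr \<Longrightarrow> P \<noteq> Oi \<Longrightarrow> x \<in> P"
  using A_iff by blast

lemma A_ring: "is_subring A"
  unfolding is_subring_def
proof (intro conjI ballI)
  show "1 \<in> A" unfolding A_iff using subring_one[OF place_ring] by blast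
  fix x y assume xy: "x \<in> A" "y \<in> A"
  show "x - y \<in> A" unfolding A_iff using A_place[OF xy(1)] A_place[OF xy(2)] subring_diff[OF place_ring] by simp
  show "x * y \<in> A" unfolding A_iff using A_place[OF xy(1)] A_place[OF xy(2)] subring_mult[OF place_ring] by simp
qed

lemma Fr_A: "Fr \<subseteq> A"
  using place_Fr A_iff by blast

lemma A_Oi: "x \<in> A \<Longrightarrow> x \<in> Oi \<Longrightarrow> x \<in> Fr"
  using exists_pole[of x] A_iff by blast

lemma A_ord: "x \<in> A \<Longrightarrow> x \<noteq> 0 \<Longrightarrow> ord_elem Oi x \<le> 0"
proof (rule ccontr)
  assume x: "x \<in> A" "x \<noteq> 0" "\<not> ord_elem Oi x \<le> 0"
  hence "x \<in> max_ideal Oi" using max_ideal_iff_ord[OF place_Oi] by auto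
  moreover have "x \<in> Fr" using calculation A_Oi x max_ideal_subset by blast
  ultimately show False using Fr_max_ideal[OF place_Oi] x by blast
qed

text \<open>Start from w with a pole at \<open>Oi\<close> and regular at the other poles
  \<open>Ps\<close> of t. The parts b_n of w^n that are regular wherever t is keep, for n > N, a
  pole at \<open>Oi\<close> of order proportional to n, while their poles along \<open>Ps\<close>
  are bounded and so have finitely many principal parts. Two b_n with the same principal parts
  differ by a nonconstant element of \<open>A\<close>.\<close>

lemma exists_nonconstant: "\<exists>T\<in>A. T \<notin> Fr"
proof -
  obtain t where t: "t \<noteq> 0" "ord_elem Oi t = -1" using exists_ord[OF place_Oi] by blast
  have tO: "t \<notin> Oi" using t place_iff_ord[OF place_Oi, of t] by simp
  hence tF: "t \<notin> Fr" using place_Fr[OF place_Oi] by blast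
  define Ps where "Ps = {P \<in> places Fr. t \<notin> P} - {Oi}"
  have "Ps \<subseteq> {P \<in> places Fr. inverse t \<in> max_ideal P}"
    unfolding Ps_def using max_ideal_iff[of _ "inverse t"] by auto
  hence fin: "finite Ps" using finite_zeros[of "inverse t"] t finite_subset by auto
  have PsP: "P \<in> places Fr" "t \<notin> P" if "P \<in> Ps" for P using that unfolding Ps_def by auto
  obtain z where z: "z \<noteq> 0" "ord_elem Oi z > 0" "\<forall>P\<in>Ps. ord_elem P z < 0"
    using separate_finite[OF place_Oi fin] unfolding Ps_def by blast
  define w where "w = inverse z"
  have w0: "w \<noteq> 0" "ord_elem Oi w \<le> -1" using z ord_inverse[OF place_Oi z(1)] unfolding w_def by auto
  have wP: "w \<in> P" if "P \<in> Ps" for P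
    using z that place_iff_ord[OF PsP(1)[OF that]] ord_inverse[OF PsP(1)[OF that] z(1)] unfolding w_def by auto
  obtain N where N: "\<And>z. \<exists>b g. z = b + g \<and> (\<forall>P\<in>places Fr. t \<in> P \<longrightarrow> b \<in> P) \<and>
           (\<forall>P\<in>places Fr. t \<notin> P \<longrightarrow> g / t ^ N \<in> P)" using decompose[OF tF] by (elim exE) blast
  have "\<forall>n. \<exists>b. (\<forall>P\<in>places Fr. t \<in> P \<longrightarrow> b \<in> P) \<and> (\<forall>P\<in>places Fr. t \<notin> P \<longrightarrow> (w ^ n - b) / t ^ N \<in> P)"
  proof
    fix n
    obtain b g where "w ^ n = b + g" "\<forall>P\<in>places Fr. t \<in> P \<longrightarrow> b \<in> P" "\<forall>P\<in>places Fr. t \<notin> P \<longrightarrow> g / t ^ N \<in> P"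
      using N[of "w ^ n"] by (elim exE conjE)
    moreover from this have "w ^ n - b = g" by simp
    ultimately show "\<exists>b. (\<forall>P\<in>places Fr. t \<in> P \<longrightarrow> b \<in> P) \<and> (\<forall>P\<in>places Fr. t \<notin> P \<longrightarrow> (w ^ n - b) / t ^ N \<in> P)"
      by (intro exI[of _ b]) simp
  qed
  from choice[OF this] obtain b where bb: "\<forall>n. (\<forall>P\<in>places Fr. t \<in> P \<longrightarrow> b n \<in> P) \<and>
      (\<forall>P\<in>places Fr. t \<notin> P \<longrightarrow> (w ^ n - b n) / t ^ N \<in> P)" ..
  have b1: "b n \<in> P" if "P \<in> places Fr" "t \<in> P" for n P using bb that by simp
  have b2: "w ^ n - b n \<in> fpower P (int N * ord_elem P t)" if "P \<in> places Fr" "t \<notin> P" for n P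
    using bb that t fpower_iff_place[OF that(1), of "t ^ N"] ord_power[OF that(1), of t N] by simp
  have bO: "b n \<noteq> 0 \<and> ord_elem Oi (b n) = int n * ord_elem Oi w" if n: "n > N" for n
  proof -
    have "w ^ n - b n \<in> fpower Oi (- int N)" using b2[OF place_Oi tO, of n] t(2) by simp
    hence "- (w ^ n - b n) \<in> fpower Oi (- int N)" by (rule add_subgroup_minus[OF fpower_group[OF place_Oi]])
    moreover have "int n * ord_elem Oi w \<le> int n * (-1)" using w0 by (intro mult_left_mono) auto
    hence "ord_elem Oi (w ^ n) + 1 \<le> - int N" using n w0 by (simp add: ord_power[OF place_Oi])
    ultimately have "- (w ^ n - b n) \<in> fpower Oi (ord_elem Oi (w ^ n) + 1)" using fpower_mono by blast
    from ord_add_eq[OF place_Oi _ this] w0 show ?thesis by (simp add: ord_power[OF place_Oi])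
  qed
  have "\<exists>R f. finite R \<and> (\<forall>x\<in>fpower P (int N * ord_elem P t). f x \<in> R \<and> x - f x \<in> P)" if P: "P \<in> Ps" for P
  proof -
    have "ord_elem P t < 0" using PsP[OF P] place_iff_ord[of P t] by auto
    hence le: "int N * ord_elem P t \<le> 0" by (simp add: mult_nonneg_nonpos)
    have "int N * ord_elem P t + int (nat (- (int N * ord_elem P t))) = 0" using le by linarith
    hence "\<exists>n. has_index (fpower P (int N * ord_elem P t)) P n"
      using fpower_index[OF PsP(1)[OF P], of "int N * ord_elem P t" "nat (- (int N * ord_elem P t))"]
        fpower_0[OF PsP(1)[OF P]] by auto
    then obtain R where R: "transversal (fpower P (int N * ord_elem P t)) P R" "finite R"
      unfolding has_index_def by blast
    hence "\<forall>x\<in>fpower P (int N * ord_elem P t). \<exists>y. y \<in> R \<and> x - y \<in> P" unfolding transversal_def by blast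
    from bchoice[OF this] show ?thesis using R(2) by blast
  qed
  hence "\<forall>P\<in>Ps. \<exists>Rf. finite (fst Rf) \<and> (\<forall>x\<in>fpower P (int N * ord_elem P t). snd Rf x \<in> fst Rf \<and> x - snd Rf x \<in> P)"
    by (metis fst_conv snd_conv)
  from bchoice[OF this] obtain Rf where Rf: "\<forall>P\<in>Ps. finite (fst (Rf P)) \<and>
      (\<forall>x\<in>fpower P (int N * ord_elem P t). snd (Rf P) x \<in> fst (Rf P) \<and> x - snd (Rf P) x \<in> P)" ..
  have bf: "b n \<in> fpower P (int N * ord_elem P t)" if P: "P \<in> Ps" for n P
  proof -
    have "ord_elem P t < 0" using PsP[OF P] place_iff_ord[of P t] by auto
    hence "int N * ord_elem P t \<le> 0" by (simp add: mult_nonneg_nonpos)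
    moreover have "w ^ n \<in> fpower P 0"
      using subring_power[OF place_ring wP] PsP(1)[OF P] P fpower_0 by auto
    ultimately have "w ^ n \<in> fpower P (int N * ord_elem P t)" using fpower_mono by blast
    from add_subgroup_diff[OF fpower_group[OF PsP(1)[OF P]] this b2[OF PsP[OF P], of n]] show ?thesis by simp
  qed
  \<comment> \<open>The principal parts of b_n along \<open>Ps\<close>, recorded by representatives
    modulo P.\<close>
  define \<Phi> where "\<Phi> n = (\<lambda>P\<in>Ps. snd (Rf P) (b n))" for n
  have "\<Phi> ` {N<..} \<subseteq> (\<Pi>\<^sub>E P\<in>Ps. fst (Rf P))" unfolding \<Phi>_def using Rf bf by auto
  moreover have "finite (\<Pi>\<^sub>E P\<in>Ps. fst (Rf P))" using fin Rf by (intro finite_PiE) auto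
  ultimately have "finite (\<Phi> ` {N<..})" by (rule finite_subset)
  hence "\<not> inj_on \<Phi> {N<..}" using finite_imageD infinite_Ioi by blast
  then obtain n m where nm: "n > N" "m > N" "n \<noteq> m" "\<Phi> n = \<Phi> m" unfolding inj_on_def by auto
  have main: "\<exists>T\<in>A. T \<notin> Fr" if nm: "n > N" "m > N" "n < m" "\<Phi> n = \<Phi> m" for n m
  proof -
    define T where "T = b m - b n"
    have "T \<in> A"
      unfolding A_iff
    proof (intro ballI impI)
      fix P assume P: "P \<in> places Fr" "P \<noteq> Oi"
      show "T \<in> P"
      proof (cases "t \<in> P")
        case True
        thus ?thesis unfolding T_def using b1[OF P(1)] subring_diff[OF place_ring[OF P(1)]] by blast
      next
        case False
        hence PP: "P \<in> Ps" using P unfolding Ps_def by blast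
        have "snd (Rf P) (b n) = snd (Rf P) (b m)"
          using fun_cong[OF nm(4), of P] PP unfolding \<Phi>_def by simp
        moreover have "b m - snd (Rf P) (b m) \<in> P" "b n - snd (Rf P) (b n) \<in> P" using Rf PP bf by auto
        ultimately have "(b m - snd (Rf P) (b m)) - (b n - snd (Rf P) (b m)) \<in> P"
          using subring_diff[OF place_ring[OF P(1)]] by metis
        thus ?thesis unfolding T_def by simp
      qed
    qed
    moreover have "T \<noteq> 0 \<and> ord_elem Oi T = ord_elem Oi (b m)"
    proof -
      have "int m * ord_elem Oi w + (int m - int n) \<le> int n * ord_elem Oi w"
        using w0(2) nm(3) mult_left_mono[of "ord_elem Oi w" "-1" "int m - int n"] by (simp add: algebra_simps)
      hence "ord_elem Oi (b m) + 1 \<le> ord_elem Oi (b n)" using bO nm by simp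
      hence "b n \<in> fpower Oi (ord_elem Oi (b m) + 1)" unfolding fpower_def by simp
      from add_subgroup_minus[OF fpower_group[OF place_Oi] this]
      show ?thesis using ord_add_eq[OF place_Oi, of "b m" "- b n"] bO[OF nm(2)] unfolding T_def by simp
    qed
    moreover have "ord_elem Oi (b m) < 0" using bO[OF nm(2)] w0(2) nm(2) by (simp add: mult_pos_neg)
    ultimately have "T \<notin> Oi" "T \<in> A" using place_iff_ord[OF place_Oi, of T] by auto
    thus ?thesis using place_Fr[OF place_Oi] by blast
  qed
  show ?thesis using main[of n m] main[of m n] nm by (cases "n < m") auto
qed

section \<open>Counting elements of bounded pole order at infinity\<close>

definition T :: 'k where "T = (SOME T. T \<in> A \<and> T \<notin> Fr)"

lemma T_A: "T \<in> A" and T_Fr: "T \<notin> Fr"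
  using someI_ex[of "\<lambda>T. T \<in> A \<and> T \<notin> Fr"] exists_nonconstant unfolding T_def by blast+

lemma T_Oi: "T \<notin> Oi"
  using A_Oi T_A T_Fr by blast

lemma poly_T: "p \<in> polys_over Fr \<Longrightarrow> poly p T \<in> A"
  using Fr_A by (intro poly_in_subring[OF A_ring _ T_A]) (auto simp: polys_over_def)

text \<open>\<open>T\<close> has its only pole at \<open>Oi\<close>, so the first summand in
  \<open>decompose\<close> lies in \<open>A\<close> and the second is bounded at
  \<open>Oi\<close>.\<close>

lemma A_decompose: "\<exists>N. \<forall>z. \<exists>a\<in>A. z - a \<in> fpower Oi (- int N)"
proof -
  obtain N where N: "\<forall>z. \<exists>b g. z = b + g \<and> (\<forall>P\<in>places Fr. T \<in> P \<longrightarrow> b \<in> P) \<and>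
           (\<forall>P\<in>places Fr. T \<notin> P \<longrightarrow> g / T ^ N \<in> P)" using decompose[OF T_Fr] by (elim exE)
  have T0: "T \<noteq> 0" "ord_elem Oi T < 0" using T_Oi place_iff_ord[OF place_Oi, of T] by auto
  have "\<exists>a\<in>A. z - a \<in> fpower Oi (- int (nat (- (int N * ord_elem Oi T))))" for z
  proof -
    from N[rule_format, of z] obtain b g where bg: "z = b + g" "\<forall>P\<in>places Fr. T \<in> P \<longrightarrow> b \<in> P"
      "\<forall>P\<in>places Fr. T \<notin> P \<longrightarrow> g / T ^ N \<in> P" by (elim exE conjE)
    have "b \<in> A" unfolding A_iff using bg(2) A_place[OF T_A] by blast
    moreover have "g / T ^ N \<in> Oi" using bg(3) place_Oi T_Oi by simp
    hence "g \<in> fpower Oi (int N * ord_elem Oi T)"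
      using fpower_iff_place[OF place_Oi, of "T ^ N"] T0 ord_power[OF place_Oi T0(1)] by simp
    moreover have "int N * ord_elem Oi T \<le> 0" using T0 by (simp add: mult_nonneg_nonpos)
    ultimately show ?thesis using bg(1) by (intro bexI[of _ b]) auto
  qed
  thus ?thesis by blast
qed

text \<open>A substitute for the genus: up to an error of pole order at most \<open>N0\<close>,
  every element of the field has the principal part at \<open>Oi\<close> of some element of
  \<open>A\<close>.\<close>

definition N0 :: nat where "N0 = (SOME N. \<forall>z. \<exists>a\<in>A. z - a \<in> fpower Oi (- int N))"

lemma N0: "\<exists>a\<in>A. z - a \<in> fpower Oi (- int N0)"
  using someI_ex[OF A_decompose] unfolding N0_def by blast

text \<open>The Riemann-Roch space of n times the point \<open>Oi\<close>.\<close>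

definition L :: "nat \<Rightarrow> 'k set" where "L n = A \<inter> fpower Oi (- int n)"

lemma L_group: "add_subgroup (L n)"
  unfolding L_def using subring_add_subgroup[OF A_ring] fpower_group[OF place_Oi, of "- int n"]
  unfolding add_subgroup_def by blast

lemma L_0: "L 0 = Fr"
  unfolding L_def using A_Oi Fr_A place_Fr[OF place_Oi] fpower_0[OF place_Oi] by auto

lemma L_mono: "m \<le> n \<Longrightarrow> L m \<subseteq> L n"
  unfolding L_def using fpower_mono[of "- int n" "- int m"] by auto

lemma L_mult: "x \<in> L m \<Longrightarrow> y \<in> L n \<Longrightarrow> x * y \<in> L (m + n)"
  unfolding L_def using subring_mult[OF A_ring] fpower_mult[OF place_Oi, of x "- int m" y "- int n"]
  by (simp add: algebra_simps)

lemma A_L: "x \<in> A \<Longrightarrow> \<exists>n. x \<in> L n"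
  unfolding L_def fpower_def by (intro exI[of _ "nat (- ord_elem Oi x)"]) auto

lemma L_Suc_diff: "x \<in> L (Suc n) \<Longrightarrow> y \<in> L (Suc n) \<Longrightarrow> x - y \<in> fpower Oi (- int n) \<longleftrightarrow> x - y \<in> L n"
  unfolding L_def using subring_diff[OF A_ring] by auto

lemma fpower_Suc_index: "has_index (fpower Oi (- int (Suc n))) (fpower Oi (- int n)) q"
  using fpower_index[OF place_Oi, of "- int (Suc n)" 1] by simp

text \<open>Raising the pole order by one adds at most one leading coefficient from the residue
  field; pole order 0 leaves the constants.\<close>

lemma L_finite_card: "finite (L n) \<and> card (L n) \<le> card Fr * q ^ n"
proof (induction n)
  case 0
  thus ?case using L_0 Fr_finite by simp
next
  case (Suc n)
  obtain R where R: "transversal (fpower Oi (- int (Suc n))) (fpower Oi (- int n)) R" "finite R" "card R = q"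
    using fpower_Suc_index unfolding has_index_def by blast
  hence "\<forall>x\<in>fpower Oi (- int (Suc n)). \<exists>y. y \<in> R \<and> x - y \<in> fpower Oi (- int n)" unfolding transversal_def by blast
  from bchoice[OF this] obtain f where f: "\<forall>x\<in>fpower Oi (- int (Suc n)). f x \<in> R \<and> x - f x \<in> fpower Oi (- int n)" ..
  have fR: "f ` L (Suc n) \<subseteq> R" using f unfolding L_def by blast
  have fd: "x - y \<in> L n" if "x \<in> L (Suc n)" "y \<in> L (Suc n)" "f x = f y" for x y
  proof -
    have "x - f x \<in> fpower Oi (- int n)" "y - f y \<in> fpower Oi (- int n)" using f that unfolding L_def by auto
    hence "x - y \<in> fpower Oi (- int n)" using that(3) fpower_group[OF place_Oi]
      by (metis add_subgroup_diff_swap add_subgroup_diff_trans)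
    thus ?thesis using L_Suc_diff that by blast
  qed
  obtain j where j: "has_index (L (Suc n)) (L n) j" using has_index_exists[OF L_group R(2) fR fd] by blast
  then obtain R' where R': "transversal (L (Suc n)) (L n) R'" "finite R'" "card R' = j" unfolding has_index_def by blast
  have "card R' \<le> card R" using has_index_le_card[OF L_group R'(1) R(2) fR fd] ..
  hence "j \<le> q" unfolding R(3) R'(3) .
  have "has_index (L (Suc n)) {0} (j * card (L n))"
    by (rule has_index_trans[OF L_group _ _ L_mono L_group j has_index_zero])
      (use Suc add_subgroup_zero[OF L_group] in \<open>auto simp: add_subgroup_def\<close>)
  from has_index_finite[OF this] have "finite (L (Suc n))" "card (L (Suc n)) = j * card (L n)" by auto
  moreover have "j * card (L n) \<le> q * (card Fr * q ^ n)" using \<open>j \<le> q\<close> Suc by (intro mult_mono) auto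
  ultimately show ?case by (simp add: ac_simps)
qed

lemma L_finite: "finite (L n)" and L_card_upper: "card (L n) \<le> card Fr * q ^ n"
  using L_finite_card by auto

lemma L_card_pos: "card (L n) > 0"
  using add_subgroup_zero[OF L_group] L_finite card_gt_0_iff by blast

text \<open>Beyond \<open>N0\<close> every leading coefficient is attained, so each step multiplies
  the size by exactly q. This exact growth is the form of Riemann's theorem on which the later
  counting rests.\<close>

lemma L_card_eq: "card (L (N0 + n)) = q ^ n * card (L N0)"
proof (induction n)
  case (Suc n)
  have "has_index (L (Suc (N0 + n))) (L (N0 + n)) q"
  proof (rule has_index_map_rev[OF L_group fpower_group[OF place_Oi], of _ "\<lambda>x. x"])
    fix x assume "x \<in> L (Suc (N0 + n))"
    thus "x \<in> fpower Oi (- int (Suc (N0 + n)))" unfolding L_def by blast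
  next
    fix z assume z: "z \<in> fpower Oi (- int (Suc (N0 + n)))"
    obtain a where a: "a \<in> A" "z - a \<in> fpower Oi (- int N0)" using N0 by blast
    have za: "z - a \<in> fpower Oi (- int (N0 + n))"
      using a(2) fpower_mono[of "- int (N0 + n)" "- int N0"] by auto
    hence "z - a \<in> fpower Oi (- int (Suc (N0 + n)))"
      using fpower_mono[of "- int (Suc (N0 + n))" "- int (N0 + n)"] by auto
    hence "a \<in> fpower Oi (- int (Suc (N0 + n)))"
      using add_subgroup_diff[OF fpower_group[OF place_Oi] z, of "z - a"] by simp
    thus "\<exists>x\<in>L (Suc (N0 + n)). z - x \<in> fpower Oi (- int (N0 + n))" using a za unfolding L_def by blast
  next
    show "has_index (fpower Oi (- int (Suc (N0 + n)))) (fpower Oi (- int (N0 + n))) q" by (rule fpower_Suc_index)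
  next
    fix x y assume "x \<in> L (Suc (N0 + n))" "y \<in> L (Suc (N0 + n))"
    thus "x - y \<in> fpower Oi (- int (N0 + n)) \<longleftrightarrow> x - y \<in> L (N0 + n)" by (rule L_Suc_diff)
  qed
  from has_index_card[OF L_finite L_group L_group L_mono this] Suc show ?case by simp
qed simp

lemma mult_A_group: "add_subgroup ((\<lambda>a. l * a) ` A)"
  unfolding add_subgroup_def
proof (intro conjI ballI)
  show "0 \<in> (\<lambda>a. l * a) ` A" using subring_zero[OF A_ring] by (intro image_eqI[of _ _ 0]) auto
  fix x y assume "x \<in> (\<lambda>a. l * a) ` A" "y \<in> (\<lambda>a. l * a) ` A"
  then obtain a b where "a \<in> A" "b \<in> A" "x = l * a" "y = l * b" by blast
  thus "x - y \<in> (\<lambda>a. l * a) ` A"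
    using subring_diff[OF A_ring] by (intro image_eqI[of _ _ "a - b"]) (auto simp: right_diff_distrib)
qed

text \<open>Let n be the pole order of l. By \<open>N0\<close>, A / lA is represented by
  \<open>L (N0 + n)\<close>, and on that set congruence modulo lA is congruence modulo l times
  \<open>L N0\<close>. Comparing cardinalities leaves q^n.\<close>

lemma index_principal:
  assumes l: "l \<in> A" "l \<noteq> 0"
  shows "has_index A ((\<lambda>a. l * a) ` A) (q ^ nat (- ord_elem Oi l))"
proof -
  define n where "n = nat (- ord_elem Oi l)"
  have n: "ord_elem Oi l = - int n" using A_ord[OF l] unfolding n_def by simp
  have ll: "l * x \<in> fpower Oi (- int (N0 + n)) \<longleftrightarrow> x \<in> fpower Oi (- int N0)" for x
    unfolding fpower_def using l n by (cases "x = 0") (auto simp: ord_mult[OF place_Oi])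
  define M where "M = (\<lambda>a. l * a) ` L N0"
  have M: "x \<in> M \<longleftrightarrow> x \<in> L (N0 + n) \<and> x \<in> (\<lambda>a. l * a) ` A" for x
    unfolding M_def L_def using ll subring_mult[OF A_ring l(1)] by auto
  have "M = L (N0 + n) \<inter> (\<lambda>a. l * a) ` A" using M by blast
  hence Mg: "add_subgroup M"
    using L_group[of "N0 + n"] mult_A_group[of l] unfolding add_subgroup_def by blast
  have inj: "inj_on (\<lambda>a. l * a) (L N0)" using l(2) by (auto simp: inj_on_def)
  obtain j where j: "has_index (L (N0 + n)) M j"
    using has_index_exists[OF Mg L_finite, of "\<lambda>x. x" "L (N0 + n)"] add_subgroup_zero[OF Mg] by auto
  have "card (L (N0 + n)) = j * card M"
    by (rule has_index_card[OF L_finite L_group Mg _ j]) (use M in blast)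
  moreover have "card M = card (L N0)" unfolding M_def by (rule card_image[OF inj])
  ultimately have "j = q ^ n" using L_card_eq[of n] L_card_pos[of N0] by auto
  have "has_index A ((\<lambda>a. l * a) ` A) j"
  proof (rule has_index_map[OF Mg mult_A_group _ _ _ j])
    fix x assume "x \<in> L (N0 + n)"
    thus "x \<in> A" unfolding L_def by blast
  next
    fix x y assume "x \<in> L (N0 + n)" "y \<in> L (N0 + n)"
    thus "(x - y \<in> (\<lambda>a. l * a) ` A) = (x - y \<in> M)" using M add_subgroup_diff[OF L_group] by blast
  next
    fix z assume z: "z \<in> A"
    obtain a where a: "a \<in> A" "z / l - a \<in> fpower Oi (- int N0)" using N0 by blast
    have "l * (z / l - a) \<in> fpower Oi (- int (N0 + n))" using ll a(2) by blast
    moreover have "l * (z / l - a) = z - l * a" using l(2) by (simp add: right_diff_distrib)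
    moreover have "z - l * a \<in> A" using subring_diff[OF A_ring z] subring_mult[OF A_ring l(1) a(1)] by blast
    ultimately have "z - l * a \<in> L (N0 + n)" unfolding L_def by auto
    moreover have "l * a \<in> (\<lambda>a. l * a) ` A" using a(1) by (rule imageI)
    hence "z - (z - l * a) \<in> (\<lambda>a. l * a) ` A" by simp
    ultimately show "\<exists>x\<in>L (N0 + n). z - x \<in> (\<lambda>a. l * a) ` A" by blast
  qed
  thus ?thesis using \<open>j = q ^ n\<close> n_def by simp
qed

section \<open>\<open>A\<close> and its localizations at the finite places\<close>

lemma fraction: "\<exists>c\<in>A. c \<noteq> 0 \<and> c * z \<in> A"
proof -
  from exists_integral_multiple[OF T_Fr, of z] obtain h where h: "h \<in> polys_over Fr" "h \<noteq> 0"
    "\<forall>P\<in>places Fr. T \<in> P \<longrightarrow> poly h T * z \<in> P" by (elim exE conjE)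
  have "poly h T * z \<in> A" unfolding A_iff using h(3) A_place[OF T_A] by blast
  thus ?thesis using poly_T[OF h(1)] transcendental_poly[OF T_Fr h(1,2)] by blast
qed

lemma A_max_ideal_nonzero:
  assumes P: "P \<in> places Fr" "P \<noteq> Oi"
  shows "\<exists>x\<in>A. x \<noteq> 0 \<and> x \<in> max_ideal P"
proof -
  obtain y where y: "y \<in> max_ideal P" "y \<noteq> 0" using max_ideal_nonzero[OF P(1)] by blast
  obtain c where c: "c \<in> A" "c \<noteq> 0" "c * inverse y \<in> A" using fraction by blast
  have "c * inverse y * y \<in> max_ideal P" using max_ideal_mult[OF P(1)] A_place[OF c(3) P] y by blast
  moreover have "c * inverse y * y = c" using y by simp
  ultimately show ?thesis using c by (intro bexI[of _ c]) auto
qed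

lemma bounded_poles: "\<exists>M. \<forall>Q\<in>places Fr. x \<in> fpower Q (- int M)"
proof (cases "x = 0")
  case False
  have fin: "finite {P \<in> places Fr. ord_elem P x \<noteq> 0}" by (rule finite_support[OF False])
  define M where "M = nat (\<Sum>P | P \<in> places Fr \<and> ord_elem P x \<noteq> 0. \<bar>ord_elem P x\<bar>)"
  have "- int M \<le> ord_elem Q x" if "Q \<in> places Fr" for Q
  proof (cases "ord_elem Q x = 0")
    case False
    hence "\<bar>ord_elem Q x\<bar> \<le> (\<Sum>P | P \<in> places Fr \<and> ord_elem P x \<noteq> 0. \<bar>ord_elem P x\<bar>)"
      using fin that by (intro member_le_sum) auto
    thus ?thesis unfolding M_def by linarith
  qed simp
  thus ?thesis unfolding fpower_def by blast
qed (simp add: fpower_def)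

text \<open>The residue field is finite, so two powers of x agree modulo P.\<close>

lemma unit_power_residue:
  assumes P: "P \<in> places Fr" and x: "x \<in> P" "x \<notin> max_ideal P"
  shows "\<exists>j. x ^ Suc j - 1 \<in> max_ideal P"
proof -
  note ring = place_ring[OF P] and grp = max_ideal_group[OF P]
  obtain n where n: "has_index P (max_ideal P) n" using residue_finite[OF P] by blast
  have "\<exists>a b. a < b \<and> x ^ b - x ^ a \<in> max_ideal P"
  proof (rule ccontr)
    assume no: "\<not> ?thesis"
    have inj: "inj (\<lambda>i. x ^ i)"
      using no add_subgroup_zero[OF grp] by (intro linorder_injI) (metis diff_self)
    have "infinite (range (\<lambda>i. x ^ i))" using inj by (simp add: finite_image_iff)
    then have "\<exists>u\<in>range (\<lambda>i. x ^ i). \<exists>w\<in>range (\<lambda>i. x ^ i). u \<noteq> w \<and> u - w \<in> max_ideal P"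
      using subring_power[OF ring x(1)] by (intro has_index_pigeonhole[OF grp n]) auto
    then obtain a b where ab: "x ^ a \<noteq> x ^ b" "x ^ a - x ^ b \<in> max_ideal P" by blast
    thus False using no add_subgroup_diff_swap[OF grp ab(2)] by (metis linorder_neqE_nat)
  qed
  then obtain a b where ab: "a < b" "x ^ b - x ^ a \<in> max_ideal P" by blast
  have x0: "x \<noteq> 0" using x add_subgroup_zero[OF grp] by auto
  have "inverse x ^ a \<in> P" using unit_inverse[OF P x(2)] subring_power[OF ring] by blast
  hence "inverse x ^ a * (x ^ b - x ^ a) \<in> max_ideal P" using max_ideal_mult[OF P] ab(2) by blast
  moreover have "inverse x ^ a * (x ^ b - x ^ a) = x ^ Suc (b - a - 1) - 1"
  proof -
    have "x ^ b = x ^ a * x ^ Suc (b - a - 1)" using ab(1) by (simp flip: power_add power_Suc)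
    thus ?thesis using x0 by (simp add: power_inverse field_simps)
  qed
  ultimately show ?thesis by (intro exI[of _ "b - a - 1"]) simp
qed

text \<open>The multiplier must clear the poles of z and remain a unit at P. At a place where f is a
  unit, a factor f^(j+1) - 1 vanishes but is -1 at P. At the zeros \<open>Z\<close> of f no such
  factor is available, so there u, supplied by weak approximation, clears the poles; the remaining
  poles of u and z lie in \<open>Y\<close> and are left to the factors h.\<close>

lemma localize:
  assumes P: "P \<in> places Fr" "P \<noteq> Oi" and z: "z \<in> P"
  shows "\<exists>s\<in>A. s \<notin> max_ideal P \<and> s * z \<in> A"
proof -
  obtain f where f: "f \<in> A" "f \<noteq> 0" "f \<in> max_ideal P" using A_max_ideal_nonzero[OF P] by blast
  define Z where "Z = {Q \<in> places Fr. f \<in> max_ideal Q} - {Oi, P}"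
  have Z: "finite Z" "Z \<subseteq> places Fr" "P \<notin> Z" unfolding Z_def using finite_zeros[OF f(2)] by auto
  obtain m where m: "\<forall>Q\<in>places Fr. z \<in> fpower Q (- int m)" using bounded_poles by blast
  obtain u where u: "u \<noteq> 0" "u - 1 \<in> fpower P (int (m + 1))" "\<forall>Q\<in>Z. u \<in> fpower Q (int (m + 1))"
    using approximate_one[OF P(1) Z] by blast
  obtain m' where m': "\<forall>Q\<in>places Fr. u \<in> fpower Q (- int m')" using bounded_poles by blast
  define M where "M = m + m'"
  define Y where "Y = ({Q \<in> places Fr. ord_elem Q u \<noteq> 0} \<union> {Q \<in> places Fr. z \<notin> Q}) - Z - {Oi, P}"
  have sub: "{Q \<in> places Fr. z \<notin> Q} \<subseteq> {Q \<in> places Fr. inverse z \<in> max_ideal Q}"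
    using max_ideal_iff[of _ "inverse z"] by auto
  hence "finite {Q \<in> places Fr. z \<notin> Q}"
  proof (cases "z = 0")
    case True
    hence "{Q \<in> places Fr. z \<notin> Q} = {}" using subring_zero[OF place_ring] by blast
    thus ?thesis by (simp only: finite.emptyI)
  next
    case False
    thus ?thesis using finite_subset[OF sub finite_zeros] by simp
  qed
  hence Yfin: "finite Y" unfolding Y_def using finite_support[OF u(1)] by auto
  have "\<exists>h. h \<in> A \<and> h \<in> max_ideal Q \<and> h \<notin> max_ideal P" if Q: "Q \<in> Y" for Q
  proof -
    have QQ: "Q \<in> places Fr" "Q \<noteq> Oi" "f \<notin> max_ideal Q" using Q unfolding Y_def Z_def by auto
    obtain j where j: "f ^ Suc j - 1 \<in> max_ideal Q"
      using unit_power_residue[OF QQ(1) A_place[OF f(1) QQ(1,2)] QQ(3)] by blast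
    have "f ^ j * f \<in> max_ideal P"
      by (rule max_ideal_mult[OF P(1) subring_power[OF place_ring[OF P(1)]] f(3)]) (rule A_place[OF f(1) P])
    hence "f ^ Suc j \<in> max_ideal P" by (simp add: mult.commute)
    hence "f ^ Suc j - 1 \<notin> max_ideal P"
      using one_notin_max_ideal[OF P(1)] add_subgroup_diff[OF max_ideal_group[OF P(1)], of "f ^ Suc j" "f ^ Suc j - 1"]
      by auto
    moreover have "f ^ Suc j - 1 \<in> A"
      by (rule subring_diff[OF A_ring subring_power[OF A_ring f(1)] subring_one[OF A_ring]])
    ultimately show ?thesis using j by blast
  qed
  hence "\<forall>Q\<in>Y. \<exists>h. h \<in> A \<and> h \<in> max_ideal Q \<and> h \<notin> max_ideal P" by blast
  from bchoice[OF this] obtain h where h: "\<forall>Q\<in>Y. h Q \<in> A \<and> h Q \<in> max_ideal Q \<and> h Q \<notin> max_ideal P" ..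
  define s' where "s' = (\<Prod>Q\<in>Y. h Q ^ M)"
  have hA: "h Q ^ M \<in> A" if "Q \<in> Y" for Q using h that subring_power[OF A_ring] by blast
  have s'A: "s' \<in> A" unfolding s'_def using hA by (rule subring_prod[OF A_ring])
  have s'P: "s' \<notin> max_ideal P"
  proof -
    have "place_unit P (\<Prod>Q\<in>X. h Q ^ M)" if "finite X" "X \<subseteq> Y" for X
      using that
    proof (induction X rule: finite_induct)
      case (insert Q X)
      have "place_unit P (h Q)" using h insert.prems A_place[OF _ P] by blast
      thus ?case using insert place_unit_power[OF P(1)] place_unit_mult[OF P(1)] by simp
    qed (use place_unit_one[OF P(1)] in simp)
    thus ?thesis unfolding s'_def using Yfin by blast
  qed
  have s'Y: "s' \<in> fpower Q (int M)" if Q: "Q \<in> Y" for Q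
  proof -
    have QQ: "Q \<in> places Fr" "Q \<noteq> Oi" using Q unfolding Y_def by auto
    have hp: "h Q ^ i \<in> fpower Q (int i)" for i
    proof (induction i)
      case (Suc i)
      have "h Q \<in> fpower Q 1" using h Q fpower_1[OF QQ(1)] by simp
      from fpower_mult[OF QQ(1) this Suc] show ?case by simp
    qed (simp add: fpower_def ord_one[OF QQ(1)])
    have "(\<Prod>Q\<in>Y - {Q}. h Q ^ M) \<in> A" using hA by (intro subring_prod[OF A_ring]) auto
    hence "(\<Prod>Q\<in>Y - {Q}. h Q ^ M) \<in> fpower Q 0" using A_place QQ fpower_0[OF QQ(1)] by auto
    from fpower_mult[OF QQ(1) hp this] show ?thesis
      unfolding s'_def using Q Yfin by (simp add: prod.remove[of Y Q])
  qed
  have uP: "u \<in> P" "u \<notin> max_ideal P" using near_one_unit[OF P(1) u(2)] by simp_all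
  have in_A: "s' * y \<in> A"
    if y: "y \<in> P" "\<And>Q. Q \<in> Z \<Longrightarrow> y \<in> Q" "\<And>Q. Q \<in> places Fr \<Longrightarrow> y \<in> fpower Q (- int M)"
      "\<And>Q. Q \<in> places Fr \<Longrightarrow> Q \<notin> Y \<Longrightarrow> Q \<notin> Z \<Longrightarrow> Q \<noteq> P \<Longrightarrow> Q \<noteq> Oi \<Longrightarrow> y \<in> Q" for y
    unfolding A_iff
  proof (intro ballI impI)
    fix Q assume Q: "Q \<in> places Fr" "Q \<noteq> Oi"
    show "s' * y \<in> Q"
    proof (cases "Q \<in> Y")
      case True
      have "s' * y \<in> fpower Q (int M + - int M)" by (rule fpower_mult[OF Q(1) s'Y[OF True] y(3)[OF Q(1)]])
      thus ?thesis using fpower_0[OF Q(1)] by simp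
    next
      case False
      hence "y \<in> Q" using y Q by blast
      thus ?thesis using A_place[OF s'A Q] subring_mult[OF place_ring[OF Q(1)]] by blast
    qed
  qed
  have "s' * u \<in> A"
  proof (rule in_A)
    fix Q assume "Q \<in> Z"
    hence "Q \<in> places Fr" "u \<in> fpower Q (int (m + 1))" using Z u(3) by auto
    thus "u \<in> Q" using fpower_mono[of 0 "int (m + 1)" Q] fpower_0 by auto
  next
    fix Q assume Q: "Q \<in> places Fr"
    show "u \<in> fpower Q (- int M)" using m' Q fpower_mono[of "- int M" "- int m'" Q] unfolding M_def by auto
    assume "Q \<notin> Y" "Q \<notin> Z" "Q \<noteq> P" "Q \<noteq> Oi"
    hence "ord_elem Q u = 0" using Q unfolding Y_def by blast
    thus "u \<in> Q" using place_iff_ord[OF Q] by simp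
  qed (use uP in simp)
  moreover have "s' * (u * z) \<in> A"
  proof (rule in_A)
    show "u * z \<in> P" using uP z subring_mult[OF place_ring[OF P(1)]] by blast
  next
    fix Q assume "Q \<in> Z"
    hence Q: "Q \<in> places Fr" "u \<in> fpower Q (int (m + 1))" using Z u(3) by auto
    have "u * z \<in> fpower Q (int (m + 1) + - int m)" using m Q by (intro fpower_mult) auto
    thus "u * z \<in> Q" using fpower_mono[of 0 1 Q] fpower_0[OF Q(1)] by auto
  next
    fix Q assume Q: "Q \<in> places Fr"
    have "u * z \<in> fpower Q (- int m' + - int m)" using m m' Q by (intro fpower_mult) auto
    thus "u * z \<in> fpower Q (- int M)" unfolding M_def by (simp add: algebra_simps)
    assume "Q \<notin> Y" "Q \<notin> Z" "Q \<noteq> P" "Q \<noteq> Oi"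
    hence "ord_elem Q u = 0" "z \<in> Q" using Q unfolding Y_def by blast+
    thus "u * z \<in> Q" using place_iff_ord[OF Q] subring_mult[OF place_ring[OF Q]] by simp
  qed
  moreover have "s' * u \<notin> max_ideal P"
    using place_unit_mult[OF P(1)] uP s'P A_place[OF s'A P] by blast
  ultimately show ?thesis by (intro bexI[of _ "s' * u"]) (auto simp: mult.assoc)
qed

text \<open>If s z is in \<open>A\<close> and s^(j+1) is 1 modulo P, then s^j * (s z) lies in
  \<open>A\<close> and has the residue of z.\<close>

lemma A_residue_surj:
  assumes P: "P \<in> places Fr" "P \<noteq> Oi" and z: "z \<in> P"
  shows "\<exists>a\<in>A. z - a \<in> max_ideal P"
proof -
  obtain s where s: "s \<in> A" "s \<notin> max_ideal P" "s * z \<in> A" using localize[OF assms] by blast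
  obtain j where j: "s ^ Suc j - 1 \<in> max_ideal P" using unit_power_residue[OF P(1) A_place[OF s(1) P] s(2)] by blast
  have "s ^ j * (s * z) \<in> A" using s subring_mult[OF A_ring] subring_power[OF A_ring] by blast
  moreover have "z * (s ^ Suc j - 1) \<in> max_ideal P" using max_ideal_mult[OF P(1) z j] .
  hence "- (z * (s ^ Suc j - 1)) \<in> max_ideal P" by (rule add_subgroup_minus[OF max_ideal_group[OF P(1)]])
  hence "z - s ^ j * (s * z) \<in> max_ideal P" by (simp add: algebra_simps)
  ultimately show ?thesis by blast
qed

definition A_submodule :: "'k set \<Rightarrow> bool" where
  "A_submodule I \<longleftrightarrow> add_subgroup I \<and> (\<forall>a\<in>A. \<forall>x\<in>I. a * x \<in> I)"

text \<open>Fix a nonzero l in J. For each zero of l take an element of J outside that zero and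
  inside all the others; their sum w lies in J and is a unit at every zero of l. Multiplication by w
  is injective on the finite ring A / lA, hence onto, and so 1 lies in wA + lA.\<close>

lemma comaximal:
  assumes J: "A_submodule J" "J \<subseteq> A" "J \<noteq> {0}"
    and nm: "\<And>P. P \<in> places Fr \<Longrightarrow> P \<noteq> Oi \<Longrightarrow> \<exists>s\<in>J. s \<notin> max_ideal P"
  shows "1 \<in> J"
proof -
  have Jg: "add_subgroup J" and Jm: "\<And>a x. a \<in> A \<Longrightarrow> x \<in> J \<Longrightarrow> a * x \<in> J"
    using J(1) unfolding A_submodule_def by auto
  obtain l where l: "l \<in> J" "l \<noteq> 0" using J(3) add_subgroup_zero[OF Jg] by blast
  have lA: "l \<in> A" using l J by blast
  define Z where "Z = {P \<in> places Fr. l \<in> max_ideal P} - {Oi}"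
  have Zfin: "finite Z" and ZP: "\<And>P. P \<in> Z \<Longrightarrow> P \<in> places Fr \<and> P \<noteq> Oi"
    unfolding Z_def using finite_zeros[OF l(2)] by auto
  have "\<exists>x. x \<in> J \<and> x \<notin> max_ideal P \<and> (\<forall>Q\<in>Z. Q \<noteq> P \<longrightarrow> x \<in> max_ideal Q)" if PZ: "P \<in> Z" for P
  proof -
    have P: "P \<in> places Fr" "P \<noteq> Oi" using ZP PZ by auto
    obtain s where s: "s \<in> J" "s \<notin> max_ideal P" using nm[OF P] by blast
    obtain u where u: "u - 1 \<in> fpower P (int 1)" "\<forall>Q\<in>Z - {P}. u \<in> fpower Q (int 1)"
      using approximate_one[OF P(1), of "Z - {P}" 1] Zfin ZP by blast
    have uP: "u \<in> P" "u \<notin> max_ideal P" using near_one_unit[OF P(1) u(1)] by simp_all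
    obtain a where a: "a \<in> A" "a \<notin> max_ideal P" "a * u \<in> A" using localize[OF P uP(1)] by blast
    have "a * u * s \<in> J" using Jm a s by blast
    moreover have "a * u * s \<notin> max_ideal P"
      using place_unit_mult[OF P(1)] a uP s A_place[OF _ P] J(2) by blast
    moreover have "a * u * s \<in> max_ideal Q" if Q: "Q \<in> Z" "Q \<noteq> P" for Q
    proof -
      have QQ: "Q \<in> places Fr" "Q \<noteq> Oi" using ZP Q by auto
      have um: "u \<in> max_ideal Q" using u(2) Q fpower_1[OF QQ(1)] by auto
      have "a * s \<in> A" using a s J(2) subring_mult[OF A_ring] by blast
      from max_ideal_mult[OF QQ(1) A_place[OF this QQ] um] show ?thesis by (simp add: ac_simps)
    qed
    ultimately show ?thesis by blast
  qed
  hence "\<forall>P\<in>Z. \<exists>x. x \<in> J \<and> x \<notin> max_ideal P \<and> (\<forall>Q\<in>Z. Q \<noteq> P \<longrightarrow> x \<in> max_ideal Q)" by blast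
  from bchoice[OF this] obtain x where
    x: "\<forall>P\<in>Z. x P \<in> J \<and> x P \<notin> max_ideal P \<and> (\<forall>Q\<in>Z. Q \<noteq> P \<longrightarrow> x P \<in> max_ideal Q)" ..
  define w where "w = (\<Sum>P\<in>Z. x P)"
  have wJ: "w \<in> J" unfolding w_def using x by (intro add_subgroup_sum[OF Jg]) auto
  have wP: "w \<notin> max_ideal P" if P: "P \<in> Z" for P
  proof
    assume "w \<in> max_ideal P"
    moreover have "(\<Sum>Q\<in>Z - {P}. x Q) \<in> max_ideal P"
      using x P ZP by (intro add_subgroup_sum[OF max_ideal_group]) auto
    moreover have "w = x P + (\<Sum>Q\<in>Z - {P}. x Q)" unfolding w_def using P Zfin by (simp add: sum.remove)
    ultimately have "x P \<in> max_ideal P"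
      using add_subgroup_diff[OF max_ideal_group[of P], of w "\<Sum>Q\<in>Z - {P}. x Q"] ZP[OF P] by simp
    thus False using x P by blast
  qed
  let ?lA = "(\<lambda>a. l * a) ` A"
  \<comment> \<open>At a zero of l the factor w is a unit, and elsewhere l itself is, so a / l is
    regular at every finite place.\<close>
  have inj: "a \<in> ?lA" if a: "a \<in> A" "w * a \<in> ?lA" for a
  proof -
    obtain c where c: "c \<in> A" "w * a = l * c" using a(2) by blast
    have "a / l \<in> P" if P: "P \<in> places Fr" "P \<noteq> Oi" for P
    proof (cases "P \<in> Z")
      case True
      have "inverse w \<in> P" using unit_inverse[OF P(1) wP[OF True]] .
      hence "inverse w * c \<in> P" using A_place[OF c(1) P] subring_mult[OF place_ring[OF P(1)]] by blast
      moreover have "w \<noteq> 0" using wP[OF True] add_subgroup_zero[OF max_ideal_group[OF P(1)]] by auto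
      hence "inverse w * c = a / l" using c(2) l(2) by (simp add: field_simps)
      ultimately show ?thesis by simp
    next
      case False
      hence "l \<notin> max_ideal P" using P unfolding Z_def by blast
      hence "inverse l \<in> P" by (rule unit_inverse[OF P(1)])
      hence "a * inverse l \<in> P" using A_place[OF a(1) P] subring_mult[OF place_ring[OF P(1)]] by blast
      thus ?thesis by (simp add: divide_inverse)
    qed
    hence "a / l \<in> A" unfolding A_iff by blast
    thus ?thesis using l(2) by (intro image_eqI[of _ _ "a / l"]) auto
  qed
  have lAg: "add_subgroup ?lA" by (rule mult_A_group)
  obtain R where R: "transversal A ?lA R" "finite R"
    using index_principal[OF lA l(2)] unfolding has_index_def by blast
  have RA: "R \<subseteq> A" using R(1) unfolding transversal_def by blast
  have wA: "w \<in> A" using wJ J(2) by blast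
  have "\<forall>r\<in>R. \<exists>r'. r' \<in> R \<and> w * r - r' \<in> ?lA"
    using R(1) RA subring_mult[OF A_ring wA] unfolding transversal_def by blast
  from bchoice[OF this] obtain g where g: "\<forall>r\<in>R. g r \<in> R \<and> w * r - g r \<in> ?lA" ..
  have "inj_on g R"
  proof (rule inj_onI)
    fix r r' assume r: "r \<in> R" "r' \<in> R" "g r = g r'"
    have "w * r - g r \<in> ?lA" using g r(1) by blast
    moreover have "w * r' - g r \<in> ?lA" using g r(2) unfolding r(3) by blast
    ultimately have "w * r - g r \<in> ?lA" "w * r' - g r \<in> ?lA" .
    hence "w * r - w * r' \<in> ?lA" using add_subgroup_diff[OF lAg, of "w * r - g r" "w * r' - g r"] by simp
    hence "r - r' \<in> ?lA" using inj[of "r - r'"] r RA subring_diff[OF A_ring] by (simp add: right_diff_distrib subset_iff)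
    thus "r = r'" using r R(1) unfolding transversal_def by blast
  qed
  hence gR: "g ` R = R" using endo_inj_surj[OF R(2)] g by blast
  obtain r1 where r1: "r1 \<in> R" "1 - r1 \<in> ?lA" using R(1) subring_one[OF A_ring] unfolding transversal_def by blast
  have "r1 \<in> g ` R" unfolding gR by (rule r1(1))
  then obtain r where r: "r \<in> R" "g r = r1" by (elim imageE) simp
  have lJ: "?lA \<subseteq> J" using Jm l by (auto simp: mult.commute)
  have "w * r - r1 \<in> J" "1 - r1 \<in> J" using g r r1 lJ by auto
  moreover have "r * w \<in> J" using Jm wJ r RA by blast
  ultimately have "(1 - r1) - (w * r - r1) + r * w \<in> J"
    using add_subgroup_diff[OF Jg] add_subgroup_add[OF Jg] by blast
  thus ?thesis by (simp add: mult.commute)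
qed

text \<open>The elements of \<open>A\<close> that multiply x into I form an ideal. The local
  hypotheses and \<open>localize\<close> put it outside every maximal ideal, so it contains
  1.\<close>

lemma submodule_local:
  assumes I: "A_submodule I" "I \<noteq> {0}"
    and x: "\<And>P. P \<in> places Fr \<Longrightarrow> P \<noteq> Oi \<Longrightarrow> \<exists>y\<in>I. y \<noteq> 0 \<and> x / y \<in> P"
  shows "x \<in> I"
proof -
  have Ig: "add_subgroup I" and Im: "\<And>a x. a \<in> A \<Longrightarrow> x \<in> I \<Longrightarrow> a * x \<in> I"
    using I(1) unfolding A_submodule_def by auto
  define J where "J = {a \<in> A. a * x \<in> I}"
  have "A_submodule J"
    unfolding A_submodule_def add_subgroup_def J_def
    using subring_zero[OF A_ring] add_subgroup_zero[OF Ig] subring_diff[OF A_ring] add_subgroup_diff[OF Ig]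
      subring_mult[OF A_ring] Im by (auto simp: left_diff_distrib mult.assoc)
  moreover have "J \<subseteq> A" unfolding J_def by blast
  moreover have "J \<noteq> {0}"
  proof -
    obtain y where y: "y \<in> I" "y \<noteq> 0" using I(2) add_subgroup_zero[OF Ig] by blast
    obtain c where c: "c \<in> A" "c \<noteq> 0" "c * (x / y) \<in> A" using fraction by blast
    have "c * (x / y) * y \<in> I" using Im c y by blast
    hence "c \<in> J" unfolding J_def using c y by simp
    thus ?thesis using c by blast
  qed
  moreover have "\<exists>s\<in>J. s \<notin> max_ideal P" if P: "P \<in> places Fr" "P \<noteq> Oi" for P
  proof -
    obtain y where y: "y \<in> I" "y \<noteq> 0" "x / y \<in> P" using x[OF P] by blast
    obtain s where s: "s \<in> A" "s \<notin> max_ideal P" "s * (x / y) \<in> A" using localize[OF P y(3)] by blast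
    have "s * (x / y) * y \<in> I" using Im s y by blast
    hence "s \<in> J" unfolding J_def using s y by simp
    thus ?thesis using s by blast
  qed
  ultimately have "1 \<in> J" by (rule comaximal)
  thus ?thesis unfolding J_def by simp
qed

end

section \<open>Ideals and their degrees\<close>

lemma sum_lessThan_add: "(\<Sum>i<n + (m::nat). h i) = (\<Sum>i<n. h i) + (\<Sum>i<m. h (n + i) :: 'a::comm_monoid_add)"
  by (induction m) (auto simp: add.assoc)

lemma int_set_has_least:
  fixes X :: "int set"
  assumes "X \<noteq> {}" "\<And>x. x \<in> X \<Longrightarrow> b \<le> x"
  shows "\<exists>x\<in>X. \<forall>y\<in>X. x \<le> y"
proof -
  obtain x0 where x0: "x0 \<in> X" using assms(1) by blast
  define k where "k = (LEAST k. b + int k \<in> X)"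
  have "b + int (nat (x0 - b)) \<in> X" using x0 assms(2)[OF x0] by simp
  hence k: "b + int k \<in> X" unfolding k_def by (rule LeastI)
  have "b + int k \<le> y" if y: "y \<in> X" for y
  proof -
    have "b + int (nat (y - b)) \<in> X" using y assms(2)[OF y] by simp
    hence "k \<le> nat (y - b)" unfolding k_def by (rule Least_le)
    thus ?thesis using assms(2)[OF y] by linarith
  qed
  thus ?thesis using k by blast
qed

abbreviation scale :: "'a::field \<Rightarrow> 'a set \<Rightarrow> 'a set" where
  "scale l I \<equiv> (\<lambda>x. l * x) ` I"

lemma scale_scale: "scale a (scale b I) = scale (a * b) I"
  by (auto simp: image_image mult.assoc)

lemma mem_scale_iff: "l \<noteq> 0 \<Longrightarrow> x \<in> scale l I \<longleftrightarrow> x / l \<in> I"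
  by (force simp: image_iff)

context affine_curve
begin

abbreviation ideals :: "'k set set" where "ideals \<equiv> fractional_ideals A"

abbreviation finite_place :: "'k set \<Rightarrow> bool" where
  "finite_place P \<equiv> P \<in> places Fr \<and> P \<noteq> Oi"

lemma ideal_mult_closed: "I \<in> ideals \<Longrightarrow> a \<in> A \<Longrightarrow> x \<in> I \<Longrightarrow> a * x \<in> I"
  unfolding fractional_ideals_def by blast

lemma ideal_group:
  assumes I: "I \<in> ideals"
  shows "add_subgroup I"
  unfolding add_subgroup_def
proof (intro conjI ballI)
  show "0 \<in> I" using I unfolding fractional_ideals_def by blast
  fix x y assume xy: "x \<in> I" "y \<in> I"
  have "(- 1) * y \<in> I"
    using ideal_mult_closed[OF I _ xy(2)] subring_minus[OF A_ring subring_one[OF A_ring]] by blast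
  hence "x + (- 1) * y \<in> I" using I xy(1) unfolding fractional_ideals_def by blast
  thus "x - y \<in> I" by simp
qed

lemma ideal_submodule: "I \<in> ideals \<Longrightarrow> A_submodule I"
  unfolding A_submodule_def using ideal_group ideal_mult_closed by blast

lemma ideal_nonzero: "I \<in> ideals \<Longrightarrow> \<exists>x\<in>I. x \<noteq> 0"
  unfolding fractional_ideals_def by blast

lemma ideal_neq_zero: "I \<in> ideals \<Longrightarrow> I \<noteq> {0}"
  unfolding fractional_ideals_def by blast

lemma ideal_denominator: "I \<in> ideals \<Longrightarrow> \<exists>d\<in>A. d \<noteq> 0 \<and> (\<forall>x\<in>I. d * x \<in> A)"
  unfolding fractional_ideals_def by blast

lemma ideal_ord_lower:
  assumes P: "finite_place P" and d: "d \<noteq> 0" "\<forall>x\<in>I. d * x \<in> A" and x: "x \<in> I" "x \<noteq> 0"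
  shows "- ord_elem P d \<le> ord_elem P x"
  using A_place[of "d * x" P] d x P place_iff_ord[of P "d * x"] ord_mult[of P d x] by auto

lemma ord_ideal_least:
  assumes I: "I \<in> ideals" and P: "finite_place P"
  shows "(\<exists>x\<in>I. x \<noteq> 0 \<and> ord_elem P x = ord_ideal P I) \<and>
    (\<forall>x\<in>I. x \<noteq> 0 \<longrightarrow> ord_ideal P I \<le> ord_elem P x)"
proof -
  obtain d where d: "d \<noteq> 0" "\<forall>x\<in>I. d * x \<in> A" using ideal_denominator[OF I] by blast
  have "ord_elem P ` (I - {0}) \<noteq> {}" using ideal_nonzero[OF I] by blast
  moreover have "- ord_elem P d \<le> n" if "n \<in> ord_elem P ` (I - {0})" for n
    using that ideal_ord_lower[OF P d] by auto
  ultimately obtain n where n: "n \<in> ord_elem P ` (I - {0})" "\<forall>y\<in>ord_elem P ` (I - {0}). n \<le> y"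
    using int_set_has_least by meson
  have "ord_ideal P I = n" unfolding ord_ideal_def using n by (intro cInf_eq_minimum) auto
  thus ?thesis using n by auto
qed

lemma ord_ideal_attained: "I \<in> ideals \<Longrightarrow> finite_place P \<Longrightarrow> \<exists>x\<in>I. x \<noteq> 0 \<and> ord_elem P x = ord_ideal P I"
  by (rule ord_ideal_least[THEN conjunct1])

lemma ord_ideal_le: "I \<in> ideals \<Longrightarrow> finite_place P \<Longrightarrow> x \<in> I \<Longrightarrow> x \<noteq> 0 \<Longrightarrow> ord_ideal P I \<le> ord_elem P x"
  by (rule ord_ideal_least[THEN conjunct2, rule_format])

lemma ord_ideal_eqI:
  assumes "I \<in> ideals" "finite_place P" "x \<in> I" "x \<noteq> 0" "ord_elem P x = n"
    and "\<And>y. y \<in> I \<Longrightarrow> y \<noteq> 0 \<Longrightarrow> n \<le> ord_elem P y"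
  shows "ord_ideal P I = n"
  using ord_ideal_attained[OF assms(1,2)] ord_ideal_le[OF assms(1-4)] assms(5,6) by force

text \<open>Local membership is membership, by \<open>submodule_local\<close>. Together with
  additivity of orders this serves as unique factorization: an ideal is determined by its
  orders.\<close>

lemma mem_ideal_iff:
  assumes I: "I \<in> ideals"
  shows "x \<in> I \<longleftrightarrow> (\<forall>P. finite_place P \<longrightarrow> x \<in> fpower P (ord_ideal P I))"
proof
  assume "x \<in> I"
  thus "\<forall>P. finite_place P \<longrightarrow> x \<in> fpower P (ord_ideal P I)"
    unfolding fpower_def using ord_ideal_le[OF I] by auto
next
  assume r: "\<forall>P. finite_place P \<longrightarrow> x \<in> fpower P (ord_ideal P I)"
  show "x \<in> I"
  proof (rule submodule_local[OF ideal_submodule[OF I] ideal_neq_zero[OF I]])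
    fix P assume P: "P \<in> places Fr" "P \<noteq> Oi"
    obtain y where y: "y \<in> I" "y \<noteq> 0" "ord_elem P y = ord_ideal P I"
      using ord_ideal_attained[OF I conjI[OF P]] by blast
    have "x / y \<in> P" using r P fpower_iff_place[OF P(1) y(2,3)] by blast
    thus "\<exists>y\<in>I. y \<noteq> 0 \<and> x / y \<in> P" using y by blast
  qed
qed

lemma ideal_eqI:
  assumes "I \<in> ideals" "J \<in> ideals" "\<And>P. finite_place P \<Longrightarrow> ord_ideal P I = ord_ideal P J"
  shows "I = J"
  using mem_ideal_iff[OF assms(1)] mem_ideal_iff[OF assms(2)] assms(3) by auto

lemma ideal_support_finite:
  assumes I: "I \<in> ideals"
  shows "finite {P \<in> places Fr - {Oi}. ord_ideal P I \<noteq> 0}"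
proof -
  obtain d where d: "d \<noteq> 0" "\<forall>x\<in>I. d * x \<in> A" using ideal_denominator[OF I] by blast
  obtain x where x: "x \<in> I" "x \<noteq> 0" using ideal_nonzero[OF I] by blast
  have "{P \<in> places Fr - {Oi}. ord_ideal P I \<noteq> 0} \<subseteq>
      {P \<in> places Fr. ord_elem P d \<noteq> 0} \<union> {P \<in> places Fr. ord_elem P x \<noteq> 0}"
  proof
    fix P assume P: "P \<in> {P \<in> places Fr - {Oi}. ord_ideal P I \<noteq> 0}"
    hence fP: "finite_place P" by blast
    obtain y where y: "y \<in> I" "y \<noteq> 0" "ord_elem P y = ord_ideal P I" using ord_ideal_attained[OF I fP] by blast
    have "- ord_elem P d \<le> ord_ideal P I" using ideal_ord_lower[OF fP d y(1,2)] y(3) by simp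
    moreover have "ord_ideal P I \<le> ord_elem P x" by (rule ord_ideal_le[OF I fP x])
    ultimately show "P \<in> {P \<in> places Fr. ord_elem P d \<noteq> 0} \<union> {P \<in> places Fr. ord_elem P x \<noteq> 0}"
      using P by auto
  qed
  thus ?thesis using finite_support[OF d(1)] finite_support[OF x(2)] by (meson finite_Un finite_subset)
qed

section \<open>Degrees, products and indices of ideals\<close>

abbreviation deg :: "'k set \<Rightarrow> int" where "deg I \<equiv> ideal_degree Fr Oi I"

lemma deg_eq_sum:
  assumes "finite S" "S \<subseteq> places Fr - {Oi}" "\<And>P. finite_place P \<Longrightarrow> ord_ideal P I \<noteq> 0 \<Longrightarrow> P \<in> S"
  shows "deg I = (\<Sum>P\<in>S. ord_ideal P I * int (place_degree Fr P))"
  unfolding ideal_degree_def by (rule sum.mono_neutral_left) (use assms in auto)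

lemma deg_add:
  assumes I: "I \<in> ideals" and J: "J \<in> ideals"
    and K: "\<And>P. finite_place P \<Longrightarrow> ord_ideal P K = ord_ideal P I + ord_ideal P J"
  shows "deg K = deg I + deg J"
proof -
  define S where "S = {P \<in> places Fr - {Oi}. ord_ideal P I \<noteq> 0} \<union> {P \<in> places Fr - {Oi}. ord_ideal P J \<noteq> 0}"
  have S: "finite S" "S \<subseteq> places Fr - {Oi}"
    unfolding S_def using ideal_support_finite[OF I] ideal_support_finite[OF J] by auto
  have "deg I = (\<Sum>P\<in>S. ord_ideal P I * int (place_degree Fr P))" by (rule deg_eq_sum[OF S]) (auto simp: S_def)
  moreover have "deg J = (\<Sum>P\<in>S. ord_ideal P J * int (place_degree Fr P))"
    by (rule deg_eq_sum[OF S]) (auto simp: S_def)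
  moreover have "deg K = (\<Sum>P\<in>S. ord_ideal P K * int (place_degree Fr P))"
    by (rule deg_eq_sum[OF S]) (auto simp: S_def K)
  moreover have "\<dots> = (\<Sum>P\<in>S. (ord_ideal P I + ord_ideal P J) * int (place_degree Fr P))"
    by (rule sum.cong) (use S K in auto)
  ultimately show ?thesis by (simp add: distrib_right sum.distrib)
qed

lemma scale_ideal:
  assumes I: "I \<in> ideals" and l: "l \<noteq> 0"
  shows "scale l I \<in> ideals"
proof -
  obtain d where d: "d \<in> A" "d \<noteq> 0" "\<forall>x\<in>I. d * x \<in> A" using ideal_denominator[OF I] by blast
  obtain c where c: "c \<in> A" "c \<noteq> 0" "c * l \<in> A" using fraction by blast
  have "0 \<in> scale l I" using add_subgroup_zero[OF ideal_group[OF I]] by (intro image_eqI[of _ _ 0]) auto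
  moreover have "scale l I \<noteq> {0}"
  proof -
    obtain x where x: "x \<in> I" "x \<noteq> 0" using ideal_nonzero[OF I] by blast
    hence "l * x \<in> scale l I" "l * x \<noteq> 0" using l by auto
    thus ?thesis by blast
  qed
  moreover have "x + y \<in> scale l I" if "x \<in> scale l I" "y \<in> scale l I" for x y
    using that add_subgroup_add[OF ideal_group[OF I]] unfolding mem_scale_iff[OF l] by (simp add: add_divide_distrib)
  moreover have "a * x \<in> scale l I" if "a \<in> A" "x \<in> scale l I" for a x
    using that ideal_mult_closed[OF I] unfolding mem_scale_iff[OF l] by fastforce
  moreover have "(c * d) * x \<in> A" if x: "x \<in> scale l I" for x
  proof -
    obtain y where y: "y \<in> I" "x = l * y" using x by blast
    have "(c * l) * (d * y) \<in> A" using c d y subring_mult[OF A_ring] by blast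
    thus ?thesis using y by (simp add: ac_simps)
  qed
  moreover have "c * d \<in> A - {0}" using c d subring_mult[OF A_ring] by auto
  ultimately show ?thesis unfolding fractional_ideals_def by blast
qed

lemma ord_scale:
  assumes I: "I \<in> ideals" and l: "l \<noteq> 0" and P: "finite_place P"
  shows "ord_ideal P (scale l I) = ord_elem P l + ord_ideal P I"
proof -
  obtain x where x: "x \<in> I" "x \<noteq> 0" "ord_elem P x = ord_ideal P I" using ord_ideal_attained[OF I P] by blast
  show ?thesis
  proof (rule ord_ideal_eqI[OF scale_ideal[OF I l] P])
    show "l * x \<in> scale l I" using x by blast
    show "ord_elem P (l * x) = ord_elem P l + ord_ideal P I" using x l P ord_mult by simp
    fix y assume "y \<in> scale l I" "y \<noteq> 0"
    then obtain z where "z \<in> I" "z \<noteq> 0" "y = l * z" by auto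
    thus "ord_elem P l + ord_ideal P I \<le> ord_elem P y" using l P ord_mult ord_ideal_le[OF I P] by simp
  qed (use x l in simp)
qed

lemma A_ideal: "A \<in> ideals"
proof -
  have "1 \<in> A" by (rule subring_one[OF A_ring])
  thus ?thesis unfolding fractional_ideals_def
    using subring_zero[OF A_ring] subring_add[OF A_ring] subring_mult[OF A_ring]
    by (auto intro!: bexI[of _ 1])
qed

lemma ord_A: "finite_place P \<Longrightarrow> ord_ideal P A = 0"
proof (rule ord_ideal_eqI[OF A_ideal])
  fix y assume "finite_place P" "y \<in> A" "y \<noteq> 0"
  thus "0 \<le> ord_elem P y" using A_place[of y P] place_iff_ord[of P y] by blast
qed (use subring_one[OF A_ring] ord_one in auto)

lemma ord_ideal_nonneg:
  assumes "I \<in> ideals" "I \<subseteq> A" "finite_place P"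
  shows "0 \<le> ord_ideal P I"
proof -
  obtain x where "x \<in> I" "x \<noteq> 0" "ord_elem P x = ord_ideal P I" using ord_ideal_attained[OF assms(1,3)] by blast
  thus ?thesis using A_place[of x P] place_iff_ord[of P x] assms by auto
qed

lemma deg_scale: "I \<in> ideals \<Longrightarrow> l \<noteq> 0 \<Longrightarrow> deg (scale l I) = deg (scale l A) + deg I"
  using deg_add[OF scale_ideal[OF A_ideal, of l], of I "scale l I"] ord_scale[of I l] ord_scale[OF A_ideal, of l] ord_A
  by simp

lemma ideal_mult_ideal:
  assumes I: "I \<in> ideals" and J: "J \<in> ideals"
  shows "ideal_mult I J \<in> ideals"
    and "\<And>x y. x \<in> I \<Longrightarrow> y \<in> J \<Longrightarrow> x * y \<in> ideal_mult I J"
    and "\<And>K. add_subgroup K \<Longrightarrow> (\<And>x y. x \<in> I \<Longrightarrow> y \<in> J \<Longrightarrow> x * y \<in> K) \<Longrightarrow> ideal_mult I J \<subseteq> K"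
proof -
  show prod: "x * y \<in> ideal_mult I J" if "x \<in> I" "y \<in> J" for x y
    unfolding ideal_mult_def using that
    by (intro CollectI exI[of _ "\<lambda>_. x"] exI[of _ "\<lambda>_. y"] exI[of _ 1]) auto
  show least: "ideal_mult I J \<subseteq> K" if "add_subgroup K" "\<And>x y. x \<in> I \<Longrightarrow> y \<in> J \<Longrightarrow> x * y \<in> K" for K
    unfolding ideal_mult_def using that by (auto intro!: add_subgroup_sum)
  obtain d where d: "d \<in> A" "d \<noteq> 0" "\<forall>x\<in>I. d * x \<in> A" using ideal_denominator[OF I] by blast
  obtain e where e: "e \<in> A" "e \<noteq> 0" "\<forall>x\<in>J. e * x \<in> A" using ideal_denominator[OF J] by blast
  have "0 \<in> ideal_mult I J"
    using prod[of 0 0] add_subgroup_zero[OF ideal_group[OF I]] add_subgroup_zero[OF ideal_group[OF J]] by simp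
  moreover have "ideal_mult I J \<noteq> {0}"
    using ideal_nonzero[OF I] ideal_nonzero[OF J] prod by (metis mult_eq_0_iff singletonD)
  moreover have "x + y \<in> ideal_mult I J" if xy: "x \<in> ideal_mult I J" "y \<in> ideal_mult I J" for x y
  proof -
    obtain f g n where f: "x = (\<Sum>i<n. f i * g i)" "\<forall>i<(n::nat). f i \<in> I \<and> g i \<in> J"
      using xy(1) unfolding ideal_mult_def by blast
    obtain f' g' m where f': "y = (\<Sum>i<m. f' i * g' i)" "\<forall>i<(m::nat). f' i \<in> I \<and> g' i \<in> J"
      using xy(2) unfolding ideal_mult_def by blast
    show ?thesis unfolding ideal_mult_def
      by (intro CollectI exI[of _ "\<lambda>i. if i < n then f i else f' (i - n)"]
          exI[of _ "\<lambda>i. if i < n then g i else g' (i - n)"] exI[of _ "n + m"])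
        (use f f' in \<open>auto simp: sum_lessThan_add\<close>)
  qed
  moreover have "a * x \<in> ideal_mult I J" if a: "a \<in> A" "x \<in> ideal_mult I J" for a x
  proof -
    obtain f g n where f: "x = (\<Sum>i<n. f i * g i)" "\<forall>i<(n::nat). f i \<in> I \<and> g i \<in> J"
      using a(2) unfolding ideal_mult_def by blast
    show ?thesis unfolding ideal_mult_def
      by (intro CollectI exI[of _ "\<lambda>i. a * f i"] exI[of _ g] exI[of _ n])
        (use f a ideal_mult_closed[OF I] in \<open>auto simp: sum_distrib_left mult.assoc\<close>)
  qed
  moreover have "(d * e) * x \<in> A" if "x \<in> ideal_mult I J" for x
  proof -
    have "ideal_mult I J \<subseteq> {x. (d * e) * x \<in> A}"
    proof (rule least)
      show "add_subgroup {x. d * e * x \<in> A}"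
        unfolding add_subgroup_def using subring_zero[OF A_ring] subring_diff[OF A_ring]
        by (auto simp: right_diff_distrib)
      fix x y assume "x \<in> I" "y \<in> J"
      hence "(d * x) * (e * y) \<in> A" using d e subring_mult[OF A_ring] by blast
      thus "x * y \<in> {x. d * e * x \<in> A}" by (simp add: ac_simps)
    qed
    thus ?thesis using that by blast
  qed
  moreover have "d * e \<in> A - {0}" using d e subring_mult[OF A_ring] by auto
  ultimately show "ideal_mult I J \<in> ideals" unfolding fractional_ideals_def by blast
qed

lemma ord_ideal_mult:
  assumes I: "I \<in> ideals" and J: "J \<in> ideals" and P: "finite_place P"
  shows "ord_ideal P (ideal_mult I J) = ord_ideal P I + ord_ideal P J"
proof -
  obtain x where x: "x \<in> I" "x \<noteq> 0" "ord_elem P x = ord_ideal P I" using ord_ideal_attained[OF I P] by blast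
  obtain y where y: "y \<in> J" "y \<noteq> 0" "ord_elem P y = ord_ideal P J" using ord_ideal_attained[OF J P] by blast
  have "ideal_mult I J \<subseteq> fpower P (ord_ideal P I + ord_ideal P J)"
  proof (rule ideal_mult_ideal(3)[OF I J])
    show "add_subgroup (fpower P (ord_ideal P I + ord_ideal P J))" using fpower_group P by blast
    fix x y assume "x \<in> I" "y \<in> J"
    hence "x \<in> fpower P (ord_ideal P I)" "y \<in> fpower P (ord_ideal P J)"
      using mem_ideal_iff[OF I] mem_ideal_iff[OF J] P by blast+
    thus "x * y \<in> fpower P (ord_ideal P I + ord_ideal P J)" using fpower_mult P by blast
  qed
  hence ge: "ord_ideal P I + ord_ideal P J \<le> ord_elem P z" if "z \<in> ideal_mult I J" "z \<noteq> 0" for z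
    using that unfolding fpower_def by blast
  show ?thesis
    by (rule ord_ideal_eqI[OF ideal_mult_ideal(1)[OF I J] P ideal_mult_ideal(2)[OF I J x(1) y(1)]])
      (use x y P ord_mult ge in auto)
qed

lemma deg_ideal_mult: "I \<in> ideals \<Longrightarrow> J \<in> ideals \<Longrightarrow> deg (ideal_mult I J) = deg I + deg J"
  using deg_add ord_ideal_mult by blast

lemma ideal_mult_principal:
  assumes I: "I \<in> ideals" and l: "l \<noteq> 0"
  shows "ideal_mult (scale l A) I = scale l I"
  by (rule ideal_eqI[OF ideal_mult_ideal(1)[OF scale_ideal[OF A_ideal l] I] scale_ideal[OF I l]])
    (simp add: ord_ideal_mult[OF scale_ideal[OF A_ideal l] I] ord_scale[OF A_ideal l] ord_scale[OF I l] ord_A)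

text \<open>One factor P is removed from I. An element c with a simple pole at P and no other pole
  off \<open>Oi\<close> turns y, of minimal order in I at P, into an element x0 of minimal order in
  J; division by x0 identifies J / I with the residue field of P.\<close>

lemma index_ideal_step:
  assumes I: "I \<in> ideals" "I \<subseteq> A" and P: "finite_place P" and n: "ord_ideal P I > 0"
  shows "\<exists>J\<in>ideals. I \<subseteq> J \<and> J \<subseteq> A \<and> deg J = deg I - int (place_degree Fr P) \<and>
    has_index J I (card Fr ^ place_degree Fr P)"
proof -
  note PP = P[THEN conjunct1]
  obtain y where y: "y \<in> I" "y \<noteq> 0" "ord_elem P y = ord_ideal P I" using ord_ideal_attained[OF I(1) P] by blast
  obtain t where t: "t \<noteq> 0" "ord_elem P t = 1" using exists_ord[OF PP] by blast
  obtain M where M: "\<forall>Q\<in>places Fr. inverse t \<in> fpower Q (- int M)" using bounded_poles by blast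
  define Z where "Z = {Q \<in> places Fr. ord_elem Q t \<noteq> 0} - {P}"
  have Z: "finite Z" "Z \<subseteq> places Fr" "P \<notin> Z" unfolding Z_def using finite_support[OF t(1)] by auto
  obtain u where u: "u - 1 \<in> fpower P (int (M + 1))" "\<forall>Q\<in>Z. u \<in> fpower Q (int (M + 1))"
    using approximate_one[OF PP Z] by blast
  have uP: "u \<notin> max_ideal P" and uP': "u \<in> P" using near_one_unit[OF PP u(1)] by simp_all
  \<comment> \<open>u is a unit at P that cancels the other poles of 1 / t, and s clears the poles
    of u.\<close>
  have "\<exists>c. c \<noteq> 0 \<and> ord_elem P c = -1 \<and> (\<forall>Q. finite_place Q \<longrightarrow> Q \<noteq> P \<longrightarrow> c \<in> Q)"
  proof -
    obtain s where s: "s \<in> A" "s \<notin> max_ideal P" "s * u \<in> A" using localize[of P u] P uP' by blast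
    define c where "c = (s * u) / t"
    have su: "place_unit P (s * u)" using place_unit_mult[OF PP] s uP uP' A_place P by blast
    have "ord_elem P (s * u) = 0"
      using su place_iff_ord[OF PP, of "s * u"] max_ideal_iff_ord[OF PP, of "s * u"] by auto
    moreover have su0: "s * u \<noteq> 0" using place_unit_nonzero[OF PP su] .
    ultimately have "ord_elem P c = -1" unfolding c_def using ord_divide[OF PP] t by simp
    moreover have "c \<noteq> 0" unfolding c_def using su0 t by simp
    moreover have "c \<in> Q" if Q: "finite_place Q" "Q \<noteq> P" for Q
    proof (cases "Q \<in> Z")
      case True
      have "u \<in> fpower Q (int (M + 1))" "inverse t \<in> fpower Q (- int M)" using u(2) True M Q by auto
      hence "u * inverse t \<in> fpower Q (int (M + 1) + - int M)" using Q by (intro fpower_mult) auto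
      hence "u * inverse t \<in> Q" using fpower_mono[of 0 1 Q] fpower_0[of Q] Q by auto
      hence "s * (u * inverse t) \<in> Q" using subring_mult[OF place_ring] A_place s Q by blast
      thus ?thesis unfolding c_def by (simp add: divide_inverse mult.assoc)
    next
      case False
      hence "ord_elem Q t = 0" using Q unfolding Z_def by blast
      moreover have "ord_elem Q (s * u) \<ge> 0" using A_place[OF s(3)] place_iff_ord su0 Q by blast
      ultimately show ?thesis unfolding c_def using su0 t Q place_iff_ord[of Q] ord_divide[of Q] by auto
    qed
    ultimately show ?thesis by blast
  qed
  then obtain c where c: "c \<noteq> 0" "ord_elem P c = -1" "\<And>Q. finite_place Q \<Longrightarrow> Q \<noteq> P \<Longrightarrow> c \<in> Q" by blast
  define m where "m Q = (if Q = P then ord_ideal P I - 1 else ord_ideal Q I)" for Q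
  define J where "J = {x. \<forall>Q. finite_place Q \<longrightarrow> x \<in> fpower Q (m Q)}"
  have m_le: "m Q \<le> ord_ideal Q I" for Q unfolding m_def by simp
  have m0: "m Q \<ge> 0" if "finite_place Q" for Q unfolding m_def using n ord_ideal_nonneg[OF I that] by auto
  have IJ: "I \<subseteq> J" unfolding J_def using mem_ideal_iff[OF I(1)] fpower_mono[OF m_le] by blast
  have JA: "J \<subseteq> A"
  proof
    fix x assume x: "x \<in> J"
    show "x \<in> A" unfolding A_iff
    proof (intro ballI impI)
      fix Q assume Q: "Q \<in> places Fr" "Q \<noteq> Oi"
      have "x \<in> fpower Q (m Q)" using x Q unfolding J_def by blast
      thus "x \<in> Q" using fpower_mono[OF m0[of Q]] fpower_0[OF Q(1)] Q by blast
    qed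
  qed
  have J: "J \<in> ideals"
  proof -
    have "0 \<in> J" unfolding J_def fpower_def by simp
    moreover have "x + y \<in> J" if "x \<in> J" "y \<in> J" for x y
      using that add_subgroup_add[OF fpower_group] unfolding J_def by blast
    moreover have "a * x \<in> J" if "a \<in> A" "x \<in> J" for a x
      unfolding J_def
    proof (intro CollectI allI impI)
      fix Q assume Q: "finite_place Q"
      have "a \<in> fpower Q 0" "x \<in> fpower Q (m Q)" using that A_place Q fpower_0 unfolding J_def by auto
      thus "a * x \<in> fpower Q (m Q)" using fpower_mult[of Q a 0 x "m Q"] Q by simp
    qed
    moreover have "J \<noteq> {0}" using IJ y by blast
    ultimately show ?thesis unfolding fractional_ideals_def
      using JA subring_one[OF A_ring] by (auto intro!: bexI[of _ 1])
  qed
  define x0 where "x0 = c * y"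
  have x00: "x0 \<noteq> 0" unfolding x0_def using c y by simp
  have x0P: "ord_elem P x0 = ord_ideal P I - 1" unfolding x0_def using ord_mult[OF PP] c y by simp
  have x0J: "x0 \<in> J" unfolding J_def
  proof (intro CollectI allI impI)
    fix Q assume Q: "finite_place Q"
    show "x0 \<in> fpower Q (m Q)"
    proof (cases "Q = P")
      case True
      thus ?thesis using x0P unfolding m_def fpower_def by simp
    next
      case False
      have "c \<in> fpower Q 0" "y \<in> fpower Q (ord_ideal Q I)"
        using c(3)[OF Q False] fpower_0 Q mem_ideal_iff[OF I(1)] y by auto
      from fpower_mult[OF Q[THEN conjunct1] this] show ?thesis unfolding x0_def m_def using False by simp
    qed
  qed
  have mJ: "m Q \<le> ord_elem Q z" if "finite_place Q" "z \<in> J" "z \<noteq> 0" for Q z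
    using that unfolding J_def fpower_def by blast
  have oJ: "ord_ideal Q J = m Q" if Q: "finite_place Q" for Q
  proof (cases "Q = P")
    case True
    show ?thesis
      by (rule ord_ideal_eqI[OF J Q x0J x00 _ mJ[OF Q]]) (simp_all add: x0P True m_def)
  next
    case False
    obtain w where w: "w \<in> I" "w \<noteq> 0" "ord_elem Q w = ord_ideal Q I" using ord_ideal_attained[OF I(1) Q] by blast
    show ?thesis
      by (rule ord_ideal_eqI[OF J Q subsetD[OF IJ w(1)] w(2) _ mJ[OF Q]]) (simp_all add: w(3) False m_def)
  qed
  define S where "S = insert P {Q \<in> places Fr - {Oi}. ord_ideal Q I \<noteq> 0}"
  have S: "finite S" "S \<subseteq> places Fr - {Oi}" unfolding S_def using ideal_support_finite[OF I(1)] P by auto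
  have "deg I = (\<Sum>Q\<in>S. ord_ideal Q I * int (place_degree Fr Q))" by (rule deg_eq_sum[OF S]) (auto simp: S_def)
  moreover have "deg J = (\<Sum>Q\<in>S. ord_ideal Q J * int (place_degree Fr Q))"
    by (rule deg_eq_sum[OF S]) (auto simp: S_def oJ m_def split: if_splits)
  moreover have "\<dots> = (\<Sum>Q\<in>S. ord_ideal Q I * int (place_degree Fr Q) - (if Q = P then int (place_degree Fr P) else 0))"
  proof (rule sum.cong)
    fix Q assume "Q \<in> S"
    hence "ord_ideal Q J = m Q" using S oJ by blast
    show "ord_ideal Q J * int (place_degree Fr Q) =
        ord_ideal Q I * int (place_degree Fr Q) - (if Q = P then int (place_degree Fr P) else 0)"
      unfolding \<open>ord_ideal Q J = m Q\<close> m_def by (cases "Q = P") (simp_all add: left_diff_distrib)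
  qed simp
  ultimately have "deg J = deg I - int (place_degree Fr P)"
    using S(1) by (simp add: sum_subtractf S_def)
  moreover have "has_index J I (card Fr ^ place_degree Fr P)"
  proof (rule has_index_map_rev[OF ideal_group[OF I(1)] max_ideal_group[OF PP] _ _ _ place_index[OF PP]])
    fix x assume "x \<in> J"
    hence "x \<in> fpower P (ord_ideal P I - 1)" using P unfolding J_def m_def by auto
    thus "x / x0 \<in> P" using fpower_iff_place[OF PP x00 x0P] by blast
  next
    fix x x' assume x: "x \<in> J" "x' \<in> J"
    have d: "x - x' \<in> J" using add_subgroup_diff[OF ideal_group[OF J] x] .
    have "x / x0 - x' / x0 \<in> max_ideal P \<longleftrightarrow> x - x' \<in> fpower P (ord_ideal P I)"
      unfolding diff_divide_distrib[symmetric] max_ideal_iff_ord[OF PP] fpower_def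
      using ord_divide[OF PP, of "x - x'" x0] x00 x0P by (cases "x = x'") auto
    also have "\<dots> \<longleftrightarrow> x - x' \<in> I"
    proof
      assume "x - x' \<in> I"
      thus "x - x' \<in> fpower P (ord_ideal P I)" using mem_ideal_iff[OF I(1)] P by blast
    next
      assume a: "x - x' \<in> fpower P (ord_ideal P I)"
      have "x - x' \<in> fpower Q (ord_ideal Q I)" if Q: "finite_place Q" for Q
      proof (cases "Q = P")
        case False
        hence "m Q = ord_ideal Q I" unfolding m_def by simp
        moreover have "x - x' \<in> fpower Q (m Q)" using d Q unfolding J_def by blast
        ultimately show ?thesis by simp
      qed (use a in simp)
      thus "x - x' \<in> I" using mem_ideal_iff[OF I(1)] by blast
    qed
    finally show "x / x0 - x' / x0 \<in> max_ideal P \<longleftrightarrow> x - x' \<in> I" .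
  next
    fix z assume "z \<in> P"
    then obtain a where a: "a \<in> A" "z - a \<in> max_ideal P" using A_residue_surj P by blast
    have "a * x0 \<in> J" using ideal_mult_closed[OF J a(1) x0J] .
    thus "\<exists>x\<in>J. z - x / x0 \<in> max_ideal P" using a x00 by (intro bexI[of _ "a * x0"]) auto
  qed
  ultimately show ?thesis using J IJ JA by blast
qed

lemma index_ideal:
  assumes I: "I \<in> ideals" "I \<subseteq> A"
  shows "deg I \<ge> 0 \<and> has_index A I (card Fr ^ nat (deg I))"
proof -
  have nonneg: "deg I \<ge> 0" if "I \<in> ideals" "I \<subseteq> A" for I
    unfolding ideal_degree_def using ord_ideal_nonneg[OF that] by (intro sum_nonneg mult_nonneg_nonneg) auto
  show ?thesis
    using I
  proof (induction "nat (deg I)" arbitrary: I rule: less_induct)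
    case less
    show ?case
    proof (cases "\<exists>P. finite_place P \<and> ord_ideal P I > 0")
      case True
      then obtain P where P: "finite_place P" "ord_ideal P I > 0" by blast
      obtain J where J: "J \<in> ideals" "I \<subseteq> J" "J \<subseteq> A" "deg J = deg I - int (place_degree Fr P)"
        "has_index J I (card Fr ^ place_degree Fr P)" using index_ideal_step[OF less.prems P] by blast
      have pos: "place_degree Fr P > 0" using place_degree_pos P by blast
      have dJ: "deg J \<ge> 0" by (rule nonneg[OF J(1,3)])
      have "has_index A J (card Fr ^ nat (deg J))" using less.hyps[of J] J pos dJ by auto
      from has_index_trans[OF ideal_group[OF J(1)] ideal_group[OF less.prems(1)] J(2,3)
          subring_add_subgroup[OF A_ring] this J(5)]
      have "has_index A I (card Fr ^ (nat (deg J) + place_degree Fr P))" by (simp add: power_add)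
      moreover have "nat (deg J) + place_degree Fr P = nat (deg I)" using J(4) dJ by linarith
      ultimately show ?thesis using nonneg[OF less.prems] by simp
    next
      case False
      hence z: "ord_ideal P I = 0" if "finite_place P" for P
        using ord_ideal_nonneg[OF less.prems that] that by (meson linorder_not_less order_antisym)
      hence "I = A" using ideal_eqI[OF less.prems(1) A_ideal] ord_A by simp
      moreover have "deg I = 0" unfolding ideal_degree_def using z by (intro sum.neutral) auto
      moreover have "has_index A A 1" unfolding has_index_def transversal_def
        using subring_zero[OF A_ring] by (intro exI[of _ "{0}"]) auto
      ultimately show ?thesis by simp
    qed
  qed
qed

text \<open>The product formula, obtained by counting A / lA in two ways: through the finite places
  by \<open>index_ideal\<close>, and through the pole at infinity by \<open>index_principal\<close>.
  A general l is a quotient of elements of \<open>A\<close>.\<close>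

lemma deg_principal:
  assumes l: "l \<noteq> 0"
  shows "deg (scale l A) = - int (place_degree Fr Oi) * ord_elem Oi l"
proof -
  have *: "deg (scale l A) = - int (place_degree Fr Oi) * ord_elem Oi l" if l: "l \<in> A" "l \<noteq> 0" for l
  proof -
    have I: "scale l A \<in> ideals" "scale l A \<subseteq> A"
      using scale_ideal[OF A_ideal l(2)] l subring_mult[OF A_ring] by auto
    have "card Fr ^ nat (deg (scale l A)) = q ^ nat (- ord_elem Oi l)"
      using has_index_unique[OF ideal_group[OF I(1)] _ index_principal[OF l]] index_ideal[OF I] by blast
    also have "\<dots> = card Fr ^ (place_degree Fr Oi * nat (- ord_elem Oi l))" by (simp add: power_mult)
    finally have "nat (deg (scale l A)) = place_degree Fr Oi * nat (- ord_elem Oi l)"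
      using Fr_card by (simp add: power_inject_exp)
    hence "int (nat (deg (scale l A))) = int (place_degree Fr Oi * nat (- ord_elem Oi l))" by (simp only:)
    moreover have "int (nat (deg (scale l A))) = deg (scale l A)" using index_ideal[OF I] by (simp only: int_nat_eq if_True)
    ultimately have "deg (scale l A) = int (place_degree Fr Oi * nat (- ord_elem Oi l))" by (simp only:)
    moreover have "int (nat (- ord_elem Oi l)) = - ord_elem Oi l" using A_ord[OF l] by simp
    ultimately show ?thesis by (simp only: of_nat_mult)
  qed
  obtain c where c: "c \<in> A" "c \<noteq> 0" "c * l \<in> A" using fraction by blast
  have "deg (scale (c * l) A) = deg (scale c A) + deg (scale l A)"
    using deg_scale[OF scale_ideal[OF A_ideal l] c(2)] by (simp add: image_image mult.assoc)
  thus ?thesis using *[OF c(1,2)] *[OF c(3)] c l ord_mult[OF place_Oi c(2) l] by (simp add: algebra_simps)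
qed

text \<open>Modulo a place of degree at most D two of the powers of \<open>T\<close> up to exponent
  \<open>card Fr ^ D\<close> are congruent, so all these places are zeros of the single element
  \<open>W\<close>.\<close>

lemma finite_places_bounded_degree: "finite {P. finite_place P \<and> place_degree Fr P \<le> D}"
proof -
  define W where "W = (\<Prod>ab\<in>{(a, b). a < b \<and> b \<le> card Fr ^ D}. T ^ snd ab - T ^ fst ab)"
  have fin: "finite {(a, b). a < b \<and> b \<le> card Fr ^ D}"
    by (rule finite_subset[of _ "{..card Fr ^ D} \<times> {..card Fr ^ D}"]) auto
  have "T ^ b - T ^ a \<noteq> 0" if "a < b" for a b
  proof -
    have "monom 1 b - monom 1 a \<in> polys_over Fr"
      unfolding polys_over_def using subring_zero[OF Fr_ring] subring_one[OF Fr_ring]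
        subring_minus[OF Fr_ring subring_one[OF Fr_ring]] by auto
    moreover have "coeff (monom 1 b - monom 1 a) b = (1::'k)" using that by simp
    hence "monom 1 b - monom 1 a \<noteq> (0 :: 'k poly)" by (metis coeff_0 zero_neq_one)
    ultimately show ?thesis using transcendental_poly[OF T_Fr] by (fastforce simp: poly_monom)
  qed
  hence W0: "W \<noteq> 0" unfolding W_def using fin by auto
  have "W \<in> max_ideal P" if P: "finite_place P" and d: "place_degree Fr P \<le> D" for P
  proof -
    note PP = P[THEN conjunct1]
    have TP: "T ^ i \<in> P" for i using subring_power[OF place_ring[OF PP]] A_place[OF T_A] P by blast
    have "\<exists>a b. a < b \<and> b \<le> card Fr ^ D \<and> T ^ b - T ^ a \<in> max_ideal P"
    proof (cases "inj_on (\<lambda>i. T ^ i) {..card Fr ^ D}")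
      case False
      then obtain a b where "a \<le> card Fr ^ D" "b \<le> card Fr ^ D" "a \<noteq> b" "T ^ a = T ^ b" unfolding inj_on_def by auto
      thus ?thesis using add_subgroup_zero[OF max_ideal_group[OF PP]] by (metis diff_self linorder_neqE_nat)
    next
      case True
      have "card Fr ^ place_degree Fr P \<le> card Fr ^ D" using d Fr_card by (intro power_increasing) auto
      hence "\<not> (finite ((\<lambda>i. T ^ i) ` {..card Fr ^ D}) \<and> card ((\<lambda>i. T ^ i) ` {..card Fr ^ D}) \<le> card Fr ^ place_degree Fr P)"
        using card_image[OF True] by simp
      hence "\<exists>x\<in>(\<lambda>i. T ^ i) ` {..card Fr ^ D}. \<exists>y\<in>(\<lambda>i. T ^ i) ` {..card Fr ^ D}. x \<noteq> y \<and> x - y \<in> max_ideal P"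
        using TP by (intro has_index_pigeonhole[OF max_ideal_group[OF PP] place_index[OF PP]]) auto
      then obtain a b where ab: "a \<le> card Fr ^ D" "b \<le> card Fr ^ D" "T ^ a \<noteq> T ^ b" "T ^ a - T ^ b \<in> max_ideal P" by auto
      thus ?thesis using add_subgroup_diff_swap[OF max_ideal_group[OF PP] ab(4)] by (metis linorder_neqE_nat)
    qed
    then obtain a b where ab: "a < b" "b \<le> card Fr ^ D" "T ^ b - T ^ a \<in> max_ideal P" by blast
    define X where "X = {(a, b). a < b \<and> b \<le> card Fr ^ D} - {(a, b)}"
    have "(\<Prod>ab\<in>X. T ^ snd ab - T ^ fst ab) \<in> P"
      using TP subring_diff[OF place_ring[OF PP]] by (intro subring_prod[OF place_ring[OF PP]]) auto
    hence "(\<Prod>ab\<in>X. T ^ snd ab - T ^ fst ab) * (T ^ b - T ^ a) \<in> max_ideal P" using max_ideal_mult[OF PP _ ab(3)] by blast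
    moreover have "W = (T ^ b - T ^ a) * (\<Prod>ab\<in>X. T ^ snd ab - T ^ fst ab)"
      unfolding W_def X_def using fin ab by (subst prod.remove[of _ "(a, b)"]) auto
    ultimately show ?thesis by (simp add: mult.commute)
  qed
  hence "{P. finite_place P \<and> place_degree Fr P \<le> D} \<subseteq> {P \<in> places Fr. W \<in> max_ideal P}" by blast
  thus ?thesis using finite_zeros[OF W0] finite_subset by blast
qed

text \<open>The sign e treats integral ideals and their inverses together. Bounded degree leaves
  finitely many places, and finitely many orders at each.\<close>

lemma finite_ideals_bounded:
  assumes e: "e = 1 \<or> e = (-1 :: int)"
  shows "finite {I \<in> ideals. (\<forall>P. finite_place P \<longrightarrow> 0 \<le> e * ord_ideal P I) \<and> e * deg I \<le> int D}"
    (is "finite ?X")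
proof -
  define Z where "Z = {P. finite_place P \<and> place_degree Fr P \<le> D}"
  have Zfin: "finite Z" unfolding Z_def by (rule finite_places_bounded_degree)
  have bound: "\<bar>ord_ideal P I\<bar> * int (place_degree Fr P) \<le> int D" if I: "I \<in> ?X" and P: "finite_place P" for I P
  proof (cases "ord_ideal P I = 0")
    case False
    have nn: "0 \<le> e * ord_ideal Q I * int (place_degree Fr Q)" if "finite_place Q" for Q using I that by simp
    have fin: "finite {P \<in> places Fr - {Oi}. ord_ideal P I \<noteq> 0}" using ideal_support_finite I by blast
    have "e * ord_ideal P I * int (place_degree Fr P) \<le>
        (\<Sum>Q\<in>{P \<in> places Fr - {Oi}. ord_ideal P I \<noteq> 0}. e * ord_ideal Q I * int (place_degree Fr Q))"
      by (rule member_le_sum) (use nn fin P False in auto)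
    also have "\<dots> = e * deg I" unfolding ideal_degree_def sum_distrib_left by (simp add: mult.assoc)
    also have "\<dots> \<le> int D" using I by blast
    finally have "e * ord_ideal P I * int (place_degree Fr P) \<le> int D" .
    moreover have "\<bar>ord_ideal P I\<bar> = e * ord_ideal P I" using e I P by (auto simp: abs_if)
    ultimately show ?thesis by simp
  qed simp
  define \<Phi> where "\<Phi> I = (\<lambda>P\<in>Z. ord_ideal P I)" for I
  have "\<Phi> ` ?X \<subseteq> Z \<rightarrow>\<^sub>E {- int D..int D}"
  proof (intro image_subsetI PiE_I)
    fix I P assume I: "I \<in> ?X" and P: "P \<in> Z"
    have "place_degree Fr P > 0" using P place_degree_pos unfolding Z_def by blast
    hence "\<bar>ord_ideal P I\<bar> * 1 \<le> \<bar>ord_ideal P I\<bar> * int (place_degree Fr P)" by (intro mult_left_mono) auto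
    also have "\<dots> \<le> int D" using bound[OF I] P unfolding Z_def by blast
    finally show "\<Phi> I P \<in> {- int D..int D}" unfolding \<Phi>_def using P by auto
  qed (simp add: \<Phi>_def)
  hence "finite (\<Phi> ` ?X)" using Zfin by (meson finite_PiE finite_atLeastAtMost_int finite_subset)
  moreover have "inj_on \<Phi> ?X"
  proof (rule inj_onI)
    fix I J assume I: "I \<in> ?X" and J: "J \<in> ?X" and eq: "\<Phi> I = \<Phi> J"
    have "ord_ideal P I = ord_ideal P J" if P: "finite_place P" for P
    proof (cases "P \<in> Z")
      case True
      thus ?thesis using fun_cong[OF eq, of P] unfolding \<Phi>_def by simp
    next
      case False
      hence big: "int D < int (place_degree Fr P)" using P unfolding Z_def by auto
      have "ord_ideal P K = 0" if K: "K \<in> ?X" for K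
      proof (rule ccontr)
        assume "ord_ideal P K \<noteq> 0"
        hence "1 * int (place_degree Fr P) \<le> \<bar>ord_ideal P K\<bar> * int (place_degree Fr P)" by (intro mult_right_mono) auto
        thus False using bound[OF K P] big by linarith
      qed
      thus ?thesis using I J by simp
    qed
    thus "I = J" using ideal_eqI I J by blast
  qed
  ultimately show ?thesis by (rule finite_imageD)
qed

lemma finite_ideals_of_degree: "finite {I \<in> nonzero_ideals A. deg I = d}"
proof (rule finite_subset)
  show "finite {I \<in> ideals. (\<forall>P. finite_place P \<longrightarrow> 0 \<le> 1 * ord_ideal P I) \<and> 1 * deg I \<le> int (nat d)}"
    by (rule finite_ideals_bounded) simp
  show "{I \<in> nonzero_ideals A. deg I = d} \<subseteq>
      {I \<in> ideals. (\<forall>P. finite_place P \<longrightarrow> 0 \<le> 1 * ord_ideal P I) \<and> 1 * deg I \<le> int (nat d)}"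
    unfolding nonzero_ideals_def using ord_ideal_nonneg by auto
qed

text \<open>Minkowski's argument by pigeonhole: \<open>L (N0 + n)\<close> is larger than A / I as
  soon as n times the degree of \<open>Oi\<close> exceeds the degree of I.\<close>

lemma small_element:
  assumes I: "I \<in> ideals" "I \<subseteq> A"
  shows "\<exists>l\<in>I. l \<noteq> 0 \<and> deg (scale l A) \<le> deg I + int (place_degree Fr Oi * (N0 + 1))"
proof -
  define d where "d = place_degree Fr Oi"
  have d: "d > 0" unfolding d_def by (rule place_degree_pos[OF place_Oi])
  \<comment> \<open>The least n for which d * n exceeds the degree of I; it overshoots by at most d,
    and this excess enters the final bound.\<close>
  define n where "n = nat (deg I) div d + 1"
  have n: "nat (deg I) < d * n" "d * n \<le> nat (deg I) + d"
    unfolding n_def using d by (auto simp: dividend_less_times_div)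
  have ind: "has_index A I (card Fr ^ nat (deg I))" "deg I \<ge> 0" using index_ideal[OF I] by auto
  have "card Fr ^ nat (deg I) < card Fr ^ (d * n)" using Fr_card n by (intro power_strict_increasing) auto
  also have "\<dots> = q ^ n * 1" unfolding d_def by (simp add: power_mult)
  also have "\<dots> \<le> q ^ n * card (L N0)" using L_card_pos[of N0] by (intro mult_left_mono) auto
  also have "\<dots> = card (L (N0 + n))" by (rule L_card_eq[symmetric])
  finally have "\<not> (finite (L (N0 + n)) \<and> card (L (N0 + n)) \<le> card Fr ^ nat (deg I))" by simp
  hence "\<exists>x\<in>L (N0 + n). \<exists>y\<in>L (N0 + n). x \<noteq> y \<and> x - y \<in> I"
    by (intro has_index_pigeonhole[OF ideal_group[OF I(1)] ind(1)]) (auto simp: L_def)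
  then obtain x y where xy: "x \<in> L (N0 + n)" "y \<in> L (N0 + n)" "x \<noteq> y" "x - y \<in> I" by blast
  define l where "l = x - y"
  have l: "l \<in> L (N0 + n)" "l \<noteq> 0" "l \<in> I" unfolding l_def using xy add_subgroup_diff[OF L_group] by auto
  have "- int (N0 + n) \<le> ord_elem Oi l" using l unfolding L_def fpower_def by auto
  hence "int d * (- ord_elem Oi l) \<le> int d * int (N0 + n)" by (intro mult_left_mono) auto
  hence "deg (scale l A) \<le> int (d * N0) + int (d * n)" using deg_principal[OF l(2)] d_def by (simp add: algebra_simps)
  also have "\<dots> \<le> int (d * N0) + (deg I + int d)" using n(2) ind(2) by linarith
  finally show ?thesis using l unfolding d_def[symmetric] by (intro bexI[of _ l]) (auto simp: algebra_simps)
qed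

text \<open>Dividing an integral ideal by a small element of it gives the inverse of an integral
  ideal of bounded degree, and of those there are finitely many.\<close>

lemma finite_class_set: "\<exists>\<M>. finite \<M> \<and> \<M> \<subseteq> ideals \<and> (\<forall>I\<in>ideals. \<exists>M\<in>\<M>. \<exists>l. l \<noteq> 0 \<and> I = scale l M)"
proof -
  define D where "D = place_degree Fr Oi * (N0 + 1)"
  define \<M> where "\<M> = {I \<in> ideals. (\<forall>P. finite_place P \<longrightarrow> 0 \<le> -1 * ord_ideal P I) \<and> -1 * deg I \<le> int D}"
  have fin: "finite \<M>" unfolding \<M>_def by (rule finite_ideals_bounded) simp
  have "\<exists>M\<in>\<M>. \<exists>l. l \<noteq> 0 \<and> I = scale l M" if I: "I \<in> ideals" for I
  proof -
    obtain d where d: "d \<noteq> 0" "\<forall>x\<in>I. d * x \<in> A" using ideal_denominator[OF I] by blast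
    define J where "J = scale d I"
    have J: "J \<in> ideals" "J \<subseteq> A" unfolding J_def using scale_ideal[OF I d(1)] d by auto
    obtain l where l: "l \<in> J" "l \<noteq> 0" "deg (scale l A) \<le> deg J + int D" using small_element[OF J] unfolding D_def by blast
    define M where "M = scale (inverse l) J"
    have li: "inverse l \<noteq> 0" using l by simp
    have "deg (scale (inverse l) A) = - deg (scale l A)"
      unfolding deg_principal[OF li] deg_principal[OF l(2)] ord_inverse[OF place_Oi l(2)] by simp
    hence "deg M = deg J - deg (scale l A)" unfolding M_def deg_scale[OF J(1) li] by simp
    moreover have "ord_ideal P M \<le> 0" if P: "finite_place P" for P
      unfolding M_def ord_scale[OF J(1) li P] using ord_ideal_le[OF J(1) P l(1,2)] ord_inverse[of P l] P l by simp
    ultimately have "M \<in> \<M>" unfolding \<M>_def using l(3) scale_ideal[OF J(1) li] M_def by auto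
    moreover have "I = scale (l / d) M"
      unfolding M_def J_def scale_scale using d l by simp
    moreover have "l / d \<noteq> 0" using d l by simp
    ultimately show ?thesis by blast
  qed
  moreover have "\<M> \<subseteq> ideals" unfolding \<M>_def by blast
  ultimately show ?thesis using fin by (intro exI[of _ \<M>] conjI ballI)
qed

text \<open>The dichotomy \<open>val\<close> will come from the absolute value at v. It makes the
  localization a valuation ring at once, and A / v is its residue field because \<open>A\<close>
  meets every residue class.\<close>

lemma localization_place:
  assumes v: "v \<in> primes_of A" and val: "\<And>x. x \<in> localization A v \<or> inverse x \<in> localization A v"
  shows "finite_place (localization A v)" and "max_ideal (localization A v) \<inter> A = v"
    and "has_index A v (card Fr ^ residue_degree Fr A v)"
    and "residue_degree Fr A v = place_degree Fr (localization A v)"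
proof -
  define P where "P = localization A v"
  have vI: "v \<in> ideals" "v \<subseteq> A" "v \<noteq> A" and prime: "\<And>x y. x \<in> A \<Longrightarrow> y \<in> A \<Longrightarrow> x * y \<in> v \<Longrightarrow> x \<in> v \<or> y \<in> v"
    using v unfolding primes_of_def nonzero_ideals_def by auto
  note vg = ideal_group[OF vI(1)]
  have v1: "1 \<notin> v"
  proof
    assume "1 \<in> v"
    hence "a \<in> v" if "a \<in> A" for a using ideal_mult_closed[OF vI(1) that, of 1] by simp
    thus False using vI by blast
  qed
  have mem: "x \<in> P \<longleftrightarrow> (\<exists>a s. a \<in> A \<and> s \<in> A \<and> s \<notin> v \<and> x = a / s)" for x
    unfolding P_def localization_def by blast
  have s0: "s \<noteq> 0" if "s \<notin> v" for s using that add_subgroup_zero[OF vg] by auto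
  have AP: "A \<subseteq> P"
  proof
    fix a assume "a \<in> A"
    thus "a \<in> P" unfolding mem using subring_one[OF A_ring] v1 by (intro exI[of _ a] exI[of _ 1]) auto
  qed
  have "is_subring P"
    unfolding is_subring_def
  proof (intro conjI ballI)
    show "1 \<in> P" using AP subring_one[OF A_ring] by blast
    fix x y assume "x \<in> P" "y \<in> P"
    then obtain a s b t where h: "a \<in> A" "s \<in> A" "s \<notin> v" "x = a / s" "b \<in> A" "t \<in> A" "t \<notin> v" "y = b / t"
      unfolding mem by blast
    have st: "s * t \<in> A" "s * t \<notin> v" using h prime subring_mult[OF A_ring] by blast+
    have "x - y = (a * t - b * s) / (s * t)" using h s0 by (simp add: diff_frac_eq)
    moreover have "a * t - b * s \<in> A" using h subring_mult[OF A_ring] subring_diff[OF A_ring] by blast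
    ultimately show "x - y \<in> P" unfolding mem using st by blast
    have "x * y = (a * b) / (s * t)" using h by simp
    moreover have "a * b \<in> A" using h subring_mult[OF A_ring] by blast
    ultimately show "x * y \<in> P" unfolding mem using st by blast
  qed
  moreover have inv_v: "inverse x \<notin> P" if x: "x \<in> v" "x \<noteq> 0" for x
  proof
    assume "inverse x \<in> P"
    then obtain a s where h: "a \<in> A" "s \<in> A" "s \<notin> v" "inverse x = a / s" unfolding mem by blast
    hence "s = a * x" using x s0[OF h(3)] by (simp add: field_simps)
    thus False using h ideal_mult_closed[OF vI(1) h(1) x(1)] by simp
  qed
  obtain x where "x \<in> v" "x \<noteq> 0" using ideal_nonzero[OF vI(1)] by blast
  hence "P \<noteq> UNIV" using inv_v by blast
  ultimately have P: "P \<in> places Fr" unfolding places_def using Fr_A AP val P_def by auto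
  have "P \<noteq> Oi" using AP T_A T_Oi by blast
  hence fP: "finite_place P" using P by blast
  thus "finite_place (localization A v)" unfolding P_def .
  have mv: "max_ideal P \<inter> A = v"
  proof (intro set_eqI iffI)
    fix x assume "x \<in> v"
    thus "x \<in> max_ideal P \<inter> A" using vI inv_v max_ideal_iff[OF P] by blast
  next
    fix x assume x: "x \<in> max_ideal P \<inter> A"
    show "x \<in> v"
    proof (rule ccontr)
      assume xv: "x \<notin> v"
      have "inverse x \<in> P" unfolding mem using x xv subring_one[OF A_ring]
        by (intro exI[of _ 1] exI[of _ x]) (auto simp: divide_inverse)
      thus False using x max_ideal_iff[OF P, of x] s0[OF xv] by blast
    qed
  qed
  thus "max_ideal (localization A v) \<inter> A = v" unfolding P_def .
  have ind: "has_index A v (card Fr ^ place_degree Fr P)"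
  proof (rule has_index_map_rev[OF vg max_ideal_group[OF P] _ _ _ place_index[OF P]])
    fix x y assume "x \<in> A" "y \<in> A"
    thus "x - y \<in> max_ideal P \<longleftrightarrow> x - y \<in> v" using mv subring_diff[OF A_ring] by blast
  next
    fix z assume "z \<in> P"
    thus "\<exists>x\<in>A. z - x \<in> max_ideal P" using A_residue_surj fP by blast
  qed (use AP in blast)
  have vF: "v \<inter> Fr = {0}"
    using Fr_max_ideal[OF P] mv subring_zero[OF Fr_ring] add_subgroup_zero[OF vg] by blast
  interpret residue_extension Fr A v
  proof
    fix x assume x: "x \<in> Fr" "x \<notin> v"
    show "\<exists>y\<in>Fr. x * y - 1 \<in> v"
      using x s0[OF x(2)] subfield_inverse[OF Fr_field] add_subgroup_zero[OF vg]
      by (intro bexI[of _ "inverse x"]) auto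
  qed (use Fr_ring A_ring Fr_A vg vI v1 ideal_mult_closed[OF vI(1)] in auto)
  have "card Fr ^ place_degree Fr P = card Fr ^ residue_degree Fr A v"
    by (rule residue_degree_index[OF ind]) (simp add: vF has_index_zero Fr_finite)
  moreover from this show "residue_degree Fr A v = place_degree Fr (localization A v)"
    using Fr_card P_def by simp
  ultimately show "has_index A v (card Fr ^ residue_degree Fr A v)" using ind by simp
qed

end

section \<open>Non-archimedean analysis\<close>

lemma prime_dvd_choose_power:
  assumes p: "prime (p::nat)" and j: "0 < j" "j < p ^ n"
  shows "p dvd (p ^ n choose j)"
proof (rule ccontr)
  assume nd: "\<not> p dvd (p ^ n choose j)"
  have "j * (p ^ n choose j) = p ^ n * ((p ^ n - 1) choose (j - 1))"
    by (rule times_binomial_minus1_eq[OF j(1)])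
  hence "p ^ n dvd j * (p ^ n choose j)" by simp
  moreover have "coprime (p ^ n) (p ^ n choose j)" using p nd by (simp add: prime_imp_coprime)
  ultimately have "p ^ n dvd j" using coprime_dvd_mult_left_iff by blast
  thus False using j by (auto dest: dvd_imp_le)
qed

text \<open>In characteristic p one has (1 + X)^(p^n) = 1 + X^(p^n), so in Vandermonde's identity
  only the summand i = 0 survives below degree p^n.\<close>

lemma of_nat_choose_add_power:
  fixes z :: "'a::comm_ring_1"
  assumes p: "prime p" and char: "of_nat p = (0::'a)" and j: "j < p ^ n"
  shows "of_nat ((a + c * p ^ n) choose j) = (of_nat (a choose j) :: 'a)"
proof (induction c)
  case (Suc c)
  have zero: "of_nat (p ^ n choose i) = (0::'a)" if "0 < i" "i \<le> j" for i
    using prime_dvd_choose_power[OF p that(1), of n] that(2) j char by (auto elim!: dvdE)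
  have "(a + Suc c * p ^ n) choose j = (\<Sum>i\<le>j. (p ^ n choose i) * ((a + c * p ^ n) choose (j - i)))"
    unfolding vandermonde by (simp add: ac_simps)
  hence "of_nat ((a + Suc c * p ^ n) choose j) =
      (\<Sum>i\<le>j. of_nat (p ^ n choose i) * of_nat ((a + c * p ^ n) choose (j - i)) :: 'a)" by simp
  also have "\<dots> = (\<Sum>i\<in>{0}. of_nat (p ^ n choose i) * of_nat ((a + c * p ^ n) choose (j - i)) :: 'a)"
    by (rule sum.mono_neutral_right) (use zero in auto)
  also have "\<dots> = of_nat (a choose j)" using Suc by simp
  finally show ?case .
qed simp

lemma of_nat_choose_cong:
  fixes z :: "'a::comm_ring_1"
  assumes p: "prime p" and char: "of_nat p = (0::'a)" and j: "j < p ^ n"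
    and ab: "int a mod int (p ^ n) = int b mod int (p ^ n)"
  shows "of_nat (a choose j) = (of_nat (b choose j) :: 'a)"
proof -
  have "int (a mod p ^ n) = int (b mod p ^ n)" using ab by (simp only: zmod_int)
  hence ab': "a mod p ^ n = b mod p ^ n" by (simp only: of_nat_eq_iff)
  have "of_nat (a choose j) = (of_nat ((a mod p ^ n) choose j) :: 'a)" for a
    using of_nat_choose_add_power[OF p char j, of "a mod p ^ n" "a div p ^ n"] unfolding mod_div_mult_eq .
  thus ?thesis using ab' by metis
qed

section \<open>Fields with a non-archimedean absolute value\<close>

locale nonarch =
  fixes nrm :: "'a::field \<Rightarrow> real"
  assumes nonarch: "nonarch_abs nrm"
begin

lemma nrm_nonneg [simp]: "0 \<le> nrm x" and nrm_eq_0 [simp]: "nrm x = 0 \<longleftrightarrow> x = 0"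
  and nrm_mult: "nrm (x * y) = nrm x * nrm y" and nrm_add: "nrm (x + y) \<le> max (nrm x) (nrm y)"
  using nonarch unfolding nonarch_abs_def by blast+

lemma nrm_0 [simp]: "nrm 0 = 0" by simp

lemma nrm_pos: "x \<noteq> 0 \<Longrightarrow> 0 < nrm x"
  using nrm_nonneg[of x] nrm_eq_0[of x] by linarith

lemma nrm_1 [simp]: "nrm 1 = 1"
  using nrm_mult[of 1 1] nrm_eq_0[of 1] by simp

lemma nrm_minus [simp]: "nrm (- x) = nrm x"
proof -
  have "nrm (-1) * nrm (-1) = 1" using nrm_mult[of "-1" "-1"] by simp
  hence "nrm (-1) = 1" using nrm_nonneg[of "-1"] by (metis abs_of_nonneg abs_square_eq_1 power2_eq_square)
  thus ?thesis using nrm_mult[of "-1" x] by simp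
qed

lemma nrm_diff: "nrm (x - y) \<le> max (nrm x) (nrm y)"
  using nrm_add[of x "- y"] by simp

lemma nrm_diff_commute: "nrm (x - y) = nrm (y - x)"
  using nrm_minus[of "x - y"] by simp

lemma nrm_triangle: "nrm (x - z) \<le> max (nrm (x - y)) (nrm (y - z))"
  using nrm_add[of "x - y" "y - z"] by simp

lemma nrm_power: "nrm (x ^ n) = nrm x ^ n"
  by (induction n) (auto simp: nrm_mult)

lemma nrm_inverse: "nrm (inverse x) = inverse (nrm x)"
proof (cases "x = 0")
  case False
  hence "nrm x * nrm (inverse x) = 1" by (simp flip: nrm_mult)
  thus ?thesis by (metis inverse_unique)
qed simp

lemma nrm_divide: "nrm (x / y) = nrm x / nrm y"
  by (simp add: divide_inverse nrm_mult nrm_inverse)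

lemma nrm_power_int: "nrm (x powi n) = nrm x powi n"
  by (simp add: power_int_def nrm_power nrm_inverse)

lemma nrm_sum_le: "0 \<le> B \<Longrightarrow> (\<And>i. i \<in> X \<Longrightarrow> nrm (f i) \<le> B) \<Longrightarrow> nrm (sum f X) \<le> B"
proof (induction X rule: infinite_finite_induct)
  case (insert x X)
  thus ?case using nrm_add[of "f x" "sum f X"] by fastforce
qed auto

lemma nrm_sum_less: "0 < B \<Longrightarrow> (\<And>i. i \<in> X \<Longrightarrow> nrm (f i) < B) \<Longrightarrow> nrm (sum f X) < B"
proof (induction X rule: infinite_finite_induct)
  case (insert x X)
  thus ?case using nrm_add[of "f x" "sum f X"] by fastforce
qed auto

lemma nrm_of_nat: "nrm (of_nat n) \<le> 1"
proof (induction n)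
  case (Suc n)
  thus ?case using nrm_add[of 1 "of_nat n"] by simp
qed simp

lemma nrm_add_eq: "nrm y < nrm x \<Longrightarrow> nrm (x + y) = nrm x"
  using nrm_add[of x y] nrm_diff[of "x + y" y] by auto

lemma one_unit_nrm: "nrm (u - 1) < 1 \<Longrightarrow> nrm u = 1"
  using nrm_add_eq[of "u - 1" 1] by simp

sublocale Metric_space UNIV "\<lambda>x y. nrm (x - y)"
proof
  show "nrm (x - z) \<le> nrm (x - y) + nrm (y - z)" for x y z
    using nrm_triangle[of x z y] nrm_nonneg[of "x - y"] nrm_nonneg[of "y - z"] by linarith
qed (auto simp: nrm_diff_commute)

lemma limitin_iff: "limitin (abs_topology nrm) f l F \<longleftrightarrow> (\<forall>e>0. \<forall>\<^sub>F n in F. nrm (f n - l) < e)"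
  by (simp add: limitin_metric)

lemma closure_iff: "x \<in> abs_topology nrm closure_of S \<longleftrightarrow> (\<forall>e>0. \<exists>y\<in>S. nrm (x - y) < e)"
  by (simp add: metric_closure_of)

lemma limit_bound:
  assumes "limitin (abs_topology nrm) f l F" "F \<noteq> bot" "\<forall>\<^sub>F n in F. nrm (f n - c) \<le> B"
  shows "nrm (l - c) \<le> B"
proof (rule field_le_epsilon)
  fix e :: real assume e: "0 < e"
  have "\<forall>\<^sub>F n in F. nrm (f n - l) < e \<and> nrm (f n - c) \<le> B"
    using assms(1,3) e unfolding limitin_iff by (simp add: eventually_conj)
  then obtain n where n: "nrm (f n - l) < e" "nrm (f n - c) \<le> B" using eventually_happens'[OF assms(2)] by blast
  have "nrm (l - c) \<le> max (nrm (l - f n)) (nrm (f n - c))" by (rule nrm_triangle)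
  thus "nrm (l - c) \<le> B + e" using n nrm_diff_commute[of l "f n"] e nrm_nonneg[of "f n - c"] by linarith
qed

lemma limit_unique:
  assumes "limitin (abs_topology nrm) f l F" "limitin (abs_topology nrm) f l' F" "F \<noteq> bot"
  shows "l = l'"
proof (rule ccontr)
  assume "l \<noteq> l'"
  hence "0 < nrm (l - l') / 2" using nrm_pos[of "l - l'"] by simp
  hence "\<forall>\<^sub>F n in F. nrm (f n - l') < nrm (l - l') / 2" using assms(2) unfolding limitin_iff by blast
  hence "\<forall>\<^sub>F n in F. nrm (f n - l') \<le> nrm (l - l') / 2" by (rule eventually_mono) simp
  from limit_bound[OF assms(1,3) this] show False using \<open>0 < nrm (l - l') / 2\<close> by simp
qed

lemma fps_at_eqI: "fps_converges_to nrm f u w \<Longrightarrow> fps_at nrm f u = w"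
  unfolding fps_at_def by (rule the_equality) (auto intro: limit_unique)

end

locale complete_nonarch = nonarch +
  assumes complete: "Metric_space.mcomplete UNIV (\<lambda>x y. nrm (x - y))"
begin

lemma cauchy_converges:
  assumes "\<And>e. e > 0 \<Longrightarrow> \<exists>N. \<forall>m\<ge>N. \<forall>n\<ge>N. nrm (s m - s n) < e"
  shows "\<exists>l. limitin (abs_topology nrm) s l sequentially"
  using complete assms unfolding mcomplete_def MCauchy_def by (metis subset_UNIV)

lemma series_converges:
  assumes a: "\<And>e. e > 0 \<Longrightarrow> \<exists>N. \<forall>n\<ge>N. nrm (a n) < e"
  shows "\<exists>w. limitin (abs_topology nrm) (\<lambda>n. \<Sum>i<n. a i) w sequentially"
proof (rule cauchy_converges)
  fix e :: real assume e: "0 < e"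
  obtain N where N: "\<forall>n\<ge>N. nrm (a n) < e" using a[OF e] by blast
  have *: "nrm ((\<Sum>i<n. a i) - (\<Sum>i<m. a i)) < e" if "N \<le> m" "m \<le> n" for m n
  proof -
    have "(\<Sum>i<n. a i) - (\<Sum>i<m. a i) = (\<Sum>i\<in>{m..<n}. a i)"
      using sum_diff_nat_ivl[of 0 m n a] that by (simp add: atLeast0LessThan)
    also have "nrm \<dots> < e" using N that e by (intro nrm_sum_less) auto
    finally show ?thesis .
  qed
  have "nrm ((\<Sum>i<m. a i) - (\<Sum>i<n. a i)) < e" if "m \<ge> N" "n \<ge> N" for m n
    using *[of m n] *[of n m] that nrm_diff_commute by (cases "m \<le> n") auto
  thus "\<exists>N. \<forall>m\<ge>N. \<forall>n\<ge>N. nrm ((\<Sum>i<m. a i) - (\<Sum>i<n. a i)) < e" by blast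
qed

end

lemma small_power: "0 \<le> (x::real) \<Longrightarrow> x < 1 \<Longrightarrow> e > 0 \<Longrightarrow> \<exists>N. \<forall>n\<ge>N. x ^ n < e"
proof -
  assume x: "0 \<le> x" "x < 1" "e > 0"
  obtain N where N: "x ^ N < e" using real_arch_pow_inv[OF x(3,2)] by blast
  have "x ^ n < e" if "n \<ge> N" for n using power_decreasing[OF that, of x] x N by linarith
  thus ?thesis by blast
qed

section \<open>Powers of one-units\<close>

lemma exponents_range: "y \<in> exponents p N \<Longrightarrow> 0 \<le> y n \<and> y n < int (p ^ n * N)"
  unfolding exponents_def by blast

lemma exponents_mod:
  assumes y: "y \<in> exponents p N" and "n \<le> j"
  shows "y j mod int (p ^ n * N) = y n"
  using assms(2)
proof (induction j rule: dec_induct)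
  case base
  thus ?case using exponents_range[OF y, of n] by (intro mod_pos_pos_trivial) auto
next
  case (step j)
  have "int (p ^ n * N) dvd int (p ^ j * N)" using step by (simp add: le_imp_power_dvd)
  hence "y (Suc j) mod int (p ^ n * N) = (y (Suc j) mod int (p ^ j * N)) mod int (p ^ n * N)"
    by (simp add: mod_mod_cancel)
  also have "y (Suc j) mod int (p ^ j * N) = y j" using y unfolding exponents_def by blast
  finally show ?case using step by simp
qed

lemma exponents_reduce:
  assumes y: "y \<in> exponents p N" and p: "p > 0"
  shows "(\<lambda>n. y n mod int (p ^ n)) \<in> exponents p 1"
  unfolding exponents_def
proof (intro CollectI allI conjI)
  fix n
  show "0 \<le> y n mod int (p ^ n)" "y n mod int (p ^ n) < int (p ^ n * 1)" using p by auto
  have "y (Suc n) mod int (p ^ Suc n) mod int (p ^ n * 1) = y (Suc n) mod int (p ^ n)"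
    by (simp add: mod_mod_cancel)
  also have "\<dots> = y (Suc n) mod int (p ^ n * N) mod int (p ^ n)"
    by (rule mod_mod_cancel[symmetric]) simp
  also have "y (Suc n) mod int (p ^ n * N) = y n" using y unfolding exponents_def by blast
  finally show "y (Suc n) mod int (p ^ Suc n) mod int (p ^ n * 1) = y n mod int (p ^ n)" .
qed

lemma exponent_of_int_in: "p > 0 \<Longrightarrow> N > 0 \<Longrightarrow> exponent_of_int p N a \<in> exponents p N"
  unfolding exponents_def exponent_of_int_def by (auto simp: mod_mod_cancel)

lemma exponent_dist_less:
  assumes p: "p \<ge> 2" and d: "exponent_dist p y z < real p powr (1 - real n)"
  shows "y n = z n"
proof (rule ccontr)
  assume ne: "y n \<noteq> z n"
  hence "(LEAST n. y n \<noteq> z n) \<le> n" by (rule Least_le)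
  moreover have "y \<noteq> z" using ne by auto
  ultimately have "exponent_dist p y z \<ge> real p powr (1 - real n)"
    unfolding exponent_dist_def using p by (auto intro!: powr_mono)
  thus False using d by simp
qed

section \<open>The binomial series of a 1-unit in characteristic p\<close>

locale char_nonarch = complete_nonarch +
  fixes p :: nat
  assumes p: "prime p" and char: "of_nat p = (0::'a)"
begin

lemma binomial_expansion:
  fixes u :: 'a
  assumes "m < M"
  shows "u ^ m = (\<Sum>j<M. of_nat (m choose j) * (u - 1) ^ j)"
proof -
  have "u ^ m = (\<Sum>j\<le>m. of_nat (m choose j) * (u - 1) ^ j)" using binomial_ring[of "u - 1" 1 m] by simp
  also have "\<dots> = (\<Sum>j<M. of_nat (m choose j) * (u - 1) ^ j)"
  proof (rule sum.mono_neutral_left)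
    show "\<forall>j\<in>{..<M} - {..m}. of_nat (m choose j) * (u - 1) ^ j = 0" by (simp add: binomial_eq_0)
  qed (use assms in auto)
  finally show ?thesis .
qed

text \<open>Only summands from the p^n-th on can differ, and natural numbers have absolute value at
  most 1.\<close>

lemma coefficient_difference:
  assumes u: "nrm (u - 1) < 1" and eq: "\<And>j. j < p ^ n \<Longrightarrow> of_nat (c j) = (of_nat (d j) :: 'a)"
  shows "nrm ((\<Sum>j<M. of_nat (c j) * (u - 1) ^ j) - (\<Sum>j<M. of_nat (d j) * (u - 1) ^ j)) \<le> nrm (u - 1) ^ (p ^ n)"
  unfolding sum_subtractf[symmetric]
proof (rule nrm_sum_le)
  fix j
  show "nrm (of_nat (c j) * (u - 1) ^ j - of_nat (d j) * (u - 1) ^ j) \<le> nrm (u - 1) ^ p ^ n"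
  proof (cases "j < p ^ n")
    case False
    have le1: "nrm (of_nat k * (u - 1) ^ j) \<le> nrm (u - 1) ^ (p ^ n)" for k
    proof -
      have "nrm (of_nat k * (u - 1) ^ j) \<le> 1 * nrm (u - 1) ^ j"
        unfolding nrm_mult nrm_power by (intro mult_right_mono nrm_of_nat) simp
      also have "\<dots> \<le> nrm (u - 1) ^ (p ^ n)" using False u by (simp add: power_decreasing)
      finally show ?thesis .
    qed
    show ?thesis using nrm_diff[of "of_nat (c j) * (u - 1) ^ j" "of_nat (d j) * (u - 1) ^ j"] le1[of "c j"] le1[of "d j"]
      by linarith
  qed (simp add: eq)
qed simp

lemma power_congruent:
  assumes u: "nrm (u - 1) < 1" and ab: "int a mod int (p ^ n) = int b mod int (p ^ n)"
  shows "nrm (u ^ a - u ^ b) \<le> nrm (u - 1) ^ (p ^ n)"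
proof -
  define M where "M = Suc (max a b)"
  have e: "u ^ a = (\<Sum>j<M. of_nat (a choose j) * (u - 1) ^ j)" "u ^ b = (\<Sum>j<M. of_nat (b choose j) * (u - 1) ^ j)"
    by (rule binomial_expansion, simp add: M_def)+
  show ?thesis unfolding e
    by (rule coefficient_difference[OF u]) (rule of_nat_choose_cong[OF p char _ ab])
qed

lemma one_unit_power_limit:
  assumes u: "nrm (u - 1) < 1"
  shows "limitin (abs_topology nrm) (\<lambda>n. \<Sum>j<n. of_nat (nat (y j) choose j) * (u - 1) ^ j)
    (one_unit_power nrm u y) sequentially"
proof -
  have "\<exists>w. limitin (abs_topology nrm) (\<lambda>n. \<Sum>j<n. of_nat (nat (y j) choose j) * (u - 1) ^ j) w sequentially"
  proof (rule series_converges)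
    fix e :: real assume "0 < e"
    then obtain N where N: "\<forall>n\<ge>N. nrm (u - 1) ^ n < e" using small_power[OF nrm_nonneg u] by blast
    have "nrm (of_nat (nat (y j) choose j) * (u - 1) ^ j) \<le> 1 * nrm (u - 1) ^ j" for j
      unfolding nrm_mult nrm_power by (intro mult_right_mono nrm_of_nat) simp
    thus "\<exists>N. \<forall>n\<ge>N. nrm (of_nat (nat (y n) choose n) * (u - 1) ^ n) < e"
      using N by (intro exI[of _ N]) (metis le_less_trans mult_1)
  qed
  then obtain w where w: "limitin (abs_topology nrm) (\<lambda>n. \<Sum>j<n. of_nat (nat (y j) choose j) * (u - 1) ^ j) w sequentially"
    by blast
  have "one_unit_power nrm u y = w"
    unfolding one_unit_power_def
  proof (rule the_equality)
    fix w'
    assume "limitin (abs_topology nrm) (\<lambda>n. \<Sum>j<n. of_nat (nat (y j) choose j) * (u - 1) ^ j) w' sequentially"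
    from limit_unique[OF this w] show "w' = w" by simp
  qed (rule w)
  thus ?thesis using w by simp
qed

lemma one_unit_power_approx:
  assumes u: "nrm (u - 1) < 1" and y: "y \<in> exponents p 1" and m: "int m mod int (p ^ n) = y n"
  shows "nrm (one_unit_power nrm u y - u ^ m) \<le> nrm (u - 1) ^ (p ^ n)"
proof (rule limit_bound[OF one_unit_power_limit[OF u]])
  have "nrm ((\<Sum>j<M. of_nat (nat (y j) choose j) * (u - 1) ^ j) - u ^ m) \<le> nrm (u - 1) ^ p ^ n" if "M > m" for M
    unfolding binomial_expansion[OF that]
  proof (rule coefficient_difference[OF u])
    fix j assume j: "j < p ^ n"
    have nn: "int (nat (y j)) = y j" using exponents_range[OF y, of j] by simp
    have p2: "p \<ge> 2" using p by (rule prime_ge_2_nat)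
    show "of_nat (nat (y j) choose j) = (of_nat (m choose j) :: 'a)"
    \<comment> \<open>The j-th summand uses the residue of y modulo p^j. For j \<le> n it is
      compared with m modulo p^j, where j < p^j; for larger j modulo p^n, where j < p^n by
      assumption.\<close>
    proof (cases "j \<le> n")
      case True
      have "int m mod int (p ^ j) = (int m mod int (p ^ n)) mod int (p ^ j)"
        using True by (intro mod_mod_cancel[symmetric]) (simp add: le_imp_power_dvd)
      also have "\<dots> = y j mod int (p ^ j)" unfolding m using exponents_mod[OF y True] exponents_mod[OF y order_refl, of j] by simp
      finally have "int (nat (y j)) mod int (p ^ j) = int m mod int (p ^ j)" using nn by simp
      moreover have "j < p ^ j" using less_exp[of j] power_mono[OF p2, of j] by linarith
      ultimately show ?thesis by (intro of_nat_choose_cong[OF p char])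
    next
      case False
      hence "int (nat (y j)) mod int (p ^ n) = int m mod int (p ^ n)" using nn m exponents_mod[OF y, of n j] by simp
      thus ?thesis by (intro of_nat_choose_cong[OF p char j])
    qed
  qed
  thus "\<forall>\<^sub>F M in sequentially. nrm ((\<Sum>j<M. of_nat (nat (y j) choose j) * (u - 1) ^ j) - u ^ m) \<le> nrm (u - 1) ^ p ^ n"
    by (rule eventually_mono[OF eventually_gt_at_top[of m]])
qed simp

text \<open>For j congruent to -y modulo p^n, u^j nearly inverts u^y. Multiplying instead of
  comparing with u^(-j) keeps all exponents natural.\<close>

lemma one_unit_power_inverse:
  assumes u: "nrm (u - 1) < 1" and y: "y \<in> exponents p 1" and j: "(int j + y n) mod int (p ^ n) = 0"
  shows "nrm (one_unit_power nrm u y * u ^ j - 1) \<le> nrm (u - 1) ^ (p ^ n)"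
proof -
  define m where "m = nat (y n)"
  have m: "int m = y n" "int m mod int (p ^ n) = y n"
    using exponents_range[OF y, of n] unfolding m_def by auto
  have nu: "nrm u = 1" by (rule one_unit_nrm[OF u])
  have eq: "one_unit_power nrm u y * u ^ j - 1 = (one_unit_power nrm u y - u ^ m) * u ^ j + (u ^ (m + j) - u ^ 0)"
    by (simp add: algebra_simps power_add)
  have "nrm ((one_unit_power nrm u y - u ^ m) * u ^ j) \<le> nrm (u - 1) ^ (p ^ n)"
    using one_unit_power_approx[OF u y m(2)] nu by (simp add: nrm_mult nrm_power)
  moreover have "nrm (u ^ (m + j) - u ^ 0) \<le> nrm (u - 1) ^ (p ^ n)"
    using j m(1) by (intro power_congruent[OF u]) (simp add: add.commute)
  ultimately show ?thesis unfolding eq by (intro order_trans[OF nrm_add] max.boundedI)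
qed

lemma one_unit_power_nrm:
  assumes u: "nrm (u - 1) < 1" and y: "y \<in> exponents p 1"
  shows "nrm (one_unit_power nrm u y) = 1"
proof (rule one_unit_nrm)
  have "y 0 = 0" using exponents_range[OF y, of 0] by simp
  hence "nrm (one_unit_power nrm u y * u ^ 0 - 1) \<le> nrm (u - 1) ^ (p ^ 0)"
    by (intro one_unit_power_inverse[OF u y]) simp
  thus "nrm (one_unit_power nrm u y - 1) < 1" using u by simp
qed

end

section \<open>Continuation of Dirichlet series with rapidly decreasing coefficients\<close>

lemma linear_le_power2: "\<exists>n0. \<forall>n\<ge>n0. a * n \<le> 2 ^ (n::nat)"
proof -
  have sq: "n * n \<le> 2 ^ n" if "n \<ge> 4" for n :: nat
    using that
  proof (induction n rule: dec_induct)
    case (step n)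
    have "Suc n * Suc n = n * n + 2 * n + 1" by simp
    also have "\<dots> \<le> n * n + n * n" using mult_right_mono[of 4 n n] step(1) by linarith
    also have "\<dots> \<le> 2 ^ Suc n" using step by simp
    finally show ?case .
  qed simp
  have "a * n \<le> 2 ^ n" if "n \<ge> max a 4" for n
  proof -
    have "a * n \<le> n * n" using that by (intro mult_right_mono) auto
    also have "n * n \<le> 2 ^ n" by (rule sq) (use that in simp)
    finally show ?thesis .
  qed
  thus ?thesis by blast
qed

text \<open>From some n on \<rho>^(2^n) is at most (\<rho>^a)^n, and a is chosen with \<rho>^a < 1 /
  (2 M), so that the growth M^n is outweighed by a factor 2^n.\<close>

lemma double_exponential_decay:
  fixes C M \<rho> e :: real
  assumes \<rho>: "0 \<le> \<rho>" "\<rho> < 1" and M: "M \<ge> 1" and C: "C \<ge> 0" and e: "e > 0"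
  shows "\<exists>n0. \<forall>n\<ge>n0. C * M ^ (n + k) * \<rho> ^ (2 ^ n) < e"
proof -
  obtain a where a: "\<rho> ^ a < 1 / (2 * M)" using real_arch_pow_inv[of "1 / (2 * M)" \<rho>] M \<rho> by auto
  obtain n1 where n1: "\<forall>n\<ge>n1. a * n \<le> 2 ^ n" using linear_le_power2 by blast
  have "C * M ^ k + 1 > 0" using C M by (simp add: add_nonneg_pos)
  then obtain n2 where n2: "(1 / 2) ^ n2 < e / (C * M ^ k + 1)" using real_arch_pow_inv[of "e / (C * M ^ k + 1)" "1/2"] e by auto
  have "C * M ^ (n + k) * \<rho> ^ (2 ^ n) < e" if n: "n \<ge> max n1 n2" for n
  proof -
    have "\<rho> ^ (2 ^ n) \<le> \<rho> ^ (a * n)" using n n1 \<rho> by (intro power_decreasing) auto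
    also have "\<dots> = (\<rho> ^ a) ^ n" by (simp add: power_mult)
    also have "\<dots> \<le> (1 / (2 * M)) ^ n" using a \<rho> by (intro power_mono) auto
    finally have "C * M ^ (n + k) * \<rho> ^ (2 ^ n) \<le> C * M ^ (n + k) * (1 / (2 * M)) ^ n"
      using C M by (intro mult_left_mono) auto
    also have "\<dots> = C * M ^ k * (1 / 2) ^ n" using M by (simp add: power_add power_divide power_mult_distrib)
    also have "\<dots> \<le> C * M ^ k * (1 / 2) ^ n2" using n C M by (intro mult_left_mono power_decreasing) auto
    also have "\<dots> \<le> (C * M ^ k + 1) * (1 / 2) ^ n2" by (intro mult_right_mono) auto
    also have "\<dots> < e" using n2 \<open>C * M ^ k + 1 > 0\<close> by (simp add: field_simps)
    finally show ?thesis .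
  qed
  thus ?thesis by blast
qed

text \<open>Degree d permits an n of about d / K. Then R^d is exponential in n, whereas \<rho>^(p^n)
  is doubly exponential.\<close>

lemma coefficient_decay:
  fixes C R \<rho> e :: real
  assumes \<rho>: "0 \<le> \<rho>" "\<rho> < 1" and R: "R \<ge> 1" and C: "C \<ge> 0" and e: "e > 0" and K: "K \<ge> 1" and p: "p \<ge> 2"
  shows "\<exists>D. \<forall>d\<ge>D. \<exists>n. K * (n + 1) < d \<and> C * R ^ d * \<rho> ^ (p ^ n) < e"
proof -
  obtain n0 where n0: "\<forall>n\<ge>n0. C * (R ^ K) ^ (n + 3) * \<rho> ^ (2 ^ n) < e"
    using double_exponential_decay[OF \<rho> _ C e, of "R ^ K" 3] R by auto
  have "\<exists>n. K * (n + 1) < d \<and> C * R ^ d * \<rho> ^ (p ^ n) < e" if d: "d \<ge> K * (n0 + 3)" for d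
  proof -
    have dK: "d div K \<ge> n0 + 3" using d K by (simp add: less_eq_div_iff_mult_less_eq mult.commute)
    \<comment> \<open>The shift by 2 makes K * (n + 1) < d strict while keeping d \<le> K * (n +
      3).\<close>
    define n where "n = d div K - 2"
    have n: "n \<ge> n0" "d div K = n + 2" unfolding n_def using dK by auto
    have "K * (n + 1) < K * (d div K)" unfolding n(2) using K by simp
    also have "\<dots> \<le> d" by simp
    finally have 1: "K * (n + 1) < d" .
    have "d < K * (d div K) + K" using dividend_less_times_div[of K d] K by simp
    hence "d \<le> K * (n + 3)" unfolding n(2) by (simp add: algebra_simps)
    hence "R ^ d \<le> (R ^ K) ^ (n + 3)" using R by (simp add: power_increasing flip: power_mult)
    moreover have "\<rho> ^ (p ^ n) \<le> \<rho> ^ (2 ^ n)" using \<rho> p by (intro power_decreasing power_mono) auto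
    ultimately have "C * R ^ d * \<rho> ^ (p ^ n) \<le> C * (R ^ K) ^ (n + 3) * \<rho> ^ (2 ^ n)"
      using C R \<rho> by (intro mult_mono mult_left_mono) auto
    also have "\<dots> < e" using n0 n by blast
    finally show ?thesis using 1 by blast
  qed
  thus ?thesis by blast
qed

text \<open>The common core of both settings. \<open>W I y\<close> is the factor of the power of I
  that depends on y, and \<open>decay\<close> is where the logarithmic bound on the degrees of the
  special polynomials enters.\<close>

locale decaying_series = complete_nonarch nrm for nrm :: "'a::field \<Rightarrow> real" +
  fixes p N :: nat and X :: "'i set" and dg :: "'i \<Rightarrow> int" and a :: "'i \<Rightarrow> 'a"
    and W :: "'i \<Rightarrow> (nat \<Rightarrow> int) \<Rightarrow> 'a" and C t \<rho> :: real and K :: nat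
  assumes p: "p \<ge> 2" and C: "C \<ge> 0" and t: "t \<ge> 1" and rho: "0 \<le> \<rho>" "\<rho> < 1" and K: "K \<ge> 1"
    and dg: "I \<in> X \<Longrightarrow> dg I \<ge> 0" and fibre: "finite {I \<in> X. dg I = int d}"
    and growth: "I \<in> X \<Longrightarrow> nrm (a I) \<le> C * t ^ nat (dg I)"
    and W_cont: "I \<in> X \<Longrightarrow> y \<in> exponents p N \<Longrightarrow> z \<in> exponents p N \<Longrightarrow> y n = z n \<Longrightarrow>
      nrm (1 / W I y - 1 / W I z) \<le> \<rho> ^ (p ^ n)"
    and decay: "y \<in> exponents p N \<Longrightarrow> K * (n + 1) < d \<Longrightarrow>
      nrm (\<Sum>I | I \<in> X \<and> dg I = int d. a I / W I y) \<le> C * t ^ d * \<rho> ^ (p ^ n)"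
begin

abbreviation S :: "(nat \<Rightarrow> int) set" where "S \<equiv> exponents p N"

definition c :: "nat \<Rightarrow> (nat \<Rightarrow> int) \<Rightarrow> 'a" where
  "c d y = (\<Sum>I | I \<in> X \<and> dg I = int d. a I / W I y)"

definition g :: "(nat \<Rightarrow> int) \<Rightarrow> 'a fps" where "g y = Abs_fps (\<lambda>d. c d y)"

definition T :: "'i \<Rightarrow> 'a \<Rightarrow> (nat \<Rightarrow> int) \<Rightarrow> 'a" where
  "T I x y = a I / (x powi dg I * W I y)"

lemma c_decay:
  assumes R: "R \<ge> 1" and e: "e > 0"
  shows "\<exists>D. \<forall>d\<ge>D. \<forall>y\<in>S. \<forall>u. nrm u \<le> R \<longrightarrow> nrm (c d y * u ^ d) < e"
proof -
  have "t * R \<ge> 1" using t R mult_mono[of 1 t 1 R] by simp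
  then obtain D where D: "\<forall>d\<ge>D. \<exists>n. K * (n + 1) < d \<and> C * (t * R) ^ d * \<rho> ^ (p ^ n) < e"
    using coefficient_decay[OF rho _ C e K p] by blast
  have "nrm (c d y * u ^ d) < e" if d: "d \<ge> D" and y: "y \<in> S" and u: "nrm u \<le> R" for d y u
  proof -
    obtain n where n: "K * (n + 1) < d" "C * (t * R) ^ d * \<rho> ^ (p ^ n) < e" using D d by blast
    have "nrm (c d y * u ^ d) \<le> (C * t ^ d * \<rho> ^ (p ^ n)) * R ^ d"
      unfolding nrm_mult nrm_power c_def using decay[OF y n(1)] u C t rho
      by (intro mult_mono power_mono) auto
    also have "\<dots> = C * (t * R) ^ d * \<rho> ^ (p ^ n)" by (simp add: power_mult_distrib)
    finally show ?thesis using n by linarith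
  qed
  thus ?thesis by blast
qed

lemma g_converges:
  assumes y: "y \<in> S"
  shows "fps_converges_to nrm (g y) u (fps_at nrm (g y) u)"
proof -
  have "\<exists>w. fps_converges_to nrm (g y) u w"
  proof (rule series_converges)
    fix e :: real assume e: "0 < e"
    obtain D where "\<forall>d\<ge>D. \<forall>y\<in>S. \<forall>v. nrm v \<le> max 1 (nrm u) \<longrightarrow> nrm (c d y * v ^ d) < e"
      using c_decay[OF _ e, of "max 1 (nrm u)"] by auto
    thus "\<exists>N. \<forall>n\<ge>N. nrm (fps_nth (g y) n * u ^ n) < e"
      using y unfolding g_def by (intro exI[of _ D]) auto
  qed
  thus ?thesis using fps_at_eqI by blast
qed

lemma c_continuous:
  assumes y: "y \<in> S" and z: "z \<in> S" and eq: "y n = z n"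
  shows "nrm (c d y - c d z) \<le> C * t ^ d * \<rho> ^ (p ^ n)"
  unfolding c_def sum_subtractf[symmetric]
proof (rule nrm_sum_le)
  fix I assume I: "I \<in> {I. I \<in> X \<and> dg I = int d}"
  have "a I / W I y - a I / W I z = a I * (1 / W I y - 1 / W I z)" by (simp add: right_diff_distrib)
  moreover have "nrm (a I * (1 / W I y - 1 / W I z)) \<le> (C * t ^ d) * \<rho> ^ (p ^ n)"
    unfolding nrm_mult using I growth[of I] W_cont[of I, OF _ y z eq] C t by (intro mult_mono) auto
  ultimately show "nrm (a I / W I y - a I / W I z) \<le> C * t ^ d * \<rho> ^ (p ^ n)" by simp
qed (use C t rho in simp)

lemma g_entire: "entire_family nrm p N g"
  unfolding entire_family_def
proof (intro conjI allI impI ballI)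
  fix y u assume "y \<in> S"
  thus "\<exists>w. fps_converges_to nrm (g y) u w" using g_converges by blast
next
  fix B :: "'a set" and e :: real
  assume "(\<exists>R. \<forall>u\<in>B. nrm u \<le> R) \<and> 0 < e"
  then obtain R0 where R0: "\<forall>u\<in>B. nrm u \<le> R0" and e: "0 < e" by blast
  define R where "R = max 1 R0"
  have R: "R \<ge> 1" "\<And>u. u \<in> B \<Longrightarrow> nrm u \<le> R" unfolding R_def using R0 by auto
  have e2: "e / 2 > 0" using e by simp
  obtain D where D: "\<forall>d\<ge>D. \<forall>y\<in>S. \<forall>u. nrm u \<le> R \<longrightarrow> nrm (c d y * u ^ d) < e / 2"
    using c_decay[OF R(1) e2] by blast
  define Q where "Q = C * (t * R) ^ D + 1"
  have tR: "t * R \<ge> 1" using t R mult_mono[of 1 t 1 R] by simp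
  have Q: "Q > 0" unfolding Q_def using C tR by (simp add: add_nonneg_pos)
  obtain n where n: "\<forall>m\<ge>n. \<rho> ^ m < (e / 2) / Q" using small_power[OF rho, of "(e / 2) / Q"] e Q by auto
  have "n < p ^ n" using less_exp[of n] power_mono[OF p, of n] by linarith
  hence rn: "\<rho> ^ (p ^ n) < (e / 2) / Q" using n by simp
  define \<delta> where "\<delta> = real p powr (1 - real n)"
  have "\<delta> > 0" unfolding \<delta>_def using p by simp
  moreover have "nrm (fps_at nrm (g y) u - fps_at nrm (g z) u) < e"
    if y: "y \<in> S" and z: "z \<in> S" and d: "exponent_dist p y z < \<delta>" and u: "u \<in> B" for y z u
  proof -
    have eq: "y n = z n" using exponent_dist_less[OF p] d unfolding \<delta>_def by blast
    have close: "nrm (c d y * u ^ d - c d z * u ^ d) \<le> e / 2" for d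
    \<comment> \<open>From degree D on both terms are small, uniformly in the exponent; below D
      agreement of the exponents at level n makes their difference small.\<close>
    proof (cases "d \<ge> D")
      case True
      hence "nrm (c d y * u ^ d) < e / 2" "nrm (c d z * u ^ d) < e / 2" using D y z R(2)[OF u] by blast+
      thus ?thesis using nrm_diff[of "c d y * u ^ d" "c d z * u ^ d"] by linarith
    next
      case False
      have "nrm (c d y * u ^ d - c d z * u ^ d) \<le> (C * t ^ d * \<rho> ^ (p ^ n)) * R ^ d"
        unfolding left_diff_distrib[symmetric] nrm_mult nrm_power
        using c_continuous[OF y z eq] R(2)[OF u] C t rho by (intro mult_mono power_mono) auto
      also have "\<dots> = (C * (t * R) ^ d) * \<rho> ^ (p ^ n)" by (simp add: power_mult_distrib)
      also have "\<dots> \<le> Q * \<rho> ^ (p ^ n)"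
      proof (rule mult_right_mono)
        have "(t * R) ^ d \<le> (t * R) ^ D" using False tR by (intro power_increasing) auto
        hence "C * (t * R) ^ d \<le> C * (t * R) ^ D" using C by (intro mult_left_mono)
        thus "C * (t * R) ^ d \<le> Q" unfolding Q_def by simp
      qed (use rho in simp)
      also have "\<dots> \<le> e / 2" using rn Q by (simp add: field_simps)
      finally show ?thesis .
    qed
    have ly: "fps_converges_to nrm (g y) u (fps_at nrm (g y) u)" by (rule g_converges[OF y])
    have lz: "fps_converges_to nrm (g z) u (fps_at nrm (g z) u)" by (rule g_converges[OF z])
    have "\<forall>\<^sub>F m in sequentially. nrm ((\<Sum>i<m. fps_nth (g y) i * u ^ i) - fps_at nrm (g z) u) \<le> e / 2"
    proof -
      have "\<forall>\<^sub>F m in sequentially. nrm ((\<Sum>i<m. fps_nth (g z) i * u ^ i) - fps_at nrm (g z) u) < e / 2"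
        using lz e2 unfolding limitin_iff by blast
      thus ?thesis
      proof (rule eventually_mono)
        fix m assume m: "nrm ((\<Sum>i<m. fps_nth (g z) i * u ^ i) - fps_at nrm (g z) u) < e / 2"
        have "nrm ((\<Sum>i<m. fps_nth (g y) i * u ^ i) - (\<Sum>i<m. fps_nth (g z) i * u ^ i)) \<le> e / 2"
          unfolding sum_subtractf[symmetric] g_def fps_nth_Abs_fps using close e2 by (intro nrm_sum_le) auto
        thus "nrm ((\<Sum>i<m. fps_nth (g y) i * u ^ i) - fps_at nrm (g z) u) \<le> e / 2"
          using m nrm_triangle[of "\<Sum>i<m. fps_nth (g y) i * u ^ i" "fps_at nrm (g z) u" "\<Sum>i<m. fps_nth (g z) i * u ^ i"]
          by linarith
      qed
    qed
    from limit_bound[OF ly _ this] show ?thesis using e by simp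
  qed
  ultimately show "\<exists>\<delta>>0. \<forall>y\<in>S. \<forall>z\<in>S. exponent_dist p y z < \<delta> \<longrightarrow>
      (\<forall>u\<in>B. nrm (fps_at nrm (g y) u - fps_at nrm (g z) u) < e)" by blast
qed

lemma degree_below_finite: "finite {I \<in> X. dg I < int M}"
proof -
  have "{I \<in> X. dg I < int M} \<subseteq> (\<Union>d<M. {I \<in> X. dg I = int d})"
  proof
    fix I assume I: "I \<in> {I \<in> X. dg I < int M}"
    hence "dg I = int (nat (dg I))" "nat (dg I) < M" using dg[of I] by auto
    thus "I \<in> (\<Union>d<M. {I \<in> X. dg I = int d})" using I by blast
  qed
  thus ?thesis using fibre finite_subset by (metis (no_types, lifting) finite_UN finite_lessThan)
qed

lemma sum_degree_below:
  assumes x: "x \<noteq> 0"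
  shows "(\<Sum>I | I \<in> X \<and> dg I < int M. T I x y) = (\<Sum>d<M. fps_nth (g y) d * (1 / x) ^ d)"
proof -
  have "(\<Sum>I | I \<in> X \<and> dg I < int M. T I x y) =
      (\<Sum>d<M. \<Sum>I | I \<in> {I \<in> X. dg I < int M} \<and> nat (dg I) = d. T I x y)"
    by (rule sum.group[symmetric]) (use degree_below_finite dg in \<open>auto simp: nat_less_iff\<close>)
  also have "\<dots> = (\<Sum>d<M. fps_nth (g y) d * (1 / x) ^ d)"
  proof (rule sum.cong)
    fix d assume d: "d \<in> {..<M}"
    have "{I \<in> {I \<in> X. dg I < int M}. nat (dg I) = d} = {I. I \<in> X \<and> dg I = int d}"
      using d dg by force
    hence "(\<Sum>I | I \<in> {I \<in> X. dg I < int M} \<and> nat (dg I) = d. T I x y) = (\<Sum>I | I \<in> X \<and> dg I = int d. T I x y)"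
      by simp
    also have "\<dots> = (\<Sum>I | I \<in> X \<and> dg I = int d. a I / W I y * (1 / x) ^ d)"
      by (rule sum.cong) (auto simp: T_def power_one_over field_simps)
    also have "\<dots> = fps_nth (g y) d * (1 / x) ^ d" unfolding g_def c_def by (simp add: sum_distrib_right)
    finally show "(\<Sum>I | I \<in> {I \<in> X. dg I < int M} \<and> nat (dg I) = d. T I x y) = fps_nth (g y) d * (1 / x) ^ d" .
  qed simp
  finally show ?thesis .
qed

lemma g_continues:
  assumes conv: "\<exists>t. abs_convergent_from nrm S X dg T t"
  shows "continues_to nrm S X dg T g"
  unfolding continues_to_def
proof (intro conjI conv allI impI ballI)
  fix t' x y assume ac: "abs_convergent_from nrm S X dg T t'" and y: "y \<in> S" and x: "t' \<le> nrm x"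
  have x0: "x \<noteq> 0" using ac x unfolding abs_convergent_from_def by auto
  define w where "w = fps_at nrm (g y) (1 / x)"
  have lw: "fps_converges_to nrm (g y) (1 / x) w" unfolding w_def by (rule g_converges[OF y])
  show "limitin (abs_topology nrm) (\<lambda>F. \<Sum>I\<in>F. T I x y) w (finite_subsets_at_top X)"
    unfolding limitin_iff
  proof (intro allI impI)
    fix e :: real assume e: "0 < e"
    obtain D1 where D1: "\<forall>I\<in>X. D1 \<le> dg I \<longrightarrow> nrm (T I x y) < e"
      using ac y x e unfolding abs_convergent_from_def by blast
    have "\<forall>\<^sub>F m in sequentially. nrm ((\<Sum>i<m. fps_nth (g y) i * (1 / x) ^ i) - w) < e"
      using lw e unfolding limitin_iff by blast
    then obtain D2 where D2: "\<forall>m\<ge>D2. nrm ((\<Sum>i<m. fps_nth (g y) i * (1 / x) ^ i) - w) < e"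
      unfolding eventually_sequentially by blast
    define M where "M = max (nat D1) D2"
    \<comment> \<open>A finite set containing \<open>F0\<close> adds to the partial sum only terms
      of degree at least \<open>D1\<close>, which are all small.\<close>
    define F0 where "F0 = {I. I \<in> X \<and> dg I < int M}"
    have F0: "finite F0" "F0 \<subseteq> X" unfolding F0_def using degree_below_finite by auto
    have "nrm ((\<Sum>I\<in>F. T I x y) - w) < e" if F: "finite F" "F0 \<subseteq> F" "F \<subseteq> X" for F
    proof -
      have eq: "(\<Sum>I\<in>F. T I x y) - w = (\<Sum>I\<in>F - F0. T I x y) + ((\<Sum>I\<in>F0. T I x y) - w)"
        using sum.subset_diff[OF F(2,1), of "\<lambda>I. T I x y"] by simp
      have "nrm (\<Sum>I\<in>F - F0. T I x y) < e"
      proof (rule nrm_sum_less[OF e])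
        fix I assume "I \<in> F - F0"
        hence "I \<in> X" "D1 \<le> dg I" using F unfolding F0_def M_def by auto
        thus "nrm (T I x y) < e" using D1 by blast
      qed
      moreover have "nrm ((\<Sum>I\<in>F0. T I x y) - w) < e"
        unfolding F0_def sum_degree_below[OF x0] using D2 unfolding M_def by simp
      ultimately show ?thesis unfolding eq by (intro order_le_less_trans[OF nrm_add]) simp
    qed
    thus "\<forall>\<^sub>F F in finite_subsets_at_top X. nrm ((\<Sum>I\<in>F. T I x y) - w) < e"
      unfolding eventually_finite_subsets_at_top using F0 by blast
  qed
qed

end

section \<open>Completions\<close>

locale embedding =
  fixes S :: "'a::field set" and f :: "'a \<Rightarrow> 'b::field"
  assumes S: "is_subfield S" and f: "field_embedding_on S f"
begin

lemmas S_ring = subfield_subring[OF S]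

lemma f_one [simp]: "f 1 = 1" and f_add: "x \<in> S \<Longrightarrow> y \<in> S \<Longrightarrow> f (x + y) = f x + f y"
  and f_mult: "x \<in> S \<Longrightarrow> y \<in> S \<Longrightarrow> f (x * y) = f x * f y"
  using f unfolding field_embedding_on_def by blast+

lemma f_zero [simp]: "f 0 = 0"
proof -
  have "f (0 + 0) = f 0 + f 0" using subring_zero[OF S_ring] by (intro f_add)
  hence "f 0 = f 0 + f 0" by (simp only: add_0)
  thus ?thesis by (rule add_cancel_right_right[THEN iffD1])
qed

lemma f_minus: "x \<in> S \<Longrightarrow> f (- x) = - f x"
  using f_add[of x "- x"] subring_minus[OF S_ring, of x] by (simp add: eq_neg_iff_add_eq_0 add.commute)

lemma f_diff: "x \<in> S \<Longrightarrow> y \<in> S \<Longrightarrow> f (x - y) = f x - f y"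
  using f_add[of x "- y"] subring_minus[OF S_ring, of y] by (simp add: f_minus)

lemma f_eq_zero: "x \<in> S \<Longrightarrow> f x = 0 \<longleftrightarrow> x = 0"
proof
  assume x: "x \<in> S" "f x = 0"
  show "x = 0"
  proof (rule ccontr)
    assume "x \<noteq> 0"
    hence "f x * f (inverse x) = 1" using f_mult[OF x(1) subfield_inverse[OF S x(1)]] by simp
    thus False using x by simp
  qed
qed simp

lemma f_inverse: "x \<in> S \<Longrightarrow> f (inverse x) = inverse (f x)"
proof (cases "x = 0")
  case False
  assume x: "x \<in> S"
  hence "f x * f (inverse x) = 1" using f_mult[OF x subfield_inverse[OF S x]] False by simp
  thus ?thesis by (metis inverse_unique)
qed simp

lemma f_divide: "x \<in> S \<Longrightarrow> y \<in> S \<Longrightarrow> f (x / y) = f x / f y"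
  by (simp add: divide_inverse f_mult f_inverse subfield_inverse[OF S])

lemma f_power: "x \<in> S \<Longrightarrow> f (x ^ n) = f x ^ n"
  by (induction n) (auto simp: f_mult subring_power[OF S_ring])

lemma f_sum: "(\<And>i. i \<in> X \<Longrightarrow> h i \<in> S) \<Longrightarrow> f (sum h X) = (\<Sum>i\<in>X. f (h i))"
  by (induction X rule: infinite_finite_induct) (auto simp: f_add subring_sum[OF S_ring])

lemma f_inj: "inj_on f S"
proof (rule inj_onI)
  fix x y assume "x \<in> S" "y \<in> S" "f x = f y"
  thus "x = y" using f_diff[of x y] f_eq_zero[of "x - y"] subring_diff[OF S_ring, of x y] by simp
qed

lemma f_of_nat: "f (of_nat n) = of_nat n"
proof (induction n)
  case (Suc n)
  have "of_nat n \<in> S" for n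
    by (induction n) (auto intro: subring_zero[OF S_ring] subring_add[OF S_ring] subring_one[OF S_ring])
  thus ?case using Suc by (simp add: f_add subring_one[OF S_ring])
qed simp

lemma image_subfield: "is_subfield X \<Longrightarrow> X \<subseteq> S \<Longrightarrow> is_subfield (f ` X)"
  unfolding is_subfield_def is_subring_def
proof (intro conjI ballI)
  assume X: "((1 \<in> X \<and> (\<forall>x\<in>X. \<forall>y\<in>X. x - y \<in> X \<and> x * y \<in> X)) \<and> (\<forall>x\<in>X. inverse x \<in> X))" "X \<subseteq> S"
  show "1 \<in> f ` X" using X by (intro image_eqI[of _ _ 1]) auto
  fix x assume "x \<in> f ` X"
  then obtain x' where x': "x' \<in> X" "x = f x'" by blast
  show "inverse x \<in> f ` X" using x' X f_inverse[of x'] by (intro image_eqI[of _ _ "inverse x'"]) auto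
  fix y assume "y \<in> f ` X"
  then obtain y' where y': "y' \<in> X" "y = f y'" by blast
  have S: "x' \<in> S" "y' \<in> S" using x' y' X by blast+
  show "x - y \<in> f ` X" using x' y' X f_diff[OF S] by (intro image_eqI[of _ _ "x' - y'"]) auto
  show "x * y \<in> f ` X" using x' y' X f_mult[OF S] by (intro image_eqI[of _ _ "x' * y'"]) auto
qed

end

context nonarch
begin

lemma inverse_close:
  assumes x: "x \<noteq> 0" and xy: "nrm (x - y) < nrm x"
  shows "nrm y = nrm x" and "nrm (inverse x - inverse y) = nrm (x - y) / (nrm x * nrm x)"
proof -
  show ny: "nrm y = nrm x" using nrm_add_eq[of "y - x" x] xy nrm_diff_commute[of x y] by simp
  hence "y \<noteq> 0" using x nrm_pos[OF x] by auto
  hence "inverse x - inverse y = (y - x) / (x * y)" using x by (simp add: field_simps)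
  thus "nrm (inverse x - inverse y) = nrm (x - y) / (nrm x * nrm x)"
    using ny nrm_diff_commute[of x y] by (simp add: nrm_divide nrm_mult)
qed

lemma closure_subset: "X \<subseteq> abs_topology nrm closure_of X"
proof
  fix x assume "x \<in> X"
  thus "x \<in> abs_topology nrm closure_of X" unfolding closure_iff by (intro allI impI bexI[of _ x]) auto
qed

lemma closure_subfield:
  assumes X: "is_subfield X"
  shows "is_subfield (abs_topology nrm closure_of X)"
  unfolding is_subfield_def is_subring_def
proof (intro conjI ballI)
  note R = subfield_subring[OF X]
  show "1 \<in> abs_topology nrm closure_of X" using closure_subset subring_one[OF R] by blast
  fix x assume x: "x \<in> abs_topology nrm closure_of X"
  show "inverse x \<in> abs_topology nrm closure_of X"
  proof (cases "x = 0")
    case True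
    thus ?thesis using x by simp
  next
    case False
    show ?thesis unfolding closure_iff
    proof (intro allI impI)
      fix e :: real assume e: "0 < e"
      define d where "d = min (nrm x) (e * (nrm x * nrm x))"
      have "d > 0" unfolding d_def using e nrm_pos[OF False] by simp
      then obtain y where y: "y \<in> X" "nrm (x - y) < d" using x unfolding closure_iff by blast
      hence "nrm (inverse x - inverse y) = nrm (x - y) / (nrm x * nrm x)"
        using inverse_close(2)[OF False] unfolding d_def by simp
      also have "\<dots> < e" using y(2) nrm_pos[OF False] unfolding d_def by (simp add: divide_less_eq)
      finally show "\<exists>y\<in>X. nrm (inverse x - y) < e" using y(1) subfield_inverse[OF X] by blast
    qed
  qed
  fix y assume y: "y \<in> abs_topology nrm closure_of X"
  show "x - y \<in> abs_topology nrm closure_of X" unfolding closure_iff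
  proof (intro allI impI)
    fix e :: real assume e: "0 < e"
    obtain x' y' where h: "x' \<in> X" "nrm (x - x') < e" "y' \<in> X" "nrm (y - y') < e"
      using x y e unfolding closure_iff by blast
    have "nrm ((x - y) - (x' - y')) < e" using nrm_diff[of "x - x'" "y - y'"] h by (simp add: algebra_simps)
    thus "\<exists>z\<in>X. nrm (x - y - z) < e" using h subring_diff[OF R] by blast
  qed
  show "x * y \<in> abs_topology nrm closure_of X" unfolding closure_iff
  proof (intro allI impI)
    fix e :: real assume e: "0 < e"
    define b where "b = nrm x + nrm y + 1"
    have b: "b \<ge> 1" "nrm x < b" "nrm y < b" unfolding b_def using nrm_nonneg[of x] nrm_nonneg[of y] by linarith+
    define d where "d = min 1 (e / b)"
    have d: "d > 0" "d \<le> 1" "d \<le> e / b" unfolding d_def using e b by auto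
    obtain x' y' where h: "x' \<in> X" "nrm (x - x') < d" "y' \<in> X" "nrm (y - y') < d"
      using x y d unfolding closure_iff by blast
    have "nrm y' \<le> max (nrm (y' - y)) (nrm y)" using nrm_add[of "y' - y" y] by simp
    hence ny: "nrm y' \<le> b" using h(4) d b nrm_diff_commute[of y y'] by linarith
    have "x * y - x' * y' = x * (y - y') + (x - x') * y'" by (simp add: algebra_simps)
    moreover have "nrm (x * (y - y')) < e"
    proof -
      have "nrm x * nrm (y - y') \<le> b * nrm (y - y')" using b by (intro mult_right_mono) auto
      also have "\<dots> < b * d" using h b by simp
      also have "\<dots> \<le> e" using d b by (simp add: field_simps)
      finally show ?thesis by (simp add: nrm_mult)
    qed
    moreover have "nrm ((x - x') * y') < e"
    proof -
      have "nrm (x - x') * nrm y' \<le> nrm (x - x') * b" using ny by (intro mult_left_mono) auto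
      also have "\<dots> < d * b" using h b by simp
      also have "\<dots> \<le> e" using d b by (simp add: field_simps)
      finally show ?thesis by (simp add: nrm_mult)
    qed
    ultimately have "nrm (x * y - x' * y') < e" using nrm_add[of "x * (y - y')" "(x - x') * y'"] by simp
    thus "\<exists>z\<in>X. nrm (x * y - z) < e" using h subring_mult[OF R] by blast
  qed
qed

end

locale place_completion = function_field Fr + nonarch nrm
  for Fr :: "'k::field set" and nrm :: "'c::field \<Rightarrow> real" +
  fixes R :: "'k set" and emb :: "'k \<Rightarrow> 'c"
  assumes place_R: "R \<in> places Fr" and completed: "completed_alg_closure R emb nrm"
begin

sublocale complete_nonarch nrm
  using completed unfolding completed_alg_closure_def by unfold_locales blast

sublocale e: embedding UNIV emb
  using completed unfolding completed_alg_closure_def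
  by unfold_locales (auto simp: is_subfield_def is_subring_def)

lemma nrm_emb_le: "nrm (emb a) \<le> 1 \<longleftrightarrow> a \<in> R"
  using completed unfolding completed_alg_closure_def by blast

lemma nrm_emb_less: "nrm (emb a) < 1 \<longleftrightarrow> a \<in> max_ideal R"
proof (cases "a = 0")
  case False
  hence "nrm (emb a) > 0" using nrm_pos e.f_eq_zero by simp
  hence "nrm (emb (inverse a)) \<le> 1 \<longleftrightarrow> nrm (emb a) \<ge> 1"
    by (simp add: e.f_inverse nrm_inverse inverse_le_1_iff)
  thus ?thesis using False max_ideal_iff[OF place_R, of a] nrm_emb_le[of "inverse a"] by linarith
qed (use add_subgroup_zero[OF max_ideal_group[OF place_R]] in simp)

text \<open>The absolute value is not normalized, so the value of a uniformizer is kept as a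
  constant. It is the largest value below 1 on the completion.\<close>

definition \<kappa> :: real where "\<kappa> = nrm (emb (SOME t. uniformizes R t))"

lemma \<kappa>: "0 < \<kappa>" "\<kappa> < 1" and nrm_emb: "a \<noteq> 0 \<Longrightarrow> nrm (emb a) = \<kappa> powi ord_elem R a"
proof -
  define t where "t = (SOME t. uniformizes R t)"
  have t: "uniformizes R t" unfolding t_def using someI_ex[OF exists_uniformizer[OF place_R]] .
  have t0: "t \<noteq> 0" using t unfolding uniformizes_def by blast
  have "t \<in> max_ideal R" using uniformizes_iff[OF t, of t] t0 subring_one[OF place_ring[OF place_R]] by simp
  thus "\<kappa> < 1" unfolding \<kappa>_def t_def[symmetric] using nrm_emb_less by blast
  show "0 < \<kappa>" unfolding \<kappa>_def t_def[symmetric] using nrm_pos e.f_eq_zero t0 by simp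
  assume a: "a \<noteq> 0"
  obtain u where u: "place_unit R u" "a = u * t powi ord_elem R a" using ord_decomposition[OF place_R t a] .
  have "nrm (emb u) = 1" using u(1) nrm_emb_le[of u] nrm_emb_less[of u] by linarith
  moreover have "emb (t powi n) = emb t powi n" for n
    by (simp add: power_int_def e.f_power e.f_inverse)
  ultimately show "nrm (emb a) = \<kappa> powi ord_elem R a"
    using arg_cong[OF u(2), of "\<lambda>a. nrm (emb a)"]
    unfolding \<kappa>_def t_def[symmetric] by (simp add: e.f_mult nrm_mult nrm_power_int)
qed

abbreviation Kc :: "'c set" where "Kc \<equiv> completion_in emb nrm"

lemma Kc_iff: "x \<in> Kc \<longleftrightarrow> (\<forall>e>0. \<exists>a. nrm (x - emb a) < e)"
  unfolding completion_in_def closure_iff by simp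

lemma range_emb_subfield: "is_subfield (range emb)"
  by (rule e.image_subfield) (auto simp: is_subfield_def is_subring_def)

lemma Kc_subfield: "is_subfield Kc"
  unfolding completion_in_def by (rule closure_subfield[OF range_emb_subfield])

lemma emb_Kc: "emb a \<in> Kc"
  using closure_subset[of "range emb"] unfolding completion_in_def by blast

lemma Kc_approx:
  assumes "x \<in> Kc" "x \<noteq> 0"
  shows "\<exists>a. a \<noteq> 0 \<and> nrm (x - emb a) < nrm x \<and> nrm (emb a) = nrm x"
proof -
  obtain a where a: "nrm (x - emb a) < nrm x" using assms nrm_pos unfolding Kc_iff by blast
  hence "nrm (emb a) = nrm x" by (rule inverse_close(1)[OF assms(2)])
  moreover from this have "a \<noteq> 0" using nrm_pos[OF assms(2)] by auto
  ultimately show ?thesis using a by blast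
qed

text \<open>A nonzero element of the completion has the absolute value of a nearby element of
  \<open>'k\<close>, and those values are powers of \<kappa>.\<close>

lemma Kc_less_one:
  assumes "x \<in> Kc" "nrm x < 1"
  shows "nrm x \<le> \<kappa>"
proof (cases "x = 0")
  case False
  obtain a where a: "a \<noteq> 0" "nrm (emb a) = nrm x" using Kc_approx[OF assms(1) False] by blast
  have "a \<in> max_ideal R" using a(2) assms(2) nrm_emb_less[of a] by simp
  hence "ord_elem R a \<ge> 1" using a(1) max_ideal_iff_ord[OF place_R, of a] by simp
  hence "\<kappa> powi ord_elem R a \<le> \<kappa> powi 1" using \<kappa> by (intro power_int_decreasing) auto
  thus ?thesis using nrm_emb[OF a(1)] a(2) by simp
qed (use \<kappa> in simp)

text \<open>The prime ring lies in the finite field \<open>Fr\<close>.\<close>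

lemma CHAR_prime: "prime CHAR('k)"
proof -
  have "of_nat n \<in> Fr" for n
    by (induction n) (auto intro: subring_zero[OF Fr_ring] subring_one[OF Fr_ring] subring_add[OF Fr_ring])
  hence "range (of_nat :: nat \<Rightarrow> 'k) \<subseteq> Fr" by (rule image_subsetI)
  hence "finite (range (of_nat :: nat \<Rightarrow> 'k))" by (rule finite_subset[OF _ Fr_finite])
  hence "\<not> inj (of_nat :: nat \<Rightarrow> 'k)" using finite_imageD infinite_UNIV_nat by blast
  then obtain m n where mn: "m < n" "of_nat m = (of_nat n :: 'k)" unfolding inj_def by (metis linorder_neqE_nat)
  hence "of_nat (n - m) = (0::'k)" by (simp add: of_nat_diff)
  hence "CHAR('k) > 0" using mn unfolding CHAR_pos_iff by (intro exI[of _ "n - m"]) auto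
  thus ?thesis by (rule prime_CHAR_semidom)
qed

lemma CHAR_zero: "of_nat CHAR('k) = (0::'c)"
  using e.f_of_nat[of "CHAR('k)"] by (simp add: of_nat_CHAR)

sublocale char_nonarch nrm "CHAR('k)"
  by unfold_locales (use CHAR_prime CHAR_zero in auto)

end

context complete_nonarch
begin

lemma fps_at_polynomial:
  assumes "\<And>i. fps_nth f i * u ^ i = coeff P i * w ^ i"
  shows "fps_at nrm f u = poly P w"
proof (rule fps_at_eqI)
  have "(\<Sum>i<n. fps_nth f i * u ^ i) = poly P w" if "n > degree P" for n
  proof -
    have "(\<Sum>i<n. fps_nth f i * u ^ i) = (\<Sum>i<n. coeff P i * w ^ i)" using assms by simp
    also have "\<dots> = poly P w" unfolding poly_altdef
      by (rule sum.mono_neutral_right) (use that in \<open>auto simp: coeff_eq_0\<close>)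
    finally show ?thesis .
  qed
  hence "\<forall>\<^sub>F n in sequentially. nrm ((\<Sum>i<n. fps_nth f i * u ^ i) - poly P w) < e" if "e > 0" for e
    by (intro eventually_mono[OF eventually_gt_at_top[of "degree P"]]) (use that in simp)
  thus "fps_converges_to nrm f u (poly P w)" unfolding limitin_iff by blast
qed

end

text \<open>For j below p^n a bound logarithmic in j is linear in n.\<close>

lemma degree_log_bound:
  fixes f :: "nat \<Rightarrow> nat"
  assumes f: "(\<lambda>j. real (f j)) \<in> O(\<lambda>j. ln (real j))" and p: "p \<ge> 2"
  shows "\<exists>K\<ge>1. \<forall>n j. j < p ^ n \<longrightarrow> f j \<le> K * (n + 1)"
proof -
  obtain c where c: "c > 0" "\<forall>\<^sub>F j in sequentially. norm (real (f j)) \<le> c * norm (ln (real j))"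
    using f by (elim landau_o.bigE)
  obtain J where J: "\<forall>j\<ge>J. norm (real (f j)) \<le> c * norm (ln (real j))"
    using c(2) unfolding eventually_sequentially by blast
  define k where "k = nat \<lceil>c * ln (real p)\<rceil>"
  \<comment> \<open>The O-estimate holds from J on only; the sum of the values up to J covers the
    other j.\<close>
  define K where "K = k + (\<Sum>j\<le>J. f j) + 1"
  have "f j \<le> K * (n + 1)" if j: "j < p ^ n" for n j
  proof (cases "j \<le> J")
    case True
    hence "f j \<le> (\<Sum>j\<le>J. f j)" by (intro member_le_sum) auto
    thus ?thesis unfolding K_def by simp
  next
    case False
    have lnp: "0 \<le> ln (real p)" using p by simp
    have "ln (real j) \<le> ln (real (p ^ n))" using False j p by (subst ln_le_cancel_iff) auto
    also have "\<dots> = real n * ln (real p)" using p by (simp add: ln_realpow)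
    finally have l: "ln (real j) \<le> real n * ln (real p)" .
    have "ln (real j) \<ge> 0" using False by simp
    moreover have "norm (real (f j)) \<le> c * norm (ln (real j))" by (rule J[rule_format]) (use False in simp)
    ultimately have "real (f j) \<le> c * ln (real j)" by simp
    also have "\<dots> \<le> c * (real n * ln (real p))" using l c by simp
    also have "\<dots> = (c * ln (real p)) * real n" by simp
    also have "\<dots> \<le> real k * real n" unfolding k_def by (intro mult_right_mono real_nat_ceiling_ge) auto
    also have "\<dots> = real (k * n)" by simp
    finally have "f j \<le> k * n" by linarith
    also have "\<dots> \<le> K * (n + 1)" unfolding K_def by (intro mult_mono) auto
    finally show ?thesis .
  qed
  thus ?thesis unfolding K_def by (intro exI[of _ "k + (\<Sum>j\<le>J. f j) + 1"]) auto
qed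

section \<open>The setting at infinity\<close>

lemma (in complete_nonarch) zero_if_all_small:
  assumes \<rho>: "0 \<le> \<rho>" "\<rho> < 1" and p: "p \<ge> 2" and small: "\<And>n. nrm x \<le> \<rho> ^ (p ^ n)"
  shows "x = 0"
proof (rule ccontr)
  assume "x \<noteq> 0"
  then obtain N where N: "\<forall>n\<ge>N. \<rho> ^ n < nrm x" using small_power[OF \<rho> nrm_pos] by blast
  have "N < p ^ N" using less_exp[of N] power_mono[OF p, of N] by linarith
  hence "\<rho> ^ (p ^ N) < nrm x" using N by simp
  thus False using small[of N] by simp
qed

lemma (in char_nonarch) one_unit_power_reciprocal:
  assumes u: "nrm (u - 1) < 1" and y: "y \<in> exponents p 1" and j: "(int j + y n) mod int (p ^ n) = 0"
  shows "nrm (1 / one_unit_power nrm u y - u ^ j) \<le> nrm (u - 1) ^ (p ^ n)"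
proof -
  let ?w = "one_unit_power nrm u y"
  have nw: "nrm ?w = 1" by (rule one_unit_power_nrm[OF u y])
  hence "?w \<noteq> 0" by auto
  hence eq: "1 / ?w - u ^ j = - (?w * u ^ j - 1) / ?w" by (simp add: field_simps)
  have "nrm (1 / ?w - u ^ j) = nrm (?w * u ^ j - 1)"
    unfolding eq nrm_divide nrm_minus nw by simp
  thus ?thesis using one_unit_power_inverse[OF assms] by simp
qed

lemma exponent_complement:
  assumes "M > 0"
  shows "(int (nat (- a mod int M)) + a) mod int M = 0" "nat (- a mod int M) < M"
proof -
  have nn: "0 \<le> - a mod int M" "- a mod int M < int M" using assms by auto
  thus "nat (- a mod int M) < M" by linarith
  have "(int (nat (- a mod int M)) + a) mod int M = (- a mod int M + a) mod int M" using nn by simp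
  also have "\<dots> = (- a + a) mod int M" by (rule mod_add_left_eq)
  finally show "(int (nat (- a mod int M)) + a) mod int M = 0" by simp
qed

context infinity_setting
begin

sublocale ac: affine_curve Fr Oi
  by unfold_locales (use function_field place_infinity in auto)

sublocale pc: place_completion Fr nrm Oi emb
  by unfold_locales (use C_infinity place_infinity in \<open>auto simp: completed_alg_closure_def\<close>)

lemma p2: "CHAR('k) \<ge> 2" and p0: "CHAR('k) > 0"
  using pc.CHAR_prime prime_ge_2_nat prime_gt_0_nat by auto

lemma nrm_pi: "nrm \<pi> = pc.\<kappa>"
proof (rule antisym)
  show "nrm \<pi> \<le> pc.\<kappa>" by (rule pc.Kc_less_one[OF uniformizer(1,3)])
  obtain t where t: "t \<noteq> 0" "ord_elem Oi t = 1" using ac.exists_ord[OF place_infinity] by blast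
  have nt: "nrm (emb t) = pc.\<kappa>" using pc.nrm_emb[OF t(1)] t(2) by simp
  hence "nrm (emb t) \<le> nrm \<pi>" using pc.\<kappa> by (intro uniformizer(4) pc.emb_Kc) simp
  thus "pc.\<kappa> \<le> nrm \<pi>" using nt by simp
qed

lemma d_pos: "place_degree Fr Oi > 0"
  by (rule ac.place_degree_pos[OF place_infinity])

lemma pis_nonzero: "\<pi>s \<noteq> 0"
  using pi_star uniformizer(2) d_pos by (metis zero_power)

lemma pis_nrm: "0 < nrm \<pi>s" "nrm \<pi>s < 1"
proof -
  show "0 < nrm \<pi>s" by (rule pc.nrm_pos[OF pis_nonzero])
  have "nrm \<pi>s ^ place_degree Fr Oi < 1" using uniformizer(3) by (simp add: pi_star flip: pc.nrm_power)
  thus "nrm \<pi>s < 1" by (metis one_le_power not_less)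
qed

section \<open>One-units, positive elements and narrow ideal classes\<close>

lemma br_nrm_less: "I \<in> ac.ideals \<Longrightarrow> nrm (br I - 1) < 1"
  using br_one_unit unfolding one_units_def by blast

lemma br_nrm: "I \<in> ac.ideals \<Longrightarrow> nrm (br I) = 1"
  using pc.one_unit_nrm[OF br_nrm_less] .

lemma br_nonzero: "I \<in> ac.ideals \<Longrightarrow> br I \<noteq> 0"
  using br_nrm[of I] by auto

text \<open>The exponent of \<pi> can be left out because it is forced to be the order of l at
  \<open>Oi\<close>, by comparing absolute values.\<close>

definition positive_part :: "'k \<Rightarrow> 'c \<Rightarrow> bool" where
  "positive_part l u \<longleftrightarrow> (\<exists>n. sign_decomposition Fr emb nrm \<pi> (emb l) 1 n u)"

lemma positive_partD:
  assumes "positive_part l u"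
  shows "l \<noteq> 0" "emb l = \<pi> powi ord_elem Oi l * u" "nrm (u - 1) \<le> pc.\<kappa>" "nrm u = 1"
    "I \<in> ac.ideals \<Longrightarrow> br (scale l I) = u * br I"
proof -
  obtain n where n: "sign_decomposition Fr emb nrm \<pi> (emb l) 1 n u" using assms unfolding positive_part_def by blast
  hence u: "u \<in> pc.Kc" "nrm (u - 1) < 1" and l: "emb l = \<pi> powi n * u"
    unfolding sign_decomposition_def one_units_def by auto
  show nu: "nrm u = 1" by (rule pc.one_unit_nrm[OF u(2)])
  hence "emb l \<noteq> 0" using l uniformizer(2) by auto
  thus l0: "l \<noteq> 0" by auto
  have "nrm (emb l) = pc.\<kappa> powi n" unfolding l pc.nrm_mult pc.nrm_power_int nrm_pi nu by simp
  hence "pc.\<kappa> powi n = pc.\<kappa> powi ord_elem Oi l" using pc.nrm_emb[OF l0] by simp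
  hence "n = ord_elem Oi l" using pc.\<kappa> by (metis less_irrefl linorder_neqE power_int_strict_decreasing)
  thus "emb l = \<pi> powi ord_elem Oi l * u" using l by simp
  have "u - 1 \<in> pc.Kc" using u(1) subring_diff[OF subfield_subring[OF pc.Kc_subfield]]
      subring_one[OF subfield_subring[OF pc.Kc_subfield]] by blast
  thus "nrm (u - 1) \<le> pc.\<kappa>" using u(2) by (rule pc.Kc_less_one)
  assume I: "I \<in> ac.ideals"
  have "br (scale l I) = br (ideal_mult (scale l ac.A) I)" using ac.ideal_mult_principal[OF I l0] by simp
  also have "\<dots> = br (scale l ac.A) * br I" by (rule br_mult[OF ac.scale_ideal[OF ac.A_ideal l0] I])
  also have "br (scale l ac.A) = u" by (rule br_principal[OF n])
  finally show "br (scale l I) = u * br I" .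
qed

lemma positive_partI:
  assumes u: "u \<in> pc.Kc" "nrm (u - 1) < 1" and l: "emb l = \<pi> powi n * u"
  shows "positive_part l u"
proof -
  have "algebraic_over (emb ` Fr) 1"
    unfolding algebraic_over_def
  proof (intro exI[of _ "[:- 1, 1:]"] conjI)
    have "emb 1 = 1" "emb (- 1) = - 1" using pc.e.f_one pc.e.f_minus[of 1] by simp_all
    moreover have "1 \<in> Fr" "- 1 \<in> Fr" using subring_one[OF ac.Fr_ring] subring_minus[OF ac.Fr_ring] by auto
    ultimately have "1 \<in> emb ` Fr" "- 1 \<in> emb ` Fr" by (metis imageI)+
    thus "set (coeffs [:- 1, 1:]) \<subseteq> emb ` Fr" by (simp add: cCons_def)
  qed auto
  moreover have "1 \<in> pc.Kc" using subring_one[OF subfield_subring[OF pc.Kc_subfield]] .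
  ultimately show ?thesis
    unfolding positive_part_def sign_decomposition_def one_units_def using assms by (intro exI[of _ n]) auto
qed

text \<open>Finiteness of the narrow class group. The sign of l takes finitely many values, and
  scaling the class representatives by representatives r of the residue field absorbs it.\<close>

lemma positive_classes:
  "\<exists>\<M>. finite \<M> \<and> \<M> \<subseteq> ac.ideals \<and> (\<forall>I\<in>ac.ideals. \<exists>M\<in>\<M>. \<exists>l u. positive_part l u \<and> I = scale l M)"
proof -
  obtain \<M>0 where M0: "finite \<M>0" "\<M>0 \<subseteq> ac.ideals"
    "\<forall>I\<in>ac.ideals. \<exists>M\<in>\<M>0. \<exists>l. l \<noteq> 0 \<and> I = scale l M" using ac.finite_class_set by blast
  obtain Rt where Rt: "transversal Oi (max_ideal Oi) Rt" "finite Rt"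
    using ac.place_index[OF place_infinity] unfolding has_index_def by blast
  define \<M> where "\<M> = (\<lambda>(r, M). scale r M) ` ((Rt - {0}) \<times> \<M>0)"
  have "finite \<M>" unfolding \<M>_def using Rt M0 by auto
  moreover have "\<M> \<subseteq> ac.ideals"
  proof
    fix I assume "I \<in> \<M>"
    then obtain r M where rM: "r \<in> Rt" "r \<noteq> 0" "M \<in> \<M>0" "I = scale r M" unfolding \<M>_def by auto
    thus "I \<in> ac.ideals" using ac.scale_ideal[OF subsetD[OF M0(2) rM(3)] rM(2)] by simp
  qed
  moreover have "\<exists>M\<in>\<M>. \<exists>l u. positive_part l u \<and> I = scale l M" if I: "I \<in> ac.ideals" for I
  proof -
    obtain M l where M: "M \<in> \<M>0" "l \<noteq> 0" "I = scale l M" using bspec[OF M0(3) I] by blast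
    define n where "n = ord_elem Oi l"
    \<comment> \<open>The unit part of l. Its residue, represented by r, carries the sign, so l / r
      is a power of \<pi> times a 1-unit.\<close>
    define \<tau> where "\<tau> = emb l / \<pi> powi n"
    have Kf: "is_subring pc.Kc" by (rule subfield_subring[OF pc.Kc_subfield])
    have piK: "\<pi> powi n \<in> pc.Kc"
      unfolding power_int_def using uniformizer(1) subring_power[OF Kf] subfield_inverse[OF pc.Kc_subfield] by auto
    have tK: "\<tau> \<in> pc.Kc" unfolding \<tau>_def by (rule subfield_divide[OF pc.Kc_subfield pc.emb_Kc piK])
    have nt: "nrm \<tau> = 1" unfolding \<tau>_def pc.nrm_divide pc.nrm_power_int nrm_pi pc.nrm_emb[OF M(2)] n_def
      using pc.\<kappa> by simp
    have t0: "\<tau> \<noteq> 0" using nt by auto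
    obtain a where a: "nrm (\<tau> - emb a) < 1" "nrm (emb a) = 1" using pc.Kc_approx[OF tK t0] nt by auto
    have "a \<in> Oi" using a(2) pc.nrm_emb_le[of a] by linarith
    then obtain r where r: "r \<in> Rt" "a - r \<in> max_ideal Oi" using Rt(1) unfolding transversal_def by blast
    have "nrm (emb a - emb r) < 1" using r(2) pc.nrm_emb_less pc.e.f_diff by (metis UNIV_I)
    hence tr: "nrm (\<tau> - emb r) < 1" using pc.nrm_triangle[of \<tau> "emb r" "emb a"] a(1) by linarith
    have nr: "nrm (emb r) = 1" using pc.inverse_close(1)[OF t0] tr nt by simp
    hence r0: "r \<noteq> 0" by auto
    define u where "u = \<tau> / emb r"
    have "u - 1 = (\<tau> - emb r) / emb r" unfolding u_def using nr by (auto simp: diff_divide_distrib)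
    hence "nrm (u - 1) < 1" using tr nr by (simp add: pc.nrm_divide)
    moreover have "u \<in> pc.Kc" unfolding u_def by (rule subfield_divide[OF pc.Kc_subfield tK pc.emb_Kc])
    moreover have "emb (l / r) = \<pi> powi n * u"
      unfolding u_def \<tau>_def using uniformizer(2) by (simp add: pc.e.f_divide)
    ultimately have "positive_part (l / r) u" by (intro positive_partI)
    moreover have "I = scale (l / r) (scale r M)" unfolding scale_scale M(3) using r0 by simp
    moreover have "scale r M \<in> \<M>" unfolding \<M>_def using r r0 M by auto
    ultimately show ?thesis by blast
  qed
  ultimately show ?thesis by (intro exI[of _ \<M>] conjI ballI)
qed

lemma power_s1_nonzero: "I \<in> ac.ideals \<Longrightarrow> power_s1 I \<noteq> 0"
  unfolding power_s1_def using pis_nonzero br_nonzero by simp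

text \<open>The exponent \<open>s\<^sub>1\<close> is normalized so that this holds, by the product formula.\<close>

lemma power_s1_scale:
  assumes l: "positive_part l u" and I: "I \<in> ac.ideals"
  shows "power_s1 (scale l I) = emb l * power_s1 I"
proof -
  note l' = positive_partD[OF l]
  have "- deg (scale l I) = int (place_degree Fr Oi) * ord_elem Oi l + (- deg I)"
    unfolding deg_def using ac.deg_scale[OF I l'(1)] ac.deg_principal[OF l'(1)] by simp
  hence "\<pi>s powi (- deg (scale l I)) = \<pi>s powi (int (place_degree Fr Oi) * ord_elem Oi l) * \<pi>s powi (- deg I)"
    by (simp only: power_int_add[OF disjI1[OF pis_nonzero]])
  also have "\<pi>s powi (int (place_degree Fr Oi) * ord_elem Oi l) = \<pi> powi ord_elem Oi l"
    unfolding power_int_mult by (simp add: pi_star)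
  finally show ?thesis unfolding power_s1_def using l'(5)[OF I] l'(2) by (simp add: ac_simps)
qed

lemma power_s1_mult:
  assumes "I \<in> ac.ideals" "J \<in> ac.ideals"
  shows "power_s1 (ideal_mult I J) = power_s1 I * power_s1 J"
proof -
  have d: "- deg (ideal_mult I J) = - deg I + - deg J" unfolding deg_def using ac.deg_ideal_mult[OF assms] by simp
  show ?thesis unfolding power_s1_def d br_mult[OF assms] power_int_add[OF disjI1[OF pis_nonzero]] by (simp only: ac_simps)
qed

text \<open>The 1-unit part u of a positive element lies in the completion, where |u - 1| \<le>
  \<kappa> by discreteness, so besides \<kappa> only the finitely many class representatives
  matter.\<close>

lemma br_uniform: "\<exists>\<rho>. 0 \<le> \<rho> \<and> \<rho> < 1 \<and> (\<forall>I\<in>ac.ideals. nrm (br I - 1) \<le> \<rho>)"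
proof -
  obtain \<M> where M: "finite \<M>" "\<M> \<subseteq> ac.ideals"
    "\<forall>I\<in>ac.ideals. \<exists>M\<in>\<M>. \<exists>l u. positive_part l u \<and> I = scale l M" using positive_classes by blast
  define \<rho> where "\<rho> = Max (insert pc.\<kappa> ((\<lambda>M. nrm (br M - 1)) ` \<M>))"
  have fin: "finite (insert pc.\<kappa> ((\<lambda>M. nrm (br M - 1)) ` \<M>))" using M by simp
  have k: "pc.\<kappa> \<le> \<rho>" and b: "\<And>M. M \<in> \<M> \<Longrightarrow> nrm (br M - 1) \<le> \<rho>"
    unfolding \<rho>_def using fin by (auto intro!: Max_ge)
  have "\<rho> < 1" unfolding \<rho>_def using fin M(2) br_nrm_less pc.\<kappa> by (subst Max_less_iff) auto
  moreover have "nrm (br I - 1) \<le> \<rho>" if I: "I \<in> ac.ideals" for I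
  proof -
    obtain M' l u where Ml: "M' \<in> \<M>" "positive_part l u" "I = scale l M'" using bspec[OF M(3) I] by blast
    have MI: "M' \<in> ac.ideals" using Ml M by blast
    have eq: "br I - 1 = u * (br M' - 1) + (u - 1)"
      unfolding Ml(3) positive_partD(5)[OF Ml(2) MI] by (simp add: algebra_simps)
    have "nrm (u * (br M' - 1)) \<le> \<rho>" using b[OF Ml(1)] positive_partD(4)[OF Ml(2)] by (simp add: pc.nrm_mult)
    moreover have "nrm (u - 1) \<le> \<rho>" using positive_partD(3)[OF Ml(2)] k by linarith
    ultimately show ?thesis unfolding eq by (intro order_trans[OF pc.nrm_add] max.boundedI)
  qed
  moreover have "0 \<le> \<rho>" using k pc.\<kappa> by linarith
  ultimately show ?thesis by blast
qed

section \<open>Growth of the coefficients, and continuation at infinity\<close>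

lemma nonzero_ideals_ideals: "I \<in> nonzero_ideals A \<Longrightarrow> I \<in> ac.ideals \<and> I \<subseteq> ac.A"
  unfolding nonzero_ideals_def A_def by blast

lemma deg_nonneg: "I \<in> nonzero_ideals A \<Longrightarrow> deg I \<ge> 0"
  unfolding deg_def using ac.index_ideal nonzero_ideals_ideals by blast

lemma degree_fibre_finite: "finite {I \<in> nonzero_ideals A. deg I = d}"
  unfolding A_def deg_def by (rule ac.finite_ideals_of_degree)

lemma power_s1_power:
  assumes "I \<in> nonzero_ideals A" "deg I = int d"
  shows "power_s1 I ^ j * \<pi>s ^ (d * j) = br I ^ j"
proof -
  have "power_s1 I * \<pi>s ^ d = br I"
    unfolding power_s1_def assms(2) using pis_nonzero by (simp add: power_int_minus)
  hence "(power_s1 I * \<pi>s ^ d) ^ j = br I ^ j" by simp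
  thus ?thesis by (simp add: power_mult_distrib power_mult)
qed

text \<open>Convergence at one point x suffices: in large degree the terms are below 1 there, and
  the power of I has absolute value |x|^d because its 1-unit factor has absolute value 1.\<close>

lemma coefficient_growth:
  assumes "motivic_class b"
  shows "\<exists>C t. C \<ge> 0 \<and> t \<ge> 1 \<and> (\<forall>I\<in>nonzero_ideals A. nrm (emb (b I)) \<le> C * t ^ nat (deg I))"
proof -
  obtain t0 where t0: "abs_convergent_from nrm (exponents CHAR('k) 1) (nonzero_ideals A) deg (L_term b) t0"
    using assms unfolding motivic_class_def by blast
  define B where "B = max 1 t0"
  have B: "B \<ge> 1" "B \<ge> t0" unfolding B_def by auto
  \<comment> \<open>A high power of 1 / \<pi> is a point of the half-plane of convergence.\<close>
  obtain m where m: "nrm \<pi> ^ m < 1 / B" using real_arch_pow_inv[of "1 / B" "nrm \<pi>"] uniformizer(3) B by auto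
  define x where "x = inverse \<pi> ^ m"
  have pm: "nrm \<pi> ^ m > 0" using pc.nrm_pos[OF uniformizer(2)] by simp
  have "B * nrm \<pi> ^ m < 1" using m B by (simp add: pos_less_divide_eq mult.commute)
  hence "B < 1 / nrm \<pi> ^ m" using pm by (simp add: pos_less_divide_eq)
  moreover have "nrm x = 1 / nrm \<pi> ^ m"
    unfolding x_def pc.nrm_power pc.nrm_inverse by (simp only: power_inverse inverse_eq_divide power_one_over)
  ultimately have nx: "nrm x \<ge> 1" "nrm x \<ge> t0" using B by linarith+
  define y where "y = exponent_of_int CHAR('k) 1 0"
  have y: "y \<in> exponents CHAR('k) 1" unfolding y_def using exponent_of_int_in p0 by simp
  obtain D where D: "\<forall>I\<in>nonzero_ideals A. D \<le> deg I \<longrightarrow> nrm (L_term b I x y) < 1"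
    using t0 nx y unfolding abs_convergent_from_def by (metis zero_less_one)
  define F where "F = {I \<in> nonzero_ideals A. deg I < int (nat D)}"
  have "F \<subseteq> (\<Union>d<nat D. {I \<in> nonzero_ideals A. deg I = int d})"
  proof
    fix I assume I: "I \<in> F"
    hence "0 \<le> deg I" "deg I < int (nat D)" using deg_nonneg unfolding F_def by blast+
    hence "deg I = int (nat (deg I))" "nat (deg I) < nat D" by linarith+
    thus "I \<in> (\<Union>d<nat D. {I \<in> nonzero_ideals A. deg I = int d})" using I unfolding F_def by blast
  qed
  hence F: "finite F" using degree_fibre_finite by (meson finite_UN finite_lessThan finite_subset)
  \<comment> \<open>Absorbs the finitely many ideals of degree below \<open>D\<close>.\<close>
  define C where "C = 1 + (\<Sum>I\<in>F. nrm (emb (b I)))"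
  have C: "C \<ge> 1" unfolding C_def by (simp add: sum_nonneg)
  have "nrm (emb (b I)) \<le> C * nrm x ^ nat (deg I)" if I: "I \<in> nonzero_ideals A" for I
  proof (cases "I \<in> F")
    case True
    have "nrm (emb (b I)) \<le> (\<Sum>I\<in>F. nrm (emb (b I)))" using True F by (intro member_le_sum) auto
    also have "\<dots> \<le> C * 1" unfolding C_def by simp
    also have "\<dots> \<le> C * nrm x ^ nat (deg I)" using C nx by (intro mult_left_mono) auto
    finally show ?thesis .
  next
    case False
    hence "\<not> deg I < int (nat D)" using I unfolding F_def by blast
    hence "D \<le> deg I" by linarith
    hence less: "nrm (L_term b I x y) < 1" using D I by blast
    have II: "I \<in> ac.ideals" using nonzero_ideals_ideals[OF I] by blast
    have "nrm (power_at I x y) = nrm x powi deg I"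
      unfolding power_at_def pc.nrm_mult pc.nrm_power_int using pc.one_unit_power_nrm[OF br_nrm_less[OF II] y] by simp
    also have "\<dots> = nrm x ^ nat (deg I)" using deg_nonneg[OF I] by (simp add: power_int_def)
    finally have "nrm (emb (b I)) / nrm x ^ nat (deg I) < 1" using less unfolding L_term_def pc.nrm_divide by simp
    hence "nrm (emb (b I)) < nrm x ^ nat (deg I)" using nx by (simp add: divide_less_eq)
    also have "\<dots> \<le> C * nrm x ^ nat (deg I)" using C nx mult_right_mono[of 1 C "nrm x ^ nat (deg I)"] by simp
    finally show ?thesis by simp
  qed
  thus ?thesis using C nx by (intro exI[of _ C] exI[of _ "nrm x"]) auto
qed

lemma special_values:
  assumes "motivic_class b"
  shows "\<exists>P K. (\<forall>j d. coeff (P j) d = (\<Sum>I | I \<in> nonzero_ideals A \<and> deg I = int d. emb (b I) * power_s1 I ^ j)) \<and>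
    (\<forall>j. set (coeffs (P j)) \<subseteq> OV) \<and> K \<ge> 1 \<and>
    (\<forall>n j d. j < CHAR('k) ^ n \<longrightarrow> K * (n + 1) < d \<longrightarrow> coeff (P j) d = 0)"
proof -
  obtain P where P: "\<forall>j. special_series b j = fps_of_poly (P j) \<and> set (coeffs (P j)) \<subseteq> OV"
    "(\<lambda>j. real (degree (P j))) \<in> O(\<lambda>j. ln (real j))" using assms unfolding motivic_class_def by blast
  obtain K where K: "K \<ge> 1" "\<forall>n j. j < CHAR('k) ^ n \<longrightarrow> degree (P j) \<le> K * (n + 1)"
    using degree_log_bound[OF P(2) p2] by blast
  have "coeff (P j) d = (\<Sum>I | I \<in> nonzero_ideals A \<and> deg I = int d. emb (b I) * power_s1 I ^ j)" for j d
  proof -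
    have "fps_nth (special_series b j) d = coeff (P j) d" using P(1) by simp
    thus ?thesis unfolding special_series_def by simp
  qed
  moreover have "coeff (P j) d = 0" if "j < CHAR('k) ^ n" "K * (n + 1) < d" for n j d
    using K(2) that by (intro coeff_eq_0) (meson le_less_trans)
  ultimately show ?thesis using P(1) K(1) by blast
qed

lemma continues_essentially_algebraic:
  assumes b: "motivic_class b"
  shows "continues_essentially_algebraic b"
proof -
  obtain \<rho> where \<rho>: "0 \<le> \<rho>" "\<rho> < 1" "\<forall>I\<in>ac.ideals. nrm (br I - 1) \<le> \<rho>" using br_uniform by blast
  obtain C t where Ct: "C \<ge> 0" "t \<ge> 1" "\<forall>I\<in>nonzero_ideals A. nrm (emb (b I)) \<le> C * t ^ nat (deg I)"
    using coefficient_growth[OF b] by blast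
  obtain P K where P: "\<And>j d. coeff (P j) d = (\<Sum>I | I \<in> nonzero_ideals A \<and> deg I = int d. emb (b I) * power_s1 I ^ j)"
    and POV: "\<And>j. set (coeffs (P j)) \<subseteq> OV" and K: "K \<ge> 1"
    and van: "\<And>n j d. j < CHAR('k) ^ n \<Longrightarrow> K * (n + 1) < d \<Longrightarrow> coeff (P j) d = 0"
    using special_values[OF b] by metis
  define W where "W = (\<lambda>I y. one_unit_power nrm (br I) y)"
  have near: "nrm (1 / W I y - br I ^ j) \<le> \<rho> ^ (CHAR('k) ^ n)"
    if "I \<in> nonzero_ideals A" "y \<in> exponents CHAR('k) 1" "(int j + y n) mod int (CHAR('k) ^ n) = 0" for I y j n
  proof -
    have I: "I \<in> ac.ideals" using nonzero_ideals_ideals that by blast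
    have "nrm (1 / W I y - br I ^ j) \<le> nrm (br I - 1) ^ (CHAR('k) ^ n)"
      unfolding W_def by (rule pc.one_unit_power_reciprocal[OF br_nrm_less[OF I] that(2,3)])
    also have "\<dots> \<le> \<rho> ^ (CHAR('k) ^ n)" using \<rho>(3) I by (intro power_mono) auto
    finally show ?thesis .
  qed
  \<comment> \<open>In degree d, passing from \<open>power_s1\<close> to the 1-unit parts multiplies
    by a fixed power of \<open>\<pi>s\<close>, so vanishing coefficients stay zero.\<close>
  have scaled: "(\<Sum>I | I \<in> nonzero_ideals A \<and> deg I = int d. emb (b I) * br I ^ j) = coeff (P j) d * \<pi>s ^ (d * j)" for d j
    unfolding P sum_distrib_right by (rule sum.cong) (auto simp: power_s1_power mult.assoc)
  interpret ds: decaying_series nrm "CHAR('k)" 1 "nonzero_ideals A" deg "\<lambda>I. emb (b I)" W C t \<rho> K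
  proof
    show "finite {I \<in> nonzero_ideals A. deg I = int d}" for d by (rule degree_fibre_finite)
    show "I \<in> nonzero_ideals A \<Longrightarrow> nrm (emb (b I)) \<le> C * t ^ nat (deg I)" for I using Ct(3) by blast
    fix I y z n
    assume h: "I \<in> nonzero_ideals A" "y \<in> exponents CHAR('k) 1" "z \<in> exponents CHAR('k) 1" "y n = z n"
    define j where "j = nat (- y n mod int (CHAR('k) ^ n))"
    have j: "(int j + y n) mod int (CHAR('k) ^ n) = 0" unfolding j_def using exponent_complement(1)[of "CHAR('k) ^ n"] p0 by simp
    have "nrm (1 / W I y - br I ^ j) \<le> \<rho> ^ (CHAR('k) ^ n)" "nrm (1 / W I z - br I ^ j) \<le> \<rho> ^ (CHAR('k) ^ n)"
      using near[OF h(1,2) j] near[OF h(1,3)] j h(4) by auto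
    thus "nrm (1 / W I y - 1 / W I z) \<le> \<rho> ^ (CHAR('k) ^ n)"
      using pc.nrm_triangle[of "1 / W I y" "1 / W I z" "br I ^ j"] pc.nrm_diff_commute[of "1 / W I z"] by simp
  next
    fix y n d assume y: "y \<in> exponents CHAR('k) 1" and Kd: "K * (n + 1) < d"
    define j where "j = nat (- y n mod int (CHAR('k) ^ n))"
    have j: "(int j + y n) mod int (CHAR('k) ^ n) = 0" "j < CHAR('k) ^ n"
      unfolding j_def using exponent_complement[of "CHAR('k) ^ n"] p0 by auto
    \<comment> \<open>The coefficient at -j vanishes, so the coefficient at y equals the difference
      of the two, which \<open>near\<close> bounds term by term.\<close>
    have "(\<Sum>I | I \<in> nonzero_ideals A \<and> deg I = int d. emb (b I) * br I ^ j) = 0" unfolding scaled van[OF j(2) Kd] by simp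
    hence eq: "(\<Sum>I | I \<in> nonzero_ideals A \<and> deg I = int d. emb (b I) / W I y) =
        (\<Sum>I | I \<in> nonzero_ideals A \<and> deg I = int d. emb (b I) * (1 / W I y - br I ^ j))"
      by (simp add: right_diff_distrib sum_subtractf)
    show "nrm (\<Sum>I | I \<in> nonzero_ideals A \<and> deg I = int d. emb (b I) / W I y) \<le> C * t ^ d * \<rho> ^ (CHAR('k) ^ n)"
      unfolding eq
    proof (rule pc.nrm_sum_le)
      fix I assume I: "I \<in> {I. I \<in> nonzero_ideals A \<and> deg I = int d}"
      hence "nrm (emb (b I)) \<le> C * t ^ d" using Ct(3) by auto
      thus "nrm (emb (b I) * (1 / W I y - br I ^ j)) \<le> C * t ^ d * \<rho> ^ (CHAR('k) ^ n)"
        unfolding pc.nrm_mult using near[OF _ y j(1)] I Ct by (intro mult_mono) auto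
    qed (use Ct \<rho> in simp)
  qed (use p2 Ct \<rho> K deg_nonneg in auto)
  have T: "ds.T = L_term b" unfolding ds.T_def unfolding L_term_def power_at_def W_def ..
  have "continues_to nrm (exponents CHAR('k) 1) (nonzero_ideals A) deg (L_term b) ds.g"
    unfolding T[symmetric] by (rule ds.g_continues) (use b T in \<open>auto simp: motivic_class_def\<close>)
  moreover have "essentially_algebraic ds.g"
    unfolding essentially_algebraic_def
  proof
    fix j :: nat
    define y where "y = exponent_of_int CHAR('k) 1 (- int j)"
    have y: "y \<in> exponents CHAR('k) 1" unfolding y_def using exponent_of_int_in p0 by simp
    have yn: "(int j + y n) mod int (CHAR('k) ^ n) = 0" for n
      unfolding y_def exponent_of_int_def by (simp add: mod_add_right_eq)
    \<comment> \<open>At y = -j the approximation holds at every level n, so it is an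
      equality.\<close>
    have W: "1 / W I y = br I ^ j" if I: "I \<in> nonzero_ideals A" for I
      using pc.zero_if_all_small[OF \<rho>(1,2) p2 near[OF I y yn]] by simp
    have c: "ds.c d y = coeff (P j) d * \<pi>s ^ (d * j)" for d
      unfolding scaled[symmetric] ds.c_def
    proof (rule sum.cong)
      fix I assume "I \<in> {I. I \<in> nonzero_ideals A \<and> deg I = int d}"
      thus "emb (b I) / W I y = emb (b I) * br I ^ j" using W[of I] by (metis (no_types, lifting) mem_Collect_eq times_divide_eq_right mult.right_neutral)
    qed simp
    have "fps_at nrm (ds.g y) (1 / (\<pi>s ^ j * x)) = poly (P j) (1 / x)" if "x \<noteq> 0" for x
    proof (rule pc.fps_at_polynomial)
      fix i
      show "fps_nth (ds.g y) i * (1 / (\<pi>s ^ j * x)) ^ i = coeff (P j) i * (1 / x) ^ i"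
        unfolding ds.g_def fps_nth_Abs_fps c using pis_nonzero
        by (simp add: power_divide power_mult_distrib mult.commute flip: power_mult)
    qed
    moreover have "set (coeffs (P j)) \<subseteq> V" using POV unfolding OV_def by blast
    ultimately show "\<exists>P. set (coeffs P) \<subseteq> V \<and> (\<forall>x. x \<noteq> 0 \<longrightarrow>
        fps_at nrm (ds.g (exponent_of_int CHAR('k) 1 (- int j))) (1 / (\<pi>s ^ j * x)) = poly P (1 / x))"
      unfolding y_def by blast
  qed
  ultimately show ?thesis unfolding continues_essentially_algebraic_def using ds.g_entire by blast
qed

end

section \<open>The field \<open>\<V>\<close> and a Liouville inequality\<close>

context infinity_setting
begin

definition classes :: "'k set set" where
  "classes = (SOME \<M>. finite \<M> \<and> \<M> \<subseteq> ac.ideals \<and>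
     (\<forall>I\<in>ac.ideals. \<exists>M\<in>\<M>. \<exists>l u. positive_part l u \<and> I = scale l M))"

lemma classes_finite: "finite classes" and classes_ideals: "classes \<subseteq> ac.ideals"
  and class_exists: "I \<in> ac.ideals \<Longrightarrow> \<exists>M\<in>classes. \<exists>l u. positive_part l u \<and> I = scale l M"
proof -
  have "finite classes \<and> classes \<subseteq> ac.ideals \<and>
      (\<forall>I\<in>ac.ideals. \<exists>M\<in>classes. \<exists>l u. positive_part l u \<and> I = scale l M)"
    unfolding classes_def by (rule someI_ex[OF positive_classes])
  thus "finite classes" "classes \<subseteq> ac.ideals"
    "I \<in> ac.ideals \<Longrightarrow> \<exists>M\<in>classes. \<exists>l u. positive_part l u \<and> I = scale l M" by simp_all
qed

abbreviation generators :: "'c set" where "generators \<equiv> power_s1 ` classes"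

text \<open>A product of two generators is again \<open>power_s1\<close> of an ideal and so a
  k-multiple of a generator; therefore this span is a ring. It will turn out to be all of
  \<open>V\<close>, which is how \<open>V\<close> becomes finite over k.\<close>

definition V_span :: "'c set" where "V_span = {(\<Sum>e\<in>generators. emb (c e) * e) | c. True}"

lemma generators_finite: "finite generators"
  using classes_finite by simp

lemma power_s1_generator: "I \<in> ac.ideals \<Longrightarrow> \<exists>e\<in>generators. \<exists>l. power_s1 I = emb l * e"
proof -
  assume I: "I \<in> ac.ideals"
  obtain M l u where M: "M \<in> classes" "positive_part l u" "I = scale l M" using class_exists[OF I] by blast
  have "power_s1 I = emb l * power_s1 M" unfolding M(3) by (rule power_s1_scale[OF M(2) subsetD[OF classes_ideals M(1)]])
  thus ?thesis using M(1) by blast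
qed

lemma V_span_group: "add_subgroup V_span"
  unfolding add_subgroup_def
proof (intro conjI ballI)
  show "0 \<in> V_span" unfolding V_span_def by (intro CollectI exI[of _ "\<lambda>_. 0"]) simp
  fix x y assume "x \<in> V_span" "y \<in> V_span"
  then obtain c d where "x = (\<Sum>e\<in>generators. emb (c e) * e)" "y = (\<Sum>e\<in>generators. emb (d e) * e)"
    unfolding V_span_def by blast
  thus "x - y \<in> V_span" unfolding V_span_def
    by (intro CollectI exI[of _ "\<lambda>e. c e - d e"]) (simp add: pc.e.f_diff left_diff_distrib sum_subtractf)
qed

lemma V_span_generator: "e \<in> generators \<Longrightarrow> emb a * e \<in> V_span"
proof -
  assume e: "e \<in> generators"
  have "(\<Sum>e'\<in>generators. emb (if e' = e then a else 0) * e') = (\<Sum>e'\<in>generators. if e' = e then emb a * e else 0)"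
    by (rule sum.cong) auto
  also have "\<dots> = emb a * e" using e generators_finite by simp
  finally show ?thesis unfolding V_span_def by (intro CollectI exI[of _ "\<lambda>e'. if e' = e then a else 0"]) simp
qed

lemma V_span_scale: "x \<in> V_span \<Longrightarrow> emb a * x \<in> V_span"
proof -
  assume "x \<in> V_span"
  then obtain c where "x = (\<Sum>e\<in>generators. emb (c e) * e)" unfolding V_span_def by blast
  thus ?thesis unfolding V_span_def
    by (intro CollectI exI[of _ "\<lambda>e. a * c e"]) (simp add: sum_distrib_left pc.e.f_mult mult.assoc)
qed

lemma power_s1_V_span: "I \<in> ac.ideals \<Longrightarrow> power_s1 I \<in> V_span"
  using power_s1_generator V_span_generator by fastforce

lemma br_A: "br ac.A = 1"
proof -
  have "ideal_mult ac.A ac.A = ac.A" using ac.ideal_mult_principal[OF ac.A_ideal, of 1] by simp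
  hence "br ac.A * br ac.A = br ac.A" using br_mult[OF ac.A_ideal ac.A_ideal] by simp
  thus ?thesis using br_nonzero[OF ac.A_ideal] by simp
qed

lemma deg_A: "deg ac.A = 0"
  using ac.deg_principal[of 1] ac.ord_one[OF place_infinity] unfolding deg_def by simp

lemma power_s1_A: "power_s1 ac.A = 1"
  unfolding power_s1_def br_A deg_A by simp

lemma V_span_ring: "is_subring V_span"
  unfolding is_subring_def
proof (intro conjI ballI)
  show "1 \<in> V_span" using power_s1_V_span[OF ac.A_ideal] power_s1_A by simp
  fix x y assume x: "x \<in> V_span" and y: "y \<in> V_span"
  show "x - y \<in> V_span" by (rule add_subgroup_diff[OF V_span_group x y])
  obtain c d where c: "x = (\<Sum>e\<in>generators. emb (c e) * e)" and d: "y = (\<Sum>e\<in>generators. emb (d e) * e)"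
    using x y unfolding V_span_def by blast
  have "e * e' \<in> V_span" if e: "e \<in> generators" "e' \<in> generators" for e e'
  proof -
    obtain M M' where M: "M \<in> ac.ideals" "e = power_s1 M" "M' \<in> ac.ideals" "e' = power_s1 M'"
      using e classes_ideals by blast
    show ?thesis using power_s1_V_span[OF ac.ideal_mult_ideal(1)[OF M(1,3)]] power_s1_mult[OF M(1,3)] M by simp
  qed
  hence "(\<Sum>e\<in>generators. \<Sum>e'\<in>generators. emb (c e * d e') * (e * e')) \<in> V_span"
    by (intro add_subgroup_sum[OF V_span_group] V_span_scale)
  moreover have "x * y = (\<Sum>e\<in>generators. \<Sum>e'\<in>generators. emb (c e * d e') * (e * e'))"
    unfolding c d sum_product by (simp add: pc.e.f_mult ac_simps)
  ultimately show "x * y \<in> V_span" by simp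
qed

lemma emb_V_span: "emb a \<in> V_span"
  using V_span_scale[OF subring_one[OF V_span_ring], of a] by simp

section \<open>Heights on the span, and relations found by counting\<close>

lemma common_denominator: "finite X \<Longrightarrow> \<exists>g\<in>ac.A. g \<noteq> 0 \<and> (\<forall>e\<in>X. g * c e \<in> ac.A)"
proof (induction X rule: finite_induct)
  case empty
  show ?case using subring_one[OF ac.A_ring] by (intro bexI[of _ 1]) auto
next
  case (insert x X)
  then obtain g where g: "g \<in> ac.A" "g \<noteq> 0" "\<forall>e\<in>X. g * c e \<in> ac.A" by blast
  obtain h where h: "h \<in> ac.A" "h \<noteq> 0" "h * c x \<in> ac.A" using ac.fraction by blast
  have "h * (g * c e) \<in> ac.A" if "e \<in> X" for e using g h that subring_mult[OF ac.A_ring] by blast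
  moreover have "g * (h * c x) \<in> ac.A" using g h subring_mult[OF ac.A_ring] by blast
  moreover have "g * h \<in> ac.A" using g h subring_mult[OF ac.A_ring] by blast
  ultimately show ?case using g h by (intro bexI[of _ "g * h"]) (auto simp: ac_simps)
qed

lemma A_finite_subset: "finite X \<Longrightarrow> X \<subseteq> ac.A \<Longrightarrow> \<exists>D. X \<subseteq> ac.L D"
proof (induction X rule: finite_induct)
  case (insert x X)
  then obtain D where D: "X \<subseteq> ac.L D" by auto
  obtain E where E: "x \<in> ac.L E" using ac.A_L insert.prems by blast
  have "insert x X \<subseteq> ac.L (max D E)" using D E ac.L_mono[of D "max D E"] ac.L_mono[of E "max D E"] by auto
  thus ?case by blast
qed simp

text \<open>The height on the span is measured by the pole order at infinity of coefficients in
  \<open>A\<close>.\<close>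

sublocale fs: filtered_span "\<lambda>D. emb ` ac.L D" generators V_span
proof
  show "emb ` ac.L D \<subseteq> V_span" for D using emb_V_span by blast
  show "generators \<subseteq> V_span" using power_s1_V_span classes_ideals by blast
  have "1 \<in> ac.L 0" using ac.L_0 subring_one[OF ac.Fr_ring] by simp
  thus "1 \<in> emb ` ac.L 0" by (intro image_eqI[of _ _ 1]) auto
  show "emb ` ac.L D \<subseteq> emb ` ac.L (Suc D)" for D using ac.L_mono[of D "Suc D"] by (intro image_mono) auto
  fix x y D
  assume x: "x \<in> emb ` ac.L D"
  show "x - y \<in> emb ` ac.L D" if "y \<in> emb ` ac.L D"
  proof -
    obtain a b where ab: "x = emb a" "a \<in> ac.L D" "y = emb b" "b \<in> ac.L D" using x \<open>y \<in> emb ` ac.L D\<close> by blast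
    hence "x - y = emb (a - b)" by (simp add: pc.e.f_diff)
    thus ?thesis using add_subgroup_diff[OF ac.L_group ab(2,4)] by blast
  qed
  show "x * y \<in> emb ` ac.L (D + E)" if "y \<in> emb ` ac.L E" for E
  proof -
    obtain a b where ab: "x = emb a" "a \<in> ac.L D" "y = emb b" "b \<in> ac.L E" using x \<open>y \<in> emb ` ac.L E\<close> by blast
    hence "x * y = emb (a * b)" by (simp add: pc.e.f_mult)
    thus ?thesis using ac.L_mult[OF ab(2,4)] by blast
  qed
next
  fix x assume "x \<in> V_span"
  then obtain c where c: "x = (\<Sum>e\<in>generators. emb (c e) * e)" unfolding V_span_def by blast
  obtain g where g: "g \<in> ac.A" "g \<noteq> 0" "\<forall>e\<in>generators. g * c e \<in> ac.A"
    using common_denominator[OF generators_finite] by blast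
  obtain D where D: "insert g ((\<lambda>e. g * c e) ` generators) \<subseteq> ac.L D"
    using A_finite_subset[of "insert g ((\<lambda>e. g * c e) ` generators)"] generators_finite g by auto
  have "emb g * x = (\<Sum>e\<in>generators. emb (g * c e) * e)"
    unfolding c by (simp add: sum_distrib_left pc.e.f_mult mult.assoc)
  moreover have "emb g \<in> emb ` ac.L D" "\<forall>e\<in>generators. emb (g * c e) \<in> emb ` ac.L D" using D by auto
  moreover have "emb g \<noteq> 0" using g(2) pc.e.f_eq_zero by simp
  ultimately show "\<exists>D g p. g \<in> emb ` ac.L D \<and> g \<noteq> 0 \<and> (\<forall>e\<in>generators. p e \<in> emb ` ac.L D) \<and>
      g * x = (\<Sum>e\<in>generators. p e * e)"
    by (intro exI[of _ D] exI[of _ "emb g"] exI[of _ "\<lambda>e. emb (g * c e)"]) simp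
qed (use V_span_ring generators_finite ac.L_finite in auto)

lemma card_emb: "card (emb ` X) = card X"
  by (rule card_image) (rule inj_on_subset[OF pc.e.f_inj], simp)

text \<open>By the exact growth of \<open>L\<close> both sides are powers of q times powers of the
  size of \<open>L N0\<close>; with m = k n + 1 the comparison is decided by q^(k n) < q^m.\<close>

lemma L_room: "card (ac.L (ac.N0 + (k * n + 1) + k)) ^ n < card (ac.L (ac.N0 + (k * n + 1))) ^ (n + 1)"
proof -
  define c0 m where "c0 = card (ac.L ac.N0)" and "m = k * n + 1"
  have c0: "c0 > 0" unfolding c0_def by (rule ac.L_card_pos)
  have q2: "ac.q \<ge> 2"
    using power_increasing[of 1 "place_degree Fr Oi" "card Fr"] ac.Fr_card d_pos by auto
  have q_less: "ac.q ^ (k * n) < ac.q ^ m"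
    unfolding m_def by (rule power_strict_increasing) (use q2 in linarith)+
  have "ac.q > 0" using q2 by linarith
  hence pos: "ac.q ^ (m * n) * c0 ^ n > 0" using c0 by (metis mult_pos_pos zero_less_power)
  have "card (ac.L (ac.N0 + m + k)) ^ n = (ac.q ^ (m + k) * c0) ^ n"
    unfolding c0_def using ac.L_card_eq[of "m + k"] by (simp add: add.assoc)
  also have "\<dots> = ac.q ^ (m * n) * c0 ^ n * ac.q ^ (k * n)"
    by (simp add: power_mult_distrib power_add power_mult ac_simps)
  also have "\<dots> < ac.q ^ (m * n) * c0 ^ n * ac.q ^ m"
    by (rule mult_strict_left_mono[OF q_less pos])
  also have "\<dots> \<le> ac.q ^ (m * n) * c0 ^ n * ac.q ^ m * c0" using c0 by simp
  also have "\<dots> = (ac.q ^ m * c0) ^ (n + 1)" by (simp add: power_mult_distrib power_mult ac_simps)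
  also have "\<dots> = card (ac.L (ac.N0 + m)) ^ (n + 1)" unfolding c0_def using ac.L_card_eq[of m] by simp
  finally show ?thesis unfolding m_def .
qed

text \<open>The generators may themselves be dependent; counting bounds the dimension over k by
  their number all the same.\<close>

lemma V_linear_relation:
  assumes y: "\<And>j. j \<le> card generators \<Longrightarrow> y j \<in> V_span"
  shows "\<exists>a. (\<exists>j\<le>card generators. a j \<noteq> 0) \<and> (\<Sum>j\<le>card generators. emb (a j) * y j) = 0"
proof -
  let ?n = "card generators"
  have "y ` {..?n} \<subseteq> V_span" using y by auto
  from fs.common_den[OF finite_imageI[OF finite_atMost] this]
  obtain D g where g: "g \<noteq> 0" "\<forall>z\<in>y ` {..?n}. g * z \<in> fs.U D" by blast
  obtain c where c: "\<forall>i\<le>?n. c i \<in> emb ` ac.L (ac.N0 + (D * ?n + 1))" "\<exists>i\<le>?n. c i \<noteq> 0"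
    "(\<Sum>i\<le>?n. c i * (g * y i)) = 0"
    using fs.small_relation[of ?n "\<lambda>i. g * y i" D "ac.N0 + (D * ?n + 1)"] g(2) L_room[of D ?n]
    unfolding card_emb by auto
  have "\<forall>i\<in>{..?n}. \<exists>a. c i = emb a" using c(1) by blast
  from bchoice[OF this] obtain a where a: "\<forall>i\<in>{..?n}. c i = emb (a i)" ..
  have "(\<Sum>i\<le>?n. c i * (g * y i)) = g * (\<Sum>i\<le>?n. emb (a i) * y i)"
    using a by (simp add: sum_distrib_left ac_simps)
  hence "(\<Sum>i\<le>?n. emb (a i) * y i) = 0" using c(3) g(1) by simp
  moreover have "\<exists>j\<le>?n. a j \<noteq> 0" using c(2) a by auto
  ultimately show ?thesis by blast
qed

text \<open>The multiple \<open>a\<close> is the lowest nonzero coefficient of an equation for \<open>e\<close> found by counting.\<close>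

lemma bounded_multiple:
  "\<exists>K. \<forall>E e. e \<in> fs.U E \<longrightarrow> e \<noteq> 0 \<longrightarrow> (\<exists>a\<in>ac.L (K * (E + 1)). a \<noteq> 0 \<and>
     (\<exists>d N. (\<forall>i<(N::nat). d i \<in> ac.A) \<and> emb a = e * (\<Sum>i<N. emb (d i) * e ^ i)))"
proof -
  define n where "n = card generators"
  obtain K1 where K1: "\<forall>E R e. e \<in> fs.U E \<longrightarrow>
     card (emb ` ac.L (R + K1 * (E + 1))) ^ n < card (emb ` ac.L R) ^ (n + 1) \<longrightarrow>
     (\<exists>c. (\<forall>i\<le>n. c i \<in> emb ` ac.L R) \<and> (\<exists>i\<le>n. c i \<noteq> 0) \<and> (\<Sum>i\<le>n. c i * e ^ i) = 0)"
    using fs.power_relation unfolding n_def by blast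
  \<comment> \<open>Makes the bound N0 + K1 * (E + 1) * n + 1 on the coefficients of the equation at
    most K * (E + 1).\<close>
  define K where "K = ac.N0 + n * K1 + 1"
  have "\<exists>a\<in>ac.L (K * (E + 1)). a \<noteq> 0 \<and>
     (\<exists>d N. (\<forall>i<(N::nat). d i \<in> ac.A) \<and> emb a = e * (\<Sum>i<N. emb (d i) * e ^ i))"
    if e: "e \<in> fs.U E" "e \<noteq> 0" for E e
  proof -
    define k where "k = K1 * (E + 1)"
    define m where "m = k * n + 1"
    define R where "R = ac.N0 + m"
    have "card (emb ` ac.L (R + K1 * (E + 1))) ^ n < card (emb ` ac.L R) ^ (n + 1)"
      unfolding card_emb R_def m_def k_def[symmetric] by (rule L_room)
    then obtain c where c: "\<forall>i\<le>n. c i \<in> emb ` ac.L R" "\<exists>i\<le>n. c i \<noteq> 0" "(\<Sum>i\<le>n. c i * e ^ i) = 0"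
      using K1[rule_format, OF e(1)] by blast
    have "\<forall>i\<in>{..n}. \<exists>a. a \<in> ac.L R \<and> c i = emb a" using c(1) by auto
    from bchoice[OF this] obtain a where a: "\<forall>i\<in>{..n}. a i \<in> ac.L R \<and> c i = emb (a i)" ..
    define i0 where "i0 = (LEAST i. i \<le> n \<and> c i \<noteq> 0)"
    have i0: "i0 \<le> n" "c i0 \<noteq> 0" using LeastI_ex[OF c(2)] unfolding i0_def by auto
    have below: "c i = 0" if "i < i0" for i
      using not_less_Least[of i "\<lambda>i. i \<le> n \<and> c i \<noteq> 0"] that i0(1) unfolding i0_def by auto
    have ai: "a i0 \<in> ac.L R" "c i0 = emb (a i0)" using a i0 by auto
    hence a0: "a i0 \<noteq> 0" using i0 by auto
    define N where "N = n - i0"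
    define d where "d i = - a (i0 + 1 + i)" for i
    have dA: "d i \<in> ac.A" if i: "i < N" for i
    proof -
      have "i0 + 1 + i \<in> {..n}" using i unfolding N_def by auto
      hence "a (i0 + 1 + i) \<in> ac.A" using a unfolding ac.L_def by blast
      thus ?thesis unfolding d_def by (rule subring_minus[OF ac.A_ring])
    qed
    have "0 = (\<Sum>i\<in>{i0..n}. c i * e ^ i)"
      unfolding c(3)[symmetric] by (rule sum.mono_neutral_right) (use below in \<open>auto simp: not_le\<close>)
    also have "\<dots> = c i0 * e ^ i0 + (\<Sum>i\<in>{Suc i0..n}. c i * e ^ i)" using i0(1) by (simp add: sum.atLeast_Suc_atMost)
    also have "(\<Sum>i\<in>{Suc i0..n}. c i * e ^ i) = (\<Sum>i<N. c (i0 + 1 + i) * e ^ (i0 + 1 + i))"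
      by (rule sum.reindex_bij_witness[of _ "\<lambda>i. i0 + 1 + i" "\<lambda>i. i - (i0 + 1)"]) (auto simp: N_def)
    also have "\<dots> = (\<Sum>i<N. - (emb (d i) * e ^ i * e ^ (i0 + 1)))"
    proof (rule sum.cong)
      fix i assume "i \<in> {..<N}"
      hence "i0 + 1 + i \<in> {..n}" unfolding N_def by auto
      hence "c (i0 + 1 + i) = - emb (d i)" using a unfolding d_def by (simp add: pc.e.f_minus)
      thus "c (i0 + 1 + i) * e ^ (i0 + 1 + i) = - (emb (d i) * e ^ i * e ^ (i0 + 1))"
        by (simp add: power_add ac_simps)
    qed simp
    also have "\<dots> = - ((\<Sum>i<N. emb (d i) * e ^ i) * e ^ (i0 + 1))" by (simp add: sum_negf sum_distrib_right)
    finally have "c i0 * e ^ i0 = (e * (\<Sum>i<N. emb (d i) * e ^ i)) * e ^ i0" by (simp add: ac_simps)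
    hence "emb (a i0) = e * (\<Sum>i<N. emb (d i) * e ^ i)" using e(2) ai(2) by simp
    moreover have "R \<le> K * (E + 1)" unfolding R_def m_def k_def K_def by (simp add: algebra_simps)
    hence "a i0 \<in> ac.L (K * (E + 1))" using ai(1) ac.L_mono by blast
    ultimately show ?thesis using a0 dA by blast
  qed
  thus ?thesis by blast
qed

text \<open>By \<open>bounded_multiple\<close>, applied to a multiple g x with coefficients in
  \<open>A\<close>, a nonzero element of k is divisible by g x within the ring, which inverts
  x.\<close>

lemma V_span_field: "is_subfield V_span"
  unfolding is_subfield_def
proof (intro conjI ballI V_span_ring)
  fix x assume x: "x \<in> V_span"
  show "inverse x \<in> V_span"
  proof (cases "x = 0")
    case True
    thus ?thesis using x by simp
  next
    case False
    obtain D g where g: "g \<in> emb ` ac.L D" "g \<noteq> 0" "g * x \<in> fs.U D" using fs.common_den[of "{x}"] x by auto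
    obtain b where b: "g = emb b" using g by blast
    have gx: "g * x \<noteq> 0" "g * x \<in> V_span" using g(2) False V_span_scale[OF x] b by auto
    obtain K where K: "\<forall>E e. e \<in> fs.U E \<longrightarrow> e \<noteq> 0 \<longrightarrow> (\<exists>a\<in>ac.L (K * (E + 1)). a \<noteq> 0 \<and>
     (\<exists>d N. (\<forall>i<(N::nat). d i \<in> ac.A) \<and> emb a = e * (\<Sum>i<N. emb (d i) * e ^ i)))" using bounded_multiple by blast
    obtain a d and N :: nat where a: "a \<noteq> 0" "emb a = g * x * (\<Sum>i<N. emb (d i) * (g * x) ^ i)"
      using K[rule_format, OF g(3) gx(1)] by blast
    define r where "r = (\<Sum>i<N. emb (d i) * (g * x) ^ i)"
    have "r \<in> V_span" unfolding r_def
      using gx(2) by (intro add_subgroup_sum[OF V_span_group] V_span_scale subring_power[OF V_span_ring])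
    hence "emb (inverse a * b) * r \<in> V_span" by (rule V_span_scale)
    moreover have ea: "emb a = g * x * r" unfolding r_def by (rule a(2))
    have "emb a \<noteq> 0" using a(1) pc.e.f_eq_zero[of a] by blast
    hence "r \<noteq> 0" unfolding ea by auto
    hence "g * r / (g * x * r) = inverse x" using g(2) by (simp add: field_simps)
    hence "emb (inverse a * b) * r = inverse x"
      unfolding pc.e.f_mult[OF UNIV_I UNIV_I] pc.e.f_inverse[OF UNIV_I] ea b[symmetric]
      by (simp add: divide_inverse ac_simps)
    ultimately show ?thesis by simp
  qed
qed

lemma V_eq: "V = V_span"
proof
  have "range emb \<union> power_s1 ` fractional_ideals A \<subseteq> V_span"
    using emb_V_span power_s1_V_span unfolding A_def by blast
  thus "V \<subseteq> V_span" unfolding V_def by (intro hull_minimal V_span_field)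
  have Vf: "is_subfield V" unfolding V_def by (rule subfield_hull)
  have gen: "emb a \<in> V" "I \<in> ac.ideals \<Longrightarrow> power_s1 I \<in> V" for a I
    unfolding V_def A_def by (auto intro!: hull_inc)
  show "V_span \<subseteq> V"
  proof
    fix x assume "x \<in> V_span"
    then obtain c where "x = (\<Sum>e\<in>generators. emb (c e) * e)" unfolding V_span_def by blast
    thus "x \<in> V" using gen classes_ideals
      by (auto intro!: subring_sum[OF subfield_subring[OF Vf]] subring_mult[OF subfield_subring[OF Vf]])
  qed
qed

lemma V_field: "is_subfield V"
  unfolding V_eq by (rule V_span_field)

lemma emb_V: "emb a \<in> V" and power_s1_V: "I \<in> ac.ideals \<Longrightarrow> power_s1 I \<in> V"
  unfolding V_eq by (rule emb_V_span) (rule power_s1_V_span)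

text \<open>The pole order at \<open>Oi\<close> is proportional to the logarithm of the absolute
  value, so growth exponential in d means pole order linear in d.\<close>

lemma bounded_nrm_L:
  assumes C: "C \<ge> 0" and t: "t \<ge> 0"
  shows "\<exists>K. \<forall>d a. a \<in> ac.A \<longrightarrow> nrm (emb a) \<le> C * t ^ d \<longrightarrow> a \<in> ac.L (K * (d + 1))"
proof -
  define B where "B = C + t + 1"
  have B: "B \<ge> 1" "C \<le> B" "t \<le> B" unfolding B_def using C t by auto
  obtain k where k: "pc.\<kappa> ^ k < 1 / B" using real_arch_pow_inv[of "1 / B" pc.\<kappa>] pc.\<kappa> B by auto
  have "a \<in> ac.L (k * (d + 1))" if a: "a \<in> ac.A" "nrm (emb a) \<le> C * t ^ d" for a d
  proof (cases "a = 0")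
    case True
    thus ?thesis using add_subgroup_zero[OF ac.L_group] by simp
  next
    case False
    have Bk: "B \<le> inverse pc.\<kappa> ^ k" using k pc.\<kappa> B by (simp add: power_inverse field_simps)
    have "pc.\<kappa> powi ord_elem Oi a \<le> C * t ^ d" using a(2) pc.nrm_emb[OF False] by simp
    also have "\<dots> \<le> B * B ^ d" using B C t by (intro mult_mono power_mono) auto
    also have "\<dots> = B ^ (d + 1)" by simp
    also have "\<dots> \<le> (inverse pc.\<kappa> ^ k) ^ (d + 1)" using Bk B by (intro power_mono) auto
    also have "\<dots> = pc.\<kappa> powi (- int (k * (d + 1)))"
      by (simp only: power_int_minus power_int_of_nat power_inverse power_mult)
    finally have "\<not> ord_elem Oi a < - int (k * (d + 1))"
      using power_int_strict_decreasing[of "ord_elem Oi a" "- int (k * (d + 1))" pc.\<kappa>] pc.\<kappa> by linarith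
    thus ?thesis unfolding ac.L_def ac.fpower_def using a(1) by auto
  qed
  thus ?thesis by blast
qed

text \<open>In I = lM the factor l may have denominators. With a fixed nonzero m in M the product l
  m lies in I, hence in \<open>A\<close>, and the remaining factor, the j-th power of
  \<open>power_s1 M\<close> over m, takes finitely many values with a common denominator.\<close>

lemma term_height:
  assumes b: "motivic_class b"
  shows "\<exists>g\<in>ac.A. g \<noteq> 0 \<and> (\<exists>K. \<forall>d I. I \<in> nonzero_ideals A \<longrightarrow> deg I = int d \<longrightarrow>
    emb g * (emb (b I) * power_s1 I ^ j) \<in> fs.U (K * (d + 1)))"
proof -
  obtain C t where Ct: "C \<ge> 0" "t \<ge> 1" "\<forall>I\<in>nonzero_ideals A. nrm (emb (b I)) \<le> C * t ^ nat (deg I)"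
    using coefficient_growth[OF b] by blast
  have "\<forall>M\<in>classes. \<exists>x. x \<in> M \<and> x \<noteq> 0" using ac.ideal_nonzero classes_ideals by blast
  from bchoice[OF this] obtain m where m: "\<forall>M\<in>classes. m M \<in> M \<and> m M \<noteq> 0" ..
  define w where "w M = (power_s1 M / emb (m M)) ^ j" for M
  have "w ` classes \<subseteq> V_span"
    unfolding w_def using power_s1_V_span classes_ideals emb_V_span
    by (auto intro!: subring_power[OF V_span_ring] subfield_divide[OF V_span_field])
  then obtain D g where g: "g \<in> emb ` ac.L D" "g \<noteq> 0" "\<forall>z\<in>w ` classes. g * z \<in> fs.U D"
    using fs.common_den[of "w ` classes"] classes_finite by auto
  obtain g' where g': "g = emb g'" "g' \<in> ac.L D" using g(1) by blast
  define B where "B = (\<Sum>M\<in>classes. nrm (emb (m M)) / nrm (power_s1 M))"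
  have B: "B \<ge> 0" unfolding B_def by (simp add: sum_nonneg)
  define s where "s = inverse (nrm \<pi>s)"
  have s: "s \<ge> 0" unfolding s_def using pis_nrm by simp
  obtain K where K: "\<forall>d a. a \<in> ac.A \<longrightarrow> nrm (emb a) \<le> C * B ^ j * (t * s ^ j) ^ d \<longrightarrow> a \<in> ac.L (K * (d + 1))"
    using bounded_nrm_L[of "C * B ^ j" "t * s ^ j"] Ct B s by auto
  have "emb g' * (emb (b I) * power_s1 I ^ j) \<in> fs.U ((K + D) * (d + 1))"
    if I: "I \<in> nonzero_ideals A" "deg I = int d" for I d
  proof -
    have II: "I \<in> ac.ideals" "I \<subseteq> ac.A" using nonzero_ideals_ideals[OF I(1)] by auto
    obtain M l u where M: "M \<in> classes" "positive_part l u" "I = scale l M" using class_exists[OF II(1)] by blast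
    have MI: "M \<in> ac.ideals" using M(1) classes_ideals by blast
    have pI: "power_s1 I = emb l * power_s1 M" unfolding M(3) by (rule power_s1_scale[OF M(2) MI])
    have m0: "m M \<in> M" "m M \<noteq> 0" "emb (m M) \<noteq> 0" using m M(1) pc.e.f_eq_zero by auto
    define a where "a = b I * (l * m M) ^ j"
    have "l * m M \<in> ac.A" using m0(1) II(2) unfolding M(3) by blast
    moreover have "b I \<in> ac.A" using b I(1) unfolding motivic_class_def A_def by blast
    ultimately have aA: "a \<in> ac.A" unfolding a_def using subring_mult[OF ac.A_ring] subring_power[OF ac.A_ring] by blast
    have "nrm (power_s1 I) = s ^ d"
      unfolding power_s1_def pc.nrm_mult pc.nrm_power_int br_nrm[OF II(1)] I(2) s_def
      by (simp add: power_int_minus power_inverse)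
    hence "nrm (emb l) * nrm (power_s1 M) = s ^ d" unfolding pI pc.nrm_mult .
    hence "nrm (emb l) = s ^ d / nrm (power_s1 M)"
      using pc.nrm_pos[OF power_s1_nonzero[OF MI]] by (metis less_irrefl nonzero_eq_divide_eq)
    hence "nrm (emb (l * m M)) = s ^ d * (nrm (emb (m M)) / nrm (power_s1 M))" by (simp add: pc.e.f_mult pc.nrm_mult)
    also have "\<dots> \<le> s ^ d * B"
      unfolding B_def using M(1) classes_finite s by (intro mult_left_mono member_le_sum) auto
    finally have lm: "nrm (emb (l * m M)) \<le> s ^ d * B" .
    have "nrm (emb (b I)) \<le> C * t ^ d" using Ct(3) I by auto
    moreover have "nrm (emb a) = nrm (emb (b I)) * nrm (emb (l * m M)) ^ j"
      unfolding a_def pc.e.f_mult[OF UNIV_I UNIV_I, of "b I"] pc.e.f_power[OF UNIV_I, of "l * m M"]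
        pc.nrm_mult pc.nrm_power ..
    ultimately have "nrm (emb a) \<le> (C * t ^ d) * (s ^ d * B) ^ j"
      using lm Ct by (simp only:) (intro mult_mono power_mono, auto)
    also have "\<dots> = C * B ^ j * (t * s ^ j) ^ d" by (simp add: power_mult_distrib ac_simps flip: power_mult)
    finally have "a \<in> ac.L (K * (d + 1))" using K aA by blast
    hence "emb a \<in> emb ` ac.L (K * (d + 1))" by blast
    moreover have "g * w M \<in> fs.U D" using g(3) M(1) by blast
    ultimately have "emb a * (g * w M) \<in> fs.U (K * (d + 1) + D)" by (rule fs.L_U_mult)
    moreover have "emb a * (g * w M) = emb g' * (emb (b I) * power_s1 I ^ j)"
      unfolding a_def w_def pI g'(1) using m0(3)
      by (simp add: pc.e.f_mult pc.e.f_power power_mult_distrib power_divide field_simps)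
    ultimately have "emb g' * (emb (b I) * power_s1 I ^ j) \<in> fs.U (K * (d + 1) + D)" by (simp only:)
    moreover have "K * (d + 1) + D \<le> (K + D) * (d + 1)" by (simp add: algebra_simps)
    ultimately show ?thesis using subsetD[OF fs.U_mono] by blast
  qed
  moreover have "g' \<noteq> 0" using g(2) g'(1) by auto
  ultimately show ?thesis using g'(2) unfolding ac.L_def by blast
qed

end



section \<open>The setting at a prime\<close>

context infinity_setting
begin

section \<open>Powers of ideals and bounds for zeros, in preparation for the places at v\<close>

primrec ideal_power :: "'k set \<Rightarrow> nat \<Rightarrow> 'k set" where
  "ideal_power I 0 = ac.A"
| "ideal_power I (Suc n) = ideal_mult I (ideal_power I n)"

lemma ideal_power_ideal: "I \<in> ac.ideals \<Longrightarrow> ideal_power I n \<in> ac.ideals"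
  by (induction n) (auto simp: ac.A_ideal ac.ideal_mult_ideal(1))

lemma power_s1_ideal_power: "I \<in> ac.ideals \<Longrightarrow> power_s1 (ideal_power I n) = power_s1 I ^ n"
  by (induction n) (simp_all add: power_s1_A power_s1_mult ideal_power_ideal)

lemma ord_ideal_power:
  "I \<in> ac.ideals \<Longrightarrow> ac.finite_place P \<Longrightarrow> ord_ideal P (ideal_power I n) = int n * ord_ideal P I"
proof (induction n)
  case 0
  thus ?case using ac.ord_A by simp
next
  case (Suc n)
  thus ?case using ac.ord_ideal_mult[OF Suc.prems(1) ideal_power_ideal[OF Suc.prems(1)] Suc.prems(2)]
    by (simp add: algebra_simps)
qed

text \<open>Two powers of I fall into the same narrow class, so some power of
  \<open>power_s1 I\<close> comes from k. This fixes its absolute value under every embedding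
  \<sigma>.\<close>

lemma power_of_s1_in_field:
  assumes I: "I \<in> ac.ideals"
  shows "\<exists>n l. n > 0 \<and> l \<noteq> 0 \<and> power_s1 I ^ n = emb l \<and>
    (\<forall>P. ac.finite_place P \<longrightarrow> ord_elem P l = int n * ord_ideal P I)"
proof -
  have "\<forall>n. \<exists>M. M \<in> classes \<and> (\<exists>l u. positive_part l u \<and> ideal_power I n = scale l M)"
    using class_exists[OF ideal_power_ideal[OF I]] by blast
  from choice[OF this] obtain M where M: "\<forall>n. M n \<in> classes \<and> (\<exists>l u. positive_part l u \<and> ideal_power I n = scale l (M n))" ..
  have "finite (range M)" using M classes_finite by (meson finite_subset image_subsetI)
  hence "\<not> inj M" using finite_imageD infinite_UNIV_nat by blast
  then obtain a b where ab: "a < b" "M a = M b" unfolding inj_def by (metis linorder_neqE_nat)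
  obtain l u where l: "positive_part l u" "ideal_power I a = scale l (M a)" using M by blast
  obtain l' u' where l': "positive_part l' u'" "ideal_power I b = scale l' (M a)" using M ab(2) by metis
  have MI: "M a \<in> ac.ideals" using M classes_ideals by blast
  have l0: "l \<noteq> 0" "l' \<noteq> 0" using positive_partD(1) l(1) l'(1) by blast+
  have 1: "power_s1 I ^ a = emb l * power_s1 (M a)"
    using power_s1_scale[OF l(1) MI] l(2) power_s1_ideal_power[OF I, of a] by simp
  have 2: "power_s1 I ^ b = emb l' * power_s1 (M a)"
    using power_s1_scale[OF l'(1) MI] l'(2) power_s1_ideal_power[OF I, of b] by simp
  have "power_s1 I ^ b = power_s1 I ^ (b - a) * power_s1 I ^ a" using ab(1) by (simp flip: power_add)
  hence "power_s1 I ^ (b - a) * emb l = emb l'" using 1 2 power_s1_nonzero[OF MI] by simp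
  moreover have "emb l \<noteq> 0" using l0 pc.e.f_eq_zero by simp
  ultimately have "power_s1 I ^ (b - a) = emb (l' / l)" by (simp add: pc.e.f_divide field_simps)
  moreover have "ord_elem P (l' / l) = int (b - a) * ord_ideal P I" if P: "ac.finite_place P" for P
  proof -
    have "int a * ord_ideal P I = ord_elem P l + ord_ideal P (M a)"
      using ord_ideal_power[OF I P, of a] ac.ord_scale[OF MI l0(1) P] l(2) by simp
    moreover have "int b * ord_ideal P I = ord_elem P l' + ord_ideal P (M a)"
      using ord_ideal_power[OF I P, of b] ac.ord_scale[OF MI l0(2) P] l'(2) by simp
    ultimately show ?thesis using P l0 ac.ord_divide[of P l' l] ab(1) by (simp add: of_nat_diff left_diff_distrib)
  qed
  ultimately show ?thesis using ab(1) l0 by (intro exI[of _ "b - a"] exI[of _ "l' / l"]) auto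
qed

text \<open>The prime field is an additive subgroup of \<open>Fr\<close>, so Lagrange's theorem
  applies.\<close>

lemma CHAR_dvd_card: "CHAR('k) dvd card Fr"
proof -
  define G where "G = range (of_nat :: nat \<Rightarrow> 'k)"
  note cp = of_nat_CHAR[where ?'a = 'k]
  have G: "add_subgroup G"
    unfolding add_subgroup_def
  proof (intro conjI ballI)
    show "0 \<in> G" unfolding G_def by (intro image_eqI[of _ _ 0]) auto
    fix x y assume "x \<in> G" "y \<in> G"
    then obtain i j where ij: "x = of_nat i" "y = of_nat j" unfolding G_def by blast
    have "of_nat (i + j * (CHAR('k) - 1)) = (of_nat i + of_nat j * (of_nat CHAR('k) - 1) :: 'k)"
      using p0 by (simp add: of_nat_diff)
    also have "\<dots> = x - y" unfolding ij cp by simp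
    finally show "x - y \<in> G" unfolding G_def by (metis rangeI)
  qed
  have GF: "G \<subseteq> Fr"
  proof
    fix x assume "x \<in> G"
    then obtain n where "x = of_nat n" unfolding G_def by blast
    moreover have "of_nat n \<in> Fr" for n
      by (induction n) (auto intro: subring_zero[OF ac.Fr_ring] subring_one[OF ac.Fr_ring] subring_add[OF ac.Fr_ring])
    ultimately show "x \<in> Fr" by simp
  qed
  have "G = of_nat ` {..<CHAR('k)}"
  proof
    show "G \<subseteq> of_nat ` {..<CHAR('k)}"
    proof
      fix x assume "x \<in> G"
      then obtain n where n: "x = of_nat n" unfolding G_def by blast
      have "of_nat n = (of_nat (n mod CHAR('k) + CHAR('k) * (n div CHAR('k))) :: 'k)" by simp
      also have "\<dots> = of_nat (n mod CHAR('k))" unfolding of_nat_add of_nat_mult cp by simp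
      finally have "x = of_nat (n mod CHAR('k))" using n by simp
      thus "x \<in> of_nat ` {..<CHAR('k)}" using p0 by simp
    qed
  qed (auto simp: G_def)
  moreover have "inj_on (of_nat :: nat \<Rightarrow> 'k) {..<CHAR('k)}"
  proof (rule linorder_inj_onI)
    fix i j assume ij: "i < j" "i \<in> {..<CHAR('k)}" "j \<in> {..<CHAR('k)}"
    show "of_nat i \<noteq> (of_nat j :: 'k)"
    proof
      assume "of_nat i = (of_nat j :: 'k)"
      hence "of_nat (j - i) = (0 :: 'k)" using ij by (simp add: of_nat_diff)
      hence "CHAR('k) dvd j - i" by (simp add: of_nat_eq_0_iff_char_dvd)
      thus False using ij by (auto dest!: dvd_imp_le)
    qed
  qed auto
  ultimately have cG: "card G = CHAR('k)" by (simp add: card_image)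
  obtain n where "has_index Fr G n"
    using has_index_exists[OF G ac.Fr_finite, of "\<lambda>x. x" Fr] add_subgroup_zero[OF G] by auto
  from has_index_card[OF ac.Fr_finite subring_add_subgroup[OF ac.Fr_ring] G GF this] show ?thesis using cG by simp
qed

text \<open>By the product formula the zeros of a, counted with degree, balance its pole at
  \<open>Oi\<close>. This is the arithmetic input of the Liouville inequality.\<close>

lemma ord_le_height:
  assumes a: "a \<in> ac.L H" "a \<noteq> 0" and P: "ac.finite_place P"
  shows "ord_elem P a \<le> int (place_degree Fr Oi * H)"
proof -
  have aA: "a \<in> ac.A" and oo: "- ord_elem Oi a \<le> int H" using a unfolding ac.L_def ac.fpower_def by auto
  define I where "I = scale a ac.A"
  have I: "I \<in> ac.ideals" "I \<subseteq> ac.A"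
    unfolding I_def using ac.scale_ideal[OF ac.A_ideal a(2)] subring_mult[OF ac.A_ring aA] by auto
  have oI: "ord_ideal Q I = ord_elem Q a" if "ac.finite_place Q" for Q
    unfolding I_def using ac.ord_scale[OF ac.A_ideal a(2) that] ac.ord_A[OF that] by simp
  have nn: "0 \<le> ord_ideal Q I" if "ac.finite_place Q" for Q by (rule ac.ord_ideal_nonneg[OF I that])
  have "ord_elem P a \<le> ac.deg I"
  proof (cases "ord_ideal P I = 0")
    case True
    thus ?thesis using oI[OF P] ac.index_ideal[OF I] by simp
  next
    case False
    have "P \<in> places Fr" using P by blast
    hence "1 \<le> int (place_degree Fr P)" using ac.place_degree_pos[of P] by linarith
    hence "ord_ideal P I * 1 \<le> ord_ideal P I * int (place_degree Fr P)" by (rule mult_left_mono) (rule nn[OF P])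
    also have "\<dots> \<le> ac.deg I"
      unfolding ideal_degree_def using ac.ideal_support_finite[OF I(1)] P False nn
      by (intro member_le_sum) auto
    finally show ?thesis using oI[OF P] by simp
  qed
  also have "\<dots> = int (place_degree Fr Oi) * (- ord_elem Oi a)" unfolding I_def ac.deg_principal[OF a(2)] by simp
  also have "\<dots> \<le> int (place_degree Fr Oi) * int H" using oo by (intro mult_left_mono) auto
  finally show ?thesis by simp
qed

end

context v_adic_setting
begin

abbreviation Pv :: "'k set" where "Pv \<equiv> localization A v"

lemma nonarch_v: "nonarch nrmv"
  using C_v unfolding completed_alg_closure_def by unfold_locales blast

text \<open>The localization is the unit ball of the prescribed absolute value at v, and of x and 1
  / x one always lies in the unit ball.\<close>

lemma localization_total: "x \<in> localization ac.A v \<or> inverse x \<in> localization ac.A v"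
proof -
  interpret nv: nonarch nrmv by (rule nonarch_v)
  interpret ev: embedding UNIV embv
    using C_v unfolding completed_alg_closure_def by unfold_locales (auto simp: is_subfield_def is_subring_def)
  have iff: "nrmv (embv a) \<le> 1 \<longleftrightarrow> a \<in> localization ac.A v" for a
    using C_v unfolding completed_alg_closure_def A_def by blast
  show ?thesis
  proof (cases "nrmv (embv x) \<le> 1")
    case False
    hence "nrmv (embv (inverse x)) \<le> 1" by (simp add: ev.f_inverse nv.nrm_inverse inverse_le_1_iff)
    thus ?thesis using iff by blast
  qed (use iff in blast)
qed

lemma prime_v': "v \<in> primes_of ac.A"
  using prime_v unfolding A_def .

lemmas local_v = ac.localization_place[OF prime_v' localization_total, folded A_def]

lemma Pv_place: "ac.finite_place Pv" and Pv_residue: "has_index A v (card Fr ^ residue_degree Fr A v)"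
  and Pv_max: "max_ideal Pv \<inter> A = v" and Pv_degree: "residue_degree Fr A v = place_degree Fr Pv"
  using local_v by (simp_all only: simp_thms)

sublocale pv: place_completion Fr nrmv Pv embv
  by unfold_locales (use nonarch_v Pv_place C_v in \<open>auto simp: nonarch_def\<close>)

sublocale s: embedding V \<sigma>
  by unfold_locales (rule V_field, rule sigma_embedding)

abbreviation sV :: "'d set" where "sV \<equiv> \<sigma> ` V"

lemma sV_field: "is_subfield sV"
  by (rule s.image_subfield[OF V_field]) simp

lemma embv_sV: "embv a \<in> sV"
  using emb_V[of a] sigma_over_k[of a] by (metis imageI)

definition \<beta> :: "'k set \<Rightarrow> 'd" where "\<beta> I = \<sigma> (power_s1 I)"

text \<open>Some power of \<beta> I comes from k, where the absolute value is given by the order;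
  roots of positive reals are unique.\<close>

lemma beta_nrm:
  assumes I: "I \<in> ac.ideals"
  shows "nrmv (\<beta> I) = pv.\<kappa> powi ord_ideal Pv I"
proof -
  obtain n l where nl: "n > 0" "l \<noteq> 0" "power_s1 I ^ n = emb l"
    "\<forall>P. ac.finite_place P \<longrightarrow> ord_elem P l = int n * ord_ideal P I" using power_of_s1_in_field[OF I] by blast
  have "\<beta> I ^ n = embv l" unfolding \<beta>_def s.f_power[OF power_s1_V[OF I], symmetric] nl(3) by (rule sigma_over_k)
  hence "nrmv (\<beta> I) ^ n = pv.\<kappa> powi (ord_ideal Pv I * int n)"
    using pv.nrm_emb[OF nl(2)] nl(4) Pv_place by (simp add: mult.commute flip: pv.nrm_power)
  also have "\<dots> = (pv.\<kappa> powi ord_ideal Pv I) ^ n" by (simp add: power_int_mult)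
  finally show ?thesis using pv.\<kappa> by (intro power_eq_imp_eq_base[OF _ pv.nrm_nonneg _ nl(1)]) simp_all
qed

lemma beta_sV: "I \<in> ac.ideals \<Longrightarrow> \<beta> I \<in> sV"
  unfolding \<beta>_def using power_s1_V by blast

lemma v_ideals_iff: "I \<in> v_ideals \<longleftrightarrow> I \<in> nonzero_ideals A \<and> ord_ideal Pv I = 0"
  unfolding v_ideals_def ideals_prime_to_def nonzero_ideals_def by auto

lemma beta_unit: "I \<in> v_ideals \<Longrightarrow> nrmv (\<beta> I) = 1"
  using beta_nrm nonzero_ideals_ideals v_ideals_iff by simp

lemma beta_small:
  assumes I: "I \<in> nonzero_ideals A" "I \<notin> v_ideals"
  shows "nrmv (\<beta> I) \<le> pv.\<kappa>"
proof -
  have II: "I \<in> ac.ideals" "I \<subseteq> ac.A" using nonzero_ideals_ideals[OF I(1)] by auto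
  have "ord_ideal Pv I \<ge> 1" using ac.ord_ideal_nonneg[OF II Pv_place] I v_ideals_iff by force
  hence "pv.\<kappa> powi ord_ideal Pv I \<le> pv.\<kappa> powi 1" using pv.\<kappa> by (intro power_int_decreasing) auto
  thus ?thesis using beta_nrm[OF II(1)] by simp
qed

section \<open>The completion of \<open>\<sigma>(\<V>)\<close>\<close>

lemma kv_field: "is_subfield kv" and kv_closed: "abs_topology nrmv closure_of kv \<subseteq> kv"
  unfolding kv_def by (rule pv.Kc_subfield) (simp add: completion_in_def closure_of_closure_of)

lemma ksigma_field: "is_subfield k\<sigma>"
  unfolding k\<sigma>_def by (rule subfield_hull)

lemmas ksigma_ring = subfield_subring[OF ksigma_field]

lemma kv_ksigma: "kv \<subseteq> k\<sigma>" and sV_ksigma: "sV \<subseteq> k\<sigma>"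
  unfolding k\<sigma>_def by (auto intro: hull_inc)

lemma embv_ksigma: "embv a \<in> k\<sigma>"
  using embv_sV sV_ksigma by blast

text \<open>The closure of \<sigma>(V) is a field containing both \<open>kv\<close> and \<sigma>(V),
  hence all of \<open>k\<sigma>\<close>.\<close>

lemma ksigma_approx:
  assumes "x \<in> k\<sigma>" "e > 0"
  shows "\<exists>y\<in>V. nrmv (x - \<sigma> y) < e"
proof -
  have "kv \<subseteq> abs_topology nrmv closure_of sV"
    unfolding kv_def completion_in_def using embv_sV by (intro closure_of_mono) auto
  hence "kv \<union> \<sigma> ` V \<subseteq> abs_topology nrmv closure_of sV" using pv.closure_subset by blast
  hence "k\<sigma> \<subseteq> abs_topology nrmv closure_of sV"
    unfolding k\<sigma>_def by (intro hull_minimal pv.closure_subfield[OF sV_field])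
  hence "x \<in> abs_topology nrmv closure_of sV" using assms(1) by blast
  thus ?thesis using assms(2) unfolding pv.closure_iff by blast
qed

abbreviation O\<sigma> :: "'d set" where "O\<sigma> \<equiv> {x \<in> k\<sigma>. nrmv x \<le> 1}"
abbreviation m\<sigma> :: "'d set" where "m\<sigma> \<equiv> {x \<in> k\<sigma>. nrmv x < 1}"

lemma residue_ring_facts:
  "is_subring O\<sigma>" "add_subgroup m\<sigma>" "m\<sigma> \<subseteq> O\<sigma>" "x \<in> O\<sigma> \<Longrightarrow> y \<in> m\<sigma> \<Longrightarrow> x * y \<in> m\<sigma>" "1 \<notin> m\<sigma>"
proof -
  show "is_subring O\<sigma>"
    unfolding is_subring_def
  proof (intro conjI ballI)
    show "1 \<in> O\<sigma>" using subring_one[OF ksigma_ring] by simp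
    fix x y assume xy: "x \<in> O\<sigma>" "y \<in> O\<sigma>"
    show "x - y \<in> O\<sigma>" using xy subring_diff[OF ksigma_ring] pv.nrm_diff[of x y] by auto
    show "x * y \<in> O\<sigma>" using xy subring_mult[OF ksigma_ring] by (auto simp: pv.nrm_mult intro: mult_le_one)
  qed
  show "add_subgroup m\<sigma>"
    unfolding add_subgroup_def
  proof (intro conjI ballI)
    show "0 \<in> m\<sigma>" using subring_zero[OF ksigma_ring] by simp
    fix x y assume xy: "x \<in> m\<sigma>" "y \<in> m\<sigma>"
    show "x - y \<in> m\<sigma>" using xy subring_diff[OF ksigma_ring] pv.nrm_diff[of x y] by auto
  qed
  show "x \<in> O\<sigma> \<Longrightarrow> y \<in> m\<sigma> \<Longrightarrow> x * y \<in> m\<sigma>"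
    using subring_mult[OF ksigma_ring] mult_left_mono[of "nrmv x" 1 "nrmv y"]
    by (auto simp: pv.nrm_mult mult.commute intro: le_less_trans)
qed auto

text \<open>Modulo \<open>m\<sigma>\<close> the y_j may be replaced by approximations \<sigma>(z_j).
  A relation of the z_j over k, divided by a coefficient of largest absolute value at v, has
  integral coefficients one of which is 1.\<close>

lemma residue_relation:
  assumes y: "\<And>j. j \<le> card generators \<Longrightarrow> y j \<in> O\<sigma>"
  shows "\<exists>c. (\<forall>j\<le>card generators. c j \<in> {x \<in> kv. nrmv x \<le> 1}) \<and> (\<exists>j\<le>card generators. c j \<notin> m\<sigma>) \<and>
    (\<Sum>j\<le>card generators. c j * y j) \<in> m\<sigma>"
proof -
  let ?n = "card generators"
  have "\<forall>j\<in>{..?n}. \<exists>z. z \<in> V \<and> nrmv (y j - \<sigma> z) < 1" using y ksigma_approx[of _ 1] by auto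
  from bchoice[OF this] obtain z where z: "\<forall>j\<in>{..?n}. z j \<in> V \<and> nrmv (y j - \<sigma> (z j)) < 1" ..
  obtain a where a: "\<exists>j\<le>?n. a j \<noteq> 0" "(\<Sum>j\<le>?n. emb (a j) * z j) = 0"
    using V_linear_relation[of z] z V_eq by auto
  define f where "f j = nrmv (embv (a j))" for j
  have "Max (f ` {..?n}) \<in> f ` {..?n}" by (rule Max_in) auto
  then obtain i where i: "i \<le> ?n" "Max (f ` {..?n}) = f i" by blast
  have fi: "f j \<le> f i" if "j \<le> ?n" for j using Max_ge[of "f ` {..?n}" "f j"] that i(2) by simp
  obtain j where j: "j \<le> ?n" "a j \<noteq> 0" using a(1) by blast
  have "0 < f j" unfolding f_def using pv.nrm_pos pv.e.f_eq_zero j(2) by simp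
  hence pos: "0 < f i" using fi[OF j(1)] by linarith
  hence ai: "a i \<noteq> 0" unfolding f_def by auto
  define c where "c j = embv (a j / a i)" for j
  have c: "c j \<in> kv" "nrmv (c j) \<le> 1" if "j \<le> ?n" for j
  proof -
    show "c j \<in> kv" unfolding c_def kv_def by (rule pv.emb_Kc)
    show "nrmv (c j) \<le> 1" using fi[OF that] pos by (simp add: c_def pv.e.f_divide pv.nrm_divide f_def)
  qed
  have tV: "emb (a j / a i) * z j \<in> V" if "j \<in> {..?n}" for j
    using z that by (intro subring_mult[OF s.S_ring emb_V]) blast
  have "(\<Sum>j\<le>?n. c j * \<sigma> (z j)) = (\<Sum>j\<le>?n. \<sigma> (emb (a j / a i) * z j))"
    unfolding c_def by (rule sum.cong) (use z emb_V in \<open>auto simp: s.f_mult sigma_over_k\<close>)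
  also have "\<dots> = \<sigma> (\<Sum>j\<le>?n. emb (a j / a i) * z j)" by (rule s.f_sum[OF tV, symmetric])
  also have "(\<Sum>j\<le>?n. emb (a j / a i) * z j) = (\<Sum>j\<le>?n. emb (a j) * z j) / emb (a i)"
    by (simp add: sum_divide_distrib pc.e.f_divide)
  finally have "(\<Sum>j\<le>?n. c j * \<sigma> (z j)) = 0" using a(2) by simp
  hence "(\<Sum>j\<le>?n. c j * y j) = (\<Sum>j\<le>?n. c j * (y j - \<sigma> (z j)))" by (simp add: right_diff_distrib sum_subtractf)
  also have "nrmv \<dots> < 1"
  proof (rule pv.nrm_sum_less)
    fix j assume j: "j \<in> {..?n}"
    have "nrmv (c j) * nrmv (y j - \<sigma> (z j)) \<le> 1 * nrmv (y j - \<sigma> (z j))" using c(2) j by (intro mult_right_mono) auto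
    thus "nrmv (c j * (y j - \<sigma> (z j))) < 1" using z j by (auto simp: pv.nrm_mult intro: le_less_trans)
  qed simp
  finally have "nrmv (\<Sum>j\<le>?n. c j * y j) < 1" .
  moreover have "(\<Sum>j\<le>?n. c j * y j) \<in> k\<sigma>"
    using y c(1) kv_ksigma by (intro subring_sum[OF ksigma_ring] subring_mult[OF ksigma_ring]) auto
  moreover have "c i = 1" unfolding c_def using ai by simp
  hence "c i \<notin> m\<sigma>" by simp
  ultimately show ?thesis using c i(1) by (intro exI[of _ c]) blast
qed

text \<open>\<open>residue_relation\<close> bounds independent sets, so a residue basis exists, and
  the index is that of \<open>kv\<close> raised to the power \<open>f\<sigma>\<close>.\<close>

lemma residue_field_card: "has_index O\<sigma> m\<sigma> Q" and Q_ge_2: "Q \<ge> 2"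
proof -
  define Okv where "Okv = {x \<in> kv. nrmv x \<le> 1}"
  note kvr = subfield_subring[OF kv_field]
  have Or: "is_subring Okv"
    unfolding is_subring_def
  proof (intro conjI ballI)
    show "1 \<in> Okv" using subring_one[OF kvr] unfolding Okv_def by simp
    fix x y assume xy: "x \<in> Okv" "y \<in> Okv"
    show "x - y \<in> Okv" using xy subring_diff[OF kvr] pv.nrm_diff[of x y] unfolding Okv_def by auto
    show "x * y \<in> Okv" using xy subring_mult[OF kvr] unfolding Okv_def by (auto simp: pv.nrm_mult intro: mult_le_one)
  qed
  have OO: "Okv \<subseteq> O\<sigma>" unfolding Okv_def using kv_ksigma by blast
  interpret r: residue_extension Okv O\<sigma> m\<sigma>
  proof
    fix x assume x: "x \<in> Okv" "x \<notin> m\<sigma>"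
    hence n1: "nrmv x = 1" using OO unfolding Okv_def by force
    hence "x \<noteq> 0" by auto
    moreover have "inverse x \<in> Okv"
      using x(1) n1 subfield_inverse[OF kv_field] unfolding Okv_def by (simp add: pv.nrm_inverse)
    ultimately show "\<exists>y\<in>Okv. x * y - 1 \<in> m\<sigma>"
      using add_subgroup_zero[OF residue_ring_facts(2)] by (intro bexI[of _ "inverse x"]) auto
  qed (fact Or OO residue_ring_facts)+
  have mg: "add_subgroup (m\<sigma> \<inter> Okv)"
    using residue_ring_facts(2) subring_add_subgroup[OF Or] unfolding add_subgroup_def by blast
  have vg: "add_subgroup v" using ac.ideal_group prime_v' unfolding primes_of_def nonzero_ideals_def by blast
  \<comment> \<open>The residue field of the completion is A / v: an integral element is congruent
    to an element of k by density, and that one to an element of \<open>A\<close>.\<close>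
  have ind: "has_index Okv (m\<sigma> \<inter> Okv) (card Fr ^ residue_degree Fr A v)"
  proof (rule has_index_map[OF vg mg _ _ _ Pv_residue, of embv])
    have AP: "a \<in> Pv" if "a \<in> A" for a using that ac.A_place[of a Pv] Pv_place unfolding A_def by blast
    show AO: "embv x \<in> Okv" if "x \<in> A" for x
      unfolding Okv_def kv_def using pv.emb_Kc pv.nrm_emb_le[of x] AP[OF that] by simp
    fix x y assume xy: "x \<in> A" "y \<in> A"
    have d: "x - y \<in> A" using xy subring_diff[OF ac.A_ring] unfolding A_def by blast
    have "embv x - embv y = embv (x - y)" by (simp add: pv.e.f_diff)
    moreover have "embv (x - y) \<in> m\<sigma> \<inter> Okv \<longleftrightarrow> x - y \<in> max_ideal Pv"
      using AO[OF d] embv_ksigma[of "x - y"] pv.nrm_emb_less[of "x - y"] by auto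
    ultimately show "embv x - embv y \<in> m\<sigma> \<inter> Okv \<longleftrightarrow> x - y \<in> v" using Pv_max d by auto
  next
    fix z assume z: "z \<in> Okv"
    have "\<forall>e>0. \<exists>a. nrmv (z - embv a) < e" using z unfolding Okv_def kv_def pv.Kc_iff by blast
    then obtain a where a: "nrmv (z - embv a) < 1" using zero_less_one by blast
    have "nrmv (embv a) \<le> 1" using pv.nrm_diff[of z "z - embv a"] a z unfolding Okv_def by auto
    hence "a \<in> Pv" using pv.nrm_emb_le by blast
    then obtain a' where a': "a' \<in> A" "a - a' \<in> max_ideal Pv"
      using ac.A_residue_surj[of Pv a] Pv_place unfolding A_def by blast
    have "nrmv (embv a - embv a') < 1" using a'(2) pv.nrm_emb_less[of "a - a'"] by (simp add: pv.e.f_diff)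
    hence "nrmv (z - embv a') < 1" using pv.nrm_triangle[of z "embv a'" "embv a"] a by linarith
    moreover have "a' \<in> Pv" using a'(1) ac.A_place[of a' Pv] Pv_place unfolding A_def by blast
    hence eO: "embv a' \<in> Okv" unfolding Okv_def kv_def using pv.emb_Kc pv.nrm_emb_le[of a'] by simp
    hence "z - embv a' \<in> Okv" using subring_diff[OF Or z] by blast
    ultimately show "\<exists>x\<in>A. z - embv x \<in> m\<sigma> \<inter> Okv" using a'(1) OO by blast
  qed
  have "card B \<le> card generators" if "finite B" "B \<subseteq> O\<sigma>" "residue_independent Okv m\<sigma> B" for B
    by (rule r.independent_bound_relation[OF _ that]) (unfold Okv_def, rule residue_relation)
  from r.basis_exists[OF this] obtain B where B: "finite B" "B \<subseteq> O\<sigma>" "residue_independent Okv m\<sigma> B"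
    "residue_spanning Okv O\<sigma> m\<sigma> B" by blast
  obtain n where n: "has_index O\<sigma> m\<sigma> n" using r.span_index[OF B ind] by blast
  have "n = (card Fr ^ residue_degree Fr A v) ^ residue_degree Okv O\<sigma> m\<sigma>" by (rule r.residue_degree_index[OF n ind])
  also have "\<dots> = Q" unfolding Q_def f\<sigma>_def Okv_def by (simp add: power_mult)
  finally show QI: "has_index O\<sigma> m\<sigma> Q" using n by simp
  show "Q \<ge> 2"
  proof (rule ccontr)
    assume "\<not> Q \<ge> 2"
    hence "\<exists>x\<in>{0,1}. \<exists>y\<in>{0,1}. x \<noteq> y \<and> x - y \<in> m\<sigma>"
      using subring_zero[OF residue_ring_facts(1)] subring_one[OF residue_ring_facts(1)]
      by (intro has_index_pigeonhole[OF residue_ring_facts(2) QI]) auto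
    thus False by auto
  qed
qed

lemma CHAR_dvd_Q: "CHAR('k) dvd Q"
proof -
  have "residue_degree Fr A v * f\<sigma> \<noteq> 0" using Q_ge_2 unfolding Q_def by (auto intro!: Nat.gr0I)
  thus ?thesis unfolding Q_def using CHAR_dvd_card by (metis dvd_power dvd_trans gr0I)
qed

end

section \<open>Teichmueller representatives\<close>

lemma (in nonarch) prod_diff_less:
  assumes "0 < B" "\<And>i. i \<in> X \<Longrightarrow> nrm (f i) \<le> 1" "\<And>i. i \<in> X \<Longrightarrow> nrm (g i) \<le> 1"
    "\<And>i. i \<in> X \<Longrightarrow> nrm (f i - g i) < B"
  shows "nrm (prod f X - prod g X) < B \<and> nrm (prod f X) \<le> 1"
  using assms(2-4)
proof (induction X rule: infinite_finite_induct)
  case (insert x X)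
  hence IH: "nrm (prod f X - prod g X) < B" "nrm (prod f X) \<le> 1" by simp_all
  have x: "nrm (f x) \<le> 1" "nrm (g x) \<le> 1" "nrm (f x - g x) < B" using insert.prems by simp_all
  have eq: "prod f (insert x X) - prod g (insert x X) = (f x - g x) * prod f X + g x * (prod f X - prod g X)"
    using insert.hyps by (simp add: algebra_simps)
  have "nrm (f x - g x) * nrm (prod f X) < B"
    using mult_left_mono[OF IH(2), of "nrm (f x - g x)"] x(3) by simp
  moreover have "nrm (g x) * nrm (prod f X - prod g X) < B"
    using mult_right_mono[OF x(2), of "nrm (prod f X - prod g X)"] IH(1) by simp
  ultimately have "nrm (prod f (insert x X) - prod g (insert x X)) < B"
    unfolding eq by (intro order_le_less_trans[OF nrm_add]) (simp add: nrm_mult)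
  moreover have "nrm (prod f (insert x X)) \<le> 1" using insert.hyps IH(2) x(1) by (simp add: nrm_mult mult_le_one)
  ultimately show ?case by blast
qed (use assms(1) in auto)

context v_adic_setting
begin

text \<open>The classical product argument: multiplication by x permutes the Q - 1 unit
  representatives up to congruence, so x^(Q - 1) times their product is congruent to that
  product.\<close>

lemma residue_fermat:
  assumes x: "x \<in> k\<sigma>" "nrmv x = 1"
  shows "nrmv (x ^ (Q - 1) - 1) < 1"
proof -
  obtain R where T: "transversal O\<sigma> m\<sigma> R" and R: "finite R" "card R = Q"
    using residue_field_card unfolding has_index_def by blast
  have RO: "r \<in> k\<sigma>" "nrmv r \<le> 1" if "r \<in> R" for r using T that unfolding transversal_def by auto
  have repr: "\<exists>r\<in>R. nrmv (z - r) < 1" if "z \<in> k\<sigma>" "nrmv z \<le> 1" for z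
    using T that unfolding transversal_def by blast
  have uniq: "r = s" if "r \<in> R" "s \<in> R" "nrmv (r - s) < 1" for r s
    using T that RO subring_diff[OF ksigma_ring] unfolding transversal_def by blast
  obtain r0 where r0: "r0 \<in> R" "nrmv r0 < 1" using repr[of 0] subring_zero[OF ksigma_ring] by auto
  define R' where "R' = R - {r0}"
  have R': "finite R'" "card R' = Q - 1" "R' \<subseteq> R" unfolding R'_def using R r0 by auto
  have unit: "nrmv r = 1" if r: "r \<in> R'" for r
  proof (rule ccontr)
    assume "nrmv r \<noteq> 1"
    hence "nrmv r < 1" using RO(2)[of r] r R'(3) by force
    hence "nrmv (r - r0) < 1" using pv.nrm_diff[of r r0] r0(2) by linarith
    thus False using uniq[of r r0] r r0(1) unfolding R'_def by blast
  qed
  have "\<forall>r\<in>R'. \<exists>s. s \<in> R' \<and> nrmv (x * r - s) < 1"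
  proof
    fix r assume r: "r \<in> R'"
    have n1: "nrmv (x * r) = 1" using x(2) unit[OF r] by (simp add: pv.nrm_mult)
    have "x * r \<in> k\<sigma>" using x(1) RO(1)[of r] r R'(3) by (intro subring_mult[OF ksigma_ring]) blast+
    then obtain s where s: "s \<in> R" "nrmv (x * r - s) < 1" using repr n1 by force
    have "s \<noteq> r0"
    proof
      assume "s = r0"
      hence "nrmv (x * r - s + s) < 1" using s(2) r0(2) by (intro order_le_less_trans[OF pv.nrm_add]) simp
      thus False using n1 by simp
    qed
    thus "\<exists>s. s \<in> R' \<and> nrmv (x * r - s) < 1" using s unfolding R'_def by blast
  qed
  from bchoice[OF this] obtain h where h: "\<forall>r\<in>R'. h r \<in> R' \<and> nrmv (x * r - h r) < 1" ..
  have inj: "inj_on h R'"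
  proof (rule inj_onI)
    fix r s assume rs: "r \<in> R'" "s \<in> R'" "h r = h s"
    have "nrmv (x * r - h r) < 1" "nrmv (x * s - h r) < 1" using h rs by auto
    hence "nrmv (x * r - x * s) < 1"
      using pv.nrm_triangle[of "x * r" "x * s" "h r"] pv.nrm_diff_commute[of "x * s" "h r"] by linarith
    hence "nrmv (r - s) < 1" using x(2) by (simp add: pv.nrm_mult flip: right_diff_distrib)
    thus "r = s" using uniq[of r s] rs R'(3) by blast
  qed
  have "h ` R' = R'" using h by (intro endo_inj_surj[OF R'(1) _ inj]) blast
  hence hp: "(\<Prod>r\<in>R'. h r) = \<Prod>R'" using prod.reindex[OF inj, of "\<lambda>r. r"] by simp
  have "nrmv ((\<Prod>r\<in>R'. x * r) - (\<Prod>r\<in>R'. h r)) < 1 \<and> nrmv (\<Prod>r\<in>R'. x * r) \<le> 1"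
    by (rule pv.prod_diff_less) (use h unit x(2) in \<open>auto simp: pv.nrm_mult\<close>)
  moreover have "(\<Prod>r\<in>R'. x * r) - (\<Prod>r\<in>R'. h r) = (x ^ (Q - 1) - 1) * \<Prod>R'"
    unfolding hp using R'(2) by (simp add: prod.distrib left_diff_distrib)
  moreover have "nrmv (\<Prod>R') = 1"
  proof -
    have "nrmv (\<Prod>X) = 1" if "X \<subseteq> R'" for X
      using that by (induction X rule: infinite_finite_induct) (auto simp: pv.nrm_mult unit)
    thus ?thesis by blast
  qed
  ultimately show ?thesis by (simp add: pv.nrm_mult)
qed

lemma CHAR_power_dvd: "int (Q ^ n) mod int (CHAR('k) ^ n) = 0"
  using dvd_power_same[OF CHAR_dvd_Q, of n] by (simp only: mod_0_imp_dvd int_dvd_int_iff flip: dvd_eq_mod_eq_0)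

text \<open>The limit of the \<open>x ^ (Q ^ n)\<close> lies in \<open>k\<^sub>\<sigma>\<close> because infinitely many of these powers lie in one
  of the closed sets \<open>x ^ r * k\<^sub>v\<close> with \<open>r < N\<close>.\<close>

lemma teichmueller_exists:
  assumes x: "x \<in> k\<sigma>" "nrmv x = 1" and N: "N > 0" "x ^ N \<in> kv"
  shows "\<exists>z. z \<in> k\<sigma> \<and> z ^ (Q - 1) = 1 \<and> nrmv (x / z - 1) < 1"
proof -
  define u where "u = x ^ (Q - 1)"
  have u: "nrmv (u - 1) < 1" unfolding u_def by (rule residue_fermat[OF x])
  define a where "a n = x ^ (Q ^ n)" for n
  have na: "nrmv (a n) = 1" for n unfolding a_def pv.nrm_power x(2) by simp
  \<comment> \<open>a_(n+1) is a_n times u^(Q^n), where u is a 1-unit and Q^n is divisible by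
    p^n.\<close>
  have step: "nrmv (a (Suc n) - a n) \<le> nrmv (u - 1) ^ (CHAR('k) ^ n)" for n
  proof -
    have "Q ^ Suc n = Q ^ n + (Q - 1) * Q ^ n" using Q_ge_2 by (cases Q) auto
    hence "a (Suc n) = a n * u ^ (Q ^ n)" unfolding a_def u_def by (simp only: power_add power_mult)
    hence "a (Suc n) - a n = a n * (u ^ (Q ^ n) - u ^ 0)" by (simp add: right_diff_distrib)
    hence "nrmv (a (Suc n) - a n) = nrmv (u ^ (Q ^ n) - u ^ 0)" by (simp add: pv.nrm_mult na)
    also have "\<dots> \<le> nrmv (u - 1) ^ (CHAR('k) ^ n)"
      by (rule pv.power_congruent[OF u]) (use CHAR_power_dvd in simp)
    finally show ?thesis .
  qed
  have "\<exists>w. limitin (abs_topology nrmv) (\<lambda>n. \<Sum>i<n. a (Suc i) - a i) w sequentially"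
  proof (rule pv.series_converges)
    fix e :: real assume "0 < e"
    then obtain M where M: "\<forall>n\<ge>M. nrmv (u - 1) ^ n < e" using small_power[OF pv.nrm_nonneg u] by blast
    have "nrmv (a (Suc n) - a n) < e" if n: "n \<ge> M" for n
    proof -
      have "n < CHAR('k) ^ n" using less_exp[of n] power_mono[OF p2, of n] by linarith
      hence "nrmv (u - 1) ^ (CHAR('k) ^ n) < e" using M n by simp
      thus ?thesis using step[of n] by linarith
    qed
    thus "\<exists>M. \<forall>n\<ge>M. nrmv (a (Suc n) - a n) < e" by blast
  qed
  then obtain w where w: "limitin (abs_topology nrmv) (\<lambda>n. \<Sum>i<n. a (Suc i) - a i) w sequentially" by blast
  define z where "z = w + a 0"
  have lim: "limitin (abs_topology nrmv) a z sequentially"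
    using w unfolding pv.limitin_iff sum_lessThan_telescope z_def by (simp add: algebra_simps)
  have ev: "\<exists>N. \<forall>n\<ge>N. nrmv (a n - z) < e" if "e > 0" for e
    using lim that unfolding pv.limitin_iff eventually_sequentially by blast
  have zK: "z \<in> k\<sigma>"
  proof -
    have "finite (range (\<lambda>n. Q ^ n mod N))" by (rule finite_subset[of _ "{..<N}"]) (use N(1) in auto)
    from pigeonhole_infinite[OF infinite_UNIV_nat this] obtain m where
      m: "infinite {n \<in> UNIV. Q ^ n mod N = Q ^ m mod N}" by blast
    define r where "r = Q ^ m mod N"
    have xr: "nrmv (x ^ r) = 1" "x ^ r \<noteq> 0" using x(2) by (auto simp: pv.nrm_power)
    have "z / x ^ r \<in> abs_topology nrmv closure_of kv"
      unfolding pv.closure_iff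
    proof (intro allI impI)
      fix e :: real assume "0 < e"
      then obtain M where M: "\<forall>n\<ge>M. nrmv (a n - z) < e" using ev by blast
      obtain n where n: "n \<ge> M" "Q ^ n mod N = r"
        using m unfolding infinite_nat_iff_unbounded_le r_def by blast
      have "Q ^ n = r + N * (Q ^ n div N)" using mod_mult_div_eq[of "Q ^ n" N] n(2) by simp
      hence an: "a n = x ^ r * (x ^ N) ^ (Q ^ n div N)" unfolding a_def by (metis power_add power_mult)
      have "z / x ^ r - (x ^ N) ^ (Q ^ n div N) = (z - a n) / x ^ r" unfolding an using xr(2) by (simp add: field_simps)
      hence "nrmv (z / x ^ r - (x ^ N) ^ (Q ^ n div N)) = nrmv (z - a n)" by (simp only: pv.nrm_divide xr(1) div_by_1)
      moreover have "nrmv (z - a n) < e" using M n(1) pv.nrm_diff_commute[of z "a n"] by simp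
      moreover have "(x ^ N) ^ (Q ^ n div N) \<in> kv" by (rule subring_power[OF subfield_subring[OF kv_field] N(2)])
      ultimately show "\<exists>y\<in>kv. nrmv (z / x ^ r - y) < e" by metis
    qed
    hence "x ^ r * (z / x ^ r) \<in> k\<sigma>"
      using kv_closed kv_ksigma x(1) by (intro subring_mult[OF ksigma_ring] subring_power[OF ksigma_ring]) blast+
    moreover have "x ^ r * (z / x ^ r) = z" by (metis nonzero_eq_divide_eq mult.commute xr(2))
    ultimately show ?thesis by (simp only:)
  qed
  have "nrmv (a n - x) \<le> nrmv (u - 1)" for n
  proof (induction n)
    case 0
    show ?case by (simp add: a_def)
  next
    case (Suc n)
    have "nrmv (u - 1) ^ (CHAR('k) ^ n) \<le> nrmv (u - 1) ^ 1"
      using u p0 by (intro power_decreasing) (auto simp: Suc_le_eq)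
    thus ?case using step[of n] Suc pv.nrm_triangle[of "a (Suc n)" x "a n"] by simp
  qed
  hence "nrmv (z - x) \<le> nrmv (u - 1)" by (intro pv.limit_bound[OF lim]) auto
  hence zx: "nrmv (x - z) < nrmv x" using u x(2) pv.nrm_diff_commute[of x z] by linarith
  have nz: "nrmv z = 1" using pv.inverse_close(1)[OF _ zx] x(2) by fastforce
  hence z0: "z \<noteq> 0" by auto
  \<comment> \<open>z^Q is the limit of a_n^Q = a_(n+1), which is z again.\<close>
  have "nrmv (z ^ Q - z) < e" if e: "e > 0" for e
  proof -
    obtain M where M: "\<forall>n\<ge>M. nrmv (a n - z) < e" using ev[OF e] by blast
    have "nrmv ((\<Prod>i<Q. a M) - (\<Prod>i<Q. z)) < e \<and> nrmv (\<Prod>i<Q. a M) \<le> 1"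
      by (rule pv.prod_diff_less) (use e M na nz in auto)
    hence "nrmv (a (Suc M) - z ^ Q) < e" by (simp add: a_def mult.commute flip: power_mult)
    moreover have "nrmv (a (Suc M) - z) < e" using M by simp
    ultimately show ?thesis
      using pv.nrm_triangle[of "z ^ Q" z "a (Suc M)"] pv.nrm_diff_commute[of "z ^ Q" "a (Suc M)"] by linarith
  qed
  hence "z ^ Q - z = 0" using pv.nrm_pos[of "z ^ Q - z"] by (metis less_irrefl)
  moreover have "z ^ Q = z * z ^ (Q - 1)" using Q_ge_2 by (cases Q) auto
  ultimately have "z ^ (Q - 1) = 1" using z0 by simp
  moreover have "x / z - 1 = (x - z) / z" using z0 by (simp add: diff_divide_distrib)
  hence "nrmv (x / z - 1) < 1" using zx x(2) nz by (simp add: pv.nrm_divide)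
  ultimately show ?thesis using zK by blast
qed

text \<open>From w^Q = w one gets w^(Q^n) = w for all n, while exponents divisible by p^n push a
  1-unit towards 1.\<close>

lemma one_unit_root_of_unity:
  assumes w: "nrmv (w - 1) < 1" "w ^ (Q - 1) = 1"
  shows "w = 1"
proof -
  have "w ^ Q = w * w ^ (Q - 1)" using Q_ge_2 by (cases Q) auto
  hence wQ: "w ^ Q = w" using w(2) by simp
  have "w ^ (Q ^ n) = w" for n by (induction n) (simp_all add: power_mult wQ)
  hence "nrmv (w - 1) \<le> nrmv (w - 1) ^ (CHAR('k) ^ n)" for n
    using pv.power_congruent[OF w(1), of "Q ^ n" n 0] CHAR_power_dvd[of n] by simp
  from pv.zero_if_all_small[OF pv.nrm_nonneg w(1) p2 this] show ?thesis by simp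
qed

lemma omega:
  assumes x: "x \<in> k\<sigma>" "nrmv x = 1" and N: "N > 0" "x ^ N \<in> kv"
  shows "\<omega> x ^ (Q - 1) = 1" "nrmv (x / \<omega> x - 1) < 1" "nrmv (\<omega> x) = 1"
proof -
  have "\<exists>!z. z \<in> k\<sigma> \<and> z ^ (Q - 1) = 1 \<and> x / z \<in> one_units nrmv"
  proof (rule ex_ex1I)
    show "\<exists>z. z \<in> k\<sigma> \<and> z ^ (Q - 1) = 1 \<and> x / z \<in> one_units nrmv"
      using teichmueller_exists[OF x N] unfolding one_units_def by blast
  next
    fix z z' assume "z \<in> k\<sigma> \<and> z ^ (Q - 1) = 1 \<and> x / z \<in> one_units nrmv"
      and "z' \<in> k\<sigma> \<and> z' ^ (Q - 1) = 1 \<and> x / z' \<in> one_units nrmv"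
    hence z: "z ^ (Q - 1) = 1" "nrmv (x / z - 1) < 1" and z': "z' ^ (Q - 1) = 1" "nrmv (x / z' - 1) < 1"
      unfolding one_units_def by auto
    have n: "nrmv (x / z) = 1" "nrmv (x / z') = 1" using pv.one_unit_nrm z(2) z'(2) by blast+
    hence nz: "z \<noteq> 0" "z' \<noteq> 0" "x \<noteq> 0" by auto
    have "z / z' - 1 = ((x / z' - 1) - (x / z - 1)) / (x / z)" using nz by (simp add: field_simps)
    hence "nrmv (z / z' - 1) = nrmv ((x / z' - 1) - (x / z - 1)) / nrmv (x / z)" by (simp only: pv.nrm_divide)
    hence "nrmv (z / z' - 1) = nrmv ((x / z' - 1) - (x / z - 1))" unfolding n(1) by simp
    also have "\<dots> < 1" using pv.nrm_diff[of "x / z' - 1" "x / z - 1"] z(2) z'(2) by linarith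
    finally have "nrmv (z / z' - 1) < 1" .
    hence "z / z' = 1" by (rule one_unit_root_of_unity) (simp only: power_divide z(1) z'(1) div_by_1)
    thus "z = z'" using nz by simp
  qed
  from theI'[OF this, folded \<omega>_def] show r: "\<omega> x ^ (Q - 1) = 1" "nrmv (x / \<omega> x - 1) < 1"
    unfolding one_units_def by auto
  have "nrmv x / nrmv (\<omega> x) = 1" using pv.one_unit_nrm[OF r(2)] by (simp only: pv.nrm_divide)
  thus "nrmv (\<omega> x) = 1" unfolding x(2) by simp
qed

lemma v_ideals_beta:
  assumes "I \<in> v_ideals"
  shows "I \<in> ac.ideals" "\<beta> I \<in> k\<sigma>" "nrmv (\<beta> I) = 1"
  using assms v_ideals_iff nonzero_ideals_ideals beta_sV sV_ksigma beta_unit by blast+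

text \<open>The power of \<beta> I in \<open>kv\<close> that \<open>omega\<close> asks for is the
  one that comes from k.\<close>

lemma omega_beta:
  assumes I: "I \<in> v_ideals"
  shows "\<omega> (\<beta> I) ^ (Q - 1) = 1" "nrmv (\<beta> I / \<omega> (\<beta> I) - 1) < 1" "nrmv (\<omega> (\<beta> I)) = 1"
proof -
  note b = v_ideals_beta[OF I]
  obtain n l where nl: "n > 0" "power_s1 I ^ n = emb l" using power_of_s1_in_field[OF b(1)] by blast
  have "\<beta> I ^ n = embv l" unfolding \<beta>_def s.f_power[OF power_s1_V[OF b(1)], symmetric] nl(2) by (rule sigma_over_k)
  hence "\<beta> I ^ n \<in> kv" using pv.emb_Kc unfolding kv_def by simp
  from omega[OF b(2,3) nl(1) this] show "\<omega> (\<beta> I) ^ (Q - 1) = 1" "nrmv (\<beta> I / \<omega> (\<beta> I) - 1) < 1"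
    "nrmv (\<omega> (\<beta> I)) = 1" by simp_all
qed

lemma unit_power_near:
  assumes I: "I \<in> v_ideals" and y: "y \<in> exponents CHAR('k) (Q - 1)"
    and j: "(int j + y n) mod int (CHAR('k) ^ n * (Q - 1)) = 0"
  shows "nrmv (1 / unit_power (\<beta> I) y - \<beta> I ^ j) \<le> nrmv (\<beta> I / \<omega> (\<beta> I) - 1) ^ (CHAR('k) ^ n)"
proof -
  define x where "x = \<beta> I"
  note o = omega_beta[OF I, folded x_def]
  define u where "u = x / \<omega> x"
  define y' where "y' = (\<lambda>n. y n mod int (CHAR('k) ^ n))"
  have y': "y' \<in> exponents CHAR('k) 1" unfolding y'_def by (rule exponents_reduce[OF y p0])
  \<comment> \<open>This one divisibility serves both components of the exponent: modulo Q - 1 the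
    roots of unity cancel exactly, and modulo p^n the 1-unit parts cancel up to the stated
    error.\<close>
  have dvd: "int (CHAR('k) ^ n) * int (Q - 1) dvd int j + y n" using j by (simp add: dvd_eq_mod_eq_0)
  have "int (CHAR('k) ^ n) dvd int j + y n" by (rule dvd_mult_left[OF dvd])
  hence j': "(int j + y' n) mod int (CHAR('k) ^ n) = 0"
    unfolding y'_def mod_add_right_eq by (simp add: dvd_eq_mod_eq_0)
  have y0: "0 \<le> y 0" using exponents_range[OF y, of 0] by blast
  have "y n mod int (Q - 1) = y 0" using exponents_mod[OF y, of 0 n] by simp
  moreover have "int (Q - 1) dvd int j + y n" by (rule dvd_mult_right[OF dvd])
  ultimately have "(int j + y 0) mod int (Q - 1) = 0"
    using mod_add_right_eq[of "int j" "y n" "int (Q - 1)"] by (simp add: dvd_eq_mod_eq_0)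
  hence "int (Q - 1) dvd int (j + nat (y 0))" using y0 by (simp add: dvd_eq_mod_eq_0)
  then obtain k where k: "j + nat (y 0) = (Q - 1) * k" using int_dvd_int_iff by (elim dvdE) (metis dvdE dvd_triv_left)
  have "\<omega> x ^ j * \<omega> x ^ nat (y 0) = 1" unfolding power_add[symmetric] k power_mult o(1) by simp
  hence oj: "1 / \<omega> x ^ nat (y 0) = \<omega> x ^ j" using o(3) by (metis divide_eq_eq mult_zero_right zero_neq_one)
  have w0: "\<omega> x \<noteq> 0" using o(3) by auto
  have "1 / unit_power x y = (1 / \<omega> x ^ nat (y 0)) * (1 / one_unit_power nrmv u y')"
    unfolding unit_power_def u_def y'_def by simp
  moreover have "x ^ j = \<omega> x ^ j * u ^ j" unfolding u_def using w0 by (simp add: power_divide)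
  ultimately have "1 / unit_power x y - x ^ j = \<omega> x ^ j * (1 / one_unit_power nrmv u y' - u ^ j)"
    unfolding oj by (simp add: right_diff_distrib)
  hence "nrmv (1 / unit_power x y - x ^ j) = nrmv (1 / one_unit_power nrmv u y' - u ^ j)"
    by (simp add: pv.nrm_mult pv.nrm_power o(3))
  also have "\<dots> \<le> nrmv (u - 1) ^ (CHAR('k) ^ n)"
    using o(2) by (intro pv.one_unit_power_reciprocal[OF _ y' j']) (simp add: u_def)
  finally show ?thesis unfolding u_def x_def .
qed

lemma unit_power_nrm:
  assumes I: "I \<in> v_ideals" and y: "y \<in> exponents CHAR('k) (Q - 1)"
  shows "nrmv (unit_power (\<beta> I) y) = 1"
  unfolding unit_power_def pv.nrm_mult pv.nrm_power
  using omega_beta[OF I] pv.one_unit_power_nrm[OF omega_beta(2)[OF I] exponents_reduce[OF y p0]] by simp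

text \<open>The 1-unit parts of two ideals with the same class and the same root of unity differ by a
  1-unit of \<open>k\<^sub>v\<close>, where the absolute value is discrete.\<close>

lemma omega_uniform:
  "\<exists>\<rho>. pv.\<kappa> \<le> \<rho> \<and> \<rho> < 1 \<and> (\<forall>I\<in>v_ideals. nrmv (\<beta> I / \<omega> (\<beta> I) - 1) \<le> \<rho>)"
proof -
  define \<delta> where "\<delta> I = nrmv (\<beta> I / \<omega> (\<beta> I) - 1)" for I
  have "\<forall>I\<in>ac.ideals. \<exists>M. M \<in> classes \<and> (\<exists>l u. positive_part l u \<and> I = scale l M)" using class_exists by blast
  from bchoice[OF this] obtain M where M: "\<forall>I\<in>ac.ideals. M I \<in> classes \<and> (\<exists>l u. positive_part l u \<and> I = scale l (M I))" ..
  \<comment> \<open>A narrow class together with a root of unity. Finitely many pairs occur, and one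
    ideal \<open>rep\<close> for each of them determines \<rho>.\<close>
  define key where "key I = (M I, \<omega> (\<beta> I))" for I
  have "finite {z :: 'd. z ^ (Q - 1) = 1}"
  proof -
    define Z :: "'d poly" where "Z = monom 1 (Q - 1) - 1"
    have "coeff Z (Q - 1) = 1" unfolding Z_def using Q_ge_2 by simp
    hence "Z \<noteq> 0" by auto
    hence "finite {z. poly Z z = 0}" by (rule poly_roots_finite)
    thus ?thesis unfolding Z_def by (simp add: poly_monom)
  qed
  moreover have "key ` v_ideals \<subseteq> classes \<times> {z. z ^ (Q - 1) = 1}"
    unfolding key_def using M v_ideals_beta(1) omega_beta(1) by auto
  ultimately have fin: "finite (key ` v_ideals)" using classes_finite by (meson finite_SigmaI finite_subset)
  define rep where "rep = inv_into v_ideals key"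
  have rep: "rep (key I) \<in> v_ideals" "key (rep (key I)) = key I" if "I \<in> v_ideals" for I
    unfolding rep_def using that by (auto intro: inv_into_into f_inv_into_f)
  have \<delta>1: "\<delta> I < 1" if "I \<in> v_ideals" for I
    unfolding \<delta>_def by (rule omega_beta(2)[OF that])
  define \<rho> where "\<rho> = Max (insert pv.\<kappa> ((\<lambda>k. \<delta> (rep k)) ` key ` v_ideals))"
  have fin': "finite (insert pv.\<kappa> ((\<lambda>k. \<delta> (rep k)) ` key ` v_ideals))" using fin by simp
  have k\<rho>: "pv.\<kappa> \<le> \<rho>" unfolding \<rho>_def using fin' by (intro Max_ge) auto
  moreover have "\<rho> < 1" unfolding \<rho>_def using fin' pv.\<kappa> rep(1) \<delta>1 by (subst Max_less_iff) auto
  moreover have "\<delta> I \<le> \<rho>" if I: "I \<in> v_ideals" for I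
  proof -
    define J where "J = rep (key I)"
    have J: "J \<in> v_ideals" "M J = M I" "\<omega> (\<beta> J) = \<omega> (\<beta> I)" using rep[OF I] unfolding J_def key_def by auto
    have \<delta>J: "\<delta> J \<le> \<rho>" unfolding \<rho>_def J_def using fin' I by (intro Max_ge) auto
    note bI = v_ideals_beta[OF I] and bJ = v_ideals_beta[OF J(1)]
    obtain l u where l: "positive_part l u" "I = scale l (M I)" using M bI(1) by blast
    obtain l' u' where l': "positive_part l' u'" "J = scale l' (M I)" using M bJ(1) J(2) by metis
    have MI: "M I \<in> ac.ideals" using M bI(1) classes_ideals by blast
    have sM: "power_s1 (M I) \<in> V" by (rule power_s1_V[OF MI])
    have "\<beta> I = \<sigma> (emb l * power_s1 (M I))" unfolding \<beta>_def using power_s1_scale[OF l(1) MI] l(2) by simp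
    hence eI: "\<beta> I = embv l * \<sigma> (power_s1 (M I))" unfolding s.f_mult[OF emb_V sM] sigma_over_k .
    have "\<beta> J = \<sigma> (emb l' * power_s1 (M I))" unfolding \<beta>_def using power_s1_scale[OF l'(1) MI] l'(2) by simp
    hence eJ: "\<beta> J = embv l' * \<sigma> (power_s1 (M I))" unfolding s.f_mult[OF emb_V sM] sigma_over_k .
    have nz: "embv l' \<noteq> 0" "\<sigma> (power_s1 (M I)) \<noteq> 0" using eJ bJ(3) by auto
    define a where "a = embv (l / l')"
    have a: "\<beta> I = a * \<beta> J" unfolding a_def eI eJ using nz by (simp add: pv.e.f_divide)
    define r where "r = \<beta> J / \<omega> (\<beta> I)"
    have r: "nrmv (r - 1) = \<delta> J" "\<beta> I / \<omega> (\<beta> I) = a * r" unfolding r_def \<delta>_def J(3) a by auto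
    have nr: "nrmv r = 1" by (rule pv.one_unit_nrm) (use r(1) \<delta>1[OF J(1)] in simp)
    have na: "nrmv a = 1" using a bI(3) bJ(3) by (simp add: pv.nrm_mult)
    have "(a - 1) * r = (a * r - 1) - (r - 1)" by (simp add: algebra_simps)
    moreover have "nrmv (a * r - 1) < 1" using \<delta>1[OF I] unfolding \<delta>_def r(2) .
    moreover have "nrmv (r - 1) < 1" using \<delta>1[OF J(1)] r(1) by simp
    ultimately have "nrmv ((a - 1) * r) < 1" using pv.nrm_diff[of "a * r - 1" "r - 1"] by simp
    hence "nrmv (a - 1) < 1" by (simp add: pv.nrm_mult nr)
    moreover have "a - 1 \<in> pv.Kc"
      unfolding a_def using pv.emb_Kc subring_one[OF subfield_subring[OF pv.Kc_subfield]]
      by (intro subring_diff[OF subfield_subring[OF pv.Kc_subfield]])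
    ultimately have "nrmv (a - 1) \<le> \<rho>" using pv.Kc_less_one k\<rho> by fastforce
    moreover have eq: "a * r - 1 = a * (r - 1) + (a - 1)" by (simp add: algebra_simps)
    moreover have "nrmv (a * (r - 1)) \<le> \<rho>" using \<delta>J by (simp add: pv.nrm_mult na r(1))
    ultimately show ?thesis unfolding \<delta>_def r(2) eq by (intro order_trans[OF pv.nrm_add] max.boundedI)
  qed
  ultimately show ?thesis unfolding \<delta>_def by blast
qed

end

section \<open>Continuation at a prime\<close>

context v_adic_setting
begin

lemma embv_coefficient:
  assumes "motivic_class b" "I \<in> nonzero_ideals A"
  shows "nrmv (embv (b I)) \<le> 1"
proof -
  have "b I \<in> ac.A" using assms unfolding motivic_class_def A_def by blast
  thus ?thesis using pv.nrm_emb_le ac.A_place[of "b I" Pv] Pv_place by blast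
qed

text \<open>Kept in \<open>V\<close>, before \<sigma> is applied, so that its height can be measured
  there.\<close>

definition special_value :: "('k set \<Rightarrow> 'k) \<Rightarrow> nat \<Rightarrow> nat \<Rightarrow> 'c" where
  "special_value b j d = (\<Sum>I | I \<in> v_ideals \<and> deg I = int d. emb (b I) * power_s1 I ^ j)"

lemma sigma_term:
  assumes "I \<in> ac.ideals"
  shows "emb a * power_s1 I ^ j \<in> V" "\<sigma> (emb a * power_s1 I ^ j) = embv a * \<beta> I ^ j"
proof -
  have p: "power_s1 I ^ j \<in> V" by (rule subring_power[OF s.S_ring power_s1_V[OF assms]])
  show "emb a * power_s1 I ^ j \<in> V" by (rule subring_mult[OF s.S_ring emb_V p])
  show "\<sigma> (emb a * power_s1 I ^ j) = embv a * \<beta> I ^ j"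
    unfolding s.f_mult[OF emb_V p] s.f_power[OF power_s1_V[OF assms]] sigma_over_k \<beta>_def ..
qed

lemma special_value_V: "special_value b j d \<in> V"
  and sigma_special_value: "\<sigma> (special_value b j d) = (\<Sum>I | I \<in> v_ideals \<and> deg I = int d. embv (b I) * \<beta> I ^ j)"
proof -
  show "special_value b j d \<in> V"
    unfolding special_value_def using sigma_term(1) v_ideals_beta(1) by (intro subring_sum[OF s.S_ring]) blast
  have "\<sigma> (special_value b j d) = (\<Sum>I | I \<in> v_ideals \<and> deg I = int d. \<sigma> (emb (b I) * power_s1 I ^ j))"
    unfolding special_value_def using sigma_term(1) v_ideals_beta(1) by (intro s.f_sum) blast
  also have "\<dots> = (\<Sum>I | I \<in> v_ideals \<and> deg I = int d. embv (b I) * \<beta> I ^ j)"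
    by (rule sum.cong) (use sigma_term(2) v_ideals_beta(1) in blast)+
  finally show "\<sigma> (special_value b j d) = (\<Sum>I | I \<in> v_ideals \<and> deg I = int d. embv (b I) * \<beta> I ^ j)" .
qed

text \<open>The special value over all ideals vanishes in high degree, and the ideals divisible by \<open>v\<close>
  contribute little to it when \<open>j\<close> is large.\<close>

lemma special_value_small:
  assumes b: "motivic_class b"
  shows "\<exists>K\<ge>1. \<forall>j n d. CHAR('k) ^ n \<le> j \<longrightarrow> j < 2 * (CHAR('k) ^ n * (Q - 1)) \<longrightarrow> K * (n + 1) < d \<longrightarrow>
    nrmv (\<sigma> (special_value b j d)) \<le> pv.\<kappa> ^ (CHAR('k) ^ n)"
proof -
  obtain P K where P: "\<And>j d. coeff (P j) d = (\<Sum>I | I \<in> nonzero_ideals A \<and> deg I = int d. emb (b I) * power_s1 I ^ j)"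
    and K: "K \<ge> 1" and van: "\<And>n j d. j < CHAR('k) ^ n \<Longrightarrow> K * (n + 1) < d \<Longrightarrow> coeff (P j) d = 0"
    using special_values[OF b] by metis
  \<comment> \<open>The exponents j reach up to p^n * s. As s < p^s they lie below p^(n + s), which
    only enlarges the constant \<open>K\<close>.\<close>
  define s where "s = 2 * (Q - 1)"
  have s: "s < CHAR('k) ^ s" using less_exp[of s] power_mono[OF p2, of s] by linarith
  have "nrmv (\<sigma> (special_value b j d)) \<le> pv.\<kappa> ^ (CHAR('k) ^ n)"
    if j: "CHAR('k) ^ n \<le> j" "j < 2 * (CHAR('k) ^ n * (Q - 1))" and d: "K * (s + 1) * (n + 1) < d" for j n d
  proof -
    let ?X = "{I. I \<in> nonzero_ideals A \<and> deg I = int d}"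
    let ?Y = "{I. I \<in> v_ideals \<and> deg I = int d}"
    have fin: "finite ?X" using degree_fibre_finite[of "int d"] by simp
    have sub: "?Y \<subseteq> ?X" unfolding v_ideals_def by blast
    have "j < CHAR('k) ^ n * s" using j(2) unfolding s_def by (simp add: ac_simps)
    also have "\<dots> \<le> CHAR('k) ^ (n + s)" unfolding power_add using s by simp
    finally have "j < CHAR('k) ^ (n + s)" .
    moreover have "K * (n + s + 1) \<le> K * (s + 1) * (n + 1)" by (simp add: algebra_simps)
    ultimately have z: "(\<Sum>I\<in>?X. emb (b I) * power_s1 I ^ j) = 0" using van[of j "n + s" d] P d by simp
    have "0 = \<sigma> (\<Sum>I\<in>?X. emb (b I) * power_s1 I ^ j)" unfolding z by simp
    also have "\<dots> = (\<Sum>I\<in>?X. \<sigma> (emb (b I) * power_s1 I ^ j))"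
      using sigma_term(1) nonzero_ideals_ideals by (intro s.f_sum) blast
    also have "\<dots> = (\<Sum>I\<in>?X. embv (b I) * \<beta> I ^ j)"
      by (rule sum.cong) (use sigma_term(2) nonzero_ideals_ideals in blast)+
    also have "\<dots> = (\<Sum>I\<in>?X - ?Y. embv (b I) * \<beta> I ^ j) + \<sigma> (special_value b j d)"
      unfolding sigma_special_value by (rule sum.subset_diff[OF sub fin])
    finally have "\<sigma> (special_value b j d) = - (\<Sum>I\<in>?X - ?Y. embv (b I) * \<beta> I ^ j)"
      by (simp add: eq_neg_iff_add_eq_0 add.commute)
    hence "nrmv (\<sigma> (special_value b j d)) = nrmv (\<Sum>I\<in>?X - ?Y. embv (b I) * \<beta> I ^ j)" by simp
    also have "\<dots> \<le> pv.\<kappa> ^ (CHAR('k) ^ n)"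
    proof (rule pv.nrm_sum_le)
      fix I assume "I \<in> ?X - ?Y"
      hence I: "I \<in> nonzero_ideals A" "I \<notin> v_ideals" by blast+
      have "nrmv (\<beta> I) ^ j \<le> pv.\<kappa> ^ j" using beta_small[OF I] by (intro power_mono) auto
      also have "\<dots> \<le> pv.\<kappa> ^ (CHAR('k) ^ n)" using j(1) pv.\<kappa> by (intro power_decreasing) auto
      finally have "nrmv (embv (b I)) * nrmv (\<beta> I) ^ j \<le> 1 * pv.\<kappa> ^ (CHAR('k) ^ n)"
        using embv_coefficient[OF b I(1)] by (intro mult_mono) auto
      thus "nrmv (embv (b I) * \<beta> I ^ j) \<le> pv.\<kappa> ^ (CHAR('k) ^ n)" by (simp add: pv.nrm_mult pv.nrm_power)
    qed (use pv.\<kappa> in simp)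
    finally show ?thesis .
  qed
  thus ?thesis using K by (intro exI[of _ "K * (s + 1)"]) auto
qed

text \<open>A nonzero value, once it is integral at v, has a nonzero multiple in \<open>A\<close> of
  height O(d) with cofactor integral at v, so its absolute value is at least \<kappa>^(k (d + 1)).
  The bound \<rho>^(p^n) with n of about d / K is smaller for large d.\<close>

lemma special_value_eventually_zero:
  assumes b: "motivic_class b" and K: "K \<ge> 1" and \<rho>: "0 \<le> \<rho>" "\<rho> < 1"
    and small: "\<And>n d. K * (n + 1) < d \<Longrightarrow> nrmv (\<sigma> (special_value b j d)) \<le> \<rho> ^ (CHAR('k) ^ n)"
  shows "\<exists>D. \<forall>d\<ge>D. special_value b j d = 0"
proof -
  obtain g K1 where g: "g \<in> ac.A" "g \<noteq> 0" and K1: "\<forall>d I. I \<in> nonzero_ideals A \<longrightarrow> deg I = int d \<longrightarrow>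
    emb g * (emb (b I) * power_s1 I ^ j) \<in> fs.U (K1 * (d + 1))" using term_height[OF b] by blast
  obtain K2 where K2: "\<forall>E e. e \<in> fs.U E \<longrightarrow> e \<noteq> 0 \<longrightarrow> (\<exists>a\<in>ac.L (K2 * (E + 1)). a \<noteq> 0 \<and>
     (\<exists>d N. (\<forall>i<(N::nat). d i \<in> ac.A) \<and> emb a = e * (\<Sum>i<N. emb (d i) * e ^ i)))" using bounded_multiple by blast
  have AO: "nrmv (embv a) \<le> 1" if "a \<in> ac.A" for a
    using pv.nrm_emb_le ac.A_place[OF that, of Pv] Pv_place by blast
  have g0: "emb g \<noteq> 0" using g(2) pc.e.f_eq_zero by simp
  \<comment> \<open>The multiple a has height at most K2 * (K1 + 1) * (d + 1), and each unit of
    height allows as many zeros as the degree of \<open>Oi\<close>.\<close>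
  define k where "k = place_degree Fr Oi * (K2 * (K1 + 1))"
  have lower: "pv.\<kappa> ^ (k * (d + 1)) \<le> nrmv (\<sigma> (special_value b j d))"
    if nz: "special_value b j d \<noteq> 0" and le1: "nrmv (\<sigma> (special_value b j d)) \<le> 1" for d
  proof -
    define X where "X = emb g * special_value b j d"
    have XV: "X \<in> V" unfolding X_def by (rule subring_mult[OF s.S_ring emb_V special_value_V])
    have "X = (\<Sum>I | I \<in> v_ideals \<and> deg I = int d. emb g * (emb (b I) * power_s1 I ^ j))"
      unfolding X_def special_value_def sum_distrib_left ..
    also have "\<dots> \<in> fs.U (K1 * (d + 1))"
      using K1 v_ideals_iff by (intro add_subgroup_sum[OF fs.U_group]) blast
    finally have XU: "X \<in> fs.U (K1 * (d + 1))" .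
    have "X \<noteq> 0" unfolding X_def using nz g0 by simp
    then obtain a c and N :: nat where a: "a \<in> ac.L (K2 * (K1 * (d + 1) + 1))" "a \<noteq> 0"
      and c: "\<forall>i<N. c i \<in> ac.A" and eq: "emb a = X * (\<Sum>i<N. emb (c i) * X ^ i)"
      using K2[rule_format, OF XU] by blast
    have "\<sigma> X = embv g * \<sigma> (special_value b j d)"
      unfolding X_def s.f_mult[OF emb_V special_value_V] sigma_over_k ..
    hence "nrmv (\<sigma> X) = nrmv (embv g) * nrmv (\<sigma> (special_value b j d))" by (simp add: pv.nrm_mult)
    also have "\<dots> \<le> 1 * nrmv (\<sigma> (special_value b j d))" by (intro mult_right_mono AO g(1)) simp
    finally have X: "nrmv (\<sigma> X) \<le> nrmv (\<sigma> (special_value b j d))" by simp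
    hence X1: "nrmv (\<sigma> X) \<le> 1" using le1 by linarith
    have tV: "emb (c i) * X ^ i \<in> V" for i by (intro subring_mult[OF s.S_ring emb_V] subring_power[OF s.S_ring XV])
    define Y where "Y = \<sigma> (\<Sum>i<N. emb (c i) * X ^ i)"
    have "Y = (\<Sum>i<N. embv (c i) * \<sigma> X ^ i)"
      unfolding Y_def s.f_sum[OF tV]
      by (simp add: s.f_mult[OF emb_V subring_power[OF s.S_ring XV]] s.f_power[OF XV] sigma_over_k)
    also have "nrmv \<dots> \<le> 1"
    proof (rule pv.nrm_sum_le)
      fix i assume "i \<in> {..<N}"
      hence "nrmv (embv (c i)) * nrmv (\<sigma> X) ^ i \<le> 1" using AO c X1 by (intro mult_le_one power_le_one) auto
      thus "nrmv (embv (c i) * \<sigma> X ^ i) \<le> 1" by (simp add: pv.nrm_mult pv.nrm_power)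
    qed simp
    finally have Y: "nrmv Y \<le> 1" .
    have "embv a = \<sigma> X * Y"
      unfolding sigma_over_k[symmetric] eq Y_def by (rule s.f_mult[OF XV]) (rule subring_sum[OF s.S_ring tV])
    hence "nrmv (embv a) \<le> nrmv (\<sigma> X) * 1" using Y by (simp only: pv.nrm_mult) (intro mult_left_mono, auto)
    hence na: "nrmv (embv a) \<le> nrmv (\<sigma> (special_value b j d))" using X by linarith
    have "K2 * (K1 * (d + 1) + 1) \<le> K2 * (K1 + 1) * (d + 1)" by (simp add: algebra_simps)
    hence "place_degree Fr Oi * (K2 * (K1 * (d + 1) + 1)) \<le> k * (d + 1)"
      unfolding k_def using mult_le_mono2 by (simp only: mult.assoc)
    moreover have "ord_elem Pv a \<le> int (place_degree Fr Oi * (K2 * (K1 * (d + 1) + 1)))"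
      by (rule ord_le_height[OF a Pv_place])
    ultimately have "ord_elem Pv a \<le> int (k * (d + 1))" by linarith
    hence "pv.\<kappa> powi int (k * (d + 1)) \<le> pv.\<kappa> powi ord_elem Pv a"
      using pv.\<kappa> by (intro power_int_decreasing) auto
    thus ?thesis using na pv.nrm_emb[OF a(2)] by (simp only: power_int_of_nat)
  qed
  \<comment> \<open>R^(d + 1) is the reciprocal of the lower bound, so
    \<open>coefficient_decay\<close> makes the upper bound drop below it.\<close>
  define R where "R = inverse (pv.\<kappa> ^ k)"
  have k1: "pv.\<kappa> ^ k \<le> 1" "0 < pv.\<kappa> ^ k" using pv.\<kappa> by (auto intro: power_le_one)
  have R: "R \<ge> 1" unfolding R_def using k1 by (simp add: one_le_inverse_iff)
  obtain D where D: "\<forall>d\<ge>D. \<exists>n. K * (n + 1) < d \<and> R * R ^ d * \<rho> ^ (CHAR('k) ^ n) < 1"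
    using coefficient_decay[OF \<rho> R _ _ K p2, of R 1] R by auto
  have "special_value b j d = 0" if dD: "d \<ge> D" for d
  proof (rule ccontr)
    assume nz: "special_value b j d \<noteq> 0"
    obtain n where n: "K * (n + 1) < d" "R * R ^ d * \<rho> ^ (CHAR('k) ^ n) < 1" using D dD by blast
    have "\<rho> ^ (CHAR('k) ^ n) \<le> 1" using \<rho> by (intro power_le_one) auto
    hence "nrmv (\<sigma> (special_value b j d)) \<le> 1" using small[OF n(1)] by linarith
    from lower[OF nz this] have "(pv.\<kappa> ^ k) ^ (d + 1) \<le> \<rho> ^ (CHAR('k) ^ n)"
      unfolding power_mult[symmetric] using small[OF n(1)] by linarith
    moreover have "R * R ^ d = inverse ((pv.\<kappa> ^ k) ^ (d + 1))" unfolding R_def by (simp add: power_inverse)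
    ultimately have "R * R ^ d * \<rho> ^ (CHAR('k) ^ n) \<ge> 1"
      using k1(2) by (metis left_inverse mult_left_mono inverse_nonnegative_iff_nonnegative less_imp_le
          order_less_irrefl zero_less_power)
    thus False using n(2) by linarith
  qed
  thus ?thesis by blast
qed

lemma v_continues_essentially_algebraic:
  assumes b: "motivic_class b"
  shows "v_continues_essentially_algebraic b"
proof -
  obtain \<rho> where \<rho>: "pv.\<kappa> \<le> \<rho>" "\<rho> < 1" "\<forall>I\<in>v_ideals. nrmv (\<beta> I / \<omega> (\<beta> I) - 1) \<le> \<rho>"
    using omega_uniform by blast
  have \<rho>0: "0 \<le> \<rho>" using \<rho>(1) pv.\<kappa> by linarith
  obtain K where K: "K \<ge> 1" and small: "\<forall>j n d. CHAR('k) ^ n \<le> j \<longrightarrow> j < 2 * (CHAR('k) ^ n * (Q - 1)) \<longrightarrow>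
    K * (n + 1) < d \<longrightarrow> nrmv (\<sigma> (special_value b j d)) \<le> pv.\<kappa> ^ (CHAR('k) ^ n)"
    using special_value_small[OF b] by blast
  have Q1: "Q - 1 > 0" using Q_ge_2 by simp
  define W where "W I y = unit_power (\<beta> I) y" for I y
  have near: "nrmv (1 / W I y - \<beta> I ^ j) \<le> \<rho> ^ (CHAR('k) ^ n)"
    if "I \<in> v_ideals" "y \<in> exponents CHAR('k) (Q - 1)" "(int j + y n) mod int (CHAR('k) ^ n * (Q - 1)) = 0" for I y j n
  proof -
    have "nrmv (1 / W I y - \<beta> I ^ j) \<le> nrmv (\<beta> I / \<omega> (\<beta> I) - 1) ^ (CHAR('k) ^ n)"
      unfolding W_def by (rule unit_power_near[OF that])
    also have "\<dots> \<le> \<rho> ^ (CHAR('k) ^ n)" using \<rho>(3) that(1) by (intro power_mono) auto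
    finally show ?thesis .
  qed
  \<comment> \<open>Adding a full period M to the least residue makes j at least p^n, as
    \<open>special_value_small\<close> demands; hence the range up to 2 M there.\<close>
  have complement: "\<exists>j. CHAR('k) ^ n \<le> j \<and> j < 2 * (CHAR('k) ^ n * (Q - 1)) \<and>
      (int j + a) mod int (CHAR('k) ^ n * (Q - 1)) = 0" for n and a :: int
  proof -
    define M where "M = CHAR('k) ^ n * (Q - 1)"
    have M: "M > 0" unfolding M_def using p0 Q1 by simp
    have "CHAR('k) ^ n * 1 \<le> M" unfolding M_def by (rule mult_le_mono2) (use Q1 in linarith)
    hence "CHAR('k) ^ n \<le> M" by simp
    moreover have "int (r + M) + a = int r + a + int M" for r by simp
    hence "(int (nat (- a mod int M) + M) + a) mod int M = 0"
      using exponent_complement(1)[OF M, of a] by (simp only: mod_add_self2)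
    ultimately show ?thesis
      using exponent_complement(2)[OF M, of a] unfolding M_def[symmetric]
      by (intro exI[of _ "nat (- a mod int M) + M"]) simp
  qed
  have fibre: "finite {I \<in> v_ideals. deg I = int d}" for d
    by (rule finite_subset[OF _ degree_fibre_finite[of "int d"]]) (auto simp: v_ideals_def)
  have vA: "I \<in> nonzero_ideals A" if "I \<in> v_ideals" for I using that v_ideals_iff by blast
  have b1: "nrmv (embv (b I)) \<le> 1" if "I \<in> v_ideals" for I by (rule embv_coefficient[OF b vA[OF that]])
  interpret ds: decaying_series nrmv "CHAR('k)" "Q - 1" v_ideals deg "\<lambda>I. embv (b I)" W 1 1 \<rho> K
  proof
    show "finite {I \<in> v_ideals. deg I = int d}" for d by (rule fibre)
    show "I \<in> v_ideals \<Longrightarrow> nrmv (embv (b I)) \<le> 1 * 1 ^ nat (deg I)" for I using b1 by simp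
    show "I \<in> v_ideals \<Longrightarrow> 0 \<le> deg I" for I by (rule deg_nonneg[OF vA])
    fix I y z n
    assume h: "I \<in> v_ideals" "y \<in> exponents CHAR('k) (Q - 1)" "z \<in> exponents CHAR('k) (Q - 1)" "y n = z n"
    obtain j where j: "(int j + y n) mod int (CHAR('k) ^ n * (Q - 1)) = 0" using complement[of n "y n"] by (elim exE conjE)
    have "nrmv (1 / W I y - \<beta> I ^ j) \<le> \<rho> ^ (CHAR('k) ^ n)" "nrmv (1 / W I z - \<beta> I ^ j) \<le> \<rho> ^ (CHAR('k) ^ n)"
      using near[OF h(1,2) j] near[OF h(1,3)] j h(4) by auto
    thus "nrmv (1 / W I y - 1 / W I z) \<le> \<rho> ^ (CHAR('k) ^ n)"
      using pv.nrm_triangle[of "1 / W I y" "1 / W I z" "\<beta> I ^ j"] pv.nrm_diff_commute[of "1 / W I z"] by simp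
  next
    fix y n d assume y: "y \<in> exponents CHAR('k) (Q - 1)" and d: "K * (n + 1) < d"
    let ?Y = "{I. I \<in> v_ideals \<and> deg I = int d}"
    obtain j where j: "CHAR('k) ^ n \<le> j" "j < 2 * (CHAR('k) ^ n * (Q - 1))"
      "(int j + y n) mod int (CHAR('k) ^ n * (Q - 1)) = 0" using complement[of n "y n"] by (elim exE conjE)
    have "nrmv (\<sigma> (special_value b j d)) \<le> pv.\<kappa> ^ (CHAR('k) ^ n)" using small j(1,2) d by blast
    also have "\<dots> \<le> \<rho> ^ (CHAR('k) ^ n)" using \<rho>(1) pv.\<kappa> by (intro power_mono) auto
    finally have 1: "nrmv (\<sigma> (special_value b j d)) \<le> \<rho> ^ (CHAR('k) ^ n)" .
    have 2: "nrmv (\<Sum>I\<in>?Y. embv (b I) * (1 / W I y - \<beta> I ^ j)) \<le> \<rho> ^ (CHAR('k) ^ n)"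
    proof (rule pv.nrm_sum_le)
      fix I assume "I \<in> ?Y"
      hence "nrmv (embv (b I)) * nrmv (1 / W I y - \<beta> I ^ j) \<le> 1 * \<rho> ^ (CHAR('k) ^ n)"
        using b1 near[OF _ y j(3)] by (intro mult_mono) auto
      thus "nrmv (embv (b I) * (1 / W I y - \<beta> I ^ j)) \<le> \<rho> ^ (CHAR('k) ^ n)" by (simp add: pv.nrm_mult)
    qed (use \<rho>0 in simp)
    \<comment> \<open>In contrast to infinity, the coefficient at -j is only known to be small; it
      enters as a second summand with the same bound.\<close>
    have "(\<Sum>I\<in>?Y. embv (b I) / W I y) =
        (\<Sum>I\<in>?Y. embv (b I) * (1 / W I y - \<beta> I ^ j)) + \<sigma> (special_value b j d)"
      unfolding sigma_special_value by (simp add: right_diff_distrib sum_subtractf)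
    thus "nrmv (\<Sum>I\<in>?Y. embv (b I) / W I y) \<le> 1 * 1 ^ d * \<rho> ^ (CHAR('k) ^ n)"
      using 1 2 pv.nrm_add[of "\<Sum>I\<in>?Y. embv (b I) * (1 / W I y - \<beta> I ^ j)" "\<sigma> (special_value b j d)"] by simp
  qed (use p2 \<rho>0 \<rho>(2) K in auto)
  have T: "ds.T = v_term b" unfolding ds.T_def unfolding v_term_def v_power_at_def W_def \<beta>_def ..
  \<comment> \<open>The b_I are integral at v and the unit powers have absolute value 1, so any
    radius above 1 serves.\<close>
  have "abs_convergent_from nrmv (exponents CHAR('k) (Q - 1)) v_ideals deg (v_term b) 2"
    unfolding abs_convergent_from_def
  proof (intro conjI allI ballI impI)
    fix x y and e :: real
    assume y: "y \<in> exponents CHAR('k) (Q - 1)" and x: "2 \<le> nrmv x" and e: "0 < e"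
    obtain N where N: "\<forall>n\<ge>N. (1 / 2 :: real) ^ n < e" using small_power[of "1 / 2" e] e by auto
    have "nrmv (v_term b I x y) < e" if I: "I \<in> v_ideals" "int N \<le> deg I" for I
    proof -
      have eq: "nrmv (v_term b I x y) = nrmv (embv (b I)) / nrmv x ^ nat (deg I)"
        unfolding T[symmetric] ds.T_def W_def pv.nrm_divide pv.nrm_mult pv.nrm_power_int
          unit_power_nrm[OF I(1) y]
        using I(2) by (simp add: power_int_def)
      also have "\<dots> \<le> 1 / 2 ^ nat (deg I)" using b1[OF I(1)] x by (intro frac_le power_mono) auto
      also have "\<dots> < e" using N I(2) by (simp add: power_one_over nat_le_iff le_nat_iff)
      finally show ?thesis .
    qed
    thus "\<exists>D. \<forall>I\<in>v_ideals. D \<le> deg I \<longrightarrow> nrmv (v_term b I x y) < e" by blast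
  qed simp
  hence "continues_to nrmv (exponents CHAR('k) (Q - 1)) v_ideals deg (v_term b) ds.g"
    unfolding T[symmetric] by (intro ds.g_continues) blast
  moreover have "v_essentially_algebraic b ds.g"
    unfolding v_essentially_algebraic_def
  proof
    fix j :: nat
    define y where "y = exponent_of_int CHAR('k) (Q - 1) (- int j)"
    have y: "y \<in> exponents CHAR('k) (Q - 1)" unfolding y_def by (rule exponent_of_int_in[OF p0 Q1])
    have yn: "(int j + y n) mod int (CHAR('k) ^ n * (Q - 1)) = 0" for n
      unfolding y_def exponent_of_int_def mod_add_right_eq by simp
    have W: "1 / W I y = \<beta> I ^ j" if I: "I \<in> v_ideals" for I
      using pv.zero_if_all_small[OF \<rho>0 \<rho>(2) p2 near[OF I y yn]] by simp
    have c: "ds.c d y = \<sigma> (special_value b j d)" for d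
      unfolding ds.c_def sigma_special_value
    proof (rule sum.cong)
      fix I assume "I \<in> {I. I \<in> v_ideals \<and> deg I = int d}"
      thus "embv (b I) / W I y = embv (b I) * \<beta> I ^ j"
        using W[of I] by (metis (no_types, lifting) mem_Collect_eq times_divide_eq_right mult.right_neutral)
    qed simp
    \<comment> \<open>Here j is fixed, and \<open>special_value_small\<close> at j itself covers
      only levels with p^n \<le> j. At y = -j the bound \<open>decay\<close> was obtained from
      larger exponents congruent to j, so it gives the estimate at all levels n.\<close>
    have "nrmv (\<sigma> (special_value b j d)) \<le> \<rho> ^ (CHAR('k) ^ n)" if "K * (n + 1) < d" for n d
      using ds.decay[OF y that] unfolding c[symmetric] ds.c_def by simp
    from special_value_eventually_zero[OF b K \<rho>0 \<rho>(2) this]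
    obtain D where D: "\<forall>d\<ge>D. special_value b j d = 0" by blast
    define P where "P = (\<Sum>d<D. monom (\<sigma> (special_value b j d)) d)"
    have P: "coeff P d = \<sigma> (special_value b j d)" for d
    proof -
      have "coeff P d = (\<Sum>i<D. if i = d then \<sigma> (special_value b j i) else 0)"
        unfolding P_def by (simp add: coeff_sum)
      thus ?thesis using D by (simp add: not_less)
    qed
    have "set (coeffs P) \<subseteq> \<sigma> ` V"
    proof
      fix x assume "x \<in> set (coeffs P)"
      then obtain d where "x = coeff P d" by (auto simp: coeffs_def split: if_splits)
      thus "x \<in> \<sigma> ` V" unfolding P using special_value_V by blast
    qed
    moreover have "v_special_series b j = fps_of_poly P"
      by (rule fps_ext) (simp add: v_special_series_def P sigma_special_value \<beta>_def)
    moreover have "fps_at nrmv (ds.g y) (1 / x) = poly P (1 / x)" for x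
      by (rule pv.fps_at_polynomial) (simp add: ds.g_def c P)
    ultimately show "\<exists>P. set (coeffs P) \<subseteq> \<sigma> ` V \<and> v_special_series b j = fps_of_poly P \<and>
       (\<forall>x. x \<noteq> 0 \<longrightarrow>
         fps_at nrmv (ds.g (exponent_of_int CHAR('k) (Q - 1) (- int j))) (1 / x) = poly P (1 / x))"
      unfolding y_def by blast
  qed
  ultimately show ?thesis unfolding v_continues_essentially_algebraic_def using ds.g_entire by blast
qed

end

theorem theorem4p3:
  fixes Fr Oi :: "'k::field set"
    and emb :: "'k \<Rightarrow> 'c::field" and nrm :: "'c \<Rightarrow> real" and \<pi> \<pi>s :: 'c and br :: "'k set \<Rightarrow> 'c"
    and b :: "'k set \<Rightarrow> 'k"
  assumes "infinity_setting Fr Oi emb nrm \<pi> \<pi>s br"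
    and "infinity_setting.motivic_class Fr Oi emb nrm \<pi>s br b"
  shows "infinity_setting.continues_essentially_algebraic Fr Oi emb nrm \<pi>s br b \<and>
    (\<forall>v (embv :: 'k \<Rightarrow> 'd::field) nrmv \<sigma>.
       v_adic_setting Fr Oi emb nrm \<pi> \<pi>s br v embv nrmv \<sigma> \<longrightarrow>
       v_adic_setting.v_continues_essentially_algebraic Fr Oi emb \<pi>s br v embv nrmv \<sigma> b)"
proof (intro conjI allI impI)
  show "infinity_setting.continues_essentially_algebraic Fr Oi emb nrm \<pi>s br b"
    by (rule infinity_setting.continues_essentially_algebraic[OF assms])
next
  fix v and embv :: "'k \<Rightarrow> 'd::field" and nrmv \<sigma>
  assume "v_adic_setting Fr Oi emb nrm \<pi> \<pi>s br v embv nrmv \<sigma>"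
  thus "v_adic_setting.v_continues_essentially_algebraic Fr Oi emb \<pi>s br v embv nrmv \<sigma> b"
    by (rule v_adic_setting.v_continues_essentially_algebraic[OF _ assms(2)])
qed

end
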